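(* Let $\mathcal M$ be a graded manifold, $\mathcal E$ a graded vector bundle over $\mathcal M$ and $k\in\mathbb N_0$. For every $a\in M$, there is a canonical $\mathcal C^\infty_{\mathcal M,a}$-linear isomorphism of the fiber $(\mathfrak J^k_{\mathcal E})_a$ of the graded vector bundle $\mathfrak J^k_{\mathcal E}$ and the $k$-th order jet space $\mathfrak J^k_{\mathcal E,a}$ of $\mathcal E$ at $a$.
   Context: Graded means $\mathbb{Z}$-graded. Graded vector spaces and modules are sequences indexed by $j\in\mathbb Z$; all elements are homogeneous and $|v|$ is the degree. A graded linear map $F$ of degree $|F|$ raises degree by $|F|$; it is linear over a graded commutative algebra if $F(f\cdot v)=(-1)^{|F||f|}f\cdot F(v)$. Graded manifold $\mathcal M$: a second countable Hausdorff space $M$ with a sheaf $\mathcal{C}^\infty_{\mathcal M}$ of graded commutative associative unital real algebras, locally isomorphic to the following model: an open subset of $\mathbb R^{n_0}$ with the sheaf of formal power series in graded commuting variables of nonzero degrees ($n_j$ of degree $j\neq 0$), with smooth coefficients; $\sum_j n_j$ is finite. Each function $f$ has a body $\underline f$ (a smooth function, zero if $|f|\neq0$), and $f(m):=\underline f(m)$. Graded vector bundle $\mathcal E$: a sheaf $\Gamma_{\mathcal E}$ of graded $\mathcal{C}^\infty_{\mathcal M}$-modules locally isomorphic to $\mathcal{C}^\infty_{\mathcal M}\otimes_{\mathbb R}K$ for a fixed finite-dimensional graded vector space $K$. Stalks at $a$ are written $\mathcal C^\infty_{\mathcal M,a}$, $\Gamma_{\mathcal E,a}$, germs $[f]_a$,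 $[\psi]_a$. The fiber is $\mathcal E_a=\mathbb R\otimes_{\mathcal C^\infty_{\mathcal M,a}}\Gamma_{\mathcal E,a}\cong\Gamma_{\mathcal E,a}/(\mathcal J_{\mathcal M,a}\cdot\Gamma_{\mathcal E,a})$, where $\mathcal J_{\mathcal M,a}=\{[f]_a: f(a)=0\}$ and $[f]_a$ acts on $\mathbb R$ by multiplication by $f(a)$. Geometrization: for $a\in U$ let $\mathcal J^a_{\mathcal M}(U)=\{f\in\mathcal{C}^\infty_{\mathcal M}(U): f(a)=0\}$. For a graded $\mathcal{C}^\infty_{\mathcal M}(U)$-module $P$ let $P^\bullet=\bigcap_{q\in\mathbb N}\bigcap_{a\in U}(\mathcal J^a_{\mathcal M}(U))^q P$. For a presheaf $\mathcal F$ of graded $\mathcal{C}^\infty_{\mathcal M}$-modules, $\mathrm{Geo}(\mathcal F)$ is the presheaf $\mathrm{Geo}(\mathcal F)(U)=\mathcal F(U)/\mathcal F(U)^\bullet$. Jets: for open $U\subseteq M$ let $\mathcal X(U)=\mathcal{C}^\infty_{\mathcal M}(U)\otimes_{\mathbb R}\Gamma_{\mathcal E}(U)$ with two actions $f\triangleright(g\otimes\psi)=(fg)\otimes\psi$ and $f\blacktriangleright(g\otimes\psi)=(-1)^{|f||g|}g\otimes(f\cdot\psi)$; let $\delta_f(x)=f\triangleright x-f\blacktriangleright x$. Let $\mathcal V_{(k)}(U)$ be the real span of all $\delta_{f_1}\cdots\delta_{f_{k+1}}(g\otimes\psi)$ and $\mathrm{pJet}^k_{\mathcal E}(U)=\mathcal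 X(U)/\mathcal V_{(k)}(U)$. Put $\mathrm{gpJet}^k_{\mathcal E}=\mathrm{Geo}(\mathrm{pJet}^k_{\mathcal E})$ (with respect to $\triangleright$), and let $\mathrm{Jet}^k_{\mathcal E}$ be the sheafification of $\mathrm{gpJet}^k_{\mathcal E}$. With the $\triangleright$ module structure, $\mathrm{Jet}^k_{\mathcal E}$ is the sheaf of sections of a graded vector bundle $\mathfrak J^k_{\mathcal E}$, the $k$-th order jet bundle of $\mathcal E$; its fiber $(\mathfrak J^k_{\mathcal E})_a$ is formed with respect to $\triangleright$. Jet spaces: let $\Gamma^{[k]}_{\mathcal E,a}=(\mathcal J_{\mathcal M,a})^{k+1}\cdot\Gamma_{\mathcal E,a}$, using the usual action $[f]_a\cdot[\psi]_a=[f\cdot\psi]_a$. The $k$-th order jet space of $\mathcal E$ at $a$ is $\mathfrak J^k_{\mathcal E,a}=\Gamma_{\mathcal E,a}/\Gamma^{[k]}_{\mathcal E,a}$. The action $\triangleright$ of $\mathcal C^\infty_{\mathcal M,a}$ on $\mathfrak J^k_{\mathcal E,a}$ is the one induced by $[f]_a\triangleright[\psi]_a=f(a)\cdot[\psi]_a$; $\mathcal C^\infty_{\mathcal M,a}$-linearity refers to the actions $\triangleright$. *)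

theory Defs
  imports "HOL-Analysis.Abstract_Euclidean_Space" "HOL-Analysis.Derivative" "HOL-Algebra.Module" "HOL-Algebra.AbelCoset"
begin

section \<open>Graded vector spaces and modules\<close>

text \<open>
  Graded objects are sequences indexed by the integers, and there are no inhomogeneous elements.
  A graded real vector space is a family \<open>V :: int \<Rightarrow> (real, 'v) module\<close> of vector spaces; since the
  components are not assumed disjoint as sets, each operation takes the degrees of its arguments.
  The ring multiplication and unit that \<open>module\<close> records carry are irrelevant.
\<close>

definition real_ring :: "real ring" where
  "real_ring = \<lparr>carrier = UNIV, mult = (*), one = 1, zero = 0, add = (+)\<rparr>"

definition mk_vs :: "'v set \<Rightarrow> 'v \<Rightarrow> ('v \<Rightarrow> 'v \<Rightarrow> 'v) \<Rightarrow> (real \<Rightarrow> 'v \<Rightarrow> 'v) \<Rightarrow> (real, 'v) module" where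
  "mk_vs S z a s = \<lparr>carrier = S, mult = undefined, one = undefined, zero = z, add = a, smult = s\<rparr>"

definition graded_vs :: "(int \<Rightarrow> (real, 'v) module) \<Rightarrow> bool" where
  "graded_vs V \<longleftrightarrow> (\<forall>j. Module.module real_ring (V j))"

definition rspan :: "(real, 'v) module \<Rightarrow> 'v set \<Rightarrow> 'v set" where
  "rspan M S = \<Inter>{N. submodule N real_ring M \<and> S \<subseteq> N}"

definition graded_fin_dim :: "(int \<Rightarrow> (real, 'v) module) \<Rightarrow> bool" where
  "graded_fin_dim V \<longleftrightarrow> graded_vs V \<and>
     (\<forall>j. \<exists>B. finite B \<and> B \<subseteq> carrier (V j) \<and> rspan (V j) B = carrier (V j)) \<and>
     finite {j. carrier (V j) \<noteq> {\<zero>\<^bsub>V j\<^esub>}}"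

text \<open>
  \<open>gact P i j f x\<close> is the action of \<open>f\<close> of degree \<open>i\<close> on \<open>x\<close> of degree \<open>j\<close>. A graded algebra is
  recorded as a graded module over itself, so that its product is its own \<open>gact\<close>.
\<close>

record ('f, 'v) gmod =
  gcomp :: "int \<Rightarrow> (real, 'v) module"
  gact :: "int \<Rightarrow> int \<Rightarrow> 'f \<Rightarrow> 'v \<Rightarrow> 'v"

abbreviation gcar :: "('f, 'v) gmod \<Rightarrow> int \<Rightarrow> 'v set" where
  "gcar P j \<equiv> carrier (gcomp P j)"

definition ksign :: "int \<Rightarrow> int \<Rightarrow> real" where
  "ksign i j = (if odd i \<and> odd j then -1 else 1)"

definition graded_module :: "('f, 'f) gmod \<Rightarrow> 'f \<Rightarrow> ('f, 'v) gmod \<Rightarrow> bool" where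
  "graded_module A e P \<longleftrightarrow>
     graded_vs (gcomp P) \<and>
     (\<forall>i j. \<forall>f \<in> gcar A i. \<forall>x \<in> gcar P j. gact P i j f x \<in> gcar P (i + j)) \<and>
     (\<forall>i j. \<forall>f \<in> gcar A i. \<forall>g \<in> gcar A i. \<forall>x \<in> gcar P j.
        gact P i j (f \<oplus>\<^bsub>gcomp A i\<^esub> g) x = gact P i j f x \<oplus>\<^bsub>gcomp P (i + j)\<^esub> gact P i j g x) \<and>
     (\<forall>i j. \<forall>f \<in> gcar A i. \<forall>x \<in> gcar P j. \<forall>y \<in> gcar P j.
        gact P i j f (x \<oplus>\<^bsub>gcomp P j\<^esub> y) = gact P i j f x \<oplus>\<^bsub>gcomp P (i + j)\<^esub> gact P i j f y) \<and>
     (\<forall>i j r. \<forall>f \<in> gcar A i. \<forall>x \<in> gcar P j.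
        gact P i j (r \<odot>\<^bsub>gcomp A i\<^esub> f) x = r \<odot>\<^bsub>gcomp P (i + j)\<^esub> gact P i j f x \<and>
        gact P i j f (r \<odot>\<^bsub>gcomp P j\<^esub> x) = r \<odot>\<^bsub>gcomp P (i + j)\<^esub> gact P i j f x) \<and>
     (\<forall>i j l. \<forall>f \<in> gcar A i. \<forall>g \<in> gcar A j. \<forall>x \<in> gcar P l.
        gact P (i + j) l (gact A i j f g) x = gact P i (j + l) f (gact P j l g x)) \<and>
     (\<forall>j. \<forall>x \<in> gcar P j. gact P 0 j e x = x)"

definition graded_comm_algebra :: "('f, 'f) gmod \<Rightarrow> 'f \<Rightarrow> bool" where
  "graded_comm_algebra A e \<longleftrightarrow>
     e \<in> gcar A 0 \<and> graded_module A e A \<and>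
     (\<forall>i j. \<forall>f \<in> gcar A i. \<forall>g \<in> gcar A j.
        gact A i j f g = ksign i j \<odot>\<^bsub>gcomp A (i + j)\<^esub> gact A j i g f)"

definition gmod_iso :: "('f, 'f) gmod \<Rightarrow> ('f, 'v) gmod \<Rightarrow> ('f, 'w) gmod \<Rightarrow> (int \<Rightarrow> 'v \<Rightarrow> 'w) \<Rightarrow> bool" where
  "gmod_iso A P Q \<Phi> \<longleftrightarrow>
     (\<forall>j. bij_betw (\<Phi> j) (gcar P j) (gcar Q j)) \<and>
     (\<forall>j. \<forall>x \<in> gcar P j. \<forall>y \<in> gcar P j. \<Phi> j (x \<oplus>\<^bsub>gcomp P j\<^esub> y) = \<Phi> j x \<oplus>\<^bsub>gcomp Q j\<^esub> \<Phi> j y) \<and>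
     (\<forall>j r. \<forall>x \<in> gcar P j. \<Phi> j (r \<odot>\<^bsub>gcomp P j\<^esub> x) = r \<odot>\<^bsub>gcomp Q j\<^esub> \<Phi> j x) \<and>
     (\<forall>i j. \<forall>f \<in> gcar A i. \<forall>x \<in> gcar P j. \<Phi> (i + j) (gact P i j f x) = gact Q i j f (\<Phi> j x))"

definition galg_iso ::
  "('f, 'f) gmod \<Rightarrow> 'f \<Rightarrow> ('g, 'g) gmod \<Rightarrow> 'g \<Rightarrow> (int \<Rightarrow> 'f \<Rightarrow> 'g) \<Rightarrow> bool" where
  "galg_iso A e B e' h \<longleftrightarrow>
     (\<forall>i. bij_betw (h i) (gcar A i) (gcar B i)) \<and>
     (\<forall>i. \<forall>f \<in> gcar A i. \<forall>g \<in> gcar A i. h i (f \<oplus>\<^bsub>gcomp A i\<^esub> g) = h i f \<oplus>\<^bsub>gcomp B i\<^esub> h i g) \<and>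
     (\<forall>i r. \<forall>f \<in> gcar A i. h i (r \<odot>\<^bsub>gcomp A i\<^esub> f) = r \<odot>\<^bsub>gcomp B i\<^esub> h i f) \<and>
     (\<forall>i j. \<forall>f \<in> gcar A i. \<forall>g \<in> gcar A j. h (i + j) (gact A i j f g) = gact B i j (h i f) (h j g)) \<and>
     h 0 e = e'"

subsection \<open>Quotients and powers of ideals\<close>

definition quot_vs :: "(real, 'v) module \<Rightarrow> 'v set \<Rightarrow> (real, 'v set) module" where
  "quot_vs M N = mk_vs (a_rcosets\<^bsub>M\<^esub> N) N (\<lambda>X Y. X <+>\<^bsub>M\<^esub> Y) (\<lambda>r X. \<Union>x\<in>X. N +>\<^bsub>M\<^esub> (r \<odot>\<^bsub>M\<^esub> x))"

definition gquot :: "('f, 'v) gmod \<Rightarrow> (int \<Rightarrow> 'v set) \<Rightarrow> ('f, 'v set) gmod" where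
  "gquot P N = \<lparr>gcomp = (\<lambda>j. quot_vs (gcomp P j) (N j)),
     gact = (\<lambda>i j f X. \<Union>x\<in>X. N (i + j) +>\<^bsub>gcomp P (i + j)\<^esub> gact P i j f x)\<rparr>"

text \<open>\<open>ideal_smul P I N\<close> is the graded subspace \<open>I \<cdot> N\<close> of \<open>P\<close>.\<close>

definition ideal_smul :: "('f, 'v) gmod \<Rightarrow> (int \<Rightarrow> 'f set) \<Rightarrow> (int \<Rightarrow> 'v set) \<Rightarrow> int \<Rightarrow> 'v set" where
  "ideal_smul P I N n = rspan (gcomp P n) {gact P i (n - i) f x | i f x. f \<in> I i \<and> x \<in> N (n - i)}"

definition ideal_pow :: "('f, 'f) gmod \<Rightarrow> (int \<Rightarrow> 'f set) \<Rightarrow> nat \<Rightarrow> int \<Rightarrow> 'f set" where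
  "ideal_pow A I q = (ideal_smul A I ^^ q) (gcar A)"

subsection \<open>Tensor products\<close>

text \<open>
  In degree \<open>n\<close>, the tensor product of \<open>P\<close> and \<open>Q\<close> over \<open>A\<close> is the real vector space freely generated
  by the triples \<open>(i, p, q)\<close> with \<open>p\<close> of degree \<open>i\<close> and \<open>q\<close> of degree \<open>n - i\<close>, divided by the relations
  of bilinearity and \<open>(p f) \<otimes> q = p \<otimes> (f q)\<close>. Modules are left modules; the right action is
  \<open>p f = (-1)^(\<bar>p\<bar> \<bar>f\<bar>) f p\<close>.
\<close>

type_synonym ('p, 'q) ftens = "int \<times> 'p \<times> 'q \<Rightarrow> real"

definition fgen :: "'x \<Rightarrow> 'x \<Rightarrow> real" where
  "fgen x = (\<lambda>y. if y = x then 1 else 0)"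

definition free_vs :: "('f, 'p) gmod \<Rightarrow> ('f, 'q) gmod \<Rightarrow> int \<Rightarrow> (real, ('p, 'q) ftens) module" where
  "free_vs P Q n = mk_vs
     {c. finite {x. c x \<noteq> 0} \<and> (\<forall>i p q. c (i, p, q) \<noteq> 0 \<longrightarrow> p \<in> gcar P i \<and> q \<in> gcar Q (n - i))}
     (\<lambda>x. 0) (\<lambda>c d x. c x + d x) (\<lambda>r c x. r * c x)"

definition tensor_rel ::
  "(int \<Rightarrow> (real, 'f) module) \<Rightarrow> ('f, 'p) gmod \<Rightarrow> ('f, 'q) gmod \<Rightarrow> int \<Rightarrow> ('p, 'q) ftens set" where
  "tensor_rel A P Q n = rspan (free_vs P Q n)
    ({\<lambda>x. fgen (i, p \<oplus>\<^bsub>gcomp P i\<^esub> p', q) x - fgen (i, p, q) x - fgen (i, p', q) x | i p p' q.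
        p \<in> gcar P i \<and> p' \<in> gcar P i \<and> q \<in> gcar Q (n - i)} \<union>
     {\<lambda>x. fgen (i, p, q \<oplus>\<^bsub>gcomp Q (n - i)\<^esub> q') x - fgen (i, p, q) x - fgen (i, p, q') x | i p q q'.
        p \<in> gcar P i \<and> q \<in> gcar Q (n - i) \<and> q' \<in> gcar Q (n - i)} \<union>
     {\<lambda>x. fgen (i, r \<odot>\<^bsub>gcomp P i\<^esub> p, q) x - r * fgen (i, p, q) x | i r p q.
        p \<in> gcar P i \<and> q \<in> gcar Q (n - i)} \<union>
     {\<lambda>x. fgen (i, p, r \<odot>\<^bsub>gcomp Q (n - i)\<^esub> q) x - r * fgen (i, p, q) x | i r p q.
        p \<in> gcar P i \<and> q \<in> gcar Q (n - i)} \<union>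
     {\<lambda>x. fgen (i + d, ksign i d \<odot>\<^bsub>gcomp P (i + d)\<^esub> gact P d i f p, q) x
          - fgen (i, p, gact Q d (n - i - d) f q) x | i d f p q.
        f \<in> carrier (A d) \<and> p \<in> gcar P i \<and> q \<in> gcar Q (n - i - d)})"

definition tensor_vs ::
  "(int \<Rightarrow> (real, 'f) module) \<Rightarrow> ('f, 'p) gmod \<Rightarrow> ('f, 'q) gmod \<Rightarrow> int \<Rightarrow> (real, ('p, 'q) ftens set) module" where
  "tensor_vs A P Q n = quot_vs (free_vs P Q n) (tensor_rel A P Q n)"

text \<open>\<open>tensor_elt A P Q n i p q\<close> is \<open>p \<otimes> q\<close> with \<open>\<bar>p\<bar> = i\<close> and \<open>\<bar>q\<bar> = n - i\<close>.\<close>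

definition tensor_elt ::
  "(int \<Rightarrow> (real, 'f) module) \<Rightarrow> ('f, 'p) gmod \<Rightarrow> ('f, 'q) gmod \<Rightarrow> int \<Rightarrow> int \<Rightarrow> 'p \<Rightarrow> 'q \<Rightarrow> ('p, 'q) ftens set" where
  "tensor_elt A P Q n i p q = tensor_rel A P Q n +>\<^bsub>free_vs P Q n\<^esub> fgen (i, p, q)"

text \<open>
  \<open>tensor_lift A P Q n s h\<close> is the linear map into the degree \<open>n\<close> part of the tensor product of \<open>P\<close>
  and \<open>Q\<close> that sends the class of a generator \<open>x\<close> to \<open>s x\<close> times the class of the generator \<open>h x\<close>.
\<close>

definition fext :: "('x \<Rightarrow> real) \<Rightarrow> ('x \<Rightarrow> 'y) \<Rightarrow> ('x \<Rightarrow> real) \<Rightarrow> 'y \<Rightarrow> real" where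
  "fext s h c = (\<lambda>y. \<Sum>x | c x \<noteq> 0 \<and> h x = y. s x * c x)"

definition tensor_lift ::
  "(int \<Rightarrow> (real, 'f) module) \<Rightarrow> ('f, 'p) gmod \<Rightarrow> ('f, 'q) gmod \<Rightarrow> int \<Rightarrow>
   (int \<times> 'a \<times> 'b \<Rightarrow> real) \<Rightarrow> (int \<times> 'a \<times> 'b \<Rightarrow> int \<times> 'p \<times> 'q) \<Rightarrow> ('a, 'b) ftens set \<Rightarrow> ('p, 'q) ftens set" where
  "tensor_lift A P Q n s h X = (\<Union>c\<in>X. tensor_rel A P Q n +>\<^bsub>free_vs P Q n\<^esub> fext s h c)"

text \<open>
  The tensor product with an algebra acting on the left factor through \<open>act\<close>; this algebra may be
  larger than the one over which the tensor product is taken.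
\<close>

definition tensor_left ::
  "(int \<Rightarrow> (real, 'f) module) \<Rightarrow> ('f, 'p) gmod \<Rightarrow> ('f, 'q) gmod \<Rightarrow> (int \<Rightarrow> int \<Rightarrow> 'g \<Rightarrow> 'p \<Rightarrow> 'p) \<Rightarrow>
   ('g, ('p, 'q) ftens set) gmod" where
  "tensor_left A P Q act = \<lparr>gcomp = tensor_vs A P Q,
     gact = (\<lambda>d n f. tensor_lift A P Q (d + n) (\<lambda>x. 1) (\<lambda>(i, p, q). (d + i, act d i f p, q)))\<rparr>"

definition real_graded :: "int \<Rightarrow> (real, real) module" where
  "real_graded j = mk_vs (if j = 0 then UNIV else {0}) 0 (+) (*)"

definition real_gmod :: "(int \<Rightarrow> (real, 'v) module) \<Rightarrow> (real, 'v) gmod" where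
  "real_gmod V = \<lparr>gcomp = V, gact = (\<lambda>i j r x. if i = 0 then r \<odot>\<^bsub>V j\<^esub> x else \<zero>\<^bsub>V (i + j)\<^esub>)\<rparr>"


section \<open>Presheaves and sheaves of graded modules\<close>

text \<open>
  Only the values on open sets matter. \<open>gres F U V j\<close> restricts sections of degree \<open>j\<close> from \<open>U\<close> to
  \<open>V \<subseteq> U\<close>. As above, a presheaf of algebras is a presheaf of modules over itself.
\<close>

record ('m, 'f, 'v) gpresheaf =
  gsec :: "'m set \<Rightarrow> ('f, 'v) gmod"
  gres :: "'m set \<Rightarrow> 'm set \<Rightarrow> int \<Rightarrow> 'v \<Rightarrow> 'v"

record ('m, 'f) galg_presheaf = "('m, 'f, 'f) gpresheaf" +
  gunit :: "'m set \<Rightarrow> 'f"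

abbreviation scar :: "('m, 'f, 'v, 'z) gpresheaf_scheme \<Rightarrow> 'm set \<Rightarrow> int \<Rightarrow> 'v set" where
  "scar F U j \<equiv> gcar (gsec F U) j"

definition module_presheaf ::
  "('m::topological_space, 'f) galg_presheaf \<Rightarrow> ('m, 'f, 'v, 'z) gpresheaf_scheme \<Rightarrow> bool" where
  "module_presheaf C F \<longleftrightarrow>
     (\<forall>U. open U \<longrightarrow> graded_module (gsec C U) (gunit C U) (gsec F U)) \<and>
     (\<forall>U V j. open U \<and> open V \<and> V \<subseteq> U \<longrightarrow> (\<forall>x \<in> scar F U j. gres F U V j x \<in> scar F V j)) \<and>
     (\<forall>U V j. open U \<and> open V \<and> V \<subseteq> U \<longrightarrow> (\<forall>x \<in> scar F U j. \<forall>y \<in> scar F U j.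
        gres F U V j (x \<oplus>\<^bsub>gcomp (gsec F U) j\<^esub> y) = gres F U V j x \<oplus>\<^bsub>gcomp (gsec F V) j\<^esub> gres F U V j y)) \<and>
     (\<forall>U V j r. open U \<and> open V \<and> V \<subseteq> U \<longrightarrow> (\<forall>x \<in> scar F U j.
        gres F U V j (r \<odot>\<^bsub>gcomp (gsec F U) j\<^esub> x) = r \<odot>\<^bsub>gcomp (gsec F V) j\<^esub> gres F U V j x)) \<and>
     (\<forall>U V i j. open U \<and> open V \<and> V \<subseteq> U \<longrightarrow> (\<forall>f \<in> scar C U i. \<forall>x \<in> scar F U j.
        gres F U V (i + j) (gact (gsec F U) i j f x) = gact (gsec F V) i j (gres C U V i f) (gres F U V j x))) \<and>
     (\<forall>U j. open U \<longrightarrow> (\<forall>x \<in> scar F U j. gres F U U j x = x)) \<and>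
     (\<forall>U V W j. open U \<and> open V \<and> open W \<and> W \<subseteq> V \<and> V \<subseteq> U \<longrightarrow>
        (\<forall>x \<in> scar F U j. gres F V W j (gres F U V j x) = gres F U W j x))"

definition sheaf_axiom :: "('m::topological_space, 'f, 'v, 'z) gpresheaf_scheme \<Rightarrow> bool" where
  "sheaf_axiom F \<longleftrightarrow> (\<forall>\<U> j s. (\<forall>V \<in> \<U>. open V \<and> s V \<in> scar F V j) \<and>
     (\<forall>V \<in> \<U>. \<forall>W \<in> \<U>. gres F V (V \<inter> W) j (s V) = gres F W (V \<inter> W) j (s W)) \<longrightarrow>
     (\<exists>!t. t \<in> scar F (\<Union>\<U>) j \<and> (\<forall>V \<in> \<U>. gres F (\<Union>\<U>) V j t = s V)))"

definition algebra_sheaf :: "('m::topological_space, 'f) galg_presheaf \<Rightarrow> bool" where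
  "algebra_sheaf C \<longleftrightarrow>
     (\<forall>U. open U \<longrightarrow> graded_comm_algebra (gsec C U) (gunit C U)) \<and>
     module_presheaf C C \<and> sheaf_axiom C \<and>
     (\<forall>U V. open U \<and> open V \<and> V \<subseteq> U \<longrightarrow> gres C U V 0 (gunit C U) = gunit C V)"

definition sheaf_iso_on ::
  "('m::topological_space, 'f) galg_presheaf \<Rightarrow> 'm set \<Rightarrow> ('m, 'f, 'v) gpresheaf \<Rightarrow> ('m, 'f, 'w) gpresheaf \<Rightarrow>
   ('m set \<Rightarrow> int \<Rightarrow> 'v \<Rightarrow> 'w) \<Rightarrow> bool" where
  "sheaf_iso_on C W F G \<Lambda> \<longleftrightarrow>
     (\<forall>V. open V \<and> V \<subseteq> W \<longrightarrow> gmod_iso (gsec C V) (gsec F V) (gsec G V) (\<Lambda> V)) \<and>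
     (\<forall>U V j. open U \<and> open V \<and> V \<subseteq> U \<and> U \<subseteq> W \<longrightarrow>
        (\<forall>x \<in> scar F U j. \<Lambda> V j (gres F U V j x) = gres G U V j (\<Lambda> U j x)))"

definition quot_presheaf ::
  "('m, 'f, 'v) gpresheaf \<Rightarrow> ('m set \<Rightarrow> int \<Rightarrow> 'v set) \<Rightarrow> ('m, 'f, 'v set) gpresheaf" where
  "quot_presheaf F N = \<lparr>gsec = (\<lambda>U. gquot (gsec F U) (N U)),
     gres = (\<lambda>U V j X. \<Union>x\<in>X. N V j +>\<^bsub>gcomp (gsec F V) j\<^esub> gres F U V j x)\<rparr>"

subsection \<open>Stalks and sheafification\<close>

definition germ ::
  "('m::topological_space, 'f, 'v, 'z) gpresheaf_scheme \<Rightarrow> 'm \<Rightarrow> int \<Rightarrow> 'm set \<Rightarrow> 'v \<Rightarrow> ('m set \<times> 'v) set" where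
  "germ F a j U s = {(V, t). open V \<and> a \<in> V \<and> t \<in> scar F V j \<and>
     (\<exists>W. open W \<and> a \<in> W \<and> W \<subseteq> U \<inter> V \<and> gres F U W j s = gres F V W j t)}"

text \<open>
  Operations on germs are computed on representatives; as the result does not depend on them, the
  unions below are unions of a single set.
\<close>

definition stalk ::
  "('m::topological_space, 'f) galg_presheaf \<Rightarrow> ('m, 'f, 'v, 'z) gpresheaf_scheme \<Rightarrow> 'm \<Rightarrow>
   (('m set \<times> 'f) set, ('m set \<times> 'v) set) gmod" where
  "stalk C F a = \<lparr>
     gcomp = (\<lambda>j. mk_vs
       {germ F a j U s | U s. open U \<and> a \<in> U \<and> s \<in> scar F U j}
       (germ F a j UNIV \<zero>\<^bsub>gcomp (gsec F UNIV) j\<^esub>)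
       (\<lambda>X Y. \<Union>(U, s)\<in>X. \<Union>(V, t)\<in>Y. germ F a j (U \<inter> V)
          (gres F U (U \<inter> V) j s \<oplus>\<^bsub>gcomp (gsec F (U \<inter> V)) j\<^esub> gres F V (U \<inter> V) j t))
       (\<lambda>r X. \<Union>(U, s)\<in>X. germ F a j U (r \<odot>\<^bsub>gcomp (gsec F U) j\<^esub> s))),
     gact = (\<lambda>i j X Y. \<Union>(U, f)\<in>X. \<Union>(V, s)\<in>Y. germ F a (i + j) (U \<inter> V)
       (gact (gsec F (U \<inter> V)) i j (gres C U (U \<inter> V) i f) (gres F V (U \<inter> V) j s)))\<rparr>"

abbreviation stalk_alg ::
  "('m::topological_space, 'f) galg_presheaf \<Rightarrow> 'm \<Rightarrow> (('m set \<times> 'f) set, ('m set \<times> 'f) set) gmod" where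
  "stalk_alg C a \<equiv> stalk C C a"

text \<open>A section over \<open>U\<close> of the sheafification is a family of germs that locally comes from sections.\<close>

definition sheafify ::
  "('m::topological_space, 'f) galg_presheaf \<Rightarrow> ('m, 'f, 'v) gpresheaf \<Rightarrow> ('m, 'f, 'm \<Rightarrow> ('m set \<times> 'v) set) gpresheaf" where
  "sheafify C F = \<lparr>
     gsec = (\<lambda>U. \<lparr>
       gcomp = (\<lambda>j. mk_vs
         {\<sigma> \<in> extensional U. \<forall>x\<in>U. \<exists>V s. open V \<and> x \<in> V \<and> V \<subseteq> U \<and> s \<in> scar F V j \<and>
            (\<forall>y\<in>V. \<sigma> y = germ F y j V s)}
         (\<lambda>x\<in>U. \<zero>\<^bsub>gcomp (stalk C F x) j\<^esub>)
         (\<lambda>\<sigma> \<tau>. \<lambda>x\<in>U. \<sigma> x \<oplus>\<^bsub>gcomp (stalk C F x) j\<^esub> \<tau> x)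
         (\<lambda>r \<sigma>. \<lambda>x\<in>U. r \<odot>\<^bsub>gcomp (stalk C F x) j\<^esub> \<sigma> x)),
       gact = (\<lambda>i j f \<sigma>. \<lambda>x\<in>U. gact (stalk C F x) i j (germ C x i U f) (\<sigma> x))\<rparr>),
     gres = (\<lambda>U V j \<sigma>. restrict \<sigma> V)\<rparr>"


section \<open>Graded manifolds\<close>

subsection \<open>The local model\<close>

text \<open>
  Smoothness on an open subset \<open>U\<close> of \<open>Euclidean_space n\<close>, the copy of \<open>\<real>\<^sup>n\<close> inside \<open>nat \<Rightarrow> real\<close>:
  \<open>F l\<close> is the iterated partial derivative along the directions in the list \<open>l\<close>.
\<close>

definition smooth_on :: "nat \<Rightarrow> (nat \<Rightarrow> real) set \<Rightarrow> ((nat \<Rightarrow> real) \<Rightarrow> real) \<Rightarrow> bool" where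
  "smooth_on n U f \<longleftrightarrow> (\<exists>F :: nat list \<Rightarrow> (nat \<Rightarrow> real) \<Rightarrow> real.
     (\<forall>x\<in>U. F [] x = f x) \<and>
     (\<forall>l. set l \<subseteq> {..<n} \<longrightarrow> continuous_map (subtopology (Euclidean_space n) U) euclideanreal (F l)) \<and>
     (\<forall>l i x. set l \<subseteq> {..<n} \<and> i < n \<and> x \<in> U \<longrightarrow>
        ((\<lambda>t. F l (x(i := t))) has_real_derivative F (i # l) x) (at (x i))))"

text \<open>
  The graded variables \<open>\<xi>\<^sub>0, \<xi>\<^sub>1, \<dots>\<close> have the nonzero degrees listed in \<open>ds\<close>. Monomials are given by
  multi-indices, in which the exponents of variables of odd degree are at most \<open>1\<close>.
\<close>

definition mindices :: "int list \<Rightarrow> (nat \<Rightarrow> nat) set" where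
  "mindices ds = {p. (\<forall>i\<ge>length ds. p i = 0) \<and> (\<forall>i<length ds. odd (ds ! i) \<longrightarrow> p i \<le> 1)}"

definition weight :: "int list \<Rightarrow> (nat \<Rightarrow> nat) \<Rightarrow> int" where
  "weight ds p = (\<Sum>i<length ds. int (p i) * ds ! i)"

text \<open>The sign in \<open>\<xi>\<^sup>q \<xi>\<^sup>r = \<plusminus> \<xi>\<^sup>q\<^sup>+\<^sup>r\<close>, from moving each \<open>\<xi>\<^sub>l\<close> of the second factor past the \<open>\<xi>\<^sub>i\<close>, \<open>i > l\<close>, of the first.\<close>

definition mono_sign :: "int list \<Rightarrow> (nat \<Rightarrow> nat) \<Rightarrow> (nat \<Rightarrow> nat) \<Rightarrow> real" where
  "mono_sign ds q r = (\<Prod>i<length ds. \<Prod>l<i. ksign (int (q i) * ds ! i) (int (r l) * ds ! l))"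

text \<open>
  A function of degree \<open>j\<close> on \<open>W\<close> is a formal power series: \<open>s p x\<close> is the value at \<open>x\<close> of the smooth
  coefficient of \<open>\<xi>\<^sup>p\<close>. Coefficients are extended by \<open>0\<close> outside \<open>W\<close>.
\<close>

type_synonym gseries = "(nat \<Rightarrow> nat) \<Rightarrow> (nat \<Rightarrow> real) \<Rightarrow> real"

definition model_alg :: "nat \<Rightarrow> int list \<Rightarrow> (nat \<Rightarrow> real) set \<Rightarrow> (gseries, gseries) gmod" where
  "model_alg n ds W = \<lparr>
     gcomp = (\<lambda>j. mk_vs
       {s. (\<forall>p x. p \<notin> mindices ds \<or> weight ds p \<noteq> j \<or> x \<notin> W \<longrightarrow> s p x = 0) \<and> (\<forall>p. smooth_on n W (s p))}
       (\<lambda>p x. 0) (\<lambda>s t p x. s p x + t p x) (\<lambda>r s p x. r * s p x)),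
     gact = (\<lambda>i j s t p x. if p \<in> mindices ds
       then \<Sum>q | q \<le> p. mono_sign ds q (\<lambda>l. p l - q l) * s q x * t (\<lambda>l. p l - q l) x else 0)\<rparr>"

definition model_unit :: "(nat \<Rightarrow> real) set \<Rightarrow> gseries" where
  "model_unit W = (\<lambda>p x. if p = (\<lambda>_. 0) \<and> x \<in> W then 1 else 0)"

definition model_res :: "(nat \<Rightarrow> real) set \<Rightarrow> gseries \<Rightarrow> gseries" where
  "model_res W s = (\<lambda>p x. if x \<in> W then s p x else 0)"

subsection \<open>Graded manifolds and values of functions\<close>

definition graded_chart ::
  "('m::topological_space, 'f) galg_presheaf \<Rightarrow> 'm \<Rightarrow> nat \<Rightarrow> int list \<Rightarrow> 'm set \<Rightarrow> ('m \<Rightarrow> nat \<Rightarrow> real) \<Rightarrow>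
   ('m set \<Rightarrow> int \<Rightarrow> 'f \<Rightarrow> gseries) \<Rightarrow> bool" where
  "graded_chart C a n ds W \<phi> \<kappa> \<longleftrightarrow>
     0 \<notin> set ds \<and> open W \<and> a \<in> W \<and> openin (Euclidean_space n) (\<phi> ` W) \<and>
     homeomorphic_map (top_of_set W) (subtopology (Euclidean_space n) (\<phi> ` W)) \<phi> \<and>
     (\<forall>V. open V \<and> V \<subseteq> W \<longrightarrow>
        galg_iso (gsec C V) (gunit C V) (model_alg n ds (\<phi> ` V)) (model_unit (\<phi> ` V)) (\<kappa> V)) \<and>
     (\<forall>U V i. open U \<and> open V \<and> V \<subseteq> U \<and> U \<subseteq> W \<longrightarrow>
        (\<forall>f \<in> scar C U i. \<kappa> V i (gres C U V i f) = model_res (\<phi> ` V) (\<kappa> U i f)))"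

definition graded_manifold :: "('m::{second_countable_topology,t2_space}, 'f) galg_presheaf \<Rightarrow> bool" where
  "graded_manifold C \<longleftrightarrow> algebra_sheaf C \<and>
     (\<exists>n ds. \<forall>a. \<exists>W \<phi> \<kappa>. graded_chart C a n ds W \<phi> \<kappa>)"

text \<open>
  \<open>gval C a U i f\<close> is \<open>f(a)\<close>: the coefficient of \<open>\<xi>\<^sup>0\<close> at \<open>a\<close>, read off in some chart around \<open>a\<close>. It does
  not depend on the chart: in degree \<open>0\<close>, \<open>f(a)\<close> is the only real number \<open>r\<close> such that the germ of
  \<open>f - r\<close> at \<open>a\<close> is not invertible. In nonzero degree the coefficient of \<open>\<xi>\<^sup>0\<close> vanishes.
\<close>

definition gval :: "('m::topological_space, 'f) galg_presheaf \<Rightarrow> 'm \<Rightarrow> 'm set \<Rightarrow> int \<Rightarrow> 'f \<Rightarrow> real" where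
  "gval C a U i f =
     (case SOME (n, ds, W, \<phi>, \<kappa>). graded_chart C a n ds W \<phi> \<kappa> of
        (n, ds, W, \<phi>, \<kappa>) \<Rightarrow> \<kappa> (U \<inter> W) i (gres C U (U \<inter> W) i f) (\<lambda>_. 0) (\<phi> a))"

definition germ_val :: "('m::topological_space, 'f) galg_presheaf \<Rightarrow> 'm \<Rightarrow> int \<Rightarrow> ('m set \<times> 'f) set \<Rightarrow> real" where
  "germ_val C a i X = (THE r. \<forall>(U, f) \<in> X. gval C a U i f = r)"

definition vanish_sec :: "('m::topological_space, 'f) galg_presheaf \<Rightarrow> 'm set \<Rightarrow> 'm \<Rightarrow> int \<Rightarrow> 'f set" where
  "vanish_sec C U a i = {f \<in> scar C U i. gval C a U i f = 0}"

definition vanish_germ :: "('m::topological_space, 'f) galg_presheaf \<Rightarrow> 'm \<Rightarrow> int \<Rightarrow> ('m set \<times> 'f) set set" where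
  "vanish_germ C a i = {X \<in> gcar (stalk_alg C a) i. germ_val C a i X = 0}"


section \<open>Graded vector bundles and their fibers\<close>

definition trivial_bundle ::
  "('m, 'f) galg_presheaf \<Rightarrow> (int \<Rightarrow> (real, 'k) module) \<Rightarrow> ('m, 'f, ('f, 'k) ftens set) gpresheaf" where
  "trivial_bundle C K = \<lparr>
     gsec = (\<lambda>U. tensor_left real_graded (real_gmod (gcomp (gsec C U))) (real_gmod K) (gact (gsec C U))),
     gres = (\<lambda>U V j. tensor_lift real_graded (real_gmod (gcomp (gsec C V))) (real_gmod K) j (\<lambda>x. 1)
       (\<lambda>(i, f, v). (i, gres C U V i f, v)))\<rparr>"

text \<open>\<open>E\<close> is the sheaf of sections of a graded vector bundle with typical fiber \<open>K\<close>.\<close>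

definition graded_vector_bundle ::
  "('m::{second_countable_topology,t2_space}, 'f) galg_presheaf \<Rightarrow> (int \<Rightarrow> (real, 'k) module) \<Rightarrow>
   ('m, 'f, 's) gpresheaf \<Rightarrow> bool" where
  "graded_vector_bundle C K E \<longleftrightarrow> graded_fin_dim K \<and> module_presheaf C E \<and> sheaf_axiom E \<and>
     (\<forall>a. \<exists>W \<Lambda>. open W \<and> a \<in> W \<and> sheaf_iso_on C W E (trivial_bundle C K) \<Lambda>)"

text \<open>The reals as a module over the stalk at \<open>a\<close>: a germ acts as multiplication by its value.\<close>

definition real_at :: "('m::topological_space, 'f) galg_presheaf \<Rightarrow> 'm \<Rightarrow> (('m set \<times> 'f) set, real) gmod" where
  "real_at C a = \<lparr>gcomp = real_graded, gact = (\<lambda>i j X r. germ_val C a i X * r)\<rparr>"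

definition fiber ::
  "('m::topological_space, 'f) galg_presheaf \<Rightarrow> ('m, 'f, 'v) gpresheaf \<Rightarrow> 'm \<Rightarrow>
   (('m set \<times> 'f) set, (real, ('m set \<times> 'v) set) ftens set) gmod" where
  "fiber C F a = tensor_left (gcomp (stalk_alg C a)) (real_at C a) (stalk C F a) (gact (real_at C a))"

text \<open>The element \<open>1 \<otimes> [\<psi>]\<^sub>a\<close> of the fiber at \<open>a\<close>, for a section \<open>\<psi>\<close> of degree \<open>j\<close> over \<open>U\<close>.\<close>

definition fiber_class ::
  "('m::topological_space, 'f) galg_presheaf \<Rightarrow> ('m, 'f, 'v) gpresheaf \<Rightarrow> 'm \<Rightarrow> 'm set \<Rightarrow> int \<Rightarrow> 'v \<Rightarrow>
   (real, ('m set \<times> 'v) set) ftens set" where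
  "fiber_class C F a U j \<psi> =
     tensor_elt (gcomp (stalk_alg C a)) (real_at C a) (stalk C F a) j 0 1 (germ F a j U \<psi>)"


section \<open>Jets\<close>

subsection \<open>Geometrization\<close>

definition bullet ::
  "('m::topological_space, 'f) galg_presheaf \<Rightarrow> ('m, 'f, 'v) gpresheaf \<Rightarrow> 'm set \<Rightarrow> int \<Rightarrow> 'v set" where
  "bullet C F U j = {x \<in> scar F U j. \<forall>q. \<forall>a\<in>U.
     x \<in> ideal_smul (gsec F U) (ideal_pow (gsec C U) (vanish_sec C U a) q) (scar F U) j}"

definition geo ::
  "('m::topological_space, 'f) galg_presheaf \<Rightarrow> ('m, 'f, 'v) gpresheaf \<Rightarrow> ('m, 'f, 'v set) gpresheaf" where
  "geo C F = quot_presheaf F (bullet C F)"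

subsection \<open>The sheaf of jets\<close>

text \<open>\<open>jetX\<close> carries the action \<open>f \<triangleright> (g \<otimes> \<psi>) = (f g) \<otimes> \<psi>\<close>, and \<open>jet_ract\<close> is the other action
  \<open>g \<otimes> \<psi> \<mapsto> (-1)^(\<bar>f\<bar> \<bar>g\<bar>) g \<otimes> (f \<psi>)\<close>.\<close>

definition jetX ::
  "('m, 'f) galg_presheaf \<Rightarrow> ('m, 'f, 's) gpresheaf \<Rightarrow> ('m, 'f, ('f, 's) ftens set) gpresheaf" where
  "jetX C E = \<lparr>
     gsec = (\<lambda>U. tensor_left real_graded (real_gmod (gcomp (gsec C U))) (real_gmod (gcomp (gsec E U))) (gact (gsec C U))),
     gres = (\<lambda>U V j. tensor_lift real_graded (real_gmod (gcomp (gsec C V))) (real_gmod (gcomp (gsec E V))) j (\<lambda>x. 1)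
       (\<lambda>(i, g, \<psi>). (i, gres C U V i g, gres E U V (j - i) \<psi>)))\<rparr>"

definition jet_elt ::
  "('m, 'f) galg_presheaf \<Rightarrow> ('m, 'f, 's) gpresheaf \<Rightarrow> 'm set \<Rightarrow> int \<Rightarrow> int \<Rightarrow> 'f \<Rightarrow> 's \<Rightarrow> ('f, 's) ftens set" where
  "jet_elt C E U = tensor_elt real_graded (real_gmod (gcomp (gsec C U))) (real_gmod (gcomp (gsec E U)))"

definition jet_ract ::
  "('m, 'f) galg_presheaf \<Rightarrow> ('m, 'f, 's) gpresheaf \<Rightarrow> 'm set \<Rightarrow> int \<Rightarrow> int \<Rightarrow> 'f \<Rightarrow>
   ('f, 's) ftens set \<Rightarrow> ('f, 's) ftens set" where
  "jet_ract C E U d n f =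
     tensor_lift real_graded (real_gmod (gcomp (gsec C U))) (real_gmod (gcomp (gsec E U))) (d + n)
       (\<lambda>(i, g, \<psi>). ksign d i) (\<lambda>(i, g, \<psi>). (i, g, gact (gsec E U) d (n - i) f \<psi>))"

definition jet_delta ::
  "('m, 'f) galg_presheaf \<Rightarrow> ('m, 'f, 's) gpresheaf \<Rightarrow> 'm set \<Rightarrow> int \<Rightarrow> int \<Rightarrow> 'f \<Rightarrow>
   ('f, 's) ftens set \<Rightarrow> ('f, 's) ftens set" where
  "jet_delta C E U d n f x =
     gact (gsec (jetX C E) U) d n f x \<ominus>\<^bsub>gcomp (gsec (jetX C E) U) (d + n)\<^esub> jet_ract C E U d n f x"

text \<open>\<open>delta_gens C E U m n\<close> consists of the elements \<open>\<delta>\<^sub>f\<^sub>1 \<cdots> \<delta>\<^sub>f\<^sub>m (g \<otimes> \<psi>)\<close> of degree \<open>n\<close>.\<close>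

primrec delta_gens ::
  "('m, 'f) galg_presheaf \<Rightarrow> ('m, 'f, 's) gpresheaf \<Rightarrow> 'm set \<Rightarrow> nat \<Rightarrow> int \<Rightarrow> ('f, 's) ftens set set" where
  "delta_gens C E U 0 = (\<lambda>n. {jet_elt C E U n i g \<psi> | i g \<psi>. g \<in> scar C U i \<and> \<psi> \<in> scar E U (n - i)})"
| "delta_gens C E U (Suc m) =
     (\<lambda>n. {jet_delta C E U d (n - d) f x | d f x. f \<in> scar C U d \<and> x \<in> delta_gens C E U m (n - d)})"

definition jetV ::
  "('m, 'f) galg_presheaf \<Rightarrow> ('m, 'f, 's) gpresheaf \<Rightarrow> nat \<Rightarrow> 'm set \<Rightarrow> int \<Rightarrow> ('f, 's) ftens set set" where
  "jetV C E k U n = rspan (gcomp (gsec (jetX C E) U) n) (delta_gens C E U (Suc k) n)"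

definition pJet ::
  "('m, 'f) galg_presheaf \<Rightarrow> ('m, 'f, 's) gpresheaf \<Rightarrow> nat \<Rightarrow> ('m, 'f, ('f, 's) ftens set set) gpresheaf" where
  "pJet C E k = quot_presheaf (jetX C E) (jetV C E k)"

definition gpJet ::
  "('m::topological_space, 'f) galg_presheaf \<Rightarrow> ('m, 'f, 's) gpresheaf \<Rightarrow> nat \<Rightarrow>
   ('m, 'f, ('f, 's) ftens set set set) gpresheaf" where
  "gpJet C E k = geo C (pJet C E k)"

definition Jet ::
  "('m::topological_space, 'f) galg_presheaf \<Rightarrow> ('m, 'f, 's) gpresheaf \<Rightarrow> nat \<Rightarrow>
   ('m, 'f, 'm \<Rightarrow> ('m set \<times> ('f, 's) ftens set set set) set) gpresheaf" where
  "Jet C E k = sheafify C (gpJet C E k)"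

text \<open>The jet prolongation of a section \<open>\<psi>\<close> of degree \<open>j\<close> over \<open>U\<close>: the section of \<open>Jet C E k\<close>
  represented by \<open>1 \<otimes> \<psi>\<close>.\<close>

definition jet_prolong ::
  "('m::topological_space, 'f) galg_presheaf \<Rightarrow> ('m, 'f, 's) gpresheaf \<Rightarrow> nat \<Rightarrow> 'm set \<Rightarrow> int \<Rightarrow> 's \<Rightarrow>
   'm \<Rightarrow> ('m set \<times> ('f, 's) ftens set set set) set" where
  "jet_prolong C E k U j \<psi> = (\<lambda>x\<in>U. germ (gpJet C E k) x j U
     (bullet C (pJet C E k) U j +>\<^bsub>gcomp (gsec (pJet C E k) U) j\<^esub>
       (jetV C E k U j +>\<^bsub>gcomp (gsec (jetX C E) U) j\<^esub> jet_elt C E U j 0 (gunit C U) \<psi>)))"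

subsection \<open>Jet spaces\<close>

definition jet_sub ::
  "('m::topological_space, 'f) galg_presheaf \<Rightarrow> ('m, 'f, 's) gpresheaf \<Rightarrow> nat \<Rightarrow> 'm \<Rightarrow> int \<Rightarrow> ('m set \<times> 's) set set" where
  "jet_sub C E k a = ideal_smul (stalk C E a) (ideal_pow (stalk_alg C a) (vanish_germ C a) (Suc k)) (gcar (stalk C E a))"

text \<open>The action is \<open>[f]\<^sub>a \<triangleright> [\<psi>]\<^sub>a = f(a) [\<psi>]\<^sub>a\<close>, where \<open>f(a) = 0\<close> if \<open>f\<close> has nonzero degree.\<close>

definition jet_space ::
  "('m::topological_space, 'f) galg_presheaf \<Rightarrow> ('m, 'f, 's) gpresheaf \<Rightarrow> nat \<Rightarrow> 'm \<Rightarrow>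
   (('m set \<times> 'f) set, ('m set \<times> 's) set set) gmod" where
  "jet_space C E k a = \<lparr>
     gcomp = (\<lambda>j. quot_vs (gcomp (stalk C E a) j) (jet_sub C E k a j)),
     gact = (\<lambda>i j X Y. if i = 0
       then germ_val C a 0 X \<odot>\<^bsub>quot_vs (gcomp (stalk C E a) j) (jet_sub C E k a j)\<^esub> Y
       else \<zero>\<^bsub>quot_vs (gcomp (stalk C E a) (i + j)) (jet_sub C E k a (i + j))\<^esub>)\<rparr>"

definition jet_class ::
  "('m::topological_space, 'f) galg_presheaf \<Rightarrow> ('m, 'f, 's) gpresheaf \<Rightarrow> nat \<Rightarrow> 'm \<Rightarrow> 'm set \<Rightarrow> int \<Rightarrow> 's \<Rightarrow>
   ('m set \<times> 's) set set" where
  "jet_class C E k a U j \<psi> = jet_sub C E k a j +>\<^bsub>gcomp (stalk C E a) j\<^esub> germ E a j U \<psi>"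

text \<open>
  The canonical map from the fiber of the jet bundle to the jet space is the isomorphism sending the
  value at \<open>a\<close> of the prolongation of \<open>\<psi>\<close> to the class of the germ of \<open>\<psi>\<close>.
\<close>

definition canonical_jet_iso ::
  "('m::topological_space, 'f) galg_presheaf \<Rightarrow> ('m, 'f, 's) gpresheaf \<Rightarrow> nat \<Rightarrow> 'm \<Rightarrow>
   (int \<Rightarrow> (real, ('m set \<times> ('m \<Rightarrow> ('m set \<times> ('f, 's) ftens set set set) set)) set) ftens set
      \<Rightarrow> ('m set \<times> 's) set set) \<Rightarrow> bool" where
  "canonical_jet_iso C E k a \<Phi> \<longleftrightarrow>
     gmod_iso (stalk_alg C a) (fiber C (Jet C E k) a) (jet_space C E k a) \<Phi> \<and>
     (\<forall>U j. \<forall>\<psi> \<in> scar E U j. open U \<and> a \<in> U \<longrightarrow>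
        \<Phi> j (fiber_class C (Jet C E k) a U j (jet_prolong C E k U j \<psi>)) = jet_class C E k a U j \<psi>)"

end

theory Submission
  imports Defs
begin

text \<open>
  Let \<open>J\<close> be the ideal of germs at \<open>a\<close> that vanish at \<open>a\<close>, and \<open>X = C\<^sup>\<infinity> \<otimes> \<Gamma>\<close> the module \<open>jetX\<close> of which \<open>k\<close>-jets are
  classes. Two maps out of \<open>X(U)\<close>, for neighbourhoods \<open>U\<close> of \<open>a\<close>, are compared.

  The map \<open>jet_value\<close> sends \<open>x\<close> to the value at \<open>a\<close> of the section of the jet bundle that \<open>x\<close> represents. It satisfies
  \<open>f \<triangleright> x \<mapsto> f(a) x\<close> and kills the relations \<open>V\<^sub>(\<^sub>k\<^sub>)\<close>. As \<open>g \<otimes> \<psi> = g \<triangleright> (1 \<otimes> \<psi>)\<close>, every element of the fiber is the value of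
  some \<open>1 \<otimes> \<psi>\<close>, that is, of a prolongation (\<open>fiber_Jet_rep\<close>); hence the canonical map is unique.

  The map \<open>jet_eval\<close> is \<open>g \<otimes> \<psi> \<mapsto> g(a) [\<psi>]\<^sub>a\<close>, with values in \<open>\<Gamma>\<^sub>a\<close>. It turns \<open>\<delta>\<^sub>f\<close> into multiplication by
  \<open>f(a) - f \<in> J\<close> (\<open>jet_eval_delta\<close>), so it sends \<open>V\<^sub>(\<^sub>k\<^sub>)\<close> into \<open>J\<^sup>k\<^sup>+\<^sup>1 \<Gamma>\<^sub>a\<close> (\<open>jet_eval_delta_gens\<close>). Modulo \<open>J\<^sup>k\<^sup>+\<^sup>1 \<Gamma>\<^sub>a\<close>
  it also kills what geometrization divides out (\<open>pJet_eval_bullet\<close>), because a function that vanishes at \<open>a\<close> acts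
  by \<open>0\<close> through \<open>\<triangleright>\<close>. It therefore descends to the jet presheaf, to the stalk of its sheafification and to the fiber.
  The resulting map sends the value of the prolongation of \<open>\<psi>\<close> to the class of \<open>[\<psi>]\<^sub>a\<close>, and is onto.

  It is injective because \<open>1 \<otimes> \<psi>\<close> has value \<open>0\<close> whenever \<open>[\<psi>]\<^sub>a \<in> J\<^sup>k\<^sup>+\<^sup>1 \<Gamma>\<^sub>a\<close>. The identity
  \<open>1 \<otimes> f \<psi> = f \<blacktriangleright> (1 \<otimes> \<psi>) = f \<triangleright> (1 \<otimes> \<psi>) - \<delta>\<^sub>f (1 \<otimes> \<psi>)\<close> and the fact that \<open>\<delta>\<^sub>f\<close> commutes with \<open>\<triangleright>\<close> up to sign show by
  induction on \<open>m\<close> that a germ in \<open>J\<^sup>m \<Gamma>\<^sub>a\<close> has a representative \<open>\<psi>\<close> such that \<open>1 \<otimes> \<psi>\<close> is a sum of elements \<open>f \<triangleright> x\<close> with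
  \<open>f(a) = 0\<close> and of elements \<open>\<delta>\<^sub>f\<^sub>1 \<cdots> \<delta>\<^sub>f\<^sub>m (g \<otimes> \<chi>)\<close> (\<open>vanish_order_rep\<close>). For \<open>m = k + 1\<close> both kinds have value \<open>0\<close>.

  The quotients, tensor products, stalks and sheafifications that occur are vector spaces with a universal
  property, so that linear maps out of them are given, and compared, on generators.
\<close>

section \<open>Real vector spaces, linear maps and quotients\<close>

text \<open>
  A component of a graded vector space is a module over \<open>real_ring\<close>. The lemmas below restate the module
  laws with all scalars in \<open>UNIV\<close>, and differences are written \<open>x \<oplus> (-1) \<odot> y\<close>, so that subspaces need to be
  closed only under addition and scaling and to contain \<open>\<zero>\<close>.
\<close>

abbreviation vs :: "(real, 'v) module \<Rightarrow> bool" where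
  "vs M \<equiv> Module.module real_ring M"

abbreviation subspace_of :: "'v set \<Rightarrow> (real, 'v) module \<Rightarrow> bool" where
  "subspace_of N M \<equiv> submodule N real_ring M"

lemma real_ring_simps:
  "carrier real_ring = UNIV" "a \<otimes>\<^bsub>real_ring\<^esub> b = a * b" "\<one>\<^bsub>real_ring\<^esub> = 1"
  "\<zero>\<^bsub>real_ring\<^esub> = 0" "a \<oplus>\<^bsub>real_ring\<^esub> b = a + b"
  by (simp_all add: real_ring_def)

lemma cring_real_ring: "cring real_ring"
proof (intro cringI abelian_groupI comm_monoidI)
  fix x :: real
  show "\<exists>y\<in>carrier real_ring. y \<oplus>\<^bsub>real_ring\<^esub> x = \<zero>\<^bsub>real_ring\<^esub>"
    by (rule bexI[of _ "-x"]) (auto simp: real_ring_simps)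
qed (auto simp: real_ring_simps algebra_simps)

lemma vs_abelian_group: "vs M \<Longrightarrow> abelian_group M"
  by (simp add: Module.module_def)

lemma vs_zero_closed [simp]: "vs M \<Longrightarrow> \<zero>\<^bsub>M\<^esub> \<in> carrier M"
  by (meson vs_abelian_group abelian_group_def abelian_monoid.zero_closed)

lemma vs_add_closed [simp]:
  "vs M \<Longrightarrow> x \<in> carrier M \<Longrightarrow> y \<in> carrier M \<Longrightarrow> x \<oplus>\<^bsub>M\<^esub> y \<in> carrier M"
  by (meson vs_abelian_group abelian_group_def abelian_monoid.a_closed)

lemma vs_add_assoc:
  "vs M \<Longrightarrow> x \<in> carrier M \<Longrightarrow> y \<in> carrier M \<Longrightarrow> z \<in> carrier M \<Longrightarrow>
     (x \<oplus>\<^bsub>M\<^esub> y) \<oplus>\<^bsub>M\<^esub> z = x \<oplus>\<^bsub>M\<^esub> (y \<oplus>\<^bsub>M\<^esub> z)"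
  by (meson vs_abelian_group abelian_group_def abelian_monoid.a_assoc)

lemma vs_add_comm:
  "vs M \<Longrightarrow> x \<in> carrier M \<Longrightarrow> y \<in> carrier M \<Longrightarrow> x \<oplus>\<^bsub>M\<^esub> y = y \<oplus>\<^bsub>M\<^esub> x"
  by (meson vs_abelian_group abelian_group_def abelian_monoid.a_comm)

lemma vs_add_lcomm:
  "vs M \<Longrightarrow> x \<in> carrier M \<Longrightarrow> y \<in> carrier M \<Longrightarrow> z \<in> carrier M \<Longrightarrow>
     x \<oplus>\<^bsub>M\<^esub> (y \<oplus>\<^bsub>M\<^esub> z) = y \<oplus>\<^bsub>M\<^esub> (x \<oplus>\<^bsub>M\<^esub> z)"
  by (metis vs_add_assoc vs_add_comm)

lemma vs_l_zero [simp]: "vs M \<Longrightarrow> x \<in> carrier M \<Longrightarrow> \<zero>\<^bsub>M\<^esub> \<oplus>\<^bsub>M\<^esub> x = x"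
  by (meson vs_abelian_group abelian_group_def abelian_monoid.l_zero)

lemma vs_r_zero [simp]: "vs M \<Longrightarrow> x \<in> carrier M \<Longrightarrow> x \<oplus>\<^bsub>M\<^esub> \<zero>\<^bsub>M\<^esub> = x"
  by (meson vs_abelian_group abelian_group_def abelian_monoid.r_zero)

lemma vs_smult_closed [simp]: "vs M \<Longrightarrow> x \<in> carrier M \<Longrightarrow> r \<odot>\<^bsub>M\<^esub> x \<in> carrier M"
  using Module.module.smult_closed[of real_ring M r x] by (simp add: real_ring_simps)

lemma vs_smult_add_left:
  "vs M \<Longrightarrow> x \<in> carrier M \<Longrightarrow> (r + s) \<odot>\<^bsub>M\<^esub> x = r \<odot>\<^bsub>M\<^esub> x \<oplus>\<^bsub>M\<^esub> s \<odot>\<^bsub>M\<^esub> x"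
  using Module.module.smult_l_distr[of real_ring M r s x] by (simp add: real_ring_simps)

lemma vs_smult_add_right:
  "vs M \<Longrightarrow> x \<in> carrier M \<Longrightarrow> y \<in> carrier M \<Longrightarrow>
     r \<odot>\<^bsub>M\<^esub> (x \<oplus>\<^bsub>M\<^esub> y) = r \<odot>\<^bsub>M\<^esub> x \<oplus>\<^bsub>M\<^esub> r \<odot>\<^bsub>M\<^esub> y"
  using Module.module.smult_r_distr[of real_ring M r x y] by (simp add: real_ring_simps)

lemma vs_smult_smult [simp]:
  "vs M \<Longrightarrow> x \<in> carrier M \<Longrightarrow> r \<odot>\<^bsub>M\<^esub> (s \<odot>\<^bsub>M\<^esub> x) = (r * s) \<odot>\<^bsub>M\<^esub> x"
  using Module.module.smult_assoc1[of real_ring M r s x] by (simp add: real_ring_simps)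

lemma vs_smult_one [simp]: "vs M \<Longrightarrow> x \<in> carrier M \<Longrightarrow> 1 \<odot>\<^bsub>M\<^esub> x = x"
  using Module.module.smult_one[of real_ring M x] by (simp add: real_ring_simps)

lemma vs_smult_zero_left [simp]: "vs M \<Longrightarrow> x \<in> carrier M \<Longrightarrow> 0 \<odot>\<^bsub>M\<^esub> x = \<zero>\<^bsub>M\<^esub>"
  using Module.module.smult_l_null[of real_ring M x] by (simp add: real_ring_simps)

lemma vs_smult_zero_right [simp]: "vs M \<Longrightarrow> r \<odot>\<^bsub>M\<^esub> \<zero>\<^bsub>M\<^esub> = \<zero>\<^bsub>M\<^esub>"
  using Module.module.smult_r_null[of real_ring M r] by (simp add: real_ring_simps)

lemma vs_neg_self [simp]: "vs M \<Longrightarrow> x \<in> carrier M \<Longrightarrow> x \<oplus>\<^bsub>M\<^esub> (-1) \<odot>\<^bsub>M\<^esub> x = \<zero>\<^bsub>M\<^esub>"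
  using vs_smult_add_left[of M x 1 "-1"] by simp

lemma vs_minus_unique:
  assumes "vs M" "x \<in> carrier M" "y \<in> carrier M" "x \<oplus>\<^bsub>M\<^esub> y = \<zero>\<^bsub>M\<^esub>"
  shows "y = (-1) \<odot>\<^bsub>M\<^esub> x"
proof -
  have neg: "(-1) \<odot>\<^bsub>M\<^esub> x \<oplus>\<^bsub>M\<^esub> x = \<zero>\<^bsub>M\<^esub>"
    using assms vs_neg_self[of M x] by (subst vs_add_comm) simp_all
  have "((-1) \<odot>\<^bsub>M\<^esub> x \<oplus>\<^bsub>M\<^esub> x) \<oplus>\<^bsub>M\<^esub> y = (-1) \<odot>\<^bsub>M\<^esub> x \<oplus>\<^bsub>M\<^esub> (x \<oplus>\<^bsub>M\<^esub> y)"
    using assms by (intro vs_add_assoc) simp_all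
  then show ?thesis using assms neg by simp
qed

lemma vs_minus_closed [simp]: "vs M \<Longrightarrow> x \<in> carrier M \<Longrightarrow> \<ominus>\<^bsub>M\<^esub> x \<in> carrier M"
  by (simp add: abelian_group.a_inv_closed vs_abelian_group)

lemma vs_uminus_eq: "vs M \<Longrightarrow> x \<in> carrier M \<Longrightarrow> \<ominus>\<^bsub>M\<^esub> x = (-1) \<odot>\<^bsub>M\<^esub> x"
  by (rule vs_minus_unique) (simp_all add: abelian_group.r_neg vs_abelian_group)

lemma vs_minus_eq:
  "vs M \<Longrightarrow> x \<in> carrier M \<Longrightarrow> y \<in> carrier M \<Longrightarrow> x \<ominus>\<^bsub>M\<^esub> y = x \<oplus>\<^bsub>M\<^esub> (-1) \<odot>\<^bsub>M\<^esub> y"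
  by (simp add: a_minus_def vs_uminus_eq)

lemma vs_eq_iff_diff:
  assumes "vs M" "x \<in> carrier M" "y \<in> carrier M"
  shows "x = y \<longleftrightarrow> x \<oplus>\<^bsub>M\<^esub> (-1) \<odot>\<^bsub>M\<^esub> y = \<zero>\<^bsub>M\<^esub>"
proof
  assume "x \<oplus>\<^bsub>M\<^esub> (-1) \<odot>\<^bsub>M\<^esub> y = \<zero>\<^bsub>M\<^esub>"
  then have "(-1) \<odot>\<^bsub>M\<^esub> y \<oplus>\<^bsub>M\<^esub> x = \<zero>\<^bsub>M\<^esub>" using assms by (simp add: vs_add_comm)
  then have "x = (-1) \<odot>\<^bsub>M\<^esub> ((-1) \<odot>\<^bsub>M\<^esub> y)" using assms by (intro vs_minus_unique) simp_all
  then show "x = y" using assms by simp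
qed (use assms in simp)

text \<open>The law \<open>0 \<odot> x = \<zero>\<close> replaces the existence of additive inverses.\<close>

lemma vsI:
  assumes "\<zero>\<^bsub>M\<^esub> \<in> carrier M"
    and "\<And>x y. x \<in> carrier M \<Longrightarrow> y \<in> carrier M \<Longrightarrow> x \<oplus>\<^bsub>M\<^esub> y \<in> carrier M"
    and "\<And>r x. x \<in> carrier M \<Longrightarrow> r \<odot>\<^bsub>M\<^esub> x \<in> carrier M"
    and "\<And>x y z. x \<in> carrier M \<Longrightarrow> y \<in> carrier M \<Longrightarrow> z \<in> carrier M \<Longrightarrow>
      (x \<oplus>\<^bsub>M\<^esub> y) \<oplus>\<^bsub>M\<^esub> z = x \<oplus>\<^bsub>M\<^esub> (y \<oplus>\<^bsub>M\<^esub> z)"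
    and "\<And>x y. x \<in> carrier M \<Longrightarrow> y \<in> carrier M \<Longrightarrow> x \<oplus>\<^bsub>M\<^esub> y = y \<oplus>\<^bsub>M\<^esub> x"
    and "\<And>x. x \<in> carrier M \<Longrightarrow> \<zero>\<^bsub>M\<^esub> \<oplus>\<^bsub>M\<^esub> x = x"
    and "\<And>x. x \<in> carrier M \<Longrightarrow> 0 \<odot>\<^bsub>M\<^esub> x = \<zero>\<^bsub>M\<^esub>"
    and "\<And>x. x \<in> carrier M \<Longrightarrow> 1 \<odot>\<^bsub>M\<^esub> x = x"
    and "\<And>r s x. x \<in> carrier M \<Longrightarrow> (r + s) \<odot>\<^bsub>M\<^esub> x = r \<odot>\<^bsub>M\<^esub> x \<oplus>\<^bsub>M\<^esub> s \<odot>\<^bsub>M\<^esub> x"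
    and "\<And>r x y. x \<in> carrier M \<Longrightarrow> y \<in> carrier M \<Longrightarrow>
      r \<odot>\<^bsub>M\<^esub> (x \<oplus>\<^bsub>M\<^esub> y) = r \<odot>\<^bsub>M\<^esub> x \<oplus>\<^bsub>M\<^esub> r \<odot>\<^bsub>M\<^esub> y"
    and "\<And>r s x. x \<in> carrier M \<Longrightarrow> (r * s) \<odot>\<^bsub>M\<^esub> x = r \<odot>\<^bsub>M\<^esub> (s \<odot>\<^bsub>M\<^esub> x)"
  shows "vs M"
proof (intro moduleI cring_real_ring abelian_groupI)
  fix x assume x: "x \<in> carrier M"
  have "(-1) \<odot>\<^bsub>M\<^esub> x \<oplus>\<^bsub>M\<^esub> x = \<zero>\<^bsub>M\<^esub>"
    using assms(9)[of x "-1" 1] x by (simp add: assms)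
  then show "\<exists>y\<in>carrier M. y \<oplus>\<^bsub>M\<^esub> x = \<zero>\<^bsub>M\<^esub>" using assms(3) x by blast
qed (use assms in \<open>simp_all add: real_ring_simps\<close>)

subsection \<open>Subspaces and spans\<close>

lemma subspace_ofI:
  assumes "vs M" "N \<subseteq> carrier M" "\<zero>\<^bsub>M\<^esub> \<in> N"
    and "\<And>x y. x \<in> N \<Longrightarrow> y \<in> N \<Longrightarrow> x \<oplus>\<^bsub>M\<^esub> y \<in> N"
    and "\<And>r x. x \<in> N \<Longrightarrow> r \<odot>\<^bsub>M\<^esub> x \<in> N"
  shows "subspace_of N M"
proof (rule Module.module.submoduleI)
  fix x assume "x \<in> N"
  then show "\<ominus>\<^bsub>M\<^esub> x \<in> N" using assms by (metis subsetD vs_uminus_eq)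
qed (use assms in auto)

lemma subspace_of_subset: "subspace_of N M \<Longrightarrow> N \<subseteq> carrier M"
  by (metis submodule.axioms(1) subgroup.subset partial_object.select_convs(1))

lemma subspace_of_carrier_mem [simp]: "subspace_of N M \<Longrightarrow> x \<in> N \<Longrightarrow> x \<in> carrier M"
  using subspace_of_subset by blast

lemma subspace_of_zero [simp]: "subspace_of N M \<Longrightarrow> \<zero>\<^bsub>M\<^esub> \<in> N"
  using subgroup.one_closed[OF submodule.axioms(1), of N real_ring M] by simp

lemma subspace_of_add [simp]: "subspace_of N M \<Longrightarrow> x \<in> N \<Longrightarrow> y \<in> N \<Longrightarrow> x \<oplus>\<^bsub>M\<^esub> y \<in> N"
  using subgroup.m_closed[OF submodule.axioms(1), of N real_ring M] by simp

lemma subspace_of_smult [simp]: "subspace_of N M \<Longrightarrow> x \<in> N \<Longrightarrow> r \<odot>\<^bsub>M\<^esub> x \<in> N"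
  using submodule.smult_closed[of N real_ring M r x] by (simp add: real_ring_simps)

lemma subspace_of_carrier: "vs M \<Longrightarrow> subspace_of (carrier M) M"
  by (rule subspace_ofI) auto

lemma subspace_of_rspan:
  assumes "vs M" "S \<subseteq> carrier M"
  shows "subspace_of (rspan M S) M"
proof (rule subspace_ofI)
  show "rspan M S \<subseteq> carrier M"
    unfolding rspan_def using subspace_of_carrier[OF assms(1)] assms(2) by blast
qed (use assms in \<open>auto simp: rspan_def\<close>)

lemma rspan_superset: "x \<in> S \<Longrightarrow> x \<in> rspan M S"
  unfolding rspan_def by blast

lemma rspan_least: "subspace_of N M \<Longrightarrow> S \<subseteq> N \<Longrightarrow> rspan M S \<subseteq> N"
  unfolding rspan_def by blast

lemma rspan_subset_carrier: "vs M \<Longrightarrow> S \<subseteq> carrier M \<Longrightarrow> rspan M S \<subseteq> carrier M"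
  by (simp add: subspace_of_rspan subspace_of_subset)

text \<open>Nothing is required of \<open>L\<close> outside the carrier of \<open>M\<close>.\<close>

definition linear_map :: "(real, 'v) module \<Rightarrow> (real, 'w) module \<Rightarrow> ('v \<Rightarrow> 'w) \<Rightarrow> bool" where
  "linear_map M W L \<longleftrightarrow>
     (\<forall>x \<in> carrier M. L x \<in> carrier W) \<and>
     (\<forall>x \<in> carrier M. \<forall>y \<in> carrier M. L (x \<oplus>\<^bsub>M\<^esub> y) = L x \<oplus>\<^bsub>W\<^esub> L y) \<and>
     (\<forall>r. \<forall>x \<in> carrier M. L (r \<odot>\<^bsub>M\<^esub> x) = r \<odot>\<^bsub>W\<^esub> L x)"

lemma linear_mapI:
  assumes "\<And>x. x \<in> carrier M \<Longrightarrow> L x \<in> carrier W"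
    and "\<And>x y. x \<in> carrier M \<Longrightarrow> y \<in> carrier M \<Longrightarrow> L (x \<oplus>\<^bsub>M\<^esub> y) = L x \<oplus>\<^bsub>W\<^esub> L y"
    and "\<And>r x. x \<in> carrier M \<Longrightarrow> L (r \<odot>\<^bsub>M\<^esub> x) = r \<odot>\<^bsub>W\<^esub> L x"
  shows "linear_map M W L"
  using assms unfolding linear_map_def by blast

lemma linear_map_closed [simp]: "linear_map M W L \<Longrightarrow> x \<in> carrier M \<Longrightarrow> L x \<in> carrier W"
  unfolding linear_map_def by blast

lemma linear_map_add:
  "linear_map M W L \<Longrightarrow> x \<in> carrier M \<Longrightarrow> y \<in> carrier M \<Longrightarrow> L (x \<oplus>\<^bsub>M\<^esub> y) = L x \<oplus>\<^bsub>W\<^esub> L y"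
  unfolding linear_map_def by blast

lemma linear_map_smult:
  "linear_map M W L \<Longrightarrow> x \<in> carrier M \<Longrightarrow> L (r \<odot>\<^bsub>M\<^esub> x) = r \<odot>\<^bsub>W\<^esub> L x"
  unfolding linear_map_def by blast

lemma linear_map_zero: "vs M \<Longrightarrow> vs W \<Longrightarrow> linear_map M W L \<Longrightarrow> L \<zero>\<^bsub>M\<^esub> = \<zero>\<^bsub>W\<^esub>"
  using linear_map_smult[of M W L "\<zero>\<^bsub>M\<^esub>" 0] by simp

lemma linear_map_cong:
  assumes "vs M" "\<And>x. x \<in> carrier M \<Longrightarrow> L x = L' x" "linear_map M W L'"
  shows "linear_map M W L"
  using assms(3) by (simp add: linear_map_def assms(1,2))

lemma linear_map_comp:
  "linear_map M N L \<Longrightarrow> linear_map N W L' \<Longrightarrow> linear_map M W (\<lambda>x. L' (L x))"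
  by (rule linear_mapI) (simp_all add: linear_map_add linear_map_smult)

lemma linear_map_smult_map:
  assumes "vs W" "linear_map M W L"
  shows "linear_map M W (\<lambda>x. r \<odot>\<^bsub>W\<^esub> L x)"
proof (rule linear_mapI)
  fix s x assume "x \<in> carrier M"
  then show "r \<odot>\<^bsub>W\<^esub> L (s \<odot>\<^bsub>M\<^esub> x) = s \<odot>\<^bsub>W\<^esub> (r \<odot>\<^bsub>W\<^esub> L x)"
    using assms by (simp add: linear_map_smult mult.commute[of r])
qed (use assms in \<open>simp_all add: linear_map_add vs_smult_add_right\<close>)

lemma vs_add_add_swap:
  assumes "vs M" "x \<in> carrier M" "y \<in> carrier M" "z \<in> carrier M" "w \<in> carrier M"
  shows "(x \<oplus>\<^bsub>M\<^esub> y) \<oplus>\<^bsub>M\<^esub> (z \<oplus>\<^bsub>M\<^esub> w) = (x \<oplus>\<^bsub>M\<^esub> z) \<oplus>\<^bsub>M\<^esub> (y \<oplus>\<^bsub>M\<^esub> w)"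
  using assms by (simp add: vs_add_assoc vs_add_lcomm[of M y z])

lemma linear_map_add_map:
  assumes "vs W" "linear_map M W L" "linear_map M W L'"
  shows "linear_map M W (\<lambda>x. L x \<oplus>\<^bsub>W\<^esub> L' x)"
  using assms
  by (intro linear_mapI) (simp_all add: linear_map_add linear_map_smult vs_smult_add_right vs_add_add_swap)

lemma subspace_of_vimage:
  assumes "vs M" "vs W" "linear_map M W L" "subspace_of N W"
  shows "subspace_of {x \<in> carrier M. L x \<in> N} M"
  using assms
  by (intro subspace_ofI) (auto simp: linear_map_add linear_map_smult linear_map_zero)

lemma linear_map_rspan:
  assumes "vs M" "vs W" "linear_map M W L" "subspace_of N W" "S \<subseteq> carrier M"
    and "\<And>x. x \<in> S \<Longrightarrow> L x \<in> N" and "x \<in> rspan M S"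
  shows "L x \<in> N"
proof -
  have "rspan M S \<subseteq> {x \<in> carrier M. L x \<in> N}"
    using assms by (intro rspan_least subspace_of_vimage) auto
  then show ?thesis using assms by blast
qed

lemma subspace_of_zero_set: "vs M \<Longrightarrow> subspace_of {\<zero>\<^bsub>M\<^esub>} M"
  by (rule subspace_ofI) auto

lemma linear_map_eq_on_rspan:
  assumes "vs M" "vs W" "linear_map M W L" "linear_map M W L'" "S \<subseteq> carrier M"
    and "\<And>x. x \<in> S \<Longrightarrow> L x = L' x" and "x \<in> rspan M S"
  shows "L x = L' x"
proof -
  have lin: "linear_map M W (\<lambda>x. L x \<oplus>\<^bsub>W\<^esub> (-1) \<odot>\<^bsub>W\<^esub> L' x)"
    using assms by (intro linear_map_add_map linear_map_smult_map)
  have "L x \<oplus>\<^bsub>W\<^esub> (-1) \<odot>\<^bsub>W\<^esub> L' x \<in> {\<zero>\<^bsub>W\<^esub>}"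
    using linear_map_rspan[OF assms(1,2) lin subspace_of_zero_set[OF assms(2)] assms(5) _ assms(7)]
      assms(2,4,5,6) by (auto simp: subset_iff)
  moreover have "x \<in> carrier M" using rspan_subset_carrier assms by blast
  ultimately show ?thesis using assms by (auto simp: vs_eq_iff_diff[of W "L x"])
qed

subsection \<open>Quotient spaces\<close>

lemma mk_vs_simps [simp]:
  "carrier (mk_vs S z p s) = S" "zero (mk_vs S z p s) = z" "add (mk_vs S z p s) = p"
  "smult (mk_vs S z p s) = s"
  by (simp_all add: mk_vs_def)

lemma mem_coset_iff:
  assumes "vs M" "subspace_of N M" "x \<in> carrier M"
  shows "y \<in> N +>\<^bsub>M\<^esub> x \<longleftrightarrow> y \<in> carrier M \<and> y \<oplus>\<^bsub>M\<^esub> (-1) \<odot>\<^bsub>M\<^esub> x \<in> N"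
proof
  assume "y \<in> N +>\<^bsub>M\<^esub> x"
  then obtain h where h: "h \<in> N" "y = h \<oplus>\<^bsub>M\<^esub> x" by (auto simp: a_r_coset_def')
  then have "h \<in> carrier M" using assms by simp
  then show "y \<in> carrier M \<and> y \<oplus>\<^bsub>M\<^esub> (-1) \<odot>\<^bsub>M\<^esub> x \<in> N" using assms h by (simp add: vs_add_assoc)
next
  assume *: "y \<in> carrier M \<and> y \<oplus>\<^bsub>M\<^esub> (-1) \<odot>\<^bsub>M\<^esub> x \<in> N"
  have "(-1) \<odot>\<^bsub>M\<^esub> x \<oplus>\<^bsub>M\<^esub> x = \<zero>\<^bsub>M\<^esub>" using assms by (subst vs_add_comm) auto
  then have "y = (y \<oplus>\<^bsub>M\<^esub> (-1) \<odot>\<^bsub>M\<^esub> x) \<oplus>\<^bsub>M\<^esub> x" using * assms by (simp add: vs_add_assoc)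
  then show "y \<in> N +>\<^bsub>M\<^esub> x" using * unfolding a_r_coset_def' by blast
qed

lemma coset_self: "vs M \<Longrightarrow> subspace_of N M \<Longrightarrow> x \<in> carrier M \<Longrightarrow> x \<in> N +>\<^bsub>M\<^esub> x"
  by (simp add: mem_coset_iff)

lemma coset_eq_iff:
  assumes "vs M" "subspace_of N M" "x \<in> carrier M" "y \<in> carrier M"
  shows "N +>\<^bsub>M\<^esub> x = N +>\<^bsub>M\<^esub> y \<longleftrightarrow> x \<oplus>\<^bsub>M\<^esub> (-1) \<odot>\<^bsub>M\<^esub> y \<in> N"
proof
  assume "N +>\<^bsub>M\<^esub> x = N +>\<^bsub>M\<^esub> y"
  then have "x \<in> N +>\<^bsub>M\<^esub> y" using coset_self[OF assms(1-3)] by simp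
  then show "x \<oplus>\<^bsub>M\<^esub> (-1) \<odot>\<^bsub>M\<^esub> y \<in> N" using assms by (simp add: mem_coset_iff)
next
  have cancel: "(a \<oplus>\<^bsub>M\<^esub> (-1) \<odot>\<^bsub>M\<^esub> b) \<oplus>\<^bsub>M\<^esub> (b \<oplus>\<^bsub>M\<^esub> (-1) \<odot>\<^bsub>M\<^esub> c) = a \<oplus>\<^bsub>M\<^esub> (-1) \<odot>\<^bsub>M\<^esub> c"
    if "a \<in> carrier M" "b \<in> carrier M" "c \<in> carrier M" for a b c
  proof -
    have "(-1) \<odot>\<^bsub>M\<^esub> b \<oplus>\<^bsub>M\<^esub> (b \<oplus>\<^bsub>M\<^esub> (-1) \<odot>\<^bsub>M\<^esub> c) = (b \<oplus>\<^bsub>M\<^esub> (-1) \<odot>\<^bsub>M\<^esub> b) \<oplus>\<^bsub>M\<^esub> (-1) \<odot>\<^bsub>M\<^esub> c"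
      by (metis that assms(1) vs_smult_closed vs_add_assoc vs_add_comm)
    also have "\<dots> = (-1) \<odot>\<^bsub>M\<^esub> c" using that assms(1) by simp
    finally show ?thesis using that assms(1) by (subst vs_add_assoc) simp_all
  qed
  have *: "N +>\<^bsub>M\<^esub> a \<subseteq> N +>\<^bsub>M\<^esub> b"
    if "a \<oplus>\<^bsub>M\<^esub> (-1) \<odot>\<^bsub>M\<^esub> b \<in> N" "a \<in> carrier M" "b \<in> carrier M" for a b
  proof
    fix z assume "z \<in> N +>\<^bsub>M\<^esub> a"
    then have z: "z \<in> carrier M" "z \<oplus>\<^bsub>M\<^esub> (-1) \<odot>\<^bsub>M\<^esub> a \<in> N" using that assms by (simp_all add: mem_coset_iff)
    have "(z \<oplus>\<^bsub>M\<^esub> (-1) \<odot>\<^bsub>M\<^esub> a) \<oplus>\<^bsub>M\<^esub> (a \<oplus>\<^bsub>M\<^esub> (-1) \<odot>\<^bsub>M\<^esub> b) \<in> N"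
      by (rule subspace_of_add[OF assms(2) z(2) that(1)])
    then show "z \<in> N +>\<^bsub>M\<^esub> b" using cancel z that assms by (simp add: mem_coset_iff)
  qed
  assume xy: "x \<oplus>\<^bsub>M\<^esub> (-1) \<odot>\<^bsub>M\<^esub> y \<in> N"
  have "(-1) \<odot>\<^bsub>M\<^esub> (x \<oplus>\<^bsub>M\<^esub> (-1) \<odot>\<^bsub>M\<^esub> y) \<in> N" using xy assms by simp
  moreover have "(-1) \<odot>\<^bsub>M\<^esub> (x \<oplus>\<^bsub>M\<^esub> (-1) \<odot>\<^bsub>M\<^esub> y) = y \<oplus>\<^bsub>M\<^esub> (-1) \<odot>\<^bsub>M\<^esub> x"
    using assms by (simp add: vs_smult_add_right vs_add_comm[of M y])
  ultimately have "y \<oplus>\<^bsub>M\<^esub> (-1) \<odot>\<^bsub>M\<^esub> x \<in> N" by simp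
  with xy * assms show "N +>\<^bsub>M\<^esub> x = N +>\<^bsub>M\<^esub> y" by blast
qed

lemma coset_eq_self_iff:
  assumes "vs M" "subspace_of N M" "x \<in> carrier M"
  shows "N +>\<^bsub>M\<^esub> x = N \<longleftrightarrow> x \<in> N"
proof -
  have "N +>\<^bsub>M\<^esub> \<zero>\<^bsub>M\<^esub> = N" using assms by (auto simp: mem_coset_iff)
  then show ?thesis using coset_eq_iff[OF assms(1,2,3), of "\<zero>\<^bsub>M\<^esub>"] assms by simp
qed

lemma carrier_quot_vs: "carrier (quot_vs M N) = {N +>\<^bsub>M\<^esub> x | x. x \<in> carrier M}"
  by (auto simp: quot_vs_def A_RCOSETS_def')

lemma zero_quot_vs: "\<zero>\<^bsub>quot_vs M N\<^esub> = N"
  by (simp add: quot_vs_def)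

lemma coset_in_quot_vs: "x \<in> carrier M \<Longrightarrow> N +>\<^bsub>M\<^esub> x \<in> carrier (quot_vs M N)"
  by (auto simp: carrier_quot_vs)

lemma UN_const: "x0 \<in> X \<Longrightarrow> (\<And>x. x \<in> X \<Longrightarrow> G x = G x0) \<Longrightarrow> (\<Union>x\<in>X. G x) = G x0"
  by blast

text \<open>
  The unions over cosets in \<open>gquot\<close>, \<open>quot_presheaf\<close> and \<open>tensor_lift\<close> are evaluated with this lemma: a
  linear map that respects the subspaces induces a map of cosets, computed on any representative.
\<close>

lemma coset_map:
  assumes "vs M" "subspace_of N M" "vs M'" "subspace_of N' M'" "linear_map M M' h"
    and "\<And>x. x \<in> N \<Longrightarrow> h x \<in> N'" and "x0 \<in> carrier M"
  shows "(\<Union>x\<in>N +>\<^bsub>M\<^esub> x0. N' +>\<^bsub>M'\<^esub> h x) = N' +>\<^bsub>M'\<^esub> h x0"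
proof (rule UN_const)
  show "x0 \<in> N +>\<^bsub>M\<^esub> x0" using assms by (simp add: coset_self)
next
  fix x assume "x \<in> N +>\<^bsub>M\<^esub> x0"
  then have x: "x \<in> carrier M" "x \<oplus>\<^bsub>M\<^esub> (-1) \<odot>\<^bsub>M\<^esub> x0 \<in> N" using assms by (simp_all add: mem_coset_iff)
  then have "h (x \<oplus>\<^bsub>M\<^esub> (-1) \<odot>\<^bsub>M\<^esub> x0) \<in> N'" using assms by blast
  then show "N' +>\<^bsub>M'\<^esub> h x = N' +>\<^bsub>M'\<^esub> h x0"
    using assms x by (subst coset_eq_iff) (simp_all add: linear_map_add linear_map_smult)
qed

lemma coset_add:
  assumes "vs M" "subspace_of N M" "x \<in> carrier M" "y \<in> carrier M"
  shows "(N +>\<^bsub>M\<^esub> x) \<oplus>\<^bsub>quot_vs M N\<^esub> (N +>\<^bsub>M\<^esub> y) = N +>\<^bsub>M\<^esub> (x \<oplus>\<^bsub>M\<^esub> y)"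
proof -
  have "abelian_subgroup N M"
    using assms by (intro abelian_subgroupI3 vs_abelian_group)
      (simp_all add: submodule.axioms(1) additive_subgroup.intro)
  then show ?thesis
    using abelian_subgroup.a_rcos_sum[of N M x y] assms by (simp add: quot_vs_def)
qed

lemma coset_smult:
  assumes "vs M" "subspace_of N M" "x \<in> carrier M"
  shows "r \<odot>\<^bsub>quot_vs M N\<^esub> (N +>\<^bsub>M\<^esub> x) = N +>\<^bsub>M\<^esub> (r \<odot>\<^bsub>M\<^esub> x)"
proof -
  have "linear_map M M (\<lambda>x. r \<odot>\<^bsub>M\<^esub> x)"
    using assms by (intro linear_map_smult_map linear_mapI) simp_all
  from coset_map[OF assms(1,2,1,2) this] show ?thesis using assms by (simp add: quot_vs_def)
qed

lemma vs_quot_vs: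
  assumes "vs M" "subspace_of N M"
  shows "vs (quot_vs M N)"
proof -
  have zero: "\<zero>\<^bsub>quot_vs M N\<^esub> = N +>\<^bsub>M\<^esub> \<zero>\<^bsub>M\<^esub>"
    using coset_eq_self_iff[OF assms, of "\<zero>\<^bsub>M\<^esub>"] assms by (simp add: zero_quot_vs)
  have rep: "\<exists>x. x \<in> carrier M \<and> X = N +>\<^bsub>M\<^esub> x" if "X \<in> carrier (quot_vs M N)" for X
    using that by (auto simp: carrier_quot_vs)
  note [simp] = coset_add[OF assms] coset_smult[OF assms] coset_in_quot_vs
  show ?thesis
  proof (rule vsI, goal_cases)
    case 1 then show ?case using assms by (simp add: zero)
  next
    case (2 X Y) with rep[of X] rep[of Y] assms show ?case by auto
  next
    case (3 r X) with rep[of X] assms show ?case by auto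
  next
    case (4 X Y Z) with rep[of X] rep[of Y] rep[of Z] assms show ?case by (auto simp: vs_add_assoc)
  next
    case (5 X Y) with rep[of X] rep[of Y] assms show ?case by (auto simp: vs_add_comm)
  next
    case (6 X) with rep[of X] assms show ?case by (auto simp: zero)
  next
    case (7 X) with rep[of X] assms show ?case by (auto simp: zero)
  next
    case (8 X) with rep[of X] assms show ?case by auto
  next
    case (9 r s X) with rep[of X] assms show ?case by (auto simp: vs_smult_add_left)
  next
    case (10 r X Y) with rep[of X] rep[of Y] assms show ?case by (auto simp: vs_smult_add_right)
  next
    case (11 r s X) with rep[of X] assms show ?case by auto
  qed
qed

lemma linear_map_coset:
  assumes "vs M" "subspace_of N M"
  shows "linear_map M (quot_vs M N) (\<lambda>x. N +>\<^bsub>M\<^esub> x)"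
  using assms by (intro linear_mapI) (simp_all add: coset_in_quot_vs coset_add coset_smult)

text \<open>The map that a map \<open>L\<close>, constant on cosets, induces on cosets.\<close>

definition quot_lift :: "('v \<Rightarrow> 'w) \<Rightarrow> 'v set \<Rightarrow> 'w" where
  "quot_lift L X = the_elem (L ` X)"

lemma quot_lift_coset:
  assumes "vs M" "subspace_of N M" "vs W" "linear_map M W L"
    and "\<And>x. x \<in> N \<Longrightarrow> L x = \<zero>\<^bsub>W\<^esub>" and "x \<in> carrier M"
  shows "quot_lift L (N +>\<^bsub>M\<^esub> x) = L x"
proof -
  have "L y = L x" if "y \<in> N +>\<^bsub>M\<^esub> x" for y
  proof -
    have y: "y \<in> carrier M" "y \<oplus>\<^bsub>M\<^esub> (-1) \<odot>\<^bsub>M\<^esub> x \<in> N" using that assms by (simp_all add: mem_coset_iff)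
    then have "L (y \<oplus>\<^bsub>M\<^esub> (-1) \<odot>\<^bsub>M\<^esub> x) = \<zero>\<^bsub>W\<^esub>" using assms by blast
    then show ?thesis using assms y
      by (simp add: linear_map_add linear_map_smult vs_eq_iff_diff[of W "L y"])
  qed
  then have "L ` (N +>\<^bsub>M\<^esub> x) = {L x}" using coset_self[OF assms(1,2,6)] by blast
  then show ?thesis by (simp add: quot_lift_def)
qed

lemma linear_map_quot_lift:
  assumes "vs M" "subspace_of N M" "vs W" "linear_map M W L"
    and "\<And>x. x \<in> N \<Longrightarrow> L x = \<zero>\<^bsub>W\<^esub>"
  shows "linear_map (quot_vs M N) W (quot_lift L)"
  using assms
  by (intro linear_mapI)
    (auto simp: carrier_quot_vs coset_add coset_smult linear_map_add linear_map_smult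
      quot_lift_coset[of M N W L])

section \<open>Graded modules and presheaves\<close>

lemma graded_module_vs: "graded_module A e P \<Longrightarrow> vs (gcomp P j)"
  by (simp add: graded_module_def graded_vs_def)

lemma graded_module_closed:
  "graded_module A e P \<Longrightarrow> f \<in> gcar A i \<Longrightarrow> x \<in> gcar P j \<Longrightarrow> gact P i j f x \<in> gcar P (i + j)"
  by (simp add: graded_module_def)

lemma graded_module_add_left:
  "graded_module A e P \<Longrightarrow> f \<in> gcar A i \<Longrightarrow> g \<in> gcar A i \<Longrightarrow> x \<in> gcar P j \<Longrightarrow>
     gact P i j (f \<oplus>\<^bsub>gcomp A i\<^esub> g) x = gact P i j f x \<oplus>\<^bsub>gcomp P (i + j)\<^esub> gact P i j g x"
  by (simp add: graded_module_def)

lemma graded_module_add_right: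
  "graded_module A e P \<Longrightarrow> f \<in> gcar A i \<Longrightarrow> x \<in> gcar P j \<Longrightarrow> y \<in> gcar P j \<Longrightarrow>
     gact P i j f (x \<oplus>\<^bsub>gcomp P j\<^esub> y) = gact P i j f x \<oplus>\<^bsub>gcomp P (i + j)\<^esub> gact P i j f y"
  by (simp add: graded_module_def)

lemma graded_module_smult_left:
  "graded_module A e P \<Longrightarrow> f \<in> gcar A i \<Longrightarrow> x \<in> gcar P j \<Longrightarrow>
     gact P i j (r \<odot>\<^bsub>gcomp A i\<^esub> f) x = r \<odot>\<^bsub>gcomp P (i + j)\<^esub> gact P i j f x"
  by (simp add: graded_module_def)

lemma graded_module_smult_right:
  "graded_module A e P \<Longrightarrow> f \<in> gcar A i \<Longrightarrow> x \<in> gcar P j \<Longrightarrow>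
     gact P i j f (r \<odot>\<^bsub>gcomp P j\<^esub> x) = r \<odot>\<^bsub>gcomp P (i + j)\<^esub> gact P i j f x"
  by (simp add: graded_module_def)

lemma graded_module_assoc:
  "graded_module A e P \<Longrightarrow> f \<in> gcar A i \<Longrightarrow> g \<in> gcar A j \<Longrightarrow> x \<in> gcar P l \<Longrightarrow>
     gact P (i + j) l (gact A i j f g) x = gact P i (j + l) f (gact P j l g x)"
  by (simp add: graded_module_def)

lemma graded_module_unit:
  "graded_module A e P \<Longrightarrow> x \<in> gcar P j \<Longrightarrow> gact P 0 j e x = x"
  by (simp add: graded_module_def)

lemma graded_moduleI:
  assumes "\<And>j. vs (gcomp P j)"
    and "\<And>i j f x. f \<in> gcar A i \<Longrightarrow> x \<in> gcar P j \<Longrightarrow> gact P i j f x \<in> gcar P (i + j)"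
    and "\<And>i j f g x. f \<in> gcar A i \<Longrightarrow> g \<in> gcar A i \<Longrightarrow> x \<in> gcar P j \<Longrightarrow>
      gact P i j (f \<oplus>\<^bsub>gcomp A i\<^esub> g) x = gact P i j f x \<oplus>\<^bsub>gcomp P (i + j)\<^esub> gact P i j g x"
    and "\<And>i j f x y. f \<in> gcar A i \<Longrightarrow> x \<in> gcar P j \<Longrightarrow> y \<in> gcar P j \<Longrightarrow>
      gact P i j f (x \<oplus>\<^bsub>gcomp P j\<^esub> y) = gact P i j f x \<oplus>\<^bsub>gcomp P (i + j)\<^esub> gact P i j f y"
    and "\<And>i j r f x. f \<in> gcar A i \<Longrightarrow> x \<in> gcar P j \<Longrightarrow>
      gact P i j (r \<odot>\<^bsub>gcomp A i\<^esub> f) x = r \<odot>\<^bsub>gcomp P (i + j)\<^esub> gact P i j f x"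
    and "\<And>i j r f x. f \<in> gcar A i \<Longrightarrow> x \<in> gcar P j \<Longrightarrow>
      gact P i j f (r \<odot>\<^bsub>gcomp P j\<^esub> x) = r \<odot>\<^bsub>gcomp P (i + j)\<^esub> gact P i j f x"
    and "\<And>i j l f g x. f \<in> gcar A i \<Longrightarrow> g \<in> gcar A j \<Longrightarrow> x \<in> gcar P l \<Longrightarrow>
      gact P (i + j) l (gact A i j f g) x = gact P i (j + l) f (gact P j l g x)"
    and "\<And>j x. x \<in> gcar P j \<Longrightarrow> gact P 0 j e x = x"
  shows "graded_module A e P"
  unfolding graded_module_def graded_vs_def
  by (intro conjI allI ballI) (simp_all add: assms)

lemma linear_map_gact:
  "graded_module A e P \<Longrightarrow> f \<in> gcar A i \<Longrightarrow>
     linear_map (gcomp P j) (gcomp P (i + j)) (gact P i j f)"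
  by (rule linear_mapI)
    (simp_all add: graded_module_closed graded_module_add_right graded_module_smult_right)

lemma linear_map_gact_left:
  "graded_module A e P \<Longrightarrow> x \<in> gcar P j \<Longrightarrow>
     linear_map (gcomp A i) (gcomp P (i + j)) (\<lambda>f. gact P i j f x)"
  by (rule linear_mapI)
    (simp_all add: graded_module_closed graded_module_add_left graded_module_smult_left)

lemma graded_comm_algebraD:
  assumes "graded_comm_algebra A e"
  shows "e \<in> gcar A 0" "graded_module A e A"
    "\<And>f g i j. f \<in> gcar A i \<Longrightarrow> g \<in> gcar A j \<Longrightarrow>
       gact A i j f g = ksign i j \<odot>\<^bsub>gcomp A (i + j)\<^esub> gact A j i g f"
  using conjunct1[OF assms[unfolded graded_comm_algebra_def]]
    conjunct1[OF conjunct2[OF assms[unfolded graded_comm_algebra_def]]]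
    conjunct2[OF conjunct2[OF assms[unfolded graded_comm_algebra_def]], rule_format] by this

subsection \<open>Quotient modules\<close>

lemma gquot_simps [simp]:
  "gcomp (gquot P N) j = quot_vs (gcomp P j) (N j)"
  by (simp add: gquot_def)

text \<open>Families of subspaces that are stable under the action of \<open>A\<close>.\<close>

definition graded_submodule :: "('f, 'f) gmod \<Rightarrow> ('f, 'v) gmod \<Rightarrow> (int \<Rightarrow> 'v set) \<Rightarrow> bool" where
  "graded_submodule A P N \<longleftrightarrow> (\<forall>j. subspace_of (N j) (gcomp P j)) \<and>
     (\<forall>i j. \<forall>f \<in> gcar A i. \<forall>x \<in> N j. gact P i j f x \<in> N (i + j))"

lemma gact_gquot:
  assumes "graded_module A e P" "graded_submodule A P N" "f \<in> gcar A i" "x \<in> gcar P j"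
  shows "gact (gquot P N) i j f (N j +>\<^bsub>gcomp P j\<^esub> x) = N (i + j) +>\<^bsub>gcomp P (i + j)\<^esub> gact P i j f x"
proof -
  have "subspace_of (N j) (gcomp P j)" "subspace_of (N (i + j)) (gcomp P (i + j))"
    and "\<And>x. x \<in> N j \<Longrightarrow> gact P i j f x \<in> N (i + j)"
    using assms unfolding graded_submodule_def by blast+
  then show ?thesis
    unfolding gquot_def using assms
    by simp (rule coset_map, auto simp: graded_module_vs intro: linear_map_gact)
qed

lemma graded_module_gquot:
  assumes P: "graded_module A e P" and N: "graded_submodule A P N"
    and A: "graded_module A e A" "e \<in> gcar A 0"
  shows "graded_module A e (gquot P N)"
proof -
  have sub: "subspace_of (N j) (gcomp P j)" for j using N unfolding graded_submodule_def by blast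
  have vs: "vs (gcomp P j)" "vs (gcomp A j)" for j using P A by (simp_all add: graded_module_vs)
  have rep: "\<exists>x. x \<in> gcar P j \<and> X = N j +>\<^bsub>gcomp P j\<^esub> x" if "X \<in> gcar (gquot P N) j" for X j
    using that by (auto simp: carrier_quot_vs)
  note [simp] = gact_gquot[OF P N] coset_add[OF vs(1) sub] coset_smult[OF vs(1) sub] coset_in_quot_vs
    graded_module_closed[OF P] graded_module_closed[OF A(1)] vs A(2)
  show ?thesis
  proof (rule graded_moduleI, goal_cases)
    case (1 j) show ?case using vs sub by (simp add: vs_quot_vs)
  next
    case (2 i j f X) with rep[OF 2(2)] show ?case by auto
  next
    case (3 i j f g X) with rep[OF 3(3)] show ?case by (auto simp: graded_module_add_left[OF P])
  next
    case (4 i j f X Y) with rep[OF 4(2)] rep[OF 4(3)] show ?case by (auto simp: graded_module_add_right[OF P])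
  next
    case (5 i j r f X) with rep[OF 5(2)] show ?case by (auto simp: graded_module_smult_left[OF P])
  next
    case (6 i j r f X) with rep[OF 6(2)] show ?case by (auto simp: graded_module_smult_right[OF P])
  next
    case (7 i j l f g X)
    from rep[OF 7(3)] obtain x where x: "x \<in> gcar P l" "X = N l +>\<^bsub>gcomp P l\<^esub> x" by blast
    have "gact (gquot P N) (i + j) l (gact A i j f g) X
        = N (i + j + l) +>\<^bsub>gcomp P (i + j + l)\<^esub> gact P (i + j) l (gact A i j f g) x"
      using 7 x by simp
    also have "\<dots> = gact (gquot P N) i (j + l) f (gact (gquot P N) j l g X)"
      using 7 x by (simp add: graded_module_assoc[OF P] add.assoc)
    finally show ?case .
  next
    case (8 j X) with rep[OF 8] show ?case
      using gact_gquot[OF P N A(2)] by (auto simp: graded_module_unit[OF P])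
  qed
qed

subsection \<open>Presheaves of modules\<close>

lemma module_presheaf_module:
  "module_presheaf C F \<Longrightarrow> open U \<Longrightarrow> graded_module (gsec C U) (gunit C U) (gsec F U)"
  by (simp add: module_presheaf_def)

lemma module_presheaf_vs: "module_presheaf C F \<Longrightarrow> open U \<Longrightarrow> vs (gcomp (gsec F U) j)"
  by (rule graded_module_vs[OF module_presheaf_module])

lemma linear_map_gres:
  assumes "module_presheaf C F" "open U" "open V" "V \<subseteq> U"
  shows "linear_map (gcomp (gsec F U) j) (gcomp (gsec F V) j) (gres F U V j)"
  using assms by (intro linear_mapI) (simp_all add: module_presheaf_def)

lemma module_presheaf_gres_closed:
  "module_presheaf C F \<Longrightarrow> open U \<Longrightarrow> open V \<Longrightarrow> V \<subseteq> U \<Longrightarrow> x \<in> scar F U j \<Longrightarrow> gres F U V j x \<in> scar F V j"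
  by (simp add: module_presheaf_def)

lemma module_presheaf_gres_gact:
  "module_presheaf C F \<Longrightarrow> open U \<Longrightarrow> open V \<Longrightarrow> V \<subseteq> U \<Longrightarrow> f \<in> scar C U i \<Longrightarrow> x \<in> scar F U j \<Longrightarrow>
     gres F U V (i + j) (gact (gsec F U) i j f x) = gact (gsec F V) i j (gres C U V i f) (gres F U V j x)"
  by (simp add: module_presheaf_def)

lemma module_presheaf_gres_self:
  "module_presheaf C F \<Longrightarrow> open U \<Longrightarrow> x \<in> scar F U j \<Longrightarrow> gres F U U j x = x"
  by (simp add: module_presheaf_def)

lemma module_presheaf_gres_gres:
  "module_presheaf C F \<Longrightarrow> open U \<Longrightarrow> open V \<Longrightarrow> open W \<Longrightarrow> W \<subseteq> V \<Longrightarrow> V \<subseteq> U \<Longrightarrow> x \<in> scar F U j \<Longrightarrow>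
     gres F V W j (gres F U V j x) = gres F U W j x"
  by (simp add: module_presheaf_def)

lemma module_presheafI:
  assumes "\<And>U. open U \<Longrightarrow> graded_module (gsec C U) (gunit C U) (gsec F U)"
    and "\<And>U V j. open U \<Longrightarrow> open V \<Longrightarrow> V \<subseteq> U \<Longrightarrow>
      linear_map (gcomp (gsec F U) j) (gcomp (gsec F V) j) (gres F U V j)"
    and "\<And>U V i j f x. open U \<Longrightarrow> open V \<Longrightarrow> V \<subseteq> U \<Longrightarrow> f \<in> scar C U i \<Longrightarrow> x \<in> scar F U j \<Longrightarrow>
      gres F U V (i + j) (gact (gsec F U) i j f x) = gact (gsec F V) i j (gres C U V i f) (gres F U V j x)"
    and "\<And>U j x. open U \<Longrightarrow> x \<in> scar F U j \<Longrightarrow> gres F U U j x = x"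
    and "\<And>U V W j x. open U \<Longrightarrow> open V \<Longrightarrow> open W \<Longrightarrow> W \<subseteq> V \<Longrightarrow> V \<subseteq> U \<Longrightarrow> x \<in> scar F U j \<Longrightarrow>
      gres F V W j (gres F U V j x) = gres F U W j x"
  shows "module_presheaf C F"
  unfolding module_presheaf_def using assms(2)
  by (intro conjI allI ballI impI) (auto simp: assms linear_map_def)

lemma algebra_sheafD:
  assumes "algebra_sheaf C"
  shows "\<And>U. open U \<Longrightarrow> graded_comm_algebra (gsec C U) (gunit C U)" "module_presheaf C C"
    "\<And>U V. open U \<Longrightarrow> open V \<Longrightarrow> V \<subseteq> U \<Longrightarrow> gres C U V 0 (gunit C U) = gunit C V"
  using assms by (simp_all add: algebra_sheaf_def)

lemma algebra_sheaf_module: "algebra_sheaf C \<Longrightarrow> module_presheaf C C"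
  by (rule algebra_sheafD(2))

lemma algebra_sheaf_unit: "algebra_sheaf C \<Longrightarrow> open U \<Longrightarrow> gunit C U \<in> scar C U 0"
  by (rule graded_comm_algebraD(1)[OF algebra_sheafD(1)])

text \<open>Graded submodules of all sections, stable under restriction.\<close>

definition subpresheaf ::
  "('m::topological_space, 'f) galg_presheaf \<Rightarrow> ('m, 'f, 'v) gpresheaf \<Rightarrow> ('m set \<Rightarrow> int \<Rightarrow> 'v set) \<Rightarrow> bool" where
  "subpresheaf C F N \<longleftrightarrow> (\<forall>U. open U \<longrightarrow> graded_submodule (gsec C U) (gsec F U) (N U)) \<and>
     (\<forall>U V j. open U \<and> open V \<and> V \<subseteq> U \<longrightarrow> (\<forall>x \<in> N U j. gres F U V j x \<in> N V j))"

lemma subpresheafD: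
  assumes "subpresheaf C F N" "open U"
  shows "graded_submodule (gsec C U) (gsec F U) (N U)" "subspace_of (N U j) (gcomp (gsec F U) j)"
  using assms unfolding subpresheaf_def graded_submodule_def by blast+

lemma gsec_quot_presheaf [simp]: "gsec (quot_presheaf F N) U = gquot (gsec F U) (N U)"
  by (simp add: quot_presheaf_def)

lemma gres_quot_presheaf:
  assumes "module_presheaf C F" "subpresheaf C F N" "open U" "open V" "V \<subseteq> U" "x \<in> scar F U j"
  shows "gres (quot_presheaf F N) U V j (N U j +>\<^bsub>gcomp (gsec F U) j\<^esub> x) = N V j +>\<^bsub>gcomp (gsec F V) j\<^esub> gres F U V j x"
proof -
  have "gres F U V j y \<in> N V j" if "y \<in> N U j" for y
    using assms that unfolding subpresheaf_def by blast
  then show ?thesis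
    unfolding quot_presheaf_def using assms
    by simp (rule coset_map, auto simp: module_presheaf_vs subpresheafD intro: linear_map_gres)
qed

lemma module_presheaf_quot_presheaf:
  assumes C: "algebra_sheaf C" and F: "module_presheaf C F" and N: "subpresheaf C F N"
  shows "module_presheaf C (quot_presheaf F N)"
proof -
  note vs = module_presheaf_vs[OF F] and sub = subpresheafD[OF N]
  have rep: "\<exists>x. x \<in> scar F U j \<and> X = N U j +>\<^bsub>gcomp (gsec F U) j\<^esub> x"
    if "X \<in> scar (quot_presheaf F N) U j" for X U j
    using that by (auto simp: carrier_quot_vs)
  note [simp] = gres_quot_presheaf[OF F N] coset_add[OF vs sub(2)] coset_smult[OF vs sub(2)]
    coset_in_quot_vs module_presheaf_gres_closed[OF F] module_presheaf_gres_closed[OF algebra_sheaf_module[OF C]] vs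
    gact_gquot[OF module_presheaf_module[OF F] sub(1)] graded_module_closed[OF module_presheaf_module[OF F]]
  show ?thesis
  proof (rule module_presheafI, goal_cases)
    case (1 U) then show ?case
      using graded_module_gquot[OF module_presheaf_module[OF F] sub(1)]
        module_presheaf_module[OF algebra_sheaf_module[OF C]] algebra_sheaf_unit[OF C] by simp
  next
    case (2 U V j) show ?case
    proof (rule linear_mapI, goal_cases)
      case (1 X) with rep[OF 1] 2 show ?case by auto
    next
      case (2 X Y) with rep[OF 2(1)] rep[OF 2(2)] \<open>open U\<close> \<open>open V\<close> \<open>V \<subseteq> U\<close> show ?case
        using linear_map_add[OF linear_map_gres[OF F]] by auto
    next
      case (3 r X) with rep[OF 3] \<open>open U\<close> \<open>open V\<close> \<open>V \<subseteq> U\<close> show ?case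
        using linear_map_smult[OF linear_map_gres[OF F]] by auto
    qed
  next
    case (3 U V i j f X) with rep[OF 3(5)] show ?case
      using module_presheaf_gres_gact[OF F] by auto
  next
    case (4 U j X) with rep[OF 4(2)] show ?case by (auto simp: module_presheaf_gres_self[OF F])
  next
    case (5 U V W j X) with rep[OF 5(6)] order.trans[OF 5(4,5)] show ?case
      using module_presheaf_gres_gres[OF F] by auto
  qed
qed

subsection \<open>Products with ideals\<close>

lemma ideal_pow_simps [simp]:
  "ideal_pow A I 0 = gcar A" "ideal_pow A I (Suc q) = ideal_smul A I (ideal_pow A I q)"
  by (simp_all add: ideal_pow_def)

lemma ideal_smul_gens_subset:
  assumes "graded_module A e P" "\<And>i. I i \<subseteq> gcar A i" "\<And>i. N i \<subseteq> gcar P i"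
  shows "{gact P i (n - i) f x | i f x. f \<in> I i \<and> x \<in> N (n - i)} \<subseteq> gcar P n"
proof clarify
  fix i f x assume "f \<in> I i" "x \<in> N (n - i)"
  then show "gact P i (n - i) f x \<in> gcar P n"
    using graded_module_closed[OF assms(1), of f i x "n - i"] assms(2,3) by auto
qed

lemma subspace_of_ideal_smul:
  assumes "graded_module A e P" "\<And>i. I i \<subseteq> gcar A i" "\<And>i. N i \<subseteq> gcar P i"
  shows "subspace_of (ideal_smul P I N n) (gcomp P n)"
  unfolding ideal_smul_def
  by (rule subspace_of_rspan[OF graded_module_vs[OF assms(1)] ideal_smul_gens_subset[OF assms]])

lemma ideal_smul_subset:
  assumes "graded_module A e P" "\<And>i. I i \<subseteq> gcar A i" "\<And>i. N i \<subseteq> gcar P i"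
  shows "ideal_smul P I N n \<subseteq> gcar P n"
  by (rule subspace_of_subset[OF subspace_of_ideal_smul[OF assms]])

lemma ideal_smulI: "f \<in> I i \<Longrightarrow> x \<in> N j \<Longrightarrow> gact P i j f x \<in> ideal_smul P I N (i + j)"
  unfolding ideal_smul_def by (rule rspan_superset) (force intro!: exI[of _ i])

lemma linear_map_ideal_smul:
  assumes "graded_module A e P" "\<And>i. I i \<subseteq> gcar A i" "\<And>i. N i \<subseteq> gcar P i"
    and "vs W" "linear_map (gcomp P n) W L" "subspace_of T W"
    and "\<And>i f x. f \<in> I i \<Longrightarrow> x \<in> N (n - i) \<Longrightarrow> L (gact P i (n - i) f x) \<in> T"
    and "y \<in> ideal_smul P I N n"
  shows "L y \<in> T"
  by (rule linear_map_rspan[OF graded_module_vs[OF assms(1), of n] assms(4-6) ideal_smul_gens_subset[OF assms(1-3)]])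
    (use assms(7,8) in \<open>auto simp: ideal_smul_def\<close>)

lemma ideal_smul_least:
  assumes "subspace_of T (gcomp P n)"
    and "\<And>i f x. f \<in> I i \<Longrightarrow> x \<in> N (n - i) \<Longrightarrow> gact P i (n - i) f x \<in> T"
  shows "ideal_smul P I N n \<subseteq> T"
  unfolding ideal_smul_def using assms by (intro rspan_least) auto

lemma ideal_pow_subset:
  assumes "graded_module A e A" "\<And>i. I i \<subseteq> gcar A i"
  shows "ideal_pow A I q n \<subseteq> gcar A n"
proof (induction q arbitrary: n)
  case (Suc q) then show ?case using ideal_smul_subset[OF assms] by simp
qed simp

text \<open>\<open>I\<^sup>m P\<close> can be computed by acting on \<open>P\<close> with one element of \<open>I\<close> at a time.\<close>

lemma ideal_smul_ideal_pow:
  assumes P: "graded_module A e P" and A: "graded_module A e A" "e \<in> gcar A 0"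
    and I: "\<And>i. I i \<subseteq> gcar A i"
  shows "ideal_smul P (ideal_pow A I m) (gcar P) = (ideal_smul P I ^^ m) (gcar P)"
proof -
  note sub = ideal_pow_subset[OF A(1) I]
  have step: "ideal_smul P (ideal_pow A I (Suc m)) (gcar P) n
      = ideal_smul P I (ideal_smul P (ideal_pow A I m) (gcar P)) n" for m n
  proof
    let ?R = "ideal_smul P I (ideal_smul P (ideal_pow A I m) (gcar P))"
    note sub' = ideal_smul_subset[OF P sub order.refl]
    show "ideal_smul P (ideal_pow A I (Suc m)) (gcar P) n \<subseteq> ?R n"
    proof (rule ideal_smul_least)
      show "subspace_of (?R n) (gcomp P n)" by (rule subspace_of_ideal_smul[OF P I sub'])
      fix i h x assume h: "h \<in> ideal_pow A I (Suc m) i" and x: "x \<in> gcar P (n - i)"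
      have lin: "linear_map (gcomp A i) (gcomp P n) (\<lambda>h. gact P i (n - i) h x)"
        using linear_map_gact_left[OF P x, of i] by simp
      show "gact P i (n - i) h x \<in> ?R n"
      proof (rule linear_map_ideal_smul[OF A(1) I sub graded_module_vs[OF P] lin \<open>subspace_of (?R n) (gcomp P n)\<close>])
        fix d f g assume f: "f \<in> I d" and g: "g \<in> ideal_pow A I m (i - d)"
        have "gact P (d + (i - d)) (n - i) (gact A d (i - d) f g) x
            = gact P d ((i - d) + (n - i)) f (gact P (i - d) (n - i) g x)"
          by (rule graded_module_assoc[OF P subsetD[OF I f] subsetD[OF sub g] x])
        moreover have "gact P (i - d) (n - i) g x \<in> ideal_smul P (ideal_pow A I m) (gcar P) (i - d + (n - i))"
          by (rule ideal_smulI[where I = "ideal_pow A I m" and N = "gcar P", OF g x])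
        from ideal_smulI[where I = I and N = "ideal_smul P (ideal_pow A I m) (gcar P)" and P = P, OF f this]
        have "gact P d ((i - d) + (n - i)) f (gact P (i - d) (n - i) g x) \<in> ?R n" by simp
        ultimately show "gact P i (n - i) (gact A d (i - d) f g) x \<in> ?R n" by simp
      qed (use h in simp)
    qed
    show "?R n \<subseteq> ideal_smul P (ideal_pow A I (Suc m)) (gcar P) n"
    proof (rule ideal_smul_least)
      let ?L = "ideal_smul P (ideal_pow A I (Suc m)) (gcar P)"
      show L: "subspace_of (?L n) (gcomp P n)"
        by (rule subspace_of_ideal_smul[OF P sub order.refl])
      fix d f y assume f: "f \<in> I d" and y: "y \<in> ideal_smul P (ideal_pow A I m) (gcar P) (n - d)"
      have fA: "f \<in> gcar A d" using f I by blast
      have lin: "linear_map (gcomp P (n - d)) (gcomp P n) (gact P d (n - d) f)"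
        using linear_map_gact[OF P fA, of "n - d"] by simp
      show "gact P d (n - d) f y \<in> ?L n"
      proof (rule linear_map_ideal_smul[OF P sub order.refl graded_module_vs[OF P] lin L])
        fix i g x assume g: "g \<in> ideal_pow A I m i" and x: "x \<in> gcar P (n - d - i)"
        have "gact P (d + i) (n - d - i) (gact A d i f g) x = gact P d (i + (n - d - i)) f (gact P i (n - d - i) g x)"
          by (rule graded_module_assoc[OF P subsetD[OF I f] subsetD[OF sub g] x])
        moreover have "gact A d i f g \<in> ideal_pow A I (Suc m) (d + i)"
          using ideal_smulI[where I = I and N = "ideal_pow A I m" and P = A, OF f g] by simp
        from ideal_smulI[where I = "ideal_pow A I (Suc m)" and N = "gcar P" and P = P, OF this x]
        have "gact P (d + i) (n - d - i) (gact A d i f g) x \<in> ?L n"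
          by (simp del: ideal_pow_simps)
        ultimately show "gact P d (n - d) f (gact P i (n - d - i) g x) \<in> ?L n"
          by (simp del: ideal_pow_simps)
      qed (rule y)
    qed
  qed
  have zero: "ideal_smul P (gcar A) (gcar P) n = gcar P n" for n
  proof
    show "gcar P n \<subseteq> ideal_smul P (gcar A) (gcar P) n"
    proof
      fix x assume "x \<in> gcar P n"
      then show "x \<in> ideal_smul P (gcar A) (gcar P) n"
        using ideal_smulI[where f = e and I = "gcar A" and i = 0 and x = x and N = "gcar P" and j = n and P = P] A(2)
            by (simp add: graded_module_unit[OF P])
    qed
  qed (rule ideal_smul_subset[OF P order.refl order.refl])
  show ?thesis
  proof (induction m)
    case 0 show ?case using zero by (simp add: fun_eq_iff)
  next
    case (Suc m)
    have "ideal_smul P (ideal_pow A I (Suc m)) (gcar P) = ideal_smul P I (ideal_smul P (ideal_pow A I m) (gcar P))"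
      using step by (simp add: fun_eq_iff)
    then show ?case using Suc by simp
  qed
qed

lemma gact_ideal_smul:
  assumes A: "graded_comm_algebra A e" and P: "graded_module A e P" and I: "\<And>i. I i \<subseteq> gcar A i"
    and f: "f \<in> gcar A i" and x: "x \<in> ideal_smul P I (gcar P) j"
  shows "gact P i j f x \<in> ideal_smul P I (gcar P) (i + j)"
proof -
  note A' = graded_comm_algebraD[OF A]
  have T: "subspace_of (ideal_smul P I (gcar P) (i + j)) (gcomp P (i + j))"
    by (rule subspace_of_ideal_smul[OF P I order.refl])
  show ?thesis
  proof (rule linear_map_ideal_smul[OF P I order.refl graded_module_vs[OF P] linear_map_gact[OF P f] T _ x])
    fix d h y assume h: "h \<in> I d" and y: "y \<in> gcar P (j - d)"
    have hA: "h \<in> gcar A d" using h I by blast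
    have "gact P i (d + (j - d)) f (gact P d (j - d) h y) = gact P (i + d) (j - d) (gact A i d f h) y"
      using f hA y by (simp add: graded_module_assoc[OF P] del: add_diff_cancel_left')
    also have "\<dots> = ksign i d \<odot>\<^bsub>gcomp P (i + d + (j - d))\<^esub> gact P (i + d) (j - d) (gact A d i h f) y"
      using A'(3)[OF f hA] graded_module_closed[OF A'(2) hA f] y
      by (simp add: graded_module_smult_left[OF P] add.commute[of i d] del: add_diff_cancel_left')
    also have "gact P (i + d) (j - d) (gact A d i h f) y = gact P d (i + (j - d)) h (gact P i (j - d) f y)"
      using graded_module_assoc[OF P hA f y] by (simp add: add.commute[of i d])
    finally have eq: "gact P i j f (gact P d (j - d) h y)
        = ksign i d \<odot>\<^bsub>gcomp P (i + j)\<^esub> gact P d (i + (j - d)) h (gact P i (j - d) f y)"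
      by simp
    have "gact P d (i + (j - d)) h (gact P i (j - d) f y) \<in> ideal_smul P I (gcar P) (d + (i + (j - d)))"
      by (rule ideal_smulI[where I = I and N = "gcar P"]) (use h f y graded_module_closed[OF P] in auto)
    then have "gact P d (i + (j - d)) h (gact P i (j - d) f y) \<in> ideal_smul P I (gcar P) (i + j)"
      by (simp add: algebra_simps)
    then show "gact P i j f (gact P d (j - d) h y) \<in> ideal_smul P I (gcar P) (i + j)"
      unfolding eq using T by simp
  qed
qed

lemma gres_ideal_smul:
  assumes F: "module_presheaf C F" and UV: "open U" "open V" "V \<subseteq> U"
    and I: "\<And>i. I i \<subseteq> scar C U i" "\<And>i. N i \<subseteq> scar F U i"
    and I': "\<And>i. I' i \<subseteq> scar C V i" "\<And>i. N' i \<subseteq> scar F V i"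
    and res: "\<And>i f. f \<in> I i \<Longrightarrow> gres C U V i f \<in> I' i" "\<And>i x. x \<in> N i \<Longrightarrow> gres F U V i x \<in> N' i"
    and x: "x \<in> ideal_smul (gsec F U) I N j"
  shows "gres F U V j x \<in> ideal_smul (gsec F V) I' N' j"
proof (rule linear_map_ideal_smul[OF module_presheaf_module[OF F UV(1)] I
      module_presheaf_vs[OF F UV(2)] linear_map_gres[OF F UV]
      subspace_of_ideal_smul[OF module_presheaf_module[OF F UV(2)] I'] _ x])
  fix i f y assume f: "f \<in> I i" and y: "y \<in> N (j - i)"
  have "gres F U V (i + (j - i)) (gact (gsec F U) i (j - i) f y)
      = gact (gsec F V) i (j - i) (gres C U V i f) (gres F U V (j - i) y)"
    using f y I UV by (intro module_presheaf_gres_gact[OF F]) auto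
  moreover have "gact (gsec F V) i (j - i) (gres C U V i f) (gres F U V (j - i) y)
      \<in> ideal_smul (gsec F V) I' N' (i + (j - i))"
    by (rule ideal_smulI[where I = I' and N = N']) (use res f y in auto)
  ultimately show "gres F U V j (gact (gsec F U) i (j - i) f y) \<in> ideal_smul (gsec F V) I' N' j"
    by simp
qed

section \<open>Values of functions at a point\<close>

lemma model_alg_simps [simp]:
  "carrier (gcomp (model_alg n ds W) j) =
     {s. (\<forall>p x. p \<notin> mindices ds \<or> weight ds p \<noteq> j \<or> x \<notin> W \<longrightarrow> s p x = 0) \<and> (\<forall>p. smooth_on n W (s p))}"
  "s \<oplus>\<^bsub>gcomp (model_alg n ds W) j\<^esub> t = (\<lambda>p x. s p x + t p x)"
  "r \<odot>\<^bsub>gcomp (model_alg n ds W) j\<^esub> s = (\<lambda>p x. r * s p x)"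
  by (simp_all add: model_alg_def)

lemma zero_mindex: "(\<lambda>_. 0) \<in> mindices ds"
  by (simp add: mindices_def)

text \<open>The coefficient of \<open>\<xi>\<^sup>0\<close> is multiplicative.\<close>

lemma gact_model_alg_zero:
  "gact (model_alg n ds W) i j s t (\<lambda>_. 0) x = s (\<lambda>_. 0) x * t (\<lambda>_. 0) x"
proof -
  have "{q :: nat \<Rightarrow> nat. q \<le> (\<lambda>_. 0)} = {\<lambda>_. 0}" by (auto simp: le_fun_def)
  moreover have "mono_sign ds (\<lambda>_. 0) (\<lambda>_. 0) = 1" by (simp add: mono_sign_def ksign_def)
  ultimately show ?thesis by (simp add: model_alg_def zero_mindex)
qed

text \<open>The chart that \<open>gval\<close> chooses at \<open>a\<close> does not depend on \<open>U\<close> or \<open>f\<close>.\<close>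

lemma gval_chart:
  assumes "graded_manifold C"
  obtains n ds W \<phi> \<kappa> where "graded_chart C a n ds W \<phi> \<kappa>"
    "\<And>U i f. gval C a U i f = \<kappa> (U \<inter> W) i (gres C U (U \<inter> W) i f) (\<lambda>_. 0) (\<phi> a)"
proof -
  define P where "P = (\<lambda>(n, ds, W, \<phi>, \<kappa>). graded_chart C a n ds W \<phi> \<kappa>)"
  obtain n ds W \<phi> \<kappa> where "graded_chart C a n ds W \<phi> \<kappa>"
    using assms unfolding graded_manifold_def by blast
  then have "\<exists>t. P t" by (intro exI[of _ "(n, ds, W, \<phi>, \<kappa>)"]) (simp add: P_def)
  then have "P (Eps P)" by (rule someI_ex)
  moreover obtain n ds W \<phi> \<kappa> where t: "Eps P = (n, ds, W, \<phi>, \<kappa>)" by (metis surj_pair)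
  ultimately have "graded_chart C a n ds W \<phi> \<kappa>" by (simp add: P_def)
  moreover have "gval C a U i f = \<kappa> (U \<inter> W) i (gres C U (U \<inter> W) i f) (\<lambda>_. 0) (\<phi> a)" for U i f
    using t by (simp add: gval_def P_def)
  ultimately show ?thesis using that by blast
qed

lemma graded_manifold_sheaf: "graded_manifold C \<Longrightarrow> algebra_sheaf C"
  by (simp add: graded_manifold_def)

lemma graded_manifold_module: "graded_manifold C \<Longrightarrow> module_presheaf C C"
  by (rule algebra_sheaf_module[OF graded_manifold_sheaf])

lemma vanish_sec_subset: "vanish_sec C U a i \<subseteq> scar C U i"
  by (auto simp: vanish_sec_def)

context
  fixes C :: "('m::{second_countable_topology,t2_space}, 'f) galg_presheaf" and a :: 'm
  assumes C: "graded_manifold C"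
begin

lemma gval_linear:
  assumes "open U" "a \<in> U" "f \<in> scar C U i"
  shows "gval C a U i (r \<odot>\<^bsub>gcomp (gsec C U) i\<^esub> f) = r * gval C a U i f"
    and "g \<in> scar C U i \<Longrightarrow> gval C a U i (f \<oplus>\<^bsub>gcomp (gsec C U) i\<^esub> g) = gval C a U i f + gval C a U i g"
proof -
  obtain n ds W \<phi> \<kappa> where chart: "graded_chart C a n ds W \<phi> \<kappa>"
    and val: "\<And>U i f. gval C a U i f = \<kappa> (U \<inter> W) i (gres C U (U \<inter> W) i f) (\<lambda>_. 0) (\<phi> a)"
    using gval_chart[OF C, where a = a] by blast
  have V: "open (U \<inter> W)" "U \<inter> W \<subseteq> U" "U \<inter> W \<subseteq> W"
    using chart assms by (auto simp: graded_chart_def)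
  then have iso: "galg_iso (gsec C (U \<inter> W)) (gunit C (U \<inter> W)) (model_alg n ds (\<phi> ` (U \<inter> W))) (model_unit (\<phi> ` (U \<inter> W)))
      (\<kappa> (U \<inter> W))"
    using chart by (simp add: graded_chart_def)
  note lin = linear_map_gres[OF graded_manifold_module[OF C] assms(1) V(1,2)]
  show "gval C a U i (r \<odot>\<^bsub>gcomp (gsec C U) i\<^esub> f) = r * gval C a U i f"
    using iso linear_map_smult[OF lin assms(3)] linear_map_closed[OF lin assms(3)] unfolding val galg_iso_def by simp
  show "gval C a U i (f \<oplus>\<^bsub>gcomp (gsec C U) i\<^esub> g) = gval C a U i f + gval C a U i g" if "g \<in> scar C U i"
    using iso linear_map_add[OF lin assms(3) that] linear_map_closed[OF lin assms(3)] linear_map_closed[OF lin that]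
    unfolding val galg_iso_def by simp
qed

lemma gval_gact:
  assumes "open U" "a \<in> U" "f \<in> scar C U i" "g \<in> scar C U j"
  shows "gval C a U (i + j) (gact (gsec C U) i j f g) = gval C a U i f * gval C a U j g"
proof -
  obtain n ds W \<phi> \<kappa> where chart: "graded_chart C a n ds W \<phi> \<kappa>"
    and val: "\<And>U i f. gval C a U i f = \<kappa> (U \<inter> W) i (gres C U (U \<inter> W) i f) (\<lambda>_. 0) (\<phi> a)"
    using gval_chart[OF C, where a = a] by blast
  have V: "open (U \<inter> W)" "U \<inter> W \<subseteq> U" "U \<inter> W \<subseteq> W"
    using chart assms by (auto simp: graded_chart_def)
  then have "galg_iso (gsec C (U \<inter> W)) (gunit C (U \<inter> W)) (model_alg n ds (\<phi> ` (U \<inter> W))) (model_unit (\<phi> ` (U \<inter> W))) (\<kappa> (U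
      \<inter> W))"
    using chart by (simp add: graded_chart_def)
  moreover note closed = module_presheaf_gres_closed[OF graded_manifold_module[OF C] assms(1) V(1,2)]
  ultimately show ?thesis
    using closed[OF assms(3)] closed[OF assms(4)]
    by (simp add: val module_presheaf_gres_gact[OF graded_manifold_module[OF C] assms(1) V(1,2) assms(3,4)] galg_iso_def
        gact_model_alg_zero)
qed

lemma gval_unit:
  assumes "open U" "a \<in> U"
  shows "gval C a U 0 (gunit C U) = 1"
proof -
  obtain n ds W \<phi> \<kappa> where chart: "graded_chart C a n ds W \<phi> \<kappa>"
    and val: "\<And>U i f. gval C a U i f = \<kappa> (U \<inter> W) i (gres C U (U \<inter> W) i f) (\<lambda>_. 0) (\<phi> a)"
    using gval_chart[OF C, where a = a] by blast
  have V: "open (U \<inter> W)" "U \<inter> W \<subseteq> U" "U \<inter> W \<subseteq> W" "a \<in> U \<inter> W"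
    using chart assms by (auto simp: graded_chart_def)
  then have "galg_iso (gsec C (U \<inter> W)) (gunit C (U \<inter> W)) (model_alg n ds (\<phi> ` (U \<inter> W))) (model_unit (\<phi> ` (U \<inter> W))) (\<kappa> (U
      \<inter> W))"
    using chart by (simp add: graded_chart_def)
  then have "\<kappa> (U \<inter> W) 0 (gunit C (U \<inter> W)) = model_unit (\<phi> ` (U \<inter> W))" by (simp add: galg_iso_def)
  then show ?thesis using V algebra_sheafD(3)[OF graded_manifold_sheaf[OF C] assms(1) V(1,2)]
    by (simp add: val model_unit_def)
qed

lemma gval_nonzero_degree:
  assumes "open U" "a \<in> U" "f \<in> scar C U i" "i \<noteq> 0"
  shows "gval C a U i f = 0"
proof -
  obtain n ds W \<phi> \<kappa> where chart: "graded_chart C a n ds W \<phi> \<kappa>"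
    and val: "\<And>U i f. gval C a U i f = \<kappa> (U \<inter> W) i (gres C U (U \<inter> W) i f) (\<lambda>_. 0) (\<phi> a)"
    using gval_chart[OF C, where a = a] by blast
  have V: "open (U \<inter> W)" "U \<inter> W \<subseteq> U" "U \<inter> W \<subseteq> W"
    using chart assms by (auto simp: graded_chart_def)
  then have "galg_iso (gsec C (U \<inter> W)) (gunit C (U \<inter> W)) (model_alg n ds (\<phi> ` (U \<inter> W))) (model_unit (\<phi> ` (U \<inter> W))) (\<kappa> (U
      \<inter> W))"
    using chart by (simp add: graded_chart_def)
  then have "\<kappa> (U \<inter> W) i (gres C U (U \<inter> W) i f) \<in> gcar (model_alg n ds (\<phi> ` (U \<inter> W))) i"
    using module_presheaf_gres_closed[OF graded_manifold_module[OF C] assms(1) V(1,2) assms(3)]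
    by (auto simp: galg_iso_def dest!: spec bij_betwE simp del: model_alg_simps)
  moreover have "weight ds (\<lambda>_. 0) = 0" by (simp add: weight_def)
  ultimately show ?thesis using assms(4) by (simp add: val)
qed

lemma gval_gres:
  assumes "open U" "open V" "V \<subseteq> U" "a \<in> V" "f \<in> scar C U i"
  shows "gval C a V i (gres C U V i f) = gval C a U i f"
proof -
  obtain n ds W \<phi> \<kappa> where chart: "graded_chart C a n ds W \<phi> \<kappa>"
    and val: "\<And>U i f. gval C a U i f = \<kappa> (U \<inter> W) i (gres C U (U \<inter> W) i f) (\<lambda>_. 0) (\<phi> a)"
    using gval_chart[OF C, where a = a] by blast
  have W: "open (U \<inter> W)" "open (V \<inter> W)" "V \<inter> W \<subseteq> U \<inter> W" "a \<in> V \<inter> W" "U \<inter> W \<subseteq> W" "V \<inter> W \<subseteq> V" "U \<inter> W \<subseteq> U"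
    using chart assms by (auto simp: graded_chart_def)
  have "gres C V (V \<inter> W) i (gres C U V i f) = gres C U (V \<inter> W) i f"
    using module_presheaf_gres_gres[OF graded_manifold_module[OF C] assms(1,2) W(2)] assms W by blast
  also have "\<dots> = gres C (U \<inter> W) (V \<inter> W) i (gres C U (U \<inter> W) i f)"
    using module_presheaf_gres_gres[OF graded_manifold_module[OF C] assms(1) W(1,2)] assms W by simp
  finally have "\<kappa> (V \<inter> W) i (gres C V (V \<inter> W) i (gres C U V i f))
      = model_res (\<phi> ` (V \<inter> W)) (\<kappa> (U \<inter> W) i (gres C U (U \<inter> W) i f))"
    using chart W module_presheaf_gres_closed[OF graded_manifold_module[OF C] assms(1) W(1,7) assms(5)]
    by (simp add: graded_chart_def)
  then show ?thesis using W(4) by (auto simp: val model_res_def)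
qed

end

section \<open>Geometrization\<close>

text \<open>
  Stability under the action uses graded commutativity, \<open>f (h x) = \<plusminus> h (f x)\<close>; stability under restriction
  uses that a function vanishing at \<open>a\<close> still does so on a smaller neighbourhood of \<open>a\<close>.
\<close>

lemma subpresheaf_bullet:
  fixes C :: "('m::{second_countable_topology,t2_space}, 'f) galg_presheaf"
  assumes C: "graded_manifold C" and F: "module_presheaf C F"
  shows "subpresheaf C F (bullet C F)"
proof -
  note C' = graded_manifold_sheaf[OF C]
  let ?I = "\<lambda>U a q. ideal_pow (gsec C U) (vanish_sec C U a) q"
  let ?B = "\<lambda>U a q. ideal_smul (gsec F U) (?I U a q) (scar F U)"
  have I: "?I U a q i \<subseteq> scar C U i" if "open U" for U a q i
    by (rule ideal_pow_subset[OF module_presheaf_module[OF algebra_sheafD(2)[OF C'] that] vanish_sec_subset])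
  have B: "subspace_of (?B U a q j) (gcomp (gsec F U) j)" if "open U" for U a q j
    by (rule subspace_of_ideal_smul[OF module_presheaf_module[OF F that] I[OF that] order.refl])
  have resI: "gres C U V i f \<in> ?I V a q i"
    if UV: "open U" "open V" "V \<subseteq> U" "a \<in> V" and f: "f \<in> ?I U a q i" for U V a q i f
    using f
  proof (induction q arbitrary: i f)
    case 0 then show ?case using module_presheaf_gres_closed[OF algebra_sheafD(2)[OF C']] UV by simp
  next
    case (Suc q)
    have "gres C U V d g \<in> vanish_sec C V a d" if "g \<in> vanish_sec C U a d" for d g
      using that UV gval_gres[OF C UV] module_presheaf_gres_closed[OF algebra_sheafD(2)[OF C'] UV(1-3)]
      by (simp add: vanish_sec_def)
    from gres_ideal_smul[OF algebra_sheafD(2)[OF C'] UV(1-3) vanish_sec_subset I[OF UV(1)]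
        vanish_sec_subset I[OF UV(2)] this Suc.IH] Suc.prems
    show ?case by simp
  qed
  show ?thesis
    unfolding subpresheaf_def graded_submodule_def
  proof (intro conjI allI ballI impI)
    fix U :: "'m set" and j assume U: "open U"
    show "subspace_of (bullet C F U j) (gcomp (gsec F U) j)"
      by (rule subspace_ofI) (use B[OF U] module_presheaf_vs[OF F U] in \<open>auto simp: bullet_def\<close>)
    fix i f x assume f: "f \<in> scar C U i" and x: "x \<in> bullet C F U j"
    have "gact (gsec F U) i j f x \<in> ?B U a q (i + j)" if "a \<in> U" for a q
      by (rule gact_ideal_smul[OF algebra_sheafD(1)[OF C' U] module_presheaf_module[OF F U] I[OF U] f])
        (use x that in \<open>simp add: bullet_def\<close>)
    then show "gact (gsec F U) i j f x \<in> bullet C F U (i + j)"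
      using graded_module_closed[OF module_presheaf_module[OF F U] f] x by (simp add: bullet_def)
  next
    fix U V :: "'m set" and j x
    assume UV: "open U \<and> open V \<and> V \<subseteq> U" and x: "x \<in> bullet C F U j"
    have "gres F U V j x \<in> ?B V a q j" if a: "a \<in> V" for a q
    proof (rule gres_ideal_smul[OF F _ _ _ I order.refl I order.refl])
      show "x \<in> ?B U a q j" using x a UV by (auto simp: bullet_def)
    qed (use UV a resI module_presheaf_gres_closed[OF F] in auto)
    then show "gres F U V j x \<in> bullet C F V j"
      using module_presheaf_gres_closed[OF F] UV x by (simp add: bullet_def)
  qed
qed

section \<open>Tensor products\<close>

lemma free_vs_simps [simp]:
  "carrier (free_vs P Q n) =
     {c. finite {x. c x \<noteq> 0} \<and> (\<forall>i p q. c (i, p, q) \<noteq> 0 \<longrightarrow> p \<in> gcar P i \<and> q \<in> gcar Q (n - i))}"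
  "\<zero>\<^bsub>free_vs P Q n\<^esub> = (\<lambda>x. 0)"
  "c \<oplus>\<^bsub>free_vs P Q n\<^esub> d = (\<lambda>x. c x + d x)"
  "r \<odot>\<^bsub>free_vs P Q n\<^esub> c = (\<lambda>x. r * c x)"
  by (simp_all add: free_vs_def)

lemma vs_free_vs: "vs (free_vs P Q n)"
proof (rule vsI, goal_cases)
  case (2 c d)
  have "{x. c x + d x \<noteq> 0} \<subseteq> {x. c x \<noteq> 0} \<union> {x. d x \<noteq> 0}" by auto
  then have "finite {x. c x + d x \<noteq> 0}" by (rule finite_subset) (use 2 in auto)
  moreover have "p \<in> gcar P i \<and> q \<in> gcar Q (n - i)" if "c (i, p, q) + d (i, p, q) \<noteq> 0" for i p q
  proof -
    have "c (i, p, q) \<noteq> 0 \<or> d (i, p, q) \<noteq> 0" using that by auto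
    then show ?thesis using 2 by auto
  qed
  ultimately show ?case by simp
next
  case (3 r c)
  have "{x. r * c x \<noteq> 0} \<subseteq> {x. c x \<noteq> 0}" by auto
  then have "finite {x. r * c x \<noteq> 0}" by (rule finite_subset) (use 3 in auto)
  then show ?case using 3 by auto
qed (auto simp: algebra_simps)

lemma fgen_in_free_vs:
  assumes "p \<in> gcar P i" "q \<in> gcar Q (n - i)"
  shows "fgen (i, p, q) \<in> carrier (free_vs P Q n)"
proof -
  have "{x. fgen (i, p, q) x \<noteq> 0} = {(i, p, q)}" by (auto simp: fgen_def)
  then show ?thesis using assms by (auto simp: fgen_def split: if_splits)
qed

text \<open>The index set of the generators \<open>p \<otimes> q\<close> of degree \<open>n\<close>.\<close>

definition tensor_gens :: "('f, 'p) gmod \<Rightarrow> ('f, 'q) gmod \<Rightarrow> int \<Rightarrow> (int \<times> 'p \<times> 'q) set" where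
  "tensor_gens P Q n = {(i, p, q). p \<in> gcar P i \<and> q \<in> gcar Q (n - i)}"

lemma carrier_free_vs_rspan: "carrier (free_vs P Q n) = rspan (free_vs P Q n) (fgen ` tensor_gens P Q n)"
proof
  have gens: "fgen ` tensor_gens P Q n \<subseteq> carrier (free_vs P Q n)"
    using fgen_in_free_vs by (auto simp: tensor_gens_def simp del: free_vs_simps)
  show "rspan (free_vs P Q n) (fgen ` tensor_gens P Q n) \<subseteq> carrier (free_vs P Q n)"
    by (rule rspan_subset_carrier[OF vs_free_vs gens])
  note sub = subspace_of_rspan[OF vs_free_vs gens]
  have "c \<in> rspan (free_vs P Q n) (fgen ` tensor_gens P Q n)"
    if "finite S" "c \<in> carrier (free_vs P Q n)" "{x. c x \<noteq> 0} \<subseteq> S" for S c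
    using that
  proof (induction S arbitrary: c)
    case empty
    then have "c = \<zero>\<^bsub>free_vs P Q n\<^esub>" by auto
    then show ?case using subspace_of_zero[OF sub] by simp
  next
    case (insert z S)
    show ?case
    proof (cases "c z = 0")
      case True
      then show ?thesis using insert.prems by (intro insert.IH) auto
    next
      case False
      have z: "z \<in> tensor_gens P Q n" using insert.prems(1) False by (cases z) (auto simp: tensor_gens_def)
      have "{x. (c(z := 0)) x \<noteq> 0} \<subseteq> {x. c x \<noteq> 0}" by auto
      then have "finite {x. (c(z := 0)) x \<noteq> 0}" by (rule finite_subset) (use insert.prems in auto)
      then have "c(z := 0) \<in> carrier (free_vs P Q n)" using insert.prems(1) by (auto split: if_splits)
      then have "c(z := 0) \<in> rspan (free_vs P Q n) (fgen ` tensor_gens P Q n)"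
        using insert.prems by (intro insert.IH) auto
      moreover have "c z \<odot>\<^bsub>free_vs P Q n\<^esub> fgen z \<in> rspan (free_vs P Q n) (fgen ` tensor_gens P Q n)"
        by (rule subspace_of_smult[OF sub rspan_superset]) (use z in blast)
      moreover have "c = c(z := 0) \<oplus>\<^bsub>free_vs P Q n\<^esub> c z \<odot>\<^bsub>free_vs P Q n\<^esub> fgen z"
        by (auto simp: fgen_def fun_eq_iff)
      ultimately show ?thesis using subspace_of_add[OF sub] by metis
    qed
  qed
  then show "carrier (free_vs P Q n) \<subseteq> rspan (free_vs P Q n) (fgen ` tensor_gens P Q n)" by auto
qed

text \<open>The linear extension to finitely supported functions of a map on generators.\<close>

definition free_ext :: "(real, 'w) module \<Rightarrow> ('x \<Rightarrow> 'w) \<Rightarrow> ('x \<Rightarrow> real) \<Rightarrow> 'w" where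
  "free_ext W h c = finsum W (\<lambda>x. c x \<odot>\<^bsub>W\<^esub> h x) {x. c x \<noteq> 0}"

lemma linear_map_free_ext:
  assumes W: "vs W" and h: "\<And>x. x \<in> tensor_gens P Q n \<Longrightarrow> h x \<in> carrier W"
  shows "linear_map (free_vs P Q n) W (free_ext W h)"
    and "x \<in> tensor_gens P Q n \<Longrightarrow> free_ext W h (fgen x) = h x"
proof -
  interpret W: abelian_group W by (rule vs_abelian_group[OF W])
  have hc: "c x \<odot>\<^bsub>W\<^esub> h x \<in> carrier W" if "c \<in> carrier (free_vs P Q n)" "c x \<noteq> 0" for c x
    using that by (intro vs_smult_closed[OF W] h) (cases x, auto simp: tensor_gens_def)
  \<comment> \<open>outside the support of \<open>c\<close>, the generator \<open>x\<close> may be invalid and \<open>h x\<close> arbitrary\<close>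
  define h' where "h' x = (if x \<in> tensor_gens P Q n then h x else \<zero>\<^bsub>W\<^esub>)" for x
  have h': "h' x \<in> carrier W" for x using h W by (simp add: h'_def)
  have ext: "free_ext W h c = finsum W (\<lambda>x. c x \<odot>\<^bsub>W\<^esub> h' x) S"
    if c: "c \<in> carrier (free_vs P Q n)" and S: "finite S" "{x. c x \<noteq> 0} \<subseteq> S" for c S
    unfolding free_ext_def
  proof (rule W.add.finprod_mono_neutral_cong_left[OF S])
    fix x assume "x \<in> {x. c x \<noteq> 0}"
    then have "x \<in> tensor_gens P Q n" using c by (cases x) (auto simp: tensor_gens_def)
    then show "c x \<odot>\<^bsub>W\<^esub> h x = c x \<odot>\<^bsub>W\<^esub> h' x" by (simp add: h'_def)
  qed (use W h' in auto)
  show "linear_map (free_vs P Q n) W (free_ext W h)"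
  proof (rule linear_mapI)
    fix c assume c: "c \<in> carrier (free_vs P Q n)"
    then show "free_ext W h c \<in> carrier W"
      unfolding free_ext_def using hc by (intro W.finsum_closed) auto
    fix r
    have rc: "r \<odot>\<^bsub>free_vs P Q n\<^esub> c \<in> carrier (free_vs P Q n)" by (rule vs_smult_closed[OF vs_free_vs c])
    have fin: "finite {x. c x \<noteq> 0}" using c by simp
    have "free_ext W h (r \<odot>\<^bsub>free_vs P Q n\<^esub> c) = finsum W (\<lambda>x. r * c x \<odot>\<^bsub>W\<^esub> h' x) {x. c x \<noteq> 0}"
      using ext[OF rc fin] by auto
    also have "\<dots> = finsum W (\<lambda>x. r \<odot>\<^bsub>W\<^esub> (c x \<odot>\<^bsub>W\<^esub> h' x)) {x. c x \<noteq> 0}"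
      using W h' by simp
    also have "\<dots> = r \<odot>\<^bsub>W\<^esub> finsum W (\<lambda>x. c x \<odot>\<^bsub>W\<^esub> h' x) {x. c x \<noteq> 0}"
      using Module.module.finsum_smult_ldistr[OF W fin, of r "\<lambda>x. c x \<odot>\<^bsub>W\<^esub> h' x"] W h'
      by (simp add: real_ring_simps)
    finally show "free_ext W h (r \<odot>\<^bsub>free_vs P Q n\<^esub> c) = r \<odot>\<^bsub>W\<^esub> free_ext W h c"
      using ext[OF c fin] by simp
  next
    fix c d assume c: "c \<in> carrier (free_vs P Q n)" and d: "d \<in> carrier (free_vs P Q n)"
    let ?S = "{x. c x \<noteq> 0} \<union> {x. d x \<noteq> 0}"
    have cd: "c \<oplus>\<^bsub>free_vs P Q n\<^esub> d \<in> carrier (free_vs P Q n)" by (rule vs_add_closed[OF vs_free_vs c d])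
    have fin: "finite ?S" using c d by simp
    have "free_ext W h (c \<oplus>\<^bsub>free_vs P Q n\<^esub> d) = finsum W (\<lambda>x. (c x + d x) \<odot>\<^bsub>W\<^esub> h' x) ?S"
      by (subst ext[OF cd fin]) auto
    also have "\<dots> = finsum W (\<lambda>x. c x \<odot>\<^bsub>W\<^esub> h' x) ?S \<oplus>\<^bsub>W\<^esub> finsum W (\<lambda>x. d x \<odot>\<^bsub>W\<^esub> h' x) ?S"
      using W h' by (simp add: vs_smult_add_left W.finsum_addf)
    finally show "free_ext W h (c \<oplus>\<^bsub>free_vs P Q n\<^esub> d) = free_ext W h c \<oplus>\<^bsub>W\<^esub> free_ext W h d"
      using ext[OF c fin] ext[OF d fin] by simp
  qed
  show "free_ext W h (fgen x) = h x" if "x \<in> tensor_gens P Q n"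
  proof -
    have "{y. fgen x y \<noteq> 0} = {x}" by (auto simp: fgen_def)
    then show ?thesis using h[OF that] W W.finsum_insert[of "{}" x "\<lambda>y. fgen x y \<odot>\<^bsub>W\<^esub> h y"]
      by (simp add: free_ext_def fgen_def)
  qed
qed

subsection \<open>Bilinear maps\<close>

text \<open>
  The part of the module axioms under which \<open>tensor_rel\<close> is a subspace: its generators have to lie in the
  free space, since otherwise the span is not a subspace but everything.
\<close>

definition tensor_ok ::
  "(int \<Rightarrow> (real, 'f) module) \<Rightarrow> ('f, 'p) gmod \<Rightarrow> ('f, 'q) gmod \<Rightarrow> bool" where
  "tensor_ok A P Q \<longleftrightarrow> graded_vs (gcomp P) \<and> graded_vs (gcomp Q) \<and>
     (\<forall>i j. \<forall>f \<in> carrier (A i). \<forall>p \<in> gcar P j. gact P i j f p \<in> gcar P (i + j)) \<and>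
     (\<forall>i j. \<forall>f \<in> carrier (A i). \<forall>q \<in> gcar Q j. gact Q i j f q \<in> gcar Q (i + j))"

lemma tensor_okD:
  assumes "tensor_ok A P Q"
  shows "vs (gcomp P j)" "vs (gcomp Q j)"
    "f \<in> carrier (A i) \<Longrightarrow> p \<in> gcar P j \<Longrightarrow> gact P i j f p \<in> gcar P (i + j)"
    "f \<in> carrier (A i) \<Longrightarrow> q \<in> gcar Q j \<Longrightarrow> gact Q i j f q \<in> gcar Q (i + j)"
  using assms unfolding tensor_ok_def graded_vs_def by simp_all

text \<open>
  The maps \<open>b i p q\<close>, defined for \<open>p\<close> of degree \<open>i\<close> and \<open>q\<close> of degree \<open>n - i\<close>, that are bilinear and balanced:
  \<open>b (p f) q = b p (f q)\<close> for the right action \<open>p f = \<plusminus> f p\<close>.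
\<close>

definition tensor_bilinear ::
  "(int \<Rightarrow> (real, 'f) module) \<Rightarrow> ('f, 'p) gmod \<Rightarrow> ('f, 'q) gmod \<Rightarrow> int \<Rightarrow> (real, 'w) module \<Rightarrow>
   (int \<Rightarrow> 'p \<Rightarrow> 'q \<Rightarrow> 'w) \<Rightarrow> bool" where
  "tensor_bilinear A P Q n W b \<longleftrightarrow>
     (\<forall>i. \<forall>p \<in> gcar P i. linear_map (gcomp Q (n - i)) W (b i p)) \<and>
     (\<forall>i. \<forall>q \<in> gcar Q (n - i). linear_map (gcomp P i) W (\<lambda>p. b i p q)) \<and>
     (\<forall>i d. \<forall>f \<in> carrier (A d). \<forall>p \<in> gcar P i. \<forall>q \<in> gcar Q (n - i - d).
        b (i + d) (ksign i d \<odot>\<^bsub>gcomp P (i + d)\<^esub> gact P d i f p) q = b i p (gact Q d (n - i - d) f q))"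

lemma tensor_bilinearD:
  assumes "tensor_bilinear A P Q n W b"
  shows "p \<in> gcar P i \<Longrightarrow> linear_map (gcomp Q (n - i)) W (b i p)"
    "q \<in> gcar Q (n - i) \<Longrightarrow> linear_map (gcomp P i) W (\<lambda>p. b i p q)"
    "f \<in> carrier (A d) \<Longrightarrow> p \<in> gcar P i \<Longrightarrow> q \<in> gcar Q (n - i - d) \<Longrightarrow>
       b (i + d) (ksign i d \<odot>\<^bsub>gcomp P (i + d)\<^esub> gact P d i f p) q = b i p (gact Q d (n - i - d) f q)"
  using assms unfolding tensor_bilinear_def by simp_all

lemma tensor_bilinear_cong:
  assumes ok: "tensor_ok A P Q" and b: "tensor_bilinear A P Q n W b"
    and eq: "\<And>i p q. p \<in> gcar P i \<Longrightarrow> q \<in> gcar Q (n - i) \<Longrightarrow> b' i p q = b i p q"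
  shows "tensor_bilinear A P Q n W b'"
  unfolding tensor_bilinear_def
proof (intro conjI allI ballI)
  fix i p assume "p \<in> gcar P i"
  then show "linear_map (gcomp Q (n - i)) W (b' i p)"
    using tensor_bilinearD(1)[OF b] tensor_okD[OF ok] by (simp add: linear_map_def eq)
next
  fix i q assume "q \<in> gcar Q (n - i)"
  then show "linear_map (gcomp P i) W (\<lambda>p. b' i p q)"
    using tensor_bilinearD(2)[OF b] tensor_okD[OF ok] by (simp add: linear_map_def eq)
next
  fix i d f p q assume fpq: "f \<in> carrier (A d)" "p \<in> gcar P i" "q \<in> gcar Q (n - i - d)"
  then show "b' (i + d) (ksign i d \<odot>\<^bsub>gcomp P (i + d)\<^esub> gact P d i f p) q = b' i p (gact Q d (n - i - d) f q)"
    using tensor_bilinearD(3)[OF b fpq] tensor_okD(1)[OF ok, of "i + d"] tensor_okD(3)[OF ok, of f d p i]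
      tensor_okD(4)[OF ok, of f d q "n - i - d"]
    by (subst (1 2) eq) (simp_all add: add.commute diff_diff_add)
qed

lemma free_vs_combs:
  fixes u v w :: "int \<times> 'y \<times> 'z \<Rightarrow> real"
  shows "(\<lambda>x. u x - v x - w x) = u \<oplus>\<^bsub>free_vs P Q n\<^esub> ((-1) \<odot>\<^bsub>free_vs P Q n\<^esub> (v \<oplus>\<^bsub>free_vs P Q n\<^esub> w))"
    "(\<lambda>x. u x - r * v x) = u \<oplus>\<^bsub>free_vs P Q n\<^esub> ((-1) \<odot>\<^bsub>free_vs P Q n\<^esub> (r \<odot>\<^bsub>free_vs P Q n\<^esub> v))"
    "(\<lambda>x. u x - v x) = u \<oplus>\<^bsub>free_vs P Q n\<^esub> ((-1) \<odot>\<^bsub>free_vs P Q n\<^esub> v)"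
  by (simp_all add: algebra_simps)

text \<open>The generators of the relations, as differences of the two sides.\<close>

definition tensor_rels ::
  "(int \<Rightarrow> (real, 'f) module) \<Rightarrow> ('f, 'p) gmod \<Rightarrow> ('f, 'q) gmod \<Rightarrow> int \<Rightarrow> ('p, 'q) ftens set" where
  "tensor_rels A P Q n =
    {\<lambda>x. fgen (i, p \<oplus>\<^bsub>gcomp P i\<^esub> p', q) x - fgen (i, p, q) x - fgen (i, p', q) x | i p p' q.
        p \<in> gcar P i \<and> p' \<in> gcar P i \<and> q \<in> gcar Q (n - i)} \<union>
     {\<lambda>x. fgen (i, p, q \<oplus>\<^bsub>gcomp Q (n - i)\<^esub> q') x - fgen (i, p, q) x - fgen (i, p, q') x | i p q q'.
        p \<in> gcar P i \<and> q \<in> gcar Q (n - i) \<and> q' \<in> gcar Q (n - i)} \<union>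
     {\<lambda>x. fgen (i, r \<odot>\<^bsub>gcomp P i\<^esub> p, q) x - r * fgen (i, p, q) x | i r p q.
        p \<in> gcar P i \<and> q \<in> gcar Q (n - i)} \<union>
     {\<lambda>x. fgen (i, p, r \<odot>\<^bsub>gcomp Q (n - i)\<^esub> q) x - r * fgen (i, p, q) x | i r p q.
        p \<in> gcar P i \<and> q \<in> gcar Q (n - i)} \<union>
     {\<lambda>x. fgen (i + d, ksign i d \<odot>\<^bsub>gcomp P (i + d)\<^esub> gact P d i f p, q) x
          - fgen (i, p, gact Q d (n - i - d) f q) x | i d f p q.
        f \<in> carrier (A d) \<and> p \<in> gcar P i \<and> q \<in> gcar Q (n - i - d)}"

lemma tensor_rel_rels: "tensor_rel A P Q n = rspan (free_vs P Q n) (tensor_rels A P Q n)"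
  by (simp only: tensor_rel_def tensor_rels_def)

text \<open>
  A linear map defined on the free space respects the relations iff it is bilinear and balanced on generators.
\<close>

lemma tensor_rels_iff:
  assumes ok: "tensor_ok A P Q" and W: "vs W" and L: "linear_map (free_vs P Q n) W L"
  shows "(\<forall>z \<in> tensor_rels A P Q n. L z = \<zero>\<^bsub>W\<^esub>) \<longleftrightarrow>
    tensor_bilinear A P Q n W (\<lambda>i p q. L (fgen (i, p, q)))"
    and "tensor_rels A P Q n \<subseteq> carrier (free_vs P Q n)"
proof -
  note D = tensor_okD[OF ok] and F = vs_free_vs[of P Q n] and g = fgen_in_free_vs
  have valid: "ksign i d \<odot>\<^bsub>gcomp P (i + d)\<^esub> gact P d i f p \<in> gcar P (i + d)"
    "q \<in> gcar Q (n - (i + d))" "gact Q d (n - i - d) f q \<in> gcar Q (n - i)"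
    if "f \<in> carrier (A d)" "p \<in> gcar P i" "q \<in> gcar Q (n - i - d)" for i d f p q
    using D(1)[of "i + d"] D(3)[of f d p i] D(4)[of f d q "n - i - d"] that by (simp_all add: add.commute diff_diff_add)
  show sub: "tensor_rels A P Q n \<subseteq> carrier (free_vs P Q n)"
    unfolding tensor_rels_def free_vs_combs[where P = P and Q = Q and n = n]
    by (intro Un_least subsetI; clarify; intro vs_add_closed[OF F] vs_smult_closed[OF F] g)
      (simp_all add: D valid)
  have 1: "L (\<lambda>x. u x - v x - w x) = \<zero>\<^bsub>W\<^esub> \<longleftrightarrow> L u = L v \<oplus>\<^bsub>W\<^esub> L w"
    if "u \<in> carrier (free_vs P Q n)" "v \<in> carrier (free_vs P Q n)" "w \<in> carrier (free_vs P Q n)" for u v w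
    unfolding free_vs_combs[where P = P and Q = Q and n = n] using that L W F
    by (simp add: linear_map_add[OF L] linear_map_smult[OF L] vs_eq_iff_diff[of W "L u"] del: free_vs_simps)
  have 2: "L (\<lambda>x. u x - r * v x) = \<zero>\<^bsub>W\<^esub> \<longleftrightarrow> L u = r \<odot>\<^bsub>W\<^esub> L v"
    if "u \<in> carrier (free_vs P Q n)" "v \<in> carrier (free_vs P Q n)" for u v r
    unfolding free_vs_combs[where P = P and Q = Q and n = n] using that L W F
    by (simp add: linear_map_add[OF L] linear_map_smult[OF L] vs_eq_iff_diff[of W "L u"] del: free_vs_simps)
  have 3: "L (\<lambda>x. u x - v x) = \<zero>\<^bsub>W\<^esub> \<longleftrightarrow> L u = L v"
    if "u \<in> carrier (free_vs P Q n)" "v \<in> carrier (free_vs P Q n)" for u v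
    unfolding free_vs_combs[where P = P and Q = Q and n = n] using that L W F
    by (simp add: linear_map_add[OF L] linear_map_smult[OF L] vs_eq_iff_diff[of W "L u"] del: free_vs_simps)
  have closed: "L (fgen (i, p, q)) \<in> carrier W" if "p \<in> gcar P i" "q \<in> gcar Q (n - i)" for i p q
    using linear_map_closed[OF L g[OF that]] .
  show "(\<forall>z \<in> tensor_rels A P Q n. L z = \<zero>\<^bsub>W\<^esub>) \<longleftrightarrow>
    tensor_bilinear A P Q n W (\<lambda>i p q. L (fgen (i, p, q)))" (is "?L \<longleftrightarrow> ?R")
  proof
    assume ?L
    then have *: "z \<in> tensor_rels A P Q n \<Longrightarrow> L z = \<zero>\<^bsub>W\<^esub>" for z by blast
    show ?R
      unfolding tensor_bilinear_def
    proof (intro conjI allI ballI)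
      fix i p assume p: "p \<in> gcar P i"
      show "linear_map (gcomp Q (n - i)) W (\<lambda>q. L (fgen (i, p, q)))"
      proof (rule linear_mapI)
        fix q q' assume q: "q \<in> gcar Q (n - i)" "q' \<in> gcar Q (n - i)"
        show "L (fgen (i, p, q \<oplus>\<^bsub>gcomp Q (n - i)\<^esub> q')) = L (fgen (i, p, q)) \<oplus>\<^bsub>W\<^esub> L (fgen (i, p, q'))"
          by (rule iffD1[OF 1[OF g g g] *])
            (use p q D in \<open>force simp: tensor_rels_def simp del: free_vs_simps\<close>)+
      next
        fix r q assume q: "q \<in> gcar Q (n - i)"
        show "L (fgen (i, p, r \<odot>\<^bsub>gcomp Q (n - i)\<^esub> q)) = r \<odot>\<^bsub>W\<^esub> L (fgen (i, p, q))"
          by (rule iffD1[OF 2[OF g g] *])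
            (use p q D in \<open>force simp: tensor_rels_def simp del: free_vs_simps\<close>)+
      qed (use closed p in simp)
    next
      fix i q assume q: "q \<in> gcar Q (n - i)"
      show "linear_map (gcomp P i) W (\<lambda>p. L (fgen (i, p, q)))"
      proof (rule linear_mapI)
        fix p p' assume p: "p \<in> gcar P i" "p' \<in> gcar P i"
        show "L (fgen (i, p \<oplus>\<^bsub>gcomp P i\<^esub> p', q)) = L (fgen (i, p, q)) \<oplus>\<^bsub>W\<^esub> L (fgen (i, p', q))"
          by (rule iffD1[OF 1[OF g g g] *])
            (use p q D in \<open>force simp: tensor_rels_def simp del: free_vs_simps\<close>)+
      next
        fix r p assume p: "p \<in> gcar P i"
        show "L (fgen (i, r \<odot>\<^bsub>gcomp P i\<^esub> p, q)) = r \<odot>\<^bsub>W\<^esub> L (fgen (i, p, q))"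
          by (rule iffD1[OF 2[OF g g] *])
            (use p q D in \<open>force simp: tensor_rels_def simp del: free_vs_simps\<close>)+
      qed (use closed q in simp)
    next
      fix i d f p q assume fpq: "f \<in> carrier (A d)" "p \<in> gcar P i" "q \<in> gcar Q (n - i - d)"
      show "L (fgen (i + d, ksign i d \<odot>\<^bsub>gcomp P (i + d)\<^esub> gact P d i f p, q))
          = L (fgen (i, p, gact Q d (n - i - d) f q))"
        by (rule iffD1[OF 3[OF g g] *])
          (use fpq valid in \<open>force simp: tensor_rels_def simp del: free_vs_simps\<close>)+
    qed
  next
    assume ?R
    note B = tensor_bilinearD[OF this]
    show ?L
      unfolding tensor_rels_def ball_Un
    proof (intro conjI ballI; clarify)
      fix i p p' q assume "p \<in> gcar P i" "p' \<in> gcar P i" "q \<in> gcar Q (n - i)"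
      then show "L (\<lambda>x. fgen (i, p \<oplus>\<^bsub>gcomp P i\<^esub> p', q) x - fgen (i, p, q) x - fgen (i, p', q) x) = \<zero>\<^bsub>W\<^esub>"
        by (subst 1) (auto simp: D linear_map_add[OF B(2)] simp del: free_vs_simps intro!: g)
    next
      fix i p q q' assume "p \<in> gcar P i" "q \<in> gcar Q (n - i)" "q' \<in> gcar Q (n - i)"
      then show "L (\<lambda>x. fgen (i, p, q \<oplus>\<^bsub>gcomp Q (n - i)\<^esub> q') x - fgen (i, p, q) x - fgen (i, p, q') x) = \<zero>\<^bsub>W\<^esub>"
        by (subst 1) (auto simp: D linear_map_add[OF B(1)] simp del: free_vs_simps intro!: g)
    next
      fix i p q and r :: real assume "p \<in> gcar P i" "q \<in> gcar Q (n - i)"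
      then show "L (\<lambda>x. fgen (i, r \<odot>\<^bsub>gcomp P i\<^esub> p, q) x - r * fgen (i, p, q) x) = \<zero>\<^bsub>W\<^esub>"
        by (subst 2) (auto simp: D linear_map_smult[OF B(2)] simp del: free_vs_simps intro!: g)
    next
      fix i p q and r :: real assume "p \<in> gcar P i" "q \<in> gcar Q (n - i)"
      then show "L (\<lambda>x. fgen (i, p, r \<odot>\<^bsub>gcomp Q (n - i)\<^esub> q) x - r * fgen (i, p, q) x) = \<zero>\<^bsub>W\<^esub>"
        by (subst 2) (auto simp: D linear_map_smult[OF B(1)] simp del: free_vs_simps intro!: g)
    next
      fix i d f p q assume "f \<in> carrier (A d)" "p \<in> gcar P i" "q \<in> gcar Q (n - i - d)"
      then show "L (\<lambda>x. fgen (i + d, ksign i d \<odot>\<^bsub>gcomp P (i + d)\<^esub> gact P d i f p, q) x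
          - fgen (i, p, gact Q d (n - i - d) f q) x) = \<zero>\<^bsub>W\<^esub>"
        by (subst 3) (auto simp: valid B(3) simp del: free_vs_simps intro!: g)
    qed
  qed
qed

lemma subspace_of_tensor_rel:
  assumes "tensor_ok A P Q"
  shows "subspace_of (tensor_rel A P Q n) (free_vs P Q n)"
  unfolding tensor_rel_rels
  by (rule subspace_of_rspan[OF vs_free_vs tensor_rels_iff(2)[OF assms vs_free_vs[of P Q n], where L = "\<lambda>x. x"]])
    (simp add: linear_map_def)

lemma vs_tensor_vs: "tensor_ok A P Q \<Longrightarrow> vs (tensor_vs A P Q n)"
  unfolding tensor_vs_def by (rule vs_quot_vs[OF vs_free_vs subspace_of_tensor_rel])

lemma linear_map_kills_tensor_rel:
  assumes ok: "tensor_ok A P Q" and W: "vs W" and L: "linear_map (free_vs P Q n) W L"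
    and b: "tensor_bilinear A P Q n W (\<lambda>i p q. L (fgen (i, p, q)))" and z: "z \<in> tensor_rel A P Q n"
  shows "L z = \<zero>\<^bsub>W\<^esub>"
  using linear_map_rspan[OF vs_free_vs W L subspace_of_zero_set[OF W] tensor_rels_iff(2)[OF ok W L]]
    tensor_rels_iff(1)[OF ok W L] b z
  by (auto simp: tensor_rel_rels)

lemma tensor_bilinear_tensor_elt:
  assumes ok: "tensor_ok A P Q"
  shows "tensor_bilinear A P Q n (tensor_vs A P Q n) (tensor_elt A P Q n)"
proof -
  note sub = subspace_of_tensor_rel[OF ok, of n]
  have lin: "linear_map (free_vs P Q n) (tensor_vs A P Q n) (\<lambda>c. tensor_rel A P Q n +>\<^bsub>free_vs P Q n\<^esub> c)"
    unfolding tensor_vs_def by (rule linear_map_coset[OF vs_free_vs sub])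
  have "tensor_rel A P Q n +>\<^bsub>free_vs P Q n\<^esub> z = \<zero>\<^bsub>tensor_vs A P Q n\<^esub>" if z: "z \<in> tensor_rels A P Q n" for z
  proof -
    have "z \<in> carrier (free_vs P Q n)" using tensor_rels_iff(2)[OF ok vs_tensor_vs[OF ok] lin] z by blast
    moreover have "z \<in> tensor_rel A P Q n" unfolding tensor_rel_rels by (rule rspan_superset[OF z])
    ultimately show ?thesis
      using coset_eq_self_iff[OF vs_free_vs sub] by (simp add: tensor_vs_def zero_quot_vs del: free_vs_simps)
  qed
  then show ?thesis
    using tensor_rels_iff(1)[OF ok vs_tensor_vs[OF ok] lin] by (simp add: tensor_elt_def[abs_def])
qed

lemma tensor_elt_closed:
  "p \<in> gcar P i \<Longrightarrow> q \<in> gcar Q (n - i) \<Longrightarrow> tensor_elt A P Q n i p q \<in> carrier (tensor_vs A P Q n)"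
  unfolding tensor_elt_def tensor_vs_def by (rule coset_in_quot_vs[OF fgen_in_free_vs])

lemma carrier_tensor_vs_rspan:
  assumes ok: "tensor_ok A P Q"
  shows "carrier (tensor_vs A P Q n) = rspan (tensor_vs A P Q n)
    {tensor_elt A P Q n i p q | i p q. p \<in> gcar P i \<and> q \<in> gcar Q (n - i)}" (is "_ = rspan _ ?S")
proof
  note T = vs_tensor_vs[OF ok]
  have S: "?S \<subseteq> carrier (tensor_vs A P Q n)" using tensor_elt_closed[of _ P _ _ Q n A] by blast
  then show "rspan (tensor_vs A P Q n) ?S \<subseteq> carrier (tensor_vs A P Q n)" by (rule rspan_subset_carrier[OF T])
  note sub = subspace_of_tensor_rel[OF ok, of n]
  have lin: "linear_map (free_vs P Q n) (tensor_vs A P Q n) (\<lambda>c. tensor_rel A P Q n +>\<^bsub>free_vs P Q n\<^esub> c)"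
    unfolding tensor_vs_def by (rule linear_map_coset[OF vs_free_vs sub])
  show "carrier (tensor_vs A P Q n) \<subseteq> rspan (tensor_vs A P Q n) ?S"
  proof
    fix x assume "x \<in> carrier (tensor_vs A P Q n)"
    then obtain c where c: "c \<in> carrier (free_vs P Q n)" "x = tensor_rel A P Q n +>\<^bsub>free_vs P Q n\<^esub> c"
      unfolding tensor_vs_def carrier_quot_vs by blast
    have gens: "fgen ` tensor_gens P Q n \<subseteq> carrier (free_vs P Q n)"
      using fgen_in_free_vs by (auto simp: tensor_gens_def simp del: free_vs_simps)
    show "x \<in> rspan (tensor_vs A P Q n) ?S"
      unfolding c(2)
      by (rule linear_map_rspan[OF vs_free_vs T lin subspace_of_rspan[OF T S] gens])
        (use c(1) in \<open>auto simp: carrier_free_vs_rspan tensor_gens_def tensor_elt_def simp del: free_vs_simps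
          intro!: rspan_superset\<close>)
  qed
qed

lemma linear_map_tensor_into:
  assumes ok: "tensor_ok A P Q" and W: "vs W" and L: "linear_map (tensor_vs A P Q n) W L"
    and N: "subspace_of N W"
    and "\<And>i p q. p \<in> gcar P i \<Longrightarrow> q \<in> gcar Q (n - i) \<Longrightarrow> L (tensor_elt A P Q n i p q) \<in> N"
    and x: "x \<in> carrier (tensor_vs A P Q n)"
  shows "L x \<in> N"
  by (rule linear_map_rspan[OF vs_tensor_vs[OF ok] W L N _ _ x[unfolded carrier_tensor_vs_rspan[OF ok]]])
    (use assms(5) tensor_elt_closed[of _ P _ _ Q n A] in blast)+

lemma linear_map_tensor_eq:
  assumes ok: "tensor_ok A P Q" and W: "vs W" and L: "linear_map (tensor_vs A P Q n) W L"
    and L': "linear_map (tensor_vs A P Q n) W L'"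
    and "\<And>i p q. p \<in> gcar P i \<Longrightarrow> q \<in> gcar Q (n - i) \<Longrightarrow>
      L (tensor_elt A P Q n i p q) = L' (tensor_elt A P Q n i p q)"
    and x: "x \<in> carrier (tensor_vs A P Q n)"
  shows "L x = L' x"
  by (rule linear_map_eq_on_rspan[OF vs_tensor_vs[OF ok] W L L' _ _ x[unfolded carrier_tensor_vs_rspan[OF ok]]])
    (use assms(5) tensor_elt_closed[of _ P _ _ Q n A] in blast)+

text \<open>The universal property of the tensor product.\<close>

definition tensor_ext :: "(real, 'w) module \<Rightarrow> (int \<Rightarrow> 'p \<Rightarrow> 'q \<Rightarrow> 'w) \<Rightarrow> ('p, 'q) ftens set \<Rightarrow> 'w" where
  "tensor_ext W b = quot_lift (free_ext W (\<lambda>(i, p, q). b i p q))"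

lemma linear_map_tensor_ext:
  assumes ok: "tensor_ok A P Q" and W: "vs W" and b: "tensor_bilinear A P Q n W b"
  shows "linear_map (tensor_vs A P Q n) W (tensor_ext W b)"
    and "p \<in> gcar P i \<Longrightarrow> q \<in> gcar Q (n - i) \<Longrightarrow> tensor_ext W b (tensor_elt A P Q n i p q) = b i p q"
proof -
  let ?L = "free_ext W (\<lambda>(i, p, q). b i p q)"
  have h: "(case x of (i, p, q) \<Rightarrow> b i p q) \<in> carrier W" if "x \<in> tensor_gens P Q n" for x
    using that linear_map_closed[OF tensor_bilinearD(1)[OF b]] by (auto simp: tensor_gens_def)
  note L = linear_map_free_ext[where P = P and Q = Q and n = n, OF W h]
  have Lgen: "?L (fgen (i, p, q)) = b i p q" if "p \<in> gcar P i" "q \<in> gcar Q (n - i)" for i p q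
    using L(2)[of _ "(i, p, q)"] that by (simp add: tensor_gens_def)
  have "tensor_bilinear A P Q n W (\<lambda>i p q. ?L (fgen (i, p, q)))"
    by (rule tensor_bilinear_cong[OF ok b Lgen])
  note kill = linear_map_kills_tensor_rel[OF ok W L(1) this]
  show "linear_map (tensor_vs A P Q n) W (tensor_ext W b)"
    unfolding tensor_vs_def tensor_ext_def
    by (rule linear_map_quot_lift[OF vs_free_vs subspace_of_tensor_rel[OF ok] W L(1) kill])
  show "tensor_ext W b (tensor_elt A P Q n i p q) = b i p q" if "p \<in> gcar P i" "q \<in> gcar Q (n - i)"
    unfolding tensor_elt_def tensor_ext_def
    using quot_lift_coset[OF vs_free_vs subspace_of_tensor_rel[OF ok] W L(1) kill fgen_in_free_vs[OF that]] Lgen[OF that]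
    by simp
qed

subsection \<open>Maps between tensor products\<close>

lemma linear_map_fext:
  assumes hval: "\<And>x. x \<in> tensor_gens P Q m \<Longrightarrow> h x \<in> tensor_gens P' Q' n"
  shows "linear_map (free_vs P Q m) (free_vs P' Q' n) (fext s h)"
    and "fext s h (fgen x) = (\<lambda>y. s x * fgen (h x) y)"
proof -
  have gens: "x \<in> tensor_gens P Q m" if "c \<in> carrier (free_vs P Q m)" "c x \<noteq> 0" for c x
    using that by (cases x) (auto simp: tensor_gens_def)
  have fin: "finite {x. c x \<noteq> 0 \<and> R x}" if "c \<in> carrier (free_vs P Q m)" for c R
    by (rule finite_subset[of _ "{x. c x \<noteq> 0}"]) (use that in auto)
  have sup: "fext s h c y = (\<Sum>x\<in>S. if h x = y then s x * c x else 0)"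
    if "finite S" "{x. c x \<noteq> 0} \<subseteq> S" for c y S
  proof -
    have "fext s h c y = (\<Sum>x | c x \<noteq> 0 \<and> h x = y. if h x = y then s x * c x else 0)"
      unfolding fext_def by (rule sum.cong) auto
    also have "\<dots> = (\<Sum>x\<in>S. if h x = y then s x * c x else 0)"
      using that by (intro sum.mono_neutral_left) auto
    finally show ?thesis .
  qed
  show "linear_map (free_vs P Q m) (free_vs P' Q' n) (fext s h)"
  proof (rule linear_mapI)
    fix c assume c: "c \<in> carrier (free_vs P Q m)"
    have nz: "\<exists>x. c x \<noteq> 0 \<and> h x = y" if "fext s h c y \<noteq> 0" for y
    proof (rule ccontr)
      assume "\<nexists>x. c x \<noteq> 0 \<and> h x = y"
      then have empty: "{x. c x \<noteq> 0 \<and> h x = y} = {}" by blast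
      have "fext s h c y = 0" unfolding fext_def empty by (rule sum.empty)
      with that show False by contradiction
    qed
    have "finite {y. fext s h c y \<noteq> 0}"
    proof (rule finite_subset)
      show "{y. fext s h c y \<noteq> 0} \<subseteq> h ` {x. c x \<noteq> 0}" using nz by blast
    qed (use c in simp)
    moreover have "p \<in> gcar P' i \<and> q \<in> gcar Q' (n - i)" if "fext s h c (i, p, q) \<noteq> 0" for i p q
    proof -
      from nz[OF that] obtain x where x: "c x \<noteq> 0" "h x = (i, p, q)" by blast
      have "(i, p, q) \<in> tensor_gens P' Q' n" using hval[OF gens[OF c x(1)]] x(2) by simp
      then show ?thesis by (simp add: tensor_gens_def)
    qed
    ultimately show "fext s h c \<in> carrier (free_vs P' Q' n)" by simp
    fix r
    have f: "finite {x. c x \<noteq> 0}" using c by simp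
    have "fext s h (r \<odot>\<^bsub>free_vs P Q m\<^esub> c) y = r * fext s h c y" for y
    proof -
      have rc: "fext s h (\<lambda>x. r * c x) y = (\<Sum>x | c x \<noteq> 0. if h x = y then s x * (r * c x) else 0)"
        by (rule sup[OF f]) auto
      show ?thesis
        unfolding free_vs_simps rc sup[OF f order.refl] sum_distrib_left by (rule sum.cong) auto
    qed
    then show "fext s h (r \<odot>\<^bsub>free_vs P Q m\<^esub> c) = r \<odot>\<^bsub>free_vs P' Q' n\<^esub> fext s h c"
      by (intro ext) (simp only: free_vs_simps)
  next
    fix c d assume c: "c \<in> carrier (free_vs P Q m)" and d: "d \<in> carrier (free_vs P Q m)"
    have f: "finite ({x. c x \<noteq> 0} \<union> {x. d x \<noteq> 0})" using c d by simp
    have "fext s h (c \<oplus>\<^bsub>free_vs P Q m\<^esub> d) y = fext s h c y + fext s h d y" for y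
    proof -
      let ?S = "{x. c x \<noteq> 0} \<union> {x. d x \<noteq> 0}"
      have cd: "fext s h (\<lambda>x. c x + d x) y = (\<Sum>x\<in>?S. if h x = y then s x * (c x + d x) else 0)"
        by (rule sup[OF f]) auto
      show ?thesis
        unfolding free_vs_simps cd sup[OF f Un_upper1] sup[OF f Un_upper2] sum.distrib[symmetric]
        by (rule sum.cong) (auto simp: algebra_simps)
    qed
    then show "fext s h (c \<oplus>\<^bsub>free_vs P Q m\<^esub> d) = fext s h c \<oplus>\<^bsub>free_vs P' Q' n\<^esub> fext s h d"
      by (intro ext) (simp only: free_vs_simps)
  qed
  show "fext s h (fgen x) = (\<lambda>y. s x * fgen (h x) y)"
    using sup[of "{x}" "fgen x"] by (auto simp: fgen_def)
qed

text \<open>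
  \<open>tensor_lift\<close> is well defined and linear as soon as \<open>s\<close> times the image of the generators is bilinear and
  balanced.
\<close>

lemma linear_map_tensor_lift:
  assumes ok: "tensor_ok A P Q" and ok': "tensor_ok A' P' Q'"
    and hval: "\<And>i p q. p \<in> gcar P i \<Longrightarrow> q \<in> gcar Q (m - i) \<Longrightarrow> h (i, p, q) \<in> tensor_gens P' Q' n"
    and b: "tensor_bilinear A P Q m (tensor_vs A' P' Q' n)
      (\<lambda>i p q. s (i, p, q) \<odot>\<^bsub>tensor_vs A' P' Q' n\<^esub> (case h (i, p, q) of (i', p', q') \<Rightarrow> tensor_elt A' P' Q' n i' p' q'))"
  shows "linear_map (tensor_vs A P Q m) (tensor_vs A' P' Q' n) (tensor_lift A' P' Q' n s h)"
    and "p \<in> gcar P i \<Longrightarrow> q \<in> gcar Q (m - i) \<Longrightarrow>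
      tensor_lift A' P' Q' n s h (tensor_elt A P Q m i p q)
        = s (i, p, q) \<odot>\<^bsub>tensor_vs A' P' Q' n\<^esub> (case h (i, p, q) of (i', p', q') \<Rightarrow> tensor_elt A' P' Q' n i' p' q')"
proof -
  note F = vs_free_vs and R = subspace_of_tensor_rel[OF ok, of m] and R' = subspace_of_tensor_rel[OF ok', of n]
  note T' = vs_tensor_vs[OF ok', of n]
  have h: "h x \<in> tensor_gens P' Q' n" if "x \<in> tensor_gens P Q m" for x
    using that hval by (cases x) (auto simp: tensor_gens_def)
  note fe = linear_map_fext[where P = P and Q = Q and m = m and P' = P' and Q' = Q' and n = n and h = h and s = s, OF h]
  let ?L = "\<lambda>c. tensor_rel A' P' Q' n +>\<^bsub>free_vs P' Q' n\<^esub> fext s h c"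
  have cos: "linear_map (free_vs P' Q' n) (tensor_vs A' P' Q' n) (\<lambda>c. tensor_rel A' P' Q' n +>\<^bsub>free_vs P' Q' n\<^esub> c)"
    unfolding tensor_vs_def by (rule linear_map_coset[OF F R'])
  have L: "linear_map (free_vs P Q m) (tensor_vs A' P' Q' n) ?L"
    by (rule linear_map_comp[OF fe(1) cos])
  have Lgen: "?L (fgen (i, p, q)) = s (i, p, q) \<odot>\<^bsub>tensor_vs A' P' Q' n\<^esub> (case h (i, p, q) of (i', p', q') \<Rightarrow> tensor_elt A'
      P' Q' n i' p' q')"
    if "p \<in> gcar P i" "q \<in> gcar Q (m - i)" for i p q
  proof -
    obtain i' p' q' where h': "h (i, p, q) = (i', p', q')" by (cases "h (i, p, q)")
    then have "fgen (h (i, p, q)) \<in> carrier (free_vs P' Q' n)"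
      using hval[OF that] fgen_in_free_vs[of p' P' i' q' Q' n] by (simp add: tensor_gens_def)
    then show ?thesis
      using linear_map_smult[OF cos, of "fgen (h (i, p, q))" "s (i, p, q)"] h'
      by (simp add: fe(2) tensor_elt_def)
  qed
  have "tensor_bilinear A P Q m (tensor_vs A' P' Q' n) (\<lambda>i p q. ?L (fgen (i, p, q)))"
    by (rule tensor_bilinear_cong[OF ok b Lgen])
  note kill = linear_map_kills_tensor_rel[OF ok T' L this]
  have rel: "fext s h c \<in> tensor_rel A' P' Q' n" if "c \<in> tensor_rel A P Q m" for c
    using kill[OF that] coset_eq_self_iff[OF F R', where x = "fext s h c"]
      linear_map_closed[OF fe(1), where x = c] subspace_of_carrier_mem[OF R that]
    by (simp add: tensor_vs_def zero_quot_vs del: free_vs_simps)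
  have lift: "tensor_lift A' P' Q' n s h (tensor_rel A P Q m +>\<^bsub>free_vs P Q m\<^esub> c) = ?L c"
    if "c \<in> carrier (free_vs P Q m)" for c
    unfolding tensor_lift_def by (rule coset_map[OF F R F R' fe(1) rel that])
  have quot: "tensor_lift A' P' Q' n s h X = quot_lift ?L X" if X: "X \<in> carrier (tensor_vs A P Q m)" for X
  proof -
    obtain c where c: "c \<in> carrier (free_vs P Q m)" "X = tensor_rel A P Q m +>\<^bsub>free_vs P Q m\<^esub> c"
      using X unfolding tensor_vs_def carrier_quot_vs by blast
    show ?thesis unfolding c(2) lift[OF c(1)] by (rule quot_lift_coset[OF F R T' L kill c(1), symmetric])
  qed
  show "linear_map (tensor_vs A P Q m) (tensor_vs A' P' Q' n) (tensor_lift A' P' Q' n s h)"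
    by (rule linear_map_cong[OF vs_tensor_vs[OF ok] quot], assumption,
        unfold tensor_vs_def[of A], rule linear_map_quot_lift[OF F R T' L kill])
  show "tensor_lift A' P' Q' n s h (tensor_elt A P Q m i p q)
      = s (i, p, q) \<odot>\<^bsub>tensor_vs A' P' Q' n\<^esub> (case h (i, p, q) of (i', p', q') \<Rightarrow> tensor_elt A' P' Q' n i' p' q')"
    if "p \<in> gcar P i" "q \<in> gcar Q (m - i)"
    unfolding tensor_elt_def[of A P] using lift[OF fgen_in_free_vs[of p P i q Q m]] Lgen[OF that] that by simp
qed

subsection \<open>Tensor products over the reals\<close>

lemma gcomp_real_gmod [simp]: "gcomp (real_gmod V) = V"
  by (simp add: real_gmod_def)

lemma gact_real_gmod: "gact (real_gmod V) i j r x = (if i = 0 then r \<odot>\<^bsub>V j\<^esub> x else \<zero>\<^bsub>V (i + j)\<^esub>)"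
  by (simp add: real_gmod_def)

lemma carrier_real_graded: "carrier (real_graded j) = (if j = 0 then UNIV else {0})"
  by (simp add: real_graded_def)

lemma tensor_ok_real:
  assumes "\<And>j. vs (V j)" "\<And>j. vs (V' j)"
  shows "tensor_ok real_graded (real_gmod V) (real_gmod V')"
  using assms by (auto simp: tensor_ok_def graded_vs_def gact_real_gmod)

text \<open>Over the reals, concentrated in degree \<open>0\<close>, a bilinear map is automatically balanced.\<close>

lemma tensor_bilinear_real:
  assumes V: "\<And>j. vs (V j)" "\<And>j. vs (V' j)" and W: "vs W"
    and 1: "\<And>i p. p \<in> carrier (V i) \<Longrightarrow> linear_map (V' (n - i)) W (b i p)"
    and 2: "\<And>i q. q \<in> carrier (V' (n - i)) \<Longrightarrow> linear_map (V i) W (\<lambda>p. b i p q)"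
  shows "tensor_bilinear real_graded (real_gmod V) (real_gmod V') n W b"
  unfolding tensor_bilinear_def gcomp_real_gmod
proof (intro conjI allI ballI 1 2)
  fix i d f p q
  assume f: "f \<in> carrier (real_graded d)" and p: "p \<in> carrier (V i)" and q: "q \<in> carrier (V' (n - i - d))"
  show "b (i + d) (ksign i d \<odot>\<^bsub>V (i + d)\<^esub> gact (real_gmod V) d i f p) q
      = b i p (gact (real_gmod V') d (n - i - d) f q)"
  proof (cases "d = 0")
    case True
    then show ?thesis using linear_map_smult[OF 1[OF p], of q f] linear_map_smult[OF 2, of q i p f] p q V
      by (simp add: gact_real_gmod ksign_def)
  next
    case False
    have "q \<in> carrier (V' (n - (i + d)))" using q by (simp add: diff_diff_add)
    from linear_map_zero[OF V(1) W 2[OF this]] linear_map_zero[OF V(2) W 1[OF p]] False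
    show ?thesis using V by (simp add: gact_real_gmod add.commute)
  qed
qed

section \<open>The tensor product of functions and sections\<close>

lemma ksign_add_right: "ksign d (e + i) = ksign d e * ksign d i"
  by (simp add: ksign_def)

lemma ksign_square [simp]: "ksign i j * ksign i j = 1"
  by (simp add: ksign_def)

lemma ksign_zero_left [simp]: "ksign 0 i = 1"
  by (simp add: ksign_def)

context
  fixes C :: "('m::topological_space, 'f) galg_presheaf" and E :: "('m, 'f, 's) gpresheaf"
  assumes C: "algebra_sheaf C" and E: "module_presheaf C E"
begin

lemma gcomp_jetX: "gcomp (gsec (jetX C E) U) n
    = tensor_vs real_graded (real_gmod (gcomp (gsec C U))) (real_gmod (gcomp (gsec E U))) n"
  by (simp add: jetX_def tensor_left_def)

lemma tensor_ok_jetX: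
  assumes "open U"
  shows "tensor_ok real_graded (real_gmod (gcomp (gsec C U))) (real_gmod (gcomp (gsec E U)))"
  by (intro tensor_ok_real module_presheaf_vs[OF algebra_sheaf_module[OF C] assms] module_presheaf_vs[OF E assms])

lemma vs_jetX: "open U \<Longrightarrow> vs (gcomp (gsec (jetX C E) U) n)"
  unfolding gcomp_jetX by (rule vs_tensor_vs[OF tensor_ok_jetX])

lemma jet_elt_linear:
  assumes "open U"
  shows "g \<in> scar C U i \<Longrightarrow> linear_map (gcomp (gsec E U) (n - i)) (gcomp (gsec (jetX C E) U) n) (jet_elt C E U n i g)"
    "\<psi> \<in> scar E U (n - i) \<Longrightarrow> linear_map (gcomp (gsec C U) i) (gcomp (gsec (jetX C E) U) n) (\<lambda>g. jet_elt C E U n i g \<psi>)"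
  using tensor_bilinearD(1,2)[OF tensor_bilinear_tensor_elt[OF tensor_ok_jetX[OF assms]]]
  by (simp_all add: jet_elt_def gcomp_jetX)

lemma jet_elt_closed:
  "g \<in> scar C U i \<Longrightarrow> \<psi> \<in> scar E U (n - i) \<Longrightarrow> jet_elt C E U n i g \<psi> \<in> scar (jetX C E) U n"
  unfolding jet_elt_def gcomp_jetX by (rule tensor_elt_closed) simp_all

text \<open>Linear maps out of \<open>jetX\<close>: by bilinearity it suffices to look at the elements \<open>g \<otimes> \<psi>\<close>.\<close>

lemma linear_map_jetX_into:
  assumes "open U" "vs W" "linear_map (gcomp (gsec (jetX C E) U) n) W L" "subspace_of N W"
    and "\<And>i g \<psi>. g \<in> scar C U i \<Longrightarrow> \<psi> \<in> scar E U (n - i) \<Longrightarrow> L (jet_elt C E U n i g \<psi>) \<in> N"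
    and "x \<in> scar (jetX C E) U n"
  shows "L x \<in> N"
  using linear_map_tensor_into[OF tensor_ok_jetX[OF assms(1)] assms(2), of n L N] assms(3-)
  by (simp add: gcomp_jetX jet_elt_def)

lemma linear_map_jetX_eq:
  assumes "open U" "vs W" "linear_map (gcomp (gsec (jetX C E) U) n) W L"
    "linear_map (gcomp (gsec (jetX C E) U) n) W L'"
    and "\<And>i g \<psi>. g \<in> scar C U i \<Longrightarrow> \<psi> \<in> scar E U (n - i) \<Longrightarrow>
      L (jet_elt C E U n i g \<psi>) = L' (jet_elt C E U n i g \<psi>)"
    and "x \<in> scar (jetX C E) U n"
  shows "L x = L' x"
  using linear_map_tensor_eq[OF tensor_ok_jetX[OF assms(1)] assms(2), of n L L'] assms(3-)
  by (simp add: gcomp_jetX jet_elt_def)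

text \<open>
  Both actions on \<open>jetX\<close> and its restriction maps have the form \<open>g \<otimes> \<psi> \<mapsto> s(\<bar>g\<bar>) \<phi>(g) \<otimes> \<theta>(\<psi>)\<close>.
\<close>

lemma jetX_lift:
  assumes U: "open U" and V: "open V"
    and h: "\<And>i g \<psi>. g \<in> scar C U i \<Longrightarrow> \<psi> \<in> scar E U (m - i) \<Longrightarrow> \<phi> i g \<in> scar C V (\<iota> i) \<and> \<theta> i \<psi> \<in> scar E V (n - \<iota> i)"
    and 1: "\<And>i. linear_map (gcomp (gsec C U) i) (gcomp (gsec C V) (\<iota> i)) (\<phi> i)"
    and 2: "\<And>i. linear_map (gcomp (gsec E U) (m - i)) (gcomp (gsec E V) (n - \<iota> i)) (\<theta> i)"
    and L_def: "L = tensor_lift real_graded (real_gmod (gcomp (gsec C V))) (real_gmod (gcomp (gsec E V))) n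
    (\<lambda>(i, g, \<psi>). s i) (\<lambda>(i, g, \<psi>). (\<iota> i, \<phi> i g, \<theta> i \<psi>))"
  shows "linear_map (gcomp (gsec (jetX C E) U) m) (gcomp (gsec (jetX C E) V) n) L"
    and "g \<in> scar C U i \<Longrightarrow> \<psi> \<in> scar E U (m - i) \<Longrightarrow>
      L (jet_elt C E U m i g \<psi>) = s i \<odot>\<^bsub>gcomp (gsec (jetX C E) V) n\<^esub> jet_elt C E V n (\<iota> i) (\<phi> i g) (\<theta> i \<psi>)"
proof -
  have b: "tensor_bilinear real_graded (real_gmod (gcomp (gsec C U))) (real_gmod (gcomp (gsec E U))) m
     (gcomp (gsec (jetX C E) V) n) (\<lambda>i g \<psi>. s i \<odot>\<^bsub>gcomp (gsec (jetX C E) V) n\<^esub> jet_elt C E V n (\<iota> i) (\<phi> i g) (\<theta> i \<psi>))"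
  proof (rule tensor_bilinear_real)
    fix i g assume g: "g \<in> scar C U i"
    show "linear_map (gcomp (gsec E U) (m - i)) (gcomp (gsec (jetX C E) V) n)
        (\<lambda>\<psi>. s i \<odot>\<^bsub>gcomp (gsec (jetX C E) V) n\<^esub> jet_elt C E V n (\<iota> i) (\<phi> i g) (\<theta> i \<psi>))"
      by (rule linear_map_smult_map[OF vs_jetX[OF V] linear_map_comp[OF 2 jet_elt_linear(1)[OF V linear_map_closed[OF 1
          g]]]])
  next
    fix i \<psi> assume \<psi>: "\<psi> \<in> scar E U (m - i)"
    show "linear_map (gcomp (gsec C U) i) (gcomp (gsec (jetX C E) V) n)
        (\<lambda>g. s i \<odot>\<^bsub>gcomp (gsec (jetX C E) V) n\<^esub> jet_elt C E V n (\<iota> i) (\<phi> i g) (\<theta> i \<psi>))"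
      by (rule linear_map_smult_map[OF vs_jetX[OF V] linear_map_comp[OF 1 jet_elt_linear(2)[OF V linear_map_closed[OF 2
          \<psi>]]]])
  qed (use module_presheaf_vs[OF algebra_sheaf_module[OF C] U] module_presheaf_vs[OF E U] vs_jetX[OF V] in simp_all)
  note lift = linear_map_tensor_lift[OF tensor_ok_jetX[OF U] tensor_ok_jetX[OF V],
      where m = m and n = n and s = "\<lambda>(i, g, \<psi>). s i" and h = "\<lambda>(i, g, \<psi>). (\<iota> i, \<phi> i g, \<theta> i \<psi>)"]
  show "linear_map (gcomp (gsec (jetX C E) U) m) (gcomp (gsec (jetX C E) V) n) L"
    unfolding L_def gcomp_jetX
    by (rule lift(1)) (use h b in \<open>simp_all add: tensor_gens_def gcomp_jetX jet_elt_def\<close>)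
  show "L (jet_elt C E U m i g \<psi>) = s i \<odot>\<^bsub>gcomp (gsec (jetX C E) V) n\<^esub> jet_elt C E V n (\<iota> i) (\<phi> i g) (\<theta> i \<psi>)"
    if "g \<in> scar C U i" "\<psi> \<in> scar E U (m - i)"
    unfolding L_def gcomp_jetX jet_elt_def
    by (rule lift(2)[THEN trans]) (use h b that in \<open>simp_all add: tensor_gens_def gcomp_jetX jet_elt_def\<close>)
qed

lemma linear_map_jetX_gact:
  assumes U: "open U" and f: "f \<in> scar C U d"
  shows "linear_map (gcomp (gsec (jetX C E) U) n) (gcomp (gsec (jetX C E) U) (d + n)) (gact (gsec (jetX C E) U) d n f)"
    and "g \<in> scar C U i \<Longrightarrow> \<psi> \<in> scar E U (n - i) \<Longrightarrow>
      gact (gsec (jetX C E) U) d n f (jet_elt C E U n i g \<psi>) = jet_elt C E U (d + n) (d + i) (gact (gsec C U) d i f g) \<psi>"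
proof -
  note m = module_presheaf_module[OF algebra_sheaf_module[OF C] U]
  have eq: "gact (gsec (jetX C E) U) d n f =
    tensor_lift real_graded (real_gmod (gcomp (gsec C U))) (real_gmod (gcomp (gsec E U))) (d + n)
      (\<lambda>(i, g, \<psi>). 1) (\<lambda>(i, g, \<psi>). (d + i, gact (gsec C U) d i f g, \<psi>))"
    by (simp add: jetX_def tensor_left_def case_prod_unfold)
  note lift = jetX_lift[OF U U _ _ _ eq, where m = n]
  show "linear_map (gcomp (gsec (jetX C E) U) n) (gcomp (gsec (jetX C E) U) (d + n)) (gact (gsec (jetX C E) U) d n f)"
    by (rule lift(1)) (simp_all add: graded_module_closed[OF m f] linear_map_gact[OF m f], simp add: linear_map_def)
  show "gact (gsec (jetX C E) U) d n f (jet_elt C E U n i g \<psi>) = jet_elt C E U (d + n) (d + i) (gact (gsec C U) d i f g) \<psi>"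
    if "g \<in> scar C U i" "\<psi> \<in> scar E U (n - i)"
    by (rule lift(2)[THEN trans])
      (use that in \<open>simp_all add: graded_module_closed[OF m f] linear_map_gact[OF m f] vs_jetX[OF U] jet_elt_closed\<close>,
       simp add: linear_map_def)
qed

lemma linear_map_jet_ract:
  assumes U: "open U" and f: "f \<in> scar C U d"
  shows "linear_map (gcomp (gsec (jetX C E) U) n) (gcomp (gsec (jetX C E) U) (d + n)) (jet_ract C E U d n f)"
    and "g \<in> scar C U i \<Longrightarrow> \<psi> \<in> scar E U (n - i) \<Longrightarrow>
      jet_ract C E U d n f (jet_elt C E U n i g \<psi>)
        = ksign d i \<odot>\<^bsub>gcomp (gsec (jetX C E) U) (d + n)\<^esub> jet_elt C E U (d + n) i g (gact (gsec E U) d (n - i) f \<psi>)"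
proof -
  note m = module_presheaf_module[OF E U]
  have cl: "gact (gsec E U) d (n - i) f \<psi> \<in> scar E U (d + n - i)" if "\<psi> \<in> scar E U (n - i)" for i \<psi>
    using graded_module_closed[OF m f that] by (simp add: add_diff_eq)
  have lin: "linear_map (gcomp (gsec E U) (n - i)) (gcomp (gsec E U) (d + n - i)) (gact (gsec E U) d (n - i) f)" for i
    using linear_map_gact[OF m f, of "n - i"] by (simp add: add_diff_eq)
  note lift = jetX_lift[OF U U _ _ _ jet_ract_def, where m = n]
  show "linear_map (gcomp (gsec (jetX C E) U) n) (gcomp (gsec (jetX C E) U) (d + n)) (jet_ract C E U d n f)"
    by (rule lift(1)) (simp_all add: cl lin, simp add: linear_map_def)
  show "jet_ract C E U d n f (jet_elt C E U n i g \<psi>)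
        = ksign d i \<odot>\<^bsub>gcomp (gsec (jetX C E) U) (d + n)\<^esub> jet_elt C E U (d + n) i g (gact (gsec E U) d (n - i) f \<psi>)"
    if "g \<in> scar C U i" "\<psi> \<in> scar E U (n - i)"
    by (rule lift(2)) (use that in \<open>simp_all add: cl lin\<close>, simp add: linear_map_def)
qed

lemma linear_map_jetX_gres:
  assumes UV: "open U" "open V" "V \<subseteq> U"
  shows "linear_map (gcomp (gsec (jetX C E) U) n) (gcomp (gsec (jetX C E) V) n) (gres (jetX C E) U V n)"
    and "g \<in> scar C U i \<Longrightarrow> \<psi> \<in> scar E U (n - i) \<Longrightarrow>
      gres (jetX C E) U V n (jet_elt C E U n i g \<psi>) = jet_elt C E V n i (gres C U V i g) (gres E U V (n - i) \<psi>)"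
proof -
  have eq: "gres (jetX C E) U V n =
    tensor_lift real_graded (real_gmod (gcomp (gsec C V))) (real_gmod (gcomp (gsec E V))) n
      (\<lambda>(i, g, \<psi>). 1) (\<lambda>(i, g, \<psi>). (i, gres C U V i g, gres E U V (n - i) \<psi>))"
    by (simp add: jetX_def case_prod_unfold)
  note lift = jetX_lift[OF UV(1,2) _ _ _ eq, where m = n]
  note r = linear_map_gres[OF algebra_sheaf_module[OF C] UV] linear_map_gres[OF E UV]
  show "linear_map (gcomp (gsec (jetX C E) U) n) (gcomp (gsec (jetX C E) V) n) (gres (jetX C E) U V n)"
    by (rule lift(1)) (use linear_map_closed[OF r(1)] linear_map_closed[OF r(2)] in \<open>simp_all add: r\<close>)
  show "gres (jetX C E) U V n (jet_elt C E U n i g \<psi>) = jet_elt C E V n i (gres C U V i g) (gres E U V (n - i) \<psi>)"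
    if "g \<in> scar C U i" "\<psi> \<in> scar E U (n - i)"
    by (rule lift(2)[THEN trans])
      (use that linear_map_closed[OF r(1)] linear_map_closed[OF r(2)] in \<open>simp_all add: r vs_jetX[OF UV(2)] jet_elt_closed\<close>)
qed

lemma module_presheaf_jetX: "module_presheaf C (jetX C E)"
proof (rule module_presheafI, goal_cases)
  case (1 U)
  note U = 1 and X = vs_jetX[OF 1] and act = linear_map_jetX_gact[OF 1] and m
      = module_presheaf_module[OF algebra_sheaf_module[OF C] 1]
  show ?case
  proof (rule graded_moduleI, goal_cases)
    case (1 j) show ?case by (rule X)
  next
    case (2 i j f x) then show ?case by (rule linear_map_closed[OF act(1)])
  next
    case (3 i j f g x)
    have fg: "f \<oplus>\<^bsub>gcomp (gsec C U) i\<^esub> g \<in> scar C U i"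
      by (rule vs_add_closed[OF module_presheaf_vs[OF algebra_sheaf_module[OF C] U] 3(1,2)])
    show ?case
    proof (rule linear_map_jetX_eq[OF U X act(1)[OF fg] linear_map_add_map[OF X act(1)[OF 3(1)] act(1)[OF 3(2)]] _ 3(3)])
      fix l h \<psi> assume h: "h \<in> scar C U l" "\<psi> \<in> scar E U (j - l)"
      then have "\<psi> \<in> scar E U (i + j - (i + l))" by simp
      from linear_map_add[OF jet_elt_linear(2)[OF U this]]
      show "gact (gsec (jetX C E) U) i j (f \<oplus>\<^bsub>gcomp (gsec C U) i\<^esub> g) (jet_elt C E U j l h \<psi>) =
        gact (gsec (jetX C E) U) i j f (jet_elt C E U j l h \<psi>) \<oplus>\<^bsub>gcomp (gsec (jetX C E) U) (i + j)\<^esub>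
        gact (gsec (jetX C E) U) i j g (jet_elt C E U j l h \<psi>)"
        using h 3 by (simp add: act(2) fg graded_module_add_left[OF m] graded_module_closed[OF m])
    qed
  next
    case (4 i j f x y) then show ?case by (intro linear_map_add[OF act(1)])
  next
    case (5 i j r f x)
    have rf: "r \<odot>\<^bsub>gcomp (gsec C U) i\<^esub> f \<in> scar C U i"
      by (rule vs_smult_closed[OF module_presheaf_vs[OF algebra_sheaf_module[OF C] U] 5(1)])
    show ?case
    proof (rule linear_map_jetX_eq[OF U X act(1)[OF rf] linear_map_smult_map[OF X act(1)[OF 5(1)]] _ 5(2)])
      fix l h \<psi> assume h: "h \<in> scar C U l" "\<psi> \<in> scar E U (j - l)"
      then have "\<psi> \<in> scar E U (i + j - (i + l))" by simp
      from linear_map_smult[OF jet_elt_linear(2)[OF U this]]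
      show "gact (gsec (jetX C E) U) i j (r \<odot>\<^bsub>gcomp (gsec C U) i\<^esub> f) (jet_elt C E U j l h \<psi>) =
        r \<odot>\<^bsub>gcomp (gsec (jetX C E) U) (i + j)\<^esub> gact (gsec (jetX C E) U) i j f (jet_elt C E U j l h \<psi>)"
        using h 5 by (simp add: act(2) rf graded_module_smult_left[OF m] graded_module_closed[OF m])
    qed
  next
    case (6 i j r f x) then show ?case by (intro linear_map_smult[OF act(1)])
  next
    case (7 i j l f g x)
    have fg: "gact (gsec C U) i j f g \<in> scar C U (i + j)" by (rule graded_module_closed[OF m 7(1,2)])
    have lin: "linear_map (gcomp (gsec (jetX C E) U) l) (gcomp (gsec (jetX C E) U) (i + j + l))
        (\<lambda>x. gact (gsec (jetX C E) U) i (j + l) f (gact (gsec (jetX C E) U) j l g x))"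
      using linear_map_comp[OF act(1)[OF 7(2)] act(1)[OF 7(1)]] by (simp add: add.assoc)
    show ?case
    proof (rule linear_map_jetX_eq[OF U X act(1)[OF fg] lin _ 7(3)])
      fix n h \<psi> assume h: "h \<in> scar C U n" "\<psi> \<in> scar E U (l - n)"
      then have "gact (gsec (jetX C E) U) i (j + l) f (gact (gsec (jetX C E) U) j l g (jet_elt C E U l n h \<psi>))
          = jet_elt C E U (i + (j + l)) (i + (j + n)) (gact (gsec C U) i (j + n) f (gact (gsec C U) j n g h)) \<psi>"
        using 7 graded_module_closed[OF m 7(2) h(1)] by (simp add: act(2))
      then show "gact (gsec (jetX C E) U) (i + j) l (gact (gsec C U) i j f g) (jet_elt C E U l n h \<psi>)
          = gact (gsec (jetX C E) U) i (j + l) f (gact (gsec (jetX C E) U) j l g (jet_elt C E U l n h \<psi>))"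
        using h act(2)[OF fg h] graded_module_assoc[OF m 7(1,2) h(1)] by (simp add: add.assoc)
    qed
  next
    case (8 j x)
    have e: "gunit C U \<in> scar C U 0" by (rule algebra_sheaf_unit[OF C U])
    have "gact (gsec (jetX C E) U) 0 j (gunit C U) x = id x"
    proof (rule linear_map_jetX_eq[OF U X _ _ _ 8])
      show "linear_map (gcomp (gsec (jetX C E) U) j) (gcomp (gsec (jetX C E) U) j) (gact (gsec (jetX C E) U) 0 j (gunit
          C U))"
        using act(1)[OF e, of j] by simp
      fix l h \<psi> assume h: "h \<in> scar C U l" "\<psi> \<in> scar E U (j - l)"
      show "gact (gsec (jetX C E) U) 0 j (gunit C U) (jet_elt C E U j l h \<psi>) = id (jet_elt C E U j l h \<psi>)"
        using act(2)[OF e h] graded_module_unit[OF m h(1)] by simp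
    qed (simp add: linear_map_def)
    then show ?case by simp
  qed
next
  case (2 U V j) then show ?case by (rule linear_map_jetX_gres)
next
  case (3 U V i j f x)
  note UV = 3(1-3)
  have f': "gres C U V i f \<in> scar C V i" by (rule module_presheaf_gres_closed[OF algebra_sheaf_module[OF C] UV 3(4)])
  show ?case
  proof (rule linear_map_jetX_eq[OF UV(1) vs_jetX[OF UV(2)]
        linear_map_comp[OF linear_map_jetX_gact(1)[OF UV(1) 3(4)] linear_map_jetX_gres(1)[OF UV]]
        linear_map_comp[OF linear_map_jetX_gres(1)[OF UV] linear_map_jetX_gact(1)[OF UV(2) f']] _ 3(5)])
    fix l h \<psi> assume h: "h \<in> scar C U l" "\<psi> \<in> scar E U (j - l)"
    then show "gres (jetX C E) U V (i + j) (gact (gsec (jetX C E) U) i j f (jet_elt C E U j l h \<psi>))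
        = gact (gsec (jetX C E) V) i j (gres C U V i f) (gres (jetX C E) U V j (jet_elt C E U j l h \<psi>))"
      using 3 f' linear_map_jetX_gres(2)[OF UV, of "gact (gsec C U) i l f h" "i + l" \<psi> "i + j"]
        graded_module_closed[OF module_presheaf_module[OF algebra_sheaf_module[OF C] UV(1)] 3(4) h(1)]
        module_presheaf_gres_closed[OF algebra_sheaf_module[OF C] UV h(1)] module_presheaf_gres_closed[OF E UV h(2)]
      by (simp add: linear_map_jetX_gact(2) linear_map_jetX_gres(2) module_presheaf_gres_gact[OF algebra_sheaf_module[OF C]])
  qed
next
  case (4 U j x)
  have "gres (jetX C E) U U j x = id x"
    by (rule linear_map_jetX_eq[OF 4(1) vs_jetX[OF 4(1)] linear_map_jetX_gres(1)[OF 4(1,1)] _ _ 4(2)])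
      (use 4 in \<open>simp_all add: linear_map_def linear_map_jetX_gres(2) module_presheaf_gres_self[OF
          algebra_sheaf_module[OF C]]
        module_presheaf_gres_self[OF E] module_presheaf_vs[OF algebra_sheaf_module[OF C]] vs_jetX\<close>)
  then show ?case by simp
next
  case (5 U V W j x)
  have WU: "W \<subseteq> U" using 5 by blast
  show ?case
  proof (rule linear_map_jetX_eq[OF 5(1) vs_jetX[OF 5(3)]
        linear_map_comp[OF linear_map_jetX_gres(1)[OF 5(1,2,5)] linear_map_jetX_gres(1)[OF 5(2,3,4)]]
        linear_map_jetX_gres(1)[OF 5(1,3) WU] _ 5(6)])
    fix l h \<psi> assume h: "h \<in> scar C U l" "\<psi> \<in> scar E U (j - l)"
    then show "gres (jetX C E) V W j (gres (jetX C E) U V j (jet_elt C E U j l h \<psi>))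
        = gres (jetX C E) U W j (jet_elt C E U j l h \<psi>)"
      using 5 WU by (simp add: linear_map_jetX_gres(2) module_presheaf_gres_closed[OF algebra_sheaf_module[OF C]]
          module_presheaf_gres_closed[OF E]
        module_presheaf_gres_gres[OF algebra_sheaf_module[OF C]] module_presheaf_gres_gres[OF E])
  qed
qed

end

section \<open>The algebraic jet presheaf\<close>

context
  fixes C :: "('m::topological_space, 'f) galg_presheaf" and E :: "('m, 'f, 's) gpresheaf"
  assumes C: "algebra_sheaf C" and E: "module_presheaf C E"
begin

lemma jet_delta_eq:
  assumes U: "open U" and f: "f \<in> scar C U d" and x: "x \<in> scar (jetX C E) U n"
  shows "jet_delta C E U d n f x = gact (gsec (jetX C E) U) d n f x
    \<oplus>\<^bsub>gcomp (gsec (jetX C E) U) (d + n)\<^esub> (-1) \<odot>\<^bsub>gcomp (gsec (jetX C E) U) (d + n)\<^esub> jet_ract C E U d n f x"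
  unfolding jet_delta_def
  by (rule vs_minus_eq[OF vs_jetX[OF C E U]
      linear_map_closed[OF linear_map_jetX_gact(1)[OF C E U f] x] linear_map_closed[OF linear_map_jet_ract(1)[OF C E U
          f] x]])

lemma linear_map_jet_delta:
  assumes U: "open U" and f: "f \<in> scar C U d"
  shows "linear_map (gcomp (gsec (jetX C E) U) n) (gcomp (gsec (jetX C E) U) (d + n)) (jet_delta C E U d n f)"
  by (rule linear_map_cong[OF vs_jetX[OF C E U] jet_delta_eq[OF U f]], assumption)
    (intro linear_map_add_map linear_map_smult_map vs_jetX[OF C E U] linear_map_jetX_gact(1)[OF C E U f]
      linear_map_jet_ract(1)[OF C E U f])

text \<open>The two actions on \<open>jetX\<close> commute up to sign.\<close>

lemma jet_ract_gact:
  assumes U: "open U" and f: "f \<in> scar C U d" and g: "g \<in> scar C U e" and x: "x \<in> scar (jetX C E) U n"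
  shows "jet_ract C E U d (e + n) f (gact (gsec (jetX C E) U) e n g x)
    = ksign d e \<odot>\<^bsub>gcomp (gsec (jetX C E) U) (d + (e + n))\<^esub> gact (gsec (jetX C E) U) e (d + n) g (jet_ract C E U d n f x)"
proof -
  note X = vs_jetX[OF C E U] and act = linear_map_jetX_gact[OF C E U] and ract = linear_map_jet_ract[OF C E U]
  have deg: "e + (d + n) = d + (e + n)" by simp
  note lin = linear_map_comp[OF ract(1)[OF f, of n] act(1)[OF g], unfolded deg]
  show ?thesis
  proof (rule linear_map_jetX_eq[OF C E U X linear_map_comp[OF act(1)[OF g] ract(1)[OF f]] linear_map_smult_map[OF X
      lin] _ x])
    fix i h \<psi> assume h: "h \<in> scar C U i" and \<psi>: "\<psi> \<in> scar E U (n - i)"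
    have gh: "gact (gsec C U) e i g h \<in> scar C U (e + i)"
      by (rule graded_module_closed[OF module_presheaf_module[OF algebra_sheaf_module[OF C] U] g h])
    have f\<psi>: "gact (gsec E U) d (n - i) f \<psi> \<in> scar E U (d + n - i)"
      using graded_module_closed[OF module_presheaf_module[OF E U] f \<psi>] by (simp add: add_diff_eq)
    have \<psi>': "\<psi> \<in> scar E U (e + n - (e + i))" using \<psi> by simp
    have e1: "jet_elt C E U (d + n) i h (gact (gsec E U) d (n - i) f \<psi>) \<in> scar (jetX C E) U (d + n)"
      by (rule jet_elt_closed[OF C E h f\<psi>])
    have "jet_elt C E U (d + (e + n)) (e + i) (gact (gsec C U) e i g h) (gact (gsec E U) d (n - i) f \<psi>)
        \<in> scar (jetX C E) U (d + (e + n))"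
      by (rule jet_elt_closed[OF C E gh]) (use f\<psi> in \<open>simp add: algebra_simps\<close>)
    then show "jet_ract C E U d (e + n) f (gact (gsec (jetX C E) U) e n g (jet_elt C E U n i h \<psi>))
      = ksign d e \<odot>\<^bsub>gcomp (gsec (jetX C E) U) (d + (e + n))\<^esub>
          gact (gsec (jetX C E) U) e (d + n) g (jet_ract C E U d n f (jet_elt C E U n i h \<psi>))"
      using linear_map_smult[OF act(1)[OF g] e1, of "ksign d i"] X
      by (simp add: act(2)[OF g h \<psi>] ract(2)[OF f gh \<psi>'] ract(2)[OF f h \<psi>] act(2)[OF g h f\<psi>] ksign_add_right deg)
  qed
qed

lemma gact_gact_commute:
  assumes A: "graded_comm_algebra A e'" and P: "graded_module A e' P"
    and f: "f \<in> gcar A d" and g: "g \<in> gcar A e" and x: "x \<in> gcar P n"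
  shows "gact P d (e + n) f (gact P e n g x) = ksign d e \<odot>\<^bsub>gcomp P (d + (e + n))\<^esub> gact P e (d + n) g (gact P d n f x)"
proof -
  note A' = graded_comm_algebraD[OF A]
  have gf: "gact A e d g f \<in> gcar A (d + e)" using graded_module_closed[OF A'(2) g f] by (simp add: add.commute)
  have "gact P d (e + n) f (gact P e n g x) = gact P (d + e) n (gact A d e f g) x"
    by (rule graded_module_assoc[OF P f g x, symmetric])
  also have "\<dots> = ksign d e \<odot>\<^bsub>gcomp P (d + e + n)\<^esub> gact P (d + e) n (gact A e d g f) x"
    using A'(3)[OF f g] graded_module_smult_left[OF P gf x] by simp
  also have "gact P (d + e) n (gact A e d g f) x = gact P e (d + n) g (gact P d n f x)"
    using graded_module_assoc[OF P g f x] by (simp add: add.commute)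
  finally show ?thesis by (simp add: add.assoc)
qed

text \<open>\<open>\<delta>\<^sub>f\<close> is linear, up to sign, for the action \<open>\<triangleright>\<close>.\<close>

lemma jet_delta_gact:
  assumes U: "open U" and f: "f \<in> scar C U d" and g: "g \<in> scar C U e" and x: "x \<in> scar (jetX C E) U n"
  shows "jet_delta C E U d (e + n) f (gact (gsec (jetX C E) U) e n g x)
    = ksign d e \<odot>\<^bsub>gcomp (gsec (jetX C E) U) (d + (e + n))\<^esub> gact (gsec (jetX C E) U) e (d + n) g (jet_delta C E U d n f x)"
proof -
  let ?X = "\<lambda>n. gcomp (gsec (jetX C E) U) n" and ?a = "gact (gsec (jetX C E) U)"
  note X = vs_jetX[OF C E U] and act = linear_map_jetX_gact(1)[OF C E U] and ract = linear_map_jet_ract(1)[OF C E U]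
  have deg: "e + (d + n) = d + (e + n)" by simp
  have fx: "?a d n f x \<in> carrier (?X (d + n))" "jet_ract C E U d n f x \<in> carrier (?X (d + n))"
    using linear_map_closed[OF act[OF f] x] linear_map_closed[OF ract[OF f] x] by simp_all
  have c: "?a e (d + n) g (?a d n f x) \<in> carrier (?X (d + (e + n)))"
    "?a e (d + n) g (jet_ract C E U d n f x) \<in> carrier (?X (d + (e + n)))"
    using linear_map_closed[OF act[OF g] fx(1)] linear_map_closed[OF act[OF g] fx(2)] by (simp_all only: deg)
  have gx: "?a e n g x \<in> carrier (?X (e + n))" by (rule linear_map_closed[OF act[OF g] x])
  have "?a e (d + n) g (jet_delta C E U d n f x)
      = ?a e (d + n) g (?a d n f x) \<oplus>\<^bsub>?X (d + (e + n))\<^esub> (-1) \<odot>\<^bsub>?X (d + (e + n))\<^esub> ?a e (d + n) g (jet_ract C E U d n f x)"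
    using fx linear_map_add[OF act[OF g], of "?a d n f x" "d + n" "(-1) \<odot>\<^bsub>?X (d + n)\<^esub> jet_ract C E U d n f x"]
      linear_map_smult[OF act[OF g] fx(2), of "-1"] X
    by (simp add: jet_delta_eq[OF U f x] deg)
  then show ?thesis
    using c X by (simp add: jet_delta_eq[OF U f gx] jet_ract_gact[OF U f g x] vs_smult_add_right mult.commute
      gact_gact_commute[OF algebra_sheafD(1)[OF C U] module_presheaf_module[OF module_presheaf_jetX[OF C E] U] f g x])
qed

lemma gres_jet_delta:
  assumes UV: "open U" "open V" "V \<subseteq> U" and f: "f \<in> scar C U d" and x: "x \<in> scar (jetX C E) U n"
  shows "gres (jetX C E) U V (d + n) (jet_delta C E U d n f x)
    = jet_delta C E V d n (gres C U V d f) (gres (jetX C E) U V n x)"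
proof -
  let ?X = "\<lambda>U n. gcomp (gsec (jetX C E) U) n"
  note res = linear_map_jetX_gres[OF C E UV]
  have f': "gres C U V d f \<in> scar C V d" by (rule module_presheaf_gres_closed[OF algebra_sheaf_module[OF C] UV f])
  have ract: "gres (jetX C E) U V (d + n) (jet_ract C E U d n f x)
      = jet_ract C E V d n (gres C U V d f) (gres (jetX C E) U V n x)"
  proof (rule linear_map_jetX_eq[OF C E UV(1) vs_jetX[OF C E UV(2)]
        linear_map_comp[OF linear_map_jet_ract(1)[OF C E UV(1) f] res(1)]
        linear_map_comp[OF res(1) linear_map_jet_ract(1)[OF C E UV(2) f']] _ x])
    fix i h \<psi> assume h: "h \<in> scar C U i" and \<psi>: "\<psi> \<in> scar E U (n - i)"
    have f\<psi>: "gact (gsec E U) d (n - i) f \<psi> \<in> scar E U (d + n - i)"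
      using graded_module_closed[OF module_presheaf_module[OF E UV(1)] f \<psi>] by (simp add: add_diff_eq)
    have h': "gres C U V i h \<in> scar C V i" "gres E U V (n - i) \<psi> \<in> scar E V (n - i)"
      using module_presheaf_gres_closed[OF algebra_sheaf_module[OF C] UV h] module_presheaf_gres_closed[OF E UV \<psi>]
          by simp_all
    show "gres (jetX C E) U V (d + n) (jet_ract C E U d n f (jet_elt C E U n i h \<psi>))
        = jet_ract C E V d n (gres C U V d f) (gres (jetX C E) U V n (jet_elt C E U n i h \<psi>))"
      using linear_map_smult[OF res(1) jet_elt_closed[OF C E h f\<psi>], of "ksign d i"] res(2)[OF h f\<psi>]
        module_presheaf_gres_gact[OF E UV f \<psi>]
      by (simp add: linear_map_jet_ract(2)[OF C E UV(1) f h \<psi>] linear_map_jet_ract(2)[OF C E UV(2) f' h'] res(2)[OF h \<psi>]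
          add_diff_eq)
  qed
  have c: "gact (gsec (jetX C E) U) d n f x \<in> carrier (?X U (d + n))" "jet_ract C E U d n f x \<in> carrier (?X U (d + n))"
    using linear_map_closed[OF linear_map_jetX_gact(1)[OF C E UV(1) f] x]
      linear_map_closed[OF linear_map_jet_ract(1)[OF C E UV(1) f] x] by simp_all
  have "gres (jetX C E) U V (d + n) (jet_delta C E U d n f x)
     = gres (jetX C E) U V (d + n) (gact (gsec (jetX C E) U) d n f x) \<oplus>\<^bsub>?X V (d + n)\<^esub> (-1) \<odot>\<^bsub>?X V (d + n)\<^esub>
       gres (jetX C E) U V (d + n) (jet_ract C E U d n f x)"
    using c vs_jetX[OF C E UV(1)] by (simp add: jet_delta_eq[OF UV(1) f x] linear_map_add[OF res(1)] linear_map_smult[OF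
        res(1)])
  also have "\<dots> = jet_delta C E V d n (gres C U V d f) (gres (jetX C E) U V n x)"
    using jet_delta_eq[OF UV(2) f' linear_map_closed[OF res(1) x]] ract
      module_presheaf_gres_gact[OF module_presheaf_jetX[OF C E] UV f x] by simp
  finally show ?thesis .
qed

lemma jet_delta_in_delta_gens:
  "f \<in> scar C U d \<Longrightarrow> x \<in> delta_gens C E U m n \<Longrightarrow> jet_delta C E U d n f x \<in> delta_gens C E U (Suc m) (d + n)"
  by (simp, rule exI[of _ d], rule exI[of _ f], rule exI[of _ x], simp)

lemma delta_gens_subset:
  assumes U: "open U"
  shows "delta_gens C E U m n \<subseteq> scar (jetX C E) U n"
proof (induction m arbitrary: n)
  case 0 show ?case using jet_elt_closed[OF C E] by auto
next
  case (Suc m)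
  show ?case
  proof
    fix y assume "y \<in> delta_gens C E U (Suc m) n"
    then obtain d f x where y: "y = jet_delta C E U d (n - d) f x" "f \<in> scar C U d" "x \<in> delta_gens C E U m (n - d)"
      by auto
    then have "x \<in> scar (jetX C E) U (n - d)" using Suc by blast
    from linear_map_closed[OF linear_map_jet_delta[OF U y(2)] this] show "y \<in> scar (jetX C E) U n"
      using y(1) by simp
  qed
qed

lemma subspace_of_rspan_delta_gens:
  "open U \<Longrightarrow> subspace_of (rspan (gcomp (gsec (jetX C E) U) n) (delta_gens C E U m n)) (gcomp (gsec (jetX C E) U) n)"
  by (rule subspace_of_rspan[OF vs_jetX[OF C E] delta_gens_subset])

lemma jet_delta_rspan_delta_gens:
  assumes U: "open U" and f: "f \<in> scar C U d" and x: "x \<in> rspan (gcomp (gsec (jetX C E) U) n) (delta_gens C E U m n)"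
  shows "jet_delta C E U d n f x \<in> rspan (gcomp (gsec (jetX C E) U) (d + n)) (delta_gens C E U (Suc m) (d + n))"
  by (rule linear_map_rspan[OF vs_jetX[OF C E U] vs_jetX[OF C E U] linear_map_jet_delta[OF U f]
        subspace_of_rspan_delta_gens[OF U] delta_gens_subset[OF U] _ x])
    (intro rspan_superset jet_delta_in_delta_gens f)

text \<open>
  By induction on \<open>m\<close>: \<open>g \<triangleright> \<delta>\<^sub>f x = \<plusminus> \<delta>\<^sub>f (g \<triangleright> x)\<close> reduces the claim to \<open>m - 1\<close>.
\<close>

lemma gact_rspan_delta_gens:
  assumes U: "open U" and g: "g \<in> scar C U e" and x: "x \<in> rspan (gcomp (gsec (jetX C E) U) n) (delta_gens C E U m n)"
  shows "gact (gsec (jetX C E) U) e n g x \<in> rspan (gcomp (gsec (jetX C E) U) (e + n)) (delta_gens C E U m (e + n))"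
  using x
proof (induction m arbitrary: n x)
  case 0
  show ?case
  proof (rule linear_map_rspan[OF vs_jetX[OF C E U] vs_jetX[OF C E U] linear_map_jetX_gact(1)[OF C E U g]
        subspace_of_rspan_delta_gens[OF U] delta_gens_subset[OF U] _ 0])
    fix y assume "y \<in> delta_gens C E U 0 n"
    then obtain i h \<psi> where y: "y = jet_elt C E U n i h \<psi>" "h \<in> scar C U i" "\<psi> \<in> scar E U (n - i)" by auto
    have "gact (gsec C U) e i g h \<in> scar C U (e + i)"
      by (rule graded_module_closed[OF module_presheaf_module[OF algebra_sheaf_module[OF C] U] g y(2)])
    moreover have "\<psi> \<in> scar E U (e + n - (e + i))" using y(3) by simp
    ultimately have "jet_elt C E U (e + n) (e + i) (gact (gsec C U) e i g h) \<psi> \<in> delta_gens C E U 0 (e + n)"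
      unfolding delta_gens.simps by blast
    then show "gact (gsec (jetX C E) U) e n g y \<in> rspan (gcomp (gsec (jetX C E) U) (e + n)) (delta_gens C E U 0 (e + n))"
      unfolding y(1) linear_map_jetX_gact(2)[OF C E U g y(2,3)] by (rule rspan_superset)
  qed
next
  case (Suc m)
  show ?case
  proof (rule linear_map_rspan[OF vs_jetX[OF C E U] vs_jetX[OF C E U] linear_map_jetX_gact(1)[OF C E U g]
        subspace_of_rspan_delta_gens[OF U] delta_gens_subset[OF U] _ Suc.prems])
    fix y assume "y \<in> delta_gens C E U (Suc m) n"
    then obtain d f x where y: "y = jet_delta C E U d (n - d) f x" "f \<in> scar C U d" "x \<in> delta_gens C E U m (n - d)"
      by auto
    have x: "x \<in> scar (jetX C E) U (n - d)" using delta_gens_subset[OF U] y(3) by blast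
    let ?X = "gcomp (gsec (jetX C E) U)"
    have gd: "gact (gsec (jetX C E) U) e n g y \<in> carrier (?X (e + n))"
      using linear_map_closed[OF linear_map_jetX_gact(1)[OF C E U g], of y n]
        linear_map_closed[OF linear_map_jet_delta[OF U y(2)] x] y(1) by simp
    have "gact (gsec (jetX C E) U) e (n - d) g x \<in> rspan (?X (e + (n - d))) (delta_gens C E U m (e + (n - d)))"
      by (rule Suc.IH[OF rspan_superset[OF y(3)]])
    from jet_delta_rspan_delta_gens[OF U y(2) this]
    have "ksign d e \<odot>\<^bsub>?X (e + n)\<^esub> gact (gsec (jetX C E) U) e n g y
        \<in> rspan (?X (e + n)) (delta_gens C E U (Suc m) (e + n))"
      unfolding jet_delta_gact[OF U y(2) g x] y(1)
      by (simp add: add.left_commute[of d e] del: delta_gens.simps)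
    from subspace_of_smult[OF subspace_of_rspan_delta_gens[OF U] this, of "ksign d e"]
    show "gact (gsec (jetX C E) U) e n g y \<in> rspan (?X (e + n)) (delta_gens C E U (Suc m) (e + n))"
      using gd vs_jetX[OF C E U] by (simp del: delta_gens.simps)
  qed
qed

lemma gres_delta_gens:
  assumes UV: "open U" "open V" "V \<subseteq> U"
  shows "x \<in> delta_gens C E U m n \<Longrightarrow> gres (jetX C E) U V n x \<in> delta_gens C E V m n"
proof (induction m arbitrary: n x)
  case 0
  then obtain i h \<psi> where y: "x = jet_elt C E U n i h \<psi>" "h \<in> scar C U i" "\<psi> \<in> scar E U (n - i)" by auto
  then show ?case
    using linear_map_jetX_gres(2)[OF C E UV y(2,3)] module_presheaf_gres_closed[OF algebra_sheaf_module[OF C] UV y(2)]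
      module_presheaf_gres_closed[OF E UV y(3)] by auto
next
  case (Suc m)
  then obtain d f y where y: "x = jet_delta C E U d (n - d) f y" "f \<in> scar C U d" "y \<in> delta_gens C E U m (n - d)"
    by auto
  have "y \<in> scar (jetX C E) U (n - d)" using delta_gens_subset[OF UV(1)] y(3) by blast
  from gres_jet_delta[OF UV y(2) this]
    jet_delta_in_delta_gens[OF module_presheaf_gres_closed[OF algebra_sheaf_module[OF C] UV y(2)] Suc.IH[OF y(3)]]
  show ?case using y(1) by (simp del: delta_gens.simps)
qed

lemma subpresheaf_jetV: "subpresheaf C (jetX C E) (jetV C E k)"
  unfolding subpresheaf_def graded_submodule_def
proof (intro conjI allI ballI impI)
  fix U :: "'m set" and j assume "open U"
  then show "subspace_of (jetV C E k U j) (gcomp (gsec (jetX C E) U) j)"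
    unfolding jetV_def by (rule subspace_of_rspan_delta_gens)
next
  fix U :: "'m set" and i j f x assume "open U" "f \<in> scar C U i" "x \<in> jetV C E k U j"
  then show "gact (gsec (jetX C E) U) i j f x \<in> jetV C E k U (i + j)"
    unfolding jetV_def by (rule gact_rspan_delta_gens)
next
  fix U V :: "'m set" and j x
  assume UV: "open U \<and> open V \<and> V \<subseteq> U" and x: "x \<in> jetV C E k U j"
  then have UV': "open U" "open V" "V \<subseteq> U" by auto
  show "gres (jetX C E) U V j x \<in> jetV C E k V j"
    unfolding jetV_def
    by (rule linear_map_rspan[OF vs_jetX[OF C E UV'(1)] vs_jetX[OF C E UV'(2)] linear_map_jetX_gres(1)[OF C E UV']
        subspace_of_rspan_delta_gens[OF UV'(2)] delta_gens_subset[OF UV'(1)] _ x[unfolded jetV_def]])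
      (rule rspan_superset[OF gres_delta_gens[OF UV']])
qed

lemma module_presheaf_pJet: "module_presheaf C (pJet C E k)"
  unfolding pJet_def by (rule module_presheaf_quot_presheaf[OF C module_presheaf_jetX[OF C E] subpresheaf_jetV])

end

section \<open>Stalks\<close>

lemma mem_germ_iff:
  "(V, t) \<in> germ F a j U s \<longleftrightarrow> open V \<and> a \<in> V \<and> t \<in> scar F V j \<and>
     (\<exists>W. open W \<and> a \<in> W \<and> W \<subseteq> U \<inter> V \<and> gres F U W j s = gres F V W j t)"
  by (simp add: germ_def)

lemma UN_UN_const:
  assumes "x0 \<in> X" "y0 \<in> Y" "\<And>x y. x \<in> X \<Longrightarrow> y \<in> Y \<Longrightarrow> G x y = c"
  shows "(\<Union>x\<in>X. \<Union>y\<in>Y. G x y) = c"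
  using assms by blast

context
  fixes C :: "('m::topological_space, 'f) galg_presheaf" and F :: "('m, 'f, 'v, 'z) gpresheaf_scheme" and a :: 'm
  assumes F: "module_presheaf C F"
begin

lemma germ_self: "open U \<Longrightarrow> a \<in> U \<Longrightarrow> s \<in> scar F U j \<Longrightarrow> (U, s) \<in> germ F a j U s"
  by (auto simp: mem_germ_iff)

lemma germ_eqI:
  assumes UV: "open U" "open V" and st: "s \<in> scar F U j" "t \<in> scar F V j"
    and W: "open W" "a \<in> W" "W \<subseteq> U \<inter> V" "gres F U W j s = gres F V W j t"
  shows "germ F a j U s = germ F a j V t"
proof -
  have *: "germ F a j U s \<subseteq> germ F a j V t"
    if UV: "open U" "open V" and st: "s \<in> scar F U j" "t \<in> scar F V j"
      and W: "open W" "a \<in> W" "W \<subseteq> U \<inter> V" "gres F U W j s = gres F V W j t" for U V s t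
  proof clarify
    fix V' t' assume "(V', t') \<in> germ F a j U s"
    then obtain W' where V': "open V'" "a \<in> V'" "t' \<in> scar F V' j" and W': "open W'" "a \<in> W'" "W' \<subseteq> U \<inter> V'"
      "gres F U W' j s = gres F V' W' j t'" by (auto simp: mem_germ_iff)
    let ?W = "W \<inter> W'"
    have W'': "open ?W" "a \<in> ?W" "?W \<subseteq> V \<inter> V'" using W W' by auto
    have "gres F V ?W j t = gres F W ?W j (gres F V W j t)"
      using module_presheaf_gres_gres[OF F UV(2) W(1) W''(1) _ _ st(2)] W(3) by simp
    also have "\<dots> = gres F U ?W j s"
      unfolding W(4)[symmetric] using module_presheaf_gres_gres[OF F UV(1) W(1) W''(1) _ _ st(1)] W(3) by simp
    also have "\<dots> = gres F W' ?W j (gres F U W' j s)"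
      using module_presheaf_gres_gres[OF F UV(1) W'(1) W''(1) _ _ st(1)] W'(3) by simp
    also have "\<dots> = gres F V' ?W j t'"
      unfolding W'(4) using module_presheaf_gres_gres[OF F V'(1) W'(1) W''(1) _ _ V'(3)] W'(3) by simp
    finally show "(V', t') \<in> germ F a j V t" using V' W'' by (auto simp: mem_germ_iff)
  qed
  show ?thesis using *[OF UV st W] *[OF UV(2,1) st(2,1) W(1,2) _ W(4)[symmetric]] W(3) by blast
qed

lemma germ_eq_iff:
  assumes "open U" "open V" "a \<in> U" "a \<in> V" "s \<in> scar F U j" "t \<in> scar F V j"
  shows "germ F a j U s = germ F a j V t \<longleftrightarrow>
    (\<exists>W. open W \<and> a \<in> W \<and> W \<subseteq> U \<inter> V \<and> gres F U W j s = gres F V W j t)"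
proof
  assume "germ F a j U s = germ F a j V t"
  then have "(V, t) \<in> germ F a j U s" using germ_self assms by simp
  then show "\<exists>W. open W \<and> a \<in> W \<and> W \<subseteq> U \<inter> V \<and> gres F U W j s = gres F V W j t"
    by (simp add: mem_germ_iff)
qed (use germ_eqI assms in blast)

lemma germ_gres:
  assumes "open U" "open V" "a \<in> V" "V \<subseteq> U" "s \<in> scar F U j"
  shows "germ F a j V (gres F U V j s) = germ F a j U s"
  by (rule germ_eqI[where W = V])
    (use assms module_presheaf_gres_closed[OF F] module_presheaf_gres_self[OF F] in auto)

lemma carrier_stalk: "gcar (stalk C F a) j = {germ F a j U s | U s. open U \<and> a \<in> U \<and> s \<in> scar F U j}"
  by (simp add: stalk_def)

lemma germ_in_stalk: "open U \<Longrightarrow> a \<in> U \<Longrightarrow> s \<in> scar F U j \<Longrightarrow> germ F a j U s \<in> gcar (stalk C F a) j"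
  by (auto simp: carrier_stalk)

lemma stalk_rep:
  assumes "X \<in> gcar (stalk C F a) j"
  obtains U s where "open U" "a \<in> U" "s \<in> scar F U j" "X = germ F a j U s"
  using assms by (auto simp: carrier_stalk)

lemma stalk_rep2:
  assumes "X \<in> gcar (stalk C F a) i" "Y \<in> gcar (stalk C F a) j"
  obtains U s t where "open U" "a \<in> U" "s \<in> scar F U i" "t \<in> scar F U j"
    "X = germ F a i U s" "Y = germ F a j U t"
proof -
  obtain U s where s: "open U" "a \<in> U" "s \<in> scar F U i" "X = germ F a i U s" by (rule stalk_rep[OF assms(1)])
  obtain V t where t: "open V" "a \<in> V" "t \<in> scar F V j" "Y = germ F a j V t" by (rule stalk_rep[OF assms(2)])
  have W: "open (U \<inter> V)" "a \<in> U \<inter> V" using s t by auto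
  show ?thesis
    by (rule that[OF W, of "gres F U (U \<inter> V) i s" "gres F V (U \<inter> V) j t"])
      (use s t W germ_gres[OF s(1) W(1)] germ_gres[OF t(1) W(1)] module_presheaf_gres_closed[OF F _ W(1)] in auto)
qed

lemma stalk_add:
  assumes U: "open U" "a \<in> U" and s: "s \<in> scar F U j" and t: "t \<in> scar F U j"
  shows "germ F a j U s \<oplus>\<^bsub>gcomp (stalk C F a) j\<^esub> germ F a j U t = germ F a j U (s \<oplus>\<^bsub>gcomp (gsec F U) j\<^esub> t)"
proof -
  have "(case x of (U', s') \<Rightarrow> case y of (V', t') \<Rightarrow> germ F a j (U' \<inter> V')
      (gres F U' (U' \<inter> V') j s' \<oplus>\<^bsub>gcomp (gsec F (U' \<inter> V')) j\<^esub> gres F V' (U' \<inter> V') j t'))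
      = germ F a j U (s \<oplus>\<^bsub>gcomp (gsec F U) j\<^esub> t)"
    if x: "x \<in> germ F a j U s" and y: "y \<in> germ F a j U t" for x y
  proof -
    obtain U' s' V' t' where xy: "x = (U', s')" "y = (V', t')" by (cases x, cases y)
    from x[unfolded xy mem_germ_iff] obtain W1 where U': "open U'" "a \<in> U'" "s' \<in> scar F U' j"
      and W1: "open W1" "a \<in> W1" "W1 \<subseteq> U \<inter> U'" "gres F U W1 j s = gres F U' W1 j s'" by blast
    from y[unfolded xy mem_germ_iff] obtain W2 where V': "open V'" "a \<in> V'" "t' \<in> scar F V' j"
      and W2: "open W2" "a \<in> W2" "W2 \<subseteq> U \<inter> V'" "gres F U W2 j t = gres F V' W2 j t'" by blast
    let ?W = "W1 \<inter> W2" and ?V = "U' \<inter> V'"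
    have W: "open ?W" "open ?V" "?W \<subseteq> U" "?W \<subseteq> ?V" "?W \<subseteq> U'" "?W \<subseteq> V'" "a \<in> ?W" "?V \<subseteq> U'" "?V \<subseteq> V'"
      using W1 W2 U' V' by auto
    note gg = module_presheaf_gres_gres[OF F] and cl = module_presheaf_gres_closed[OF F]
    have "gres F U ?W j s = gres F W1 ?W j (gres F U W1 j s)" using gg[OF U(1) W1(1) W(1) _ _ s] W1(3) by simp
    also have "\<dots> = gres F U' ?W j s'" unfolding W1(4) using gg[OF U'(1) W1(1) W(1) _ _ U'(3)] W1(3) by simp
    finally have es: "gres F U ?W j s = gres F U' ?W j s'" .
    have "gres F U ?W j t = gres F W2 ?W j (gres F U W2 j t)" using gg[OF U(1) W2(1) W(1) _ _ t] W2(3) by simp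
    also have "\<dots> = gres F V' ?W j t'" unfolding W2(4) using gg[OF V'(1) W2(1) W(1) _ _ V'(3)] W2(3) by simp
    finally have et: "gres F U ?W j t = gres F V' ?W j t'" .
    have c: "gres F U' ?V j s' \<in> scar F ?V j" "gres F V' ?V j t' \<in> scar F ?V j"
      using cl[OF U'(1) W(2) W(8) U'(3)] cl[OF V'(1) W(2) W(9) V'(3)] by simp_all
    have "germ F a j ?V (gres F U' ?V j s' \<oplus>\<^bsub>gcomp (gsec F ?V) j\<^esub> gres F V' ?V j t')
        = germ F a j U (s \<oplus>\<^bsub>gcomp (gsec F U) j\<^esub> t)"
    proof (rule germ_eqI[where W = ?W])
      show "gres F ?V ?W j (gres F U' ?V j s' \<oplus>\<^bsub>gcomp (gsec F ?V) j\<^esub> gres F V' ?V j t')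
          = gres F U ?W j (s \<oplus>\<^bsub>gcomp (gsec F U) j\<^esub> t)"
        unfolding linear_map_add[OF linear_map_gres[OF F W(2,1,4)] c] linear_map_add[OF linear_map_gres[OF F U(1)
            W(1,3)] s t]
          gg[OF U'(1) W(2,1,4,8) U'(3)] gg[OF V'(1) W(2,1,4,9) V'(3)] es et ..
    qed (use U W c s t module_presheaf_vs[OF F] in auto)
    then show ?thesis by (simp add: xy)
  qed
  from UN_UN_const[OF germ_self[OF U s] germ_self[OF U t] this]
  show ?thesis by (simp add: stalk_def case_prod_unfold)
qed

lemma stalk_smult:
  assumes U: "open U" "a \<in> U" and s: "s \<in> scar F U j"
  shows "r \<odot>\<^bsub>gcomp (stalk C F a) j\<^esub> germ F a j U s = germ F a j U (r \<odot>\<^bsub>gcomp (gsec F U) j\<^esub> s)"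
proof -
  have "(case x of (U', s') \<Rightarrow> germ F a j U' (r \<odot>\<^bsub>gcomp (gsec F U') j\<^esub> s')) = germ F a j U (r \<odot>\<^bsub>gcomp (gsec F U) j\<^esub> s)"
    if x: "x \<in> germ F a j U s" for x
  proof -
    obtain U' s' where xy: "x = (U', s')" by (cases x)
    from x[unfolded xy mem_germ_iff] obtain W where U': "open U'" "a \<in> U'" "s' \<in> scar F U' j"
      and W: "open W" "a \<in> W" "W \<subseteq> U \<inter> U'" "gres F U W j s = gres F U' W j s'" by blast
    have WU: "W \<subseteq> U" "W \<subseteq> U'" using W by auto
    have "germ F a j U' (r \<odot>\<^bsub>gcomp (gsec F U') j\<^esub> s') = germ F a j U (r \<odot>\<^bsub>gcomp (gsec F U) j\<^esub> s)"
    proof (rule germ_eqI[where W = W])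
      show "gres F U' W j (r \<odot>\<^bsub>gcomp (gsec F U') j\<^esub> s') = gres F U W j (r \<odot>\<^bsub>gcomp (gsec F U) j\<^esub> s)"
        unfolding linear_map_smult[OF linear_map_gres[OF F U'(1) W(1) WU(2)] U'(3)]
          linear_map_smult[OF linear_map_gres[OF F U(1) W(1) WU(1)] s] W(4) ..
    qed (use U U' W s module_presheaf_vs[OF F] in auto)
    then show ?thesis by (simp add: xy)
  qed
  then have "(\<Union>x\<in>germ F a j U s. case x of (U', s') \<Rightarrow> germ F a j U' (r \<odot>\<^bsub>gcomp (gsec F U') j\<^esub> s'))
      = germ F a j U (r \<odot>\<^bsub>gcomp (gsec F U) j\<^esub> s)"
    using germ_self[OF U s] by blast
  then show ?thesis by (simp add: stalk_def)
qed

lemma stalk_zero: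
  assumes U: "open U" "a \<in> U"
  shows "\<zero>\<^bsub>gcomp (stalk C F a) j\<^esub> = germ F a j U \<zero>\<^bsub>gcomp (gsec F U) j\<^esub>"
proof -
  have "gres F UNIV U j \<zero>\<^bsub>gcomp (gsec F UNIV) j\<^esub> = \<zero>\<^bsub>gcomp (gsec F U) j\<^esub>"
    by (rule linear_map_zero) (use U module_presheaf_vs[OF F] linear_map_gres[OF F] in auto)
  then show ?thesis
    using germ_gres[of UNIV U "\<zero>\<^bsub>gcomp (gsec F UNIV) j\<^esub>" j] U module_presheaf_vs[OF F] by (simp add: stalk_def)
qed

lemma vs_stalk: "vs (gcomp (stalk C F a) j)"
proof -
  note vs = module_presheaf_vs[OF F]
  have rep3: "\<exists>U s t u. open U \<and> a \<in> U \<and> s \<in> scar F U j \<and> t \<in> scar F U j \<and> u \<in> scar F U j \<and>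
      X = germ F a j U s \<and> Y = germ F a j U t \<and> Z = germ F a j U u"
    if X: "X \<in> gcar (stalk C F a) j" and Y: "Y \<in> gcar (stalk C F a) j" and Z: "Z \<in> gcar (stalk C F a) j" for X Y Z
  proof -
    obtain U s t where 1: "open U" "a \<in> U" "s \<in> scar F U j" "t \<in> scar F U j" "X = germ F a j U s" "Y = germ F a j U t"
      by (rule stalk_rep2[OF X Y])
    obtain V u where 2: "open V" "a \<in> V" "u \<in> scar F V j" "Z = germ F a j V u" by (rule stalk_rep[OF Z])
    have W: "open (U \<inter> V)" "a \<in> U \<inter> V" using 1 2 by auto
    show ?thesis
      by (rule exI[of _ "U \<inter> V"], rule exI[of _ "gres F U (U \<inter> V) j s"], rule exI[of _ "gres F U (U \<inter> V) j t"],
          rule exI[of _ "gres F V (U \<inter> V) j u"])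
        (use 1 2 W germ_gres[OF 1(1) W(1)] germ_gres[OF 2(1) W(1)] module_presheaf_gres_closed[OF F _ W(1)] in auto)
  qed
  note [simp] = stalk_add stalk_smult vs germ_in_stalk
  show ?thesis
  proof (rule vsI, goal_cases)
    case 1 show ?case using germ_in_stalk[of UNIV "\<zero>\<^bsub>gcomp (gsec F UNIV) j\<^esub>" j] vs stalk_zero[of UNIV j] by simp
  next
    case (2 X Y) from rep3[OF 2(1,2,2)] show ?case by auto
  next
    case (3 r X) from rep3[OF 3 3 3] show ?case by auto
  next
    case (4 X Y Z) from rep3[OF 4] show ?case by (auto simp: vs_add_assoc)
  next
    case (5 X Y)
    from rep3[OF 5(1,2,2)] obtain U s t where st: "open U" "a \<in> U" "s \<in> scar F U j" "t \<in> scar F U j"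
      "X = germ F a j U s" "Y = germ F a j U t" by blast
    then show ?case using vs_add_comm[OF vs[OF st(1)] st(3,4)] by simp
  next
    case (6 X)
    from rep3[OF 6 6 6] obtain U s where st: "open U" "a \<in> U" "s \<in> scar F U j" "X = germ F a j U s" by blast
    then show ?case using stalk_zero[OF st(1,2), of j] by simp
  next
    case (7 X)
    from rep3[OF 7 7 7] obtain U s where st: "open U" "a \<in> U" "s \<in> scar F U j" "X = germ F a j U s" by blast
    then show ?case using stalk_zero[OF st(1,2), of j] by simp
  next
    case (8 X) from rep3[OF 8 8 8] show ?case by auto
  next
    case (9 r s X) from rep3[OF 9 9 9] show ?case by (auto simp: vs_smult_add_left)
  next
    case (10 r X Y) from rep3[OF 10(1,2,2)] show ?case by (auto simp: vs_smult_add_right)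
  next
    case (11 r s X) from rep3[OF 11 11 11] show ?case by auto
  qed
qed

lemma linear_map_germ:
  assumes "open U" "a \<in> U"
  shows "linear_map (gcomp (gsec F U) j) (gcomp (stalk C F a) j) (germ F a j U)"
  by (rule linear_mapI) (simp_all add: germ_in_stalk stalk_add stalk_smult assms)

text \<open>The map on germs that a compatible family of maps \<open>L U\<close> on sections induces.\<close>

definition stalk_lift :: "('m set \<Rightarrow> 'v \<Rightarrow> 'w) \<Rightarrow> ('m set \<times> 'v) set \<Rightarrow> 'w" where
  "stalk_lift L X = the_elem ((\<lambda>(U, s). L U s) ` X)"

lemma stalk_lift_germ:
  assumes L: "\<And>U V s. open U \<Longrightarrow> open V \<Longrightarrow> a \<in> V \<Longrightarrow> V \<subseteq> U \<Longrightarrow> s \<in> scar F U j \<Longrightarrow> L V (gres F U V j s) = L U s"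
    and U: "open U" "a \<in> U" "s \<in> scar F U j"
  shows "stalk_lift L (germ F a j U s) = L U s"
proof -
  have *: "L V t = L U s" if "(V, t) \<in> germ F a j U s" for V t
  proof -
    from that obtain W where V: "open V" "a \<in> V" "t \<in> scar F V j" and W: "open W" "a \<in> W" "W \<subseteq> U \<inter> V"
      "gres F U W j s = gres F V W j t" by (auto simp: mem_germ_iff)
    have "L U s = L W (gres F U W j s)" using L[OF U(1) W(1,2) _ U(3)] W(3) by simp
    also have "\<dots> = L V t" unfolding W(4) using L[OF V(1) W(1,2) _ V(3)] W(3) by simp
    finally show ?thesis by simp
  qed
  have "(\<lambda>(U, s). L U s) ` germ F a j U s \<subseteq> {L U s}"
  proof (rule image_subsetI)
    fix x assume "x \<in> germ F a j U s"
    then show "(case x of (U, s) \<Rightarrow> L U s) \<in> {L U s}" by (cases x) (simp add: *)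
  qed
  moreover have "L U s \<in> (\<lambda>(U, s). L U s) ` germ F a j U s"
    by (rule image_eqI[OF _ germ_self[OF U]]) simp
  ultimately have "(\<lambda>(U, s). L U s) ` germ F a j U s = {L U s}" by blast
  then show ?thesis by (simp add: stalk_lift_def)
qed

lemma linear_map_stalk_lift:
  assumes comp: "\<And>U V s. open U \<Longrightarrow> open V \<Longrightarrow> a \<in> V \<Longrightarrow> V \<subseteq> U \<Longrightarrow> s \<in> scar F U j \<Longrightarrow> L V (gres F U V j s) = L U s"
    and L: "\<And>U. open U \<Longrightarrow> a \<in> U \<Longrightarrow> linear_map (gcomp (gsec F U) j) W (L U)"
  shows "linear_map (gcomp (stalk C F a) j) W (stalk_lift L)"
proof (rule linear_mapI)
  fix X assume "X \<in> gcar (stalk C F a) j"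
  then obtain U s where s: "open U" "a \<in> U" "s \<in> scar F U j" "X = germ F a j U s" by (rule stalk_rep)
  show "stalk_lift L X \<in> carrier W"
    using linear_map_closed[OF L[OF s(1,2)] s(3)] stalk_lift_germ[of j L, OF comp s(1-3)] s(4) by simp
  fix r
  show "stalk_lift L (r \<odot>\<^bsub>gcomp (stalk C F a) j\<^esub> X) = r \<odot>\<^bsub>W\<^esub> stalk_lift L X"
    using linear_map_smult[OF L[OF s(1,2)] s(3)] stalk_lift_germ[of j L, OF comp s(1-3)]
      stalk_lift_germ[of j L, OF comp s(1,2) vs_smult_closed[OF module_presheaf_vs[OF F s(1)] s(3)], of r] s
    by (simp add: stalk_smult)
next
  fix X Y assume "X \<in> gcar (stalk C F a) j" "Y \<in> gcar (stalk C F a) j"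
  then obtain U s t where s: "open U" "a \<in> U" "s \<in> scar F U j" "t \<in> scar F U j" "X = germ F a j U s" "Y = germ F a j U t"
    by (rule stalk_rep2)
  show "stalk_lift L (X \<oplus>\<^bsub>gcomp (stalk C F a) j\<^esub> Y) = stalk_lift L X \<oplus>\<^bsub>W\<^esub> stalk_lift L Y"
    using linear_map_add[OF L[OF s(1,2)] s(3,4)] stalk_lift_germ[of j L, OF comp s(1-3)]
      stalk_lift_germ[of j L, OF comp s(1,2,4)]
      stalk_lift_germ[of j L, OF comp s(1,2) vs_add_closed[OF module_presheaf_vs[OF F s(1)] s(3,4)]] s
    by (simp add: stalk_add)
qed

end

subsection \<open>The action on germs\<close>

context
  fixes C :: "('m::topological_space, 'f) galg_presheaf" and F :: "('m, 'f, 'v, 'z) gpresheaf_scheme" and a :: 'm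
  assumes C: "algebra_sheaf C" and F: "module_presheaf C F"
begin

lemma stalk_gact:
  assumes U: "open U" "a \<in> U" and f: "f \<in> scar C U i" and s: "s \<in> scar F U j"
  shows "gact (stalk C F a) i j (germ C a i U f) (germ F a j U s) = germ F a (i + j) U (gact (gsec F U) i j f s)"
proof -
  have "(case x of (U', f') \<Rightarrow> case y of (V', s') \<Rightarrow> germ F a (i + j) (U' \<inter> V')
      (gact (gsec F (U' \<inter> V')) i j (gres C U' (U' \<inter> V') i f') (gres F V' (U' \<inter> V') j s')))
      = germ F a (i + j) U (gact (gsec F U) i j f s)"
    if x: "x \<in> germ C a i U f" and y: "y \<in> germ F a j U s" for x y
  proof -
    obtain U' f' V' s' where xy: "x = (U', f')" "y = (V', s')" by (cases x, cases y)
    from x[unfolded xy mem_germ_iff] obtain W1 where U': "open U'" "a \<in> U'" "f' \<in> scar C U' i"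
      and W1: "open W1" "a \<in> W1" "W1 \<subseteq> U \<inter> U'" "gres C U W1 i f = gres C U' W1 i f'" by blast
    from y[unfolded xy mem_germ_iff] obtain W2 where V': "open V'" "a \<in> V'" "s' \<in> scar F V' j"
      and W2: "open W2" "a \<in> W2" "W2 \<subseteq> U \<inter> V'" "gres F U W2 j s = gres F V' W2 j s'" by blast
    let ?W = "W1 \<inter> W2" and ?V = "U' \<inter> V'"
    have W: "open ?W" "open ?V" "?W \<subseteq> U" "?W \<subseteq> ?V" "?W \<subseteq> U'" "?W \<subseteq> V'" "a \<in> ?W" "?V \<subseteq> U'" "?V \<subseteq> V'"
      using W1 W2 U' V' by auto
    note gg = module_presheaf_gres_gres[OF F] and cl = module_presheaf_gres_closed[OF F]
    note ggC = module_presheaf_gres_gres[OF algebra_sheaf_module[OF C]] and clC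
        = module_presheaf_gres_closed[OF algebra_sheaf_module[OF C]]
    have "gres C U ?W i f = gres C W1 ?W i (gres C U W1 i f)" using ggC[OF U(1) W1(1) W(1) _ _ f] W1(3) by simp
    also have "\<dots> = gres C U' ?W i f'" unfolding W1(4) using ggC[OF U'(1) W1(1) W(1) _ _ U'(3)] W1(3) by simp
    finally have es: "gres C U ?W i f = gres C U' ?W i f'" .
    have "gres F U ?W j s = gres F W2 ?W j (gres F U W2 j s)" using gg[OF U(1) W2(1) W(1) _ _ s] W2(3) by simp
    also have "\<dots> = gres F V' ?W j s'" unfolding W2(4) using gg[OF V'(1) W2(1) W(1) _ _ V'(3)] W2(3) by simp
    finally have et: "gres F U ?W j s = gres F V' ?W j s'" .
    have c: "gres C U' ?V i f' \<in> scar C ?V i" "gres F V' ?V j s' \<in> scar F ?V j"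
      using clC[OF U'(1) W(2) W(8) U'(3)] cl[OF V'(1) W(2) W(9) V'(3)] by simp_all
    have "germ F a (i + j) ?V (gact (gsec F ?V) i j (gres C U' ?V i f') (gres F V' ?V j s'))
        = germ F a (i + j) U (gact (gsec F U) i j f s)"
    proof (rule germ_eqI[OF F, where W = ?W])
      show "gres F ?V ?W (i + j) (gact (gsec F ?V) i j (gres C U' ?V i f') (gres F V' ?V j s'))
          = gres F U ?W (i + j) (gact (gsec F U) i j f s)"
        unfolding module_presheaf_gres_gact[OF F W(2,1,4) c] module_presheaf_gres_gact[OF F U(1) W(1,3) f s]
          ggC[OF U'(1) W(2,1,4,8) U'(3)] gg[OF V'(1) W(2,1,4,9) V'(3)] es et ..
      show "gact (gsec F ?V) i j (gres C U' ?V i f') (gres F V' ?V j s') \<in> scar F ?V (i + j)"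
        by (rule graded_module_closed[OF module_presheaf_module[OF F W(2)] c])
      show "gact (gsec F U) i j f s \<in> scar F U (i + j)"
        by (rule graded_module_closed[OF module_presheaf_module[OF F U(1)] f s])
    qed (use U W in auto)
    then show ?thesis by (simp add: xy)
  qed
  from UN_UN_const[OF germ_self[OF algebra_sheaf_module[OF C] U f] germ_self[OF F U s] this]
  show ?thesis by (simp add: stalk_def case_prod_unfold)
qed

end

lemma graded_module_stalk:
  fixes C :: "('m::topological_space, 'f) galg_presheaf" and F :: "('m, 'f, 'v, 'z) gpresheaf_scheme"
  assumes C: "algebra_sheaf C" and F: "module_presheaf C F"
  shows "graded_module (stalk_alg C a) (germ C a 0 UNIV (gunit C UNIV)) (stalk C F a)"
proof -
  note Cm = algebra_sheaf_module[OF C]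
  note mF = module_presheaf_module[OF F] and mC = module_presheaf_module[OF Cm]
  note act = stalk_gact[OF C F] and actC = stalk_gact[OF C Cm]
  have rep3: "\<exists>U f g s. open U \<and> a \<in> U \<and> f \<in> scar C U i \<and> g \<in> scar C U j \<and> s \<in> scar F U l \<and>
      X = germ C a i U f \<and> Y = germ C a j U g \<and> Z = germ F a l U s"
    if X: "X \<in> gcar (stalk_alg C a) i" and Y: "Y \<in> gcar (stalk_alg C a) j" and Z: "Z \<in> gcar (stalk C F a) l" for X Y Z i j l
  proof -
    obtain U f g where 1: "open U" "a \<in> U" "f \<in> scar C U i" "g \<in> scar C U j" "X = germ C a i U f" "Y = germ C a j U g"
      by (rule stalk_rep2[OF Cm X Y])
    obtain V s where 2: "open V" "a \<in> V" "s \<in> scar F V l" "Z = germ F a l V s" by (rule stalk_rep[OF F Z])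
    have W: "open (U \<inter> V)" "a \<in> U \<inter> V" using 1 2 by auto
    show ?thesis
      by (rule exI[of _ "U \<inter> V"], rule exI[of _ "gres C U (U \<inter> V) i f"], rule exI[of _ "gres C U (U \<inter> V) j g"],
          rule exI[of _ "gres F V (U \<inter> V) l s"])
        (use 1 2 W germ_gres[OF Cm 1(1) W(1)] germ_gres[OF F 2(1) W(1)] module_presheaf_gres_closed[OF F _ W(1)]
          module_presheaf_gres_closed[OF Cm _ W(1)] in auto)
  qed
  have rep3': "\<exists>U f s t. open U \<and> a \<in> U \<and> f \<in> scar C U i \<and> s \<in> scar F U l \<and> t \<in> scar F U l \<and>
      X = germ C a i U f \<and> Y = germ F a l U s \<and> Z = germ F a l U t"
    if X: "X \<in> gcar (stalk_alg C a) i" and Y: "Y \<in> gcar (stalk C F a) l" and Z: "Z \<in> gcar (stalk C F a) l" for X Y Z i l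
  proof -
    obtain U s t where 1: "open U" "a \<in> U" "s \<in> scar F U l" "t \<in> scar F U l" "Y = germ F a l U s" "Z = germ F a l U t"
      by (rule stalk_rep2[OF F Y Z])
    obtain V f where 2: "open V" "a \<in> V" "f \<in> scar C V i" "X = germ C a i V f" by (rule stalk_rep[OF Cm X])
    have W: "open (U \<inter> V)" "a \<in> U \<inter> V" using 1 2 by auto
    show ?thesis
      by (rule exI[of _ "U \<inter> V"], rule exI[of _ "gres C V (U \<inter> V) i f"], rule exI[of _ "gres F U (U \<inter> V) l s"],
          rule exI[of _ "gres F U (U \<inter> V) l t"])
        (use 1 2 W germ_gres[OF F 1(1) W(1)] germ_gres[OF Cm 2(1) W(1)] module_presheaf_gres_closed[OF F _ W(1)]
          module_presheaf_gres_closed[OF Cm _ W(1)] in auto)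
  qed
  note [simp] = act actC stalk_add[OF F] stalk_smult[OF F] stalk_add[OF Cm] stalk_smult[OF Cm] germ_in_stalk[OF F]
    germ_in_stalk[OF Cm] graded_module_closed[OF mF] graded_module_closed[OF mC]
    module_presheaf_vs[OF F] module_presheaf_vs[OF Cm]
  show ?thesis
  proof (rule graded_moduleI, goal_cases)
    case (1 j) show ?case by (rule vs_stalk[OF F])
  next
    case (2 i j X Y) from rep3[OF 2(1,1,2)] show ?case by auto
  next
    case (3 i j X Y Z) from rep3[OF 3] show ?case by (auto simp: graded_module_add_left[OF mF])
  next
    case (4 i j X Y Z) from rep3'[OF 4] show ?case by (auto simp: graded_module_add_right[OF mF])
  next
    case (5 i j r X Y) from rep3[OF 5(1,1,2)] show ?case by (auto simp: graded_module_smult_left[OF mF])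
  next
    case (6 i j r X Y) from rep3[OF 6(1,1,2)] show ?case by (auto simp: graded_module_smult_right[OF mF])
  next
    case (7 i j l X Y Z) from rep3[OF 7] show ?case by (auto simp: graded_module_assoc[OF mF] add.assoc)
  next
    case (8 j X)
    obtain U s where s: "open U" "a \<in> U" "s \<in> scar F U j" "X = germ F a j U s" by (rule stalk_rep[OF F 8])
    have e: "gunit C U \<in> scar C U 0" by (rule algebra_sheaf_unit[OF C s(1)])
    have "germ C a 0 UNIV (gunit C UNIV) = germ C a 0 U (gunit C U)"
      using germ_gres[OF Cm open_UNIV s(1,2) subset_UNIV algebra_sheaf_unit[OF C open_UNIV]]
        algebra_sheafD(3)[OF C open_UNIV s(1) subset_UNIV] by simp
    then show ?case using act[OF s(1,2) e s(3)] graded_module_unit[OF mF[OF s(1)] s(3)] s(4) by simp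
  qed
qed

section \<open>Sheafification\<close>

lemma sheafify_simps:
  "\<zero>\<^bsub>gcomp (gsec (sheafify C F) U) j\<^esub> = (\<lambda>x\<in>U. \<zero>\<^bsub>gcomp (stalk C F x) j\<^esub>)"
  "\<sigma> \<oplus>\<^bsub>gcomp (gsec (sheafify C F) U) j\<^esub> \<tau> = (\<lambda>x\<in>U. \<sigma> x \<oplus>\<^bsub>gcomp (stalk C F x) j\<^esub> \<tau> x)"
  "r \<odot>\<^bsub>gcomp (gsec (sheafify C F) U) j\<^esub> \<sigma> = (\<lambda>x\<in>U. r \<odot>\<^bsub>gcomp (stalk C F x) j\<^esub> \<sigma> x)"
  "gact (gsec (sheafify C F) U) i j f \<sigma> = (\<lambda>x\<in>U. gact (stalk C F x) i j (germ C x i U f) (\<sigma> x))"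
  "gres (sheafify C F) U V j \<sigma> = restrict \<sigma> V"
  by (simp_all add: sheafify_def)

lemma mem_sheafify_iff:
  "\<sigma> \<in> scar (sheafify C F) U j \<longleftrightarrow> \<sigma> \<in> extensional U \<and>
     (\<forall>x\<in>U. \<exists>V s. open V \<and> x \<in> V \<and> V \<subseteq> U \<and> s \<in> scar F V j \<and> (\<forall>y\<in>V. \<sigma> y = germ F y j V s))"
  by (simp add: sheafify_def)

lemma sheafifyD:
  "\<sigma> \<in> scar (sheafify C F) U j \<Longrightarrow> x \<in> U \<Longrightarrow>
     \<exists>V s. open V \<and> x \<in> V \<and> V \<subseteq> U \<and> s \<in> scar F V j \<and> (\<forall>y\<in>V. \<sigma> y = germ F y j V s)"
  by (simp add: mem_sheafify_iff)

text \<open>The section of the sheafification given by a section \<open>s\<close> of \<open>F\<close> over \<open>U\<close>: the family of its germs.\<close>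

definition germ_section :: "('m::topological_space, 'f, 'v) gpresheaf \<Rightarrow> 'm set \<Rightarrow> int \<Rightarrow> 'v \<Rightarrow> 'm \<Rightarrow> ('m set \<times> 'v) set" where
  "germ_section F U j s = (\<lambda>x\<in>U. germ F x j U s)"

context
  fixes C :: "('m::topological_space, 'f) galg_presheaf" and F :: "('m, 'f, 'v) gpresheaf"
  assumes C: "algebra_sheaf C" and F: "module_presheaf C F"
begin

lemma sheafify_apply_closed:
  assumes "\<sigma> \<in> scar (sheafify C F) U j" "x \<in> U"
  shows "\<sigma> x \<in> gcar (stalk C F x) j"
proof -
  obtain V s where "open V" "x \<in> V" "s \<in> scar F V j" "\<forall>y\<in>V. \<sigma> y = germ F y j V s"
    using sheafifyD[OF assms] by (elim exE conjE) (rule that)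
  then show ?thesis by (simp add: germ_in_stalk[OF F])
qed

lemma sheafify_rep2:
  assumes U: "open U" and \<sigma>: "\<sigma> \<in> scar (sheafify C F) U i" and \<tau>: "\<tau> \<in> scar (sheafify C F) U j" and x: "x \<in> U"
  obtains V s t where "open V" "x \<in> V" "V \<subseteq> U" "s \<in> scar F V i" "t \<in> scar F V j"
    "\<forall>y\<in>V. \<sigma> y = germ F y i V s" "\<forall>y\<in>V. \<tau> y = germ F y j V t"
proof -
  obtain V1 s where 1: "open V1" "x \<in> V1" "V1 \<subseteq> U" "s \<in> scar F V1 i" "\<forall>y\<in>V1. \<sigma> y = germ F y i V1 s"
    using sheafifyD[OF \<sigma> x] by (elim exE conjE) (rule that)
  obtain V2 t where 2: "open V2" "x \<in> V2" "V2 \<subseteq> U" "t \<in> scar F V2 j" "\<forall>y\<in>V2. \<tau> y = germ F y j V2 t"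
    using sheafifyD[OF \<tau> x] by (elim exE conjE) (rule that)
  let ?V = "V1 \<inter> V2"
  have V: "open ?V" "x \<in> ?V" "?V \<subseteq> U" using 1 2 by auto
  show ?thesis
    by (rule that[OF V, of "gres F V1 ?V i s" "gres F V2 ?V j t"])
      (use 1 2 V germ_gres[OF F 1(1) V(1)] germ_gres[OF F 2(1) V(1)] module_presheaf_gres_closed[OF F _ V(1)] in auto)
qed

lemma sheafifyI:
  assumes "\<And>x. x \<in> U \<Longrightarrow> \<exists>V s. open V \<and> x \<in> V \<and> V \<subseteq> U \<and> s \<in> scar F V j \<and> (\<forall>y\<in>V. g y = germ F y j V s)"
  shows "restrict g U \<in> scar (sheafify C F) U j"
  unfolding mem_sheafify_iff
proof (intro conjI ballI)
  fix x assume "x \<in> U"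
  then obtain V s where V: "open V" "x \<in> V" "V \<subseteq> U" "s \<in> scar F V j" "\<forall>y\<in>V. g y = germ F y j V s"
    using assms[OF \<open>x \<in> U\<close>] by (elim exE conjE) (rule that)
  then have "\<forall>y\<in>V. restrict g U y = germ F y j V s" by auto
  then show "\<exists>V s. open V \<and> x \<in> V \<and> V \<subseteq> U \<and> s \<in> scar F V j \<and> (\<forall>y\<in>V. restrict g U y = germ F y j V s)"
    using V(1-4) by (intro exI conjI)
qed simp

lemma germ_section_closed: "open U \<Longrightarrow> s \<in> scar F U j \<Longrightarrow> germ_section F U j s \<in> scar (sheafify C F) U j"
  unfolding germ_section_def by (rule sheafifyI) blast

lemma vs_sheafify:
  assumes U: "open U"
  shows "vs (gcomp (gsec (sheafify C F) U) j)"
proof -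
  note S = vs_stalk[OF F] and ap = sheafify_apply_closed
  note [simp] = sheafify_simps
  have eqI: "restrict g U = \<sigma>" if "\<sigma> \<in> scar (sheafify C F) U j" "\<And>x. x \<in> U \<Longrightarrow> g x = \<sigma> x" for g \<sigma>
    using that by (auto simp: mem_sheafify_iff fun_eq_iff extensional_def restrict_def)
  show ?thesis
  proof (rule vsI, goal_cases)
    case 1
    have "germ_section F U j \<zero>\<^bsub>gcomp (gsec F U) j\<^esub> \<in> scar (sheafify C F) U j"
      by (rule germ_section_closed[OF U vs_zero_closed[OF module_presheaf_vs[OF F U]]])
    moreover have "germ_section F U j \<zero>\<^bsub>gcomp (gsec F U) j\<^esub> = \<zero>\<^bsub>gcomp (gsec (sheafify C F) U) j\<^esub>"
      unfolding germ_section_def sheafify_simps by (rule restrict_ext) (simp add: stalk_zero[OF F U])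
    ultimately show ?case by simp
  next
    case (2 \<sigma> \<tau>)
    show ?case unfolding sheafify_simps
    proof (rule sheafifyI)
      fix x assume "x \<in> U"
      then obtain V s t where V: "open V" "x \<in> V" "V \<subseteq> U" and st: "s \<in> scar F V j" "t \<in> scar F V j"
        and eq: "\<forall>y\<in>V. \<sigma> y = germ F y j V s" "\<forall>y\<in>V. \<tau> y = germ F y j V t"
        by (rule sheafify_rep2[OF U 2])
      then show "\<exists>V s. open V \<and> x \<in> V \<and> V \<subseteq> U \<and> s \<in> scar F V j \<and> (\<forall>y\<in>V. \<sigma> y \<oplus>\<^bsub>gcomp (stalk C F y) j\<^esub> \<tau> y = germ F y j V s)"
        by (intro exI[of _ V] exI[of _ "s \<oplus>\<^bsub>gcomp (gsec F V) j\<^esub> t"])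
          (simp add: stalk_add[OF F] module_presheaf_vs[OF F])
    qed
  next
    case (3 r \<sigma>)
    show ?case unfolding sheafify_simps
    proof (rule sheafifyI)
      fix x assume "x \<in> U"
      then obtain V s t where V: "open V" "x \<in> V" "V \<subseteq> U" and st: "s \<in> scar F V j" "t \<in> scar F V j"
        and eq: "\<forall>y\<in>V. \<sigma> y = germ F y j V s" "\<forall>y\<in>V. \<sigma> y = germ F y j V t"
        by (rule sheafify_rep2[OF U 3 3])
      then show "\<exists>V s. open V \<and> x \<in> V \<and> V \<subseteq> U \<and> s \<in> scar F V j \<and> (\<forall>y\<in>V. r \<odot>\<^bsub>gcomp (stalk C F y) j\<^esub> \<sigma> y = germ F y j V s)"
        by (intro exI[of _ V] exI[of _ "r \<odot>\<^bsub>gcomp (gsec F V) j\<^esub> s"])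
          (simp add: stalk_smult[OF F] module_presheaf_vs[OF F])
    qed
  next
    case (4 \<sigma> \<tau> \<rho>) then show ?case by (auto simp: fun_eq_iff vs_add_assoc[OF S ap ap ap])
  next
    case (5 \<sigma> \<tau>)
    show ?case unfolding sheafify_simps by (rule restrict_ext) (rule vs_add_comm[OF S ap[OF 5(1)] ap[OF 5(2)]])
  next
    case (6 \<sigma>) then show ?case unfolding sheafify_simps
      by (intro eqI) (simp_all add: vs_l_zero[OF S ap[OF 6]])
  next
    case (7 \<sigma>) then show ?case unfolding sheafify_simps
      by (intro restrict_ext) (simp add: vs_smult_zero_left[OF S ap])
  next
    case (8 \<sigma>) then show ?case unfolding sheafify_simps
      by (intro eqI) (simp_all add: vs_smult_one[OF S ap[OF 8]])
  next
    case (9 r s \<sigma>) then show ?case unfolding sheafify_simps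
      by (intro restrict_ext) (simp add: vs_smult_add_left[OF S ap])
  next
    case (10 r \<sigma> \<tau>) then show ?case unfolding sheafify_simps
      by (intro restrict_ext) (simp add: vs_smult_add_right[OF S ap ap])
  next
    case (11 r s \<sigma>) then show ?case unfolding sheafify_simps
      by (intro restrict_ext) (simp add: vs_smult_smult[OF S ap])
  qed
qed

lemma module_presheaf_sheafify: "module_presheaf C (sheafify C F)"
proof -
  note S = vs_stalk[OF F] and ap = sheafify_apply_closed and G = graded_module_stalk[OF C F]
  have eqI: "restrict g U = \<sigma>" if "\<sigma> \<in> scar (sheafify C F) U j" "\<And>x. x \<in> U \<Longrightarrow> g x = \<sigma> x" for g \<sigma> U j
    using that by (auto simp: mem_sheafify_iff fun_eq_iff extensional_def restrict_def)
  have gC: "germ C x i U f \<in> gcar (stalk_alg C x) i" if "open U" "x \<in> U" "f \<in> scar C U i" for U x i f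
    by (rule germ_in_stalk[OF algebra_sheaf_module[OF C] that])
  have unit: "germ C x 0 U (gunit C U) = germ C x 0 UNIV (gunit C UNIV)" if "open U" "x \<in> U" for U x
    using germ_gres[OF algebra_sheaf_module[OF C] open_UNIV that subset_UNIV algebra_sheaf_unit[OF C open_UNIV]]
      algebra_sheafD(3)[OF C open_UNIV that(1) subset_UNIV] by simp
  show ?thesis
  proof (rule module_presheafI, goal_cases)
    case (1 U)
    note U = 1
    show ?case
    proof (rule graded_moduleI, goal_cases)
      case (1 j) show ?case by (rule vs_sheafify[OF U])
    next
      case (2 i j f \<sigma>)
      show ?case unfolding sheafify_simps
      proof (rule sheafifyI)
        fix x assume x: "x \<in> U"
        obtain V s where V: "open V" "x \<in> V" "V \<subseteq> U" and st: "s \<in> scar F V j"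
          and eq: "\<forall>y\<in>V. \<sigma> y = germ F y j V s"
          using sheafifyD[OF 2(2) x] by (elim exE conjE) (rule that)
        have f': "gres C U V i f \<in> scar C V i" by (rule module_presheaf_gres_closed[OF algebra_sheaf_module[OF C] U
            V(1,3) 2(1)])
        have "gact (stalk C F y) i j (germ C y i U f) (\<sigma> y) = germ F y (i + j) V (gact (gsec F V) i j (gres C U V i f) s)"
          if y: "y \<in> V" for y
          using stalk_gact[OF C F V(1) y f' st] germ_gres[OF algebra_sheaf_module[OF C] U V(1) y V(3) 2(1)] eq y by simp
        then show "\<exists>V s. open V \<and> x \<in> V \<and> V \<subseteq> U \<and> s \<in> scar F V (i + j) \<and>
            (\<forall>y\<in>V. gact (stalk C F y) i j (germ C y i U f) (\<sigma> y) = germ F y (i + j) V s)"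
          using V graded_module_closed[OF module_presheaf_module[OF F V(1)] f' st] by blast
      qed
    next
      case (3 i j f g \<sigma>) then show ?case unfolding sheafify_simps
        by (intro restrict_ext)
          (simp add: stalk_add[OF algebra_sheaf_module[OF C], symmetric] U graded_module_add_left[OF G gC[OF U] gC[OF U] ap])
    next
      case (4 i j f \<sigma> \<tau>) then show ?case unfolding sheafify_simps
        by (intro restrict_ext) (simp add: graded_module_add_right[OF G gC[OF U] ap ap])
    next
      case (5 i j r f \<sigma>) then show ?case unfolding sheafify_simps
        by (intro restrict_ext)
          (simp add: stalk_smult[OF algebra_sheaf_module[OF C], symmetric] U graded_module_smult_left[OF G gC[OF U] ap])
    next
      case (6 i j r f \<sigma>) then show ?case unfolding sheafify_simps
        by (intro restrict_ext) (simp add: graded_module_smult_right[OF G gC[OF U] ap])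
    next
      case (7 i j l f g \<sigma>) then show ?case unfolding sheafify_simps
        by (intro restrict_ext)
          (simp add: stalk_gact[OF C algebra_sheaf_module[OF C] U, symmetric] graded_module_assoc[OF G gC[OF U] gC[OF U] ap])
    next
      case (8 j \<sigma>) then show ?case unfolding sheafify_simps
        by (intro eqI[OF 8]) (simp add: unit[OF U] graded_module_unit[OF G ap])
    qed
  next
    case (2 U V j)
    show ?case
    proof (rule linear_mapI, goal_cases)
      case (1 \<sigma>)
      show ?case unfolding sheafify_simps
      proof (rule sheafifyI)
        fix x assume x: "x \<in> V"
        then have xU: "x \<in> U" using \<open>V \<subseteq> U\<close> by blast
        obtain V' s where V': "open V'" "x \<in> V'" "V' \<subseteq> U" "s \<in> scar F V' j"
          and eq: "\<forall>y\<in>V'. \<sigma> y = germ F y j V' s" using sheafifyD[OF 1 xU] by (elim exE conjE) (rule that)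
        let ?W = "V' \<inter> V"
        have W: "open ?W" using V' \<open>open V\<close> by auto
        have "\<forall>y\<in>?W. \<sigma> y = germ F y j ?W (gres F V' ?W j s)"
          using eq germ_gres[OF F V'(1) W _ _ V'(4)] by simp
        then show "\<exists>V' s. open V' \<and> x \<in> V' \<and> V' \<subseteq> V \<and> s \<in> scar F V' j \<and> (\<forall>y\<in>V'. \<sigma> y = germ F y j V' s)"
          using W V' x module_presheaf_gres_closed[OF F V'(1) W _ V'(4)] by (intro exI[of _ ?W]) auto
      qed
    qed (use \<open>V \<subseteq> U\<close> in \<open>auto simp: sheafify_simps fun_eq_iff\<close>)
  next
    case (3 U V i j f \<sigma>) then show ?case unfolding sheafify_simps
      by (auto simp: fun_eq_iff germ_gres[OF algebra_sheaf_module[OF C]])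
  next
    case (4 U j \<sigma>) then show ?case by (auto simp: sheafify_simps mem_sheafify_iff extensional_restrict)
  next
    case (5 U V W j \<sigma>) then show ?case by (auto simp: sheafify_simps fun_eq_iff)
  qed
qed

lemma linear_map_germ_section:
  assumes "open U"
  shows "linear_map (gcomp (gsec F U) j) (gcomp (gsec (sheafify C F) U) j) (germ_section F U j)"
  by (rule linear_mapI)
    (simp add: germ_section_closed assms,
     auto simp: germ_section_def sheafify_simps stalk_add[OF F] stalk_smult[OF F] assms fun_eq_iff)

lemma restrict_germ_section:
  assumes "open U" "open V" "V \<subseteq> U" "s \<in> scar F U j"
  shows "restrict (germ_section F U j s) V = germ_section F V j (gres F U V j s)"
  using assms by (auto simp: germ_section_def fun_eq_iff germ_gres[OF F])

lemma gact_germ_section: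
  assumes "open U" "f \<in> scar C U i" "s \<in> scar F U j"
  shows "gact (gsec (sheafify C F) U) i j f (germ_section F U j s) = germ_section F U (i + j) (gact (gsec F U) i j f s)"
  using assms by (auto simp: germ_section_def sheafify_simps fun_eq_iff stalk_gact[OF C F])

text \<open>The germs of the sheafification are the germs of sections of the presheaf.\<close>

lemma stalk_sheafify_rep:
  assumes "Y \<in> gcar (stalk C (sheafify C F) a) j"
  obtains V s where "open V" "a \<in> V" "s \<in> scar F V j" "Y = germ (sheafify C F) a j V (germ_section F V j s)"
proof -
  note Sm = module_presheaf_sheafify
  obtain U \<sigma> where U: "open U" "a \<in> U" "\<sigma> \<in> scar (sheafify C F) U j" "Y = germ (sheafify C F) a j U \<sigma>"
    by (rule stalk_rep[OF Sm assms])
  obtain V s where V: "open V" "a \<in> V" "V \<subseteq> U" "s \<in> scar F V j" "\<forall>y\<in>V. \<sigma> y = germ F y j V s"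
    using sheafifyD[OF U(3,2)] by (elim exE conjE) (rule that)
  have "gres (sheafify C F) U V j \<sigma> = germ_section F V j s"
    using V(3,5) by (auto simp: sheafify_simps germ_section_def fun_eq_iff)
  then have "Y = germ (sheafify C F) a j V (germ_section F V j s)"
    using germ_gres[OF Sm U(1) V(1,2,3) U(3)] U(4) by simp
  then show ?thesis using that V by blast
qed

end

section \<open>Fibers\<close>

lemma subspace_of_image:
  assumes "vs M" "vs W" "linear_map M W L"
  shows "subspace_of (L ` carrier M) W"
proof (rule subspace_ofI[OF assms(2)])
  show "\<zero>\<^bsub>W\<^esub> \<in> L ` carrier M" using linear_map_zero[OF assms] assms(1) by (metis imageI vs_zero_closed)
qed (use assms in \<open>auto simp: linear_map_add[symmetric] linear_map_smult[symmetric]\<close>)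

context
  fixes C :: "('m::{second_countable_topology,t2_space}, 'f) galg_presheaf" and a :: 'm
  assumes C: "graded_manifold C"
begin

lemma germ_val_germ:
  assumes "open U" "a \<in> U" "f \<in> scar C U i"
  shows "germ_val C a i (germ C a i U f) = gval C a U i f"
proof -
  have *: "gval C a V i g = gval C a U i f" if "(V, g) \<in> germ C a i U f" for V g
  proof -
    from that obtain W where V: "open V" "a \<in> V" "g \<in> scar C V i" and W: "open W" "a \<in> W" "W \<subseteq> U \<inter> V"
      "gres C U W i f = gres C V W i g" unfolding mem_germ_iff by blast
    show ?thesis
      using gval_gres[OF C assms(1) W(1) _ W(2) assms(3)] gval_gres[OF C V(1) W(1) _ W(2) V(3)] W(3,4) by simp
  qed
  show ?thesis
    unfolding germ_val_def
  proof (rule the_equality)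
    show "\<forall>(V, g)\<in>germ C a i U f. gval C a V i g = gval C a U i f"
    proof (rule ballI)
      fix x assume "x \<in> germ C a i U f"
      then show "case x of (V, g) \<Rightarrow> gval C a V i g = gval C a U i f" by (cases x) (simp add: *)
    qed
    fix r assume "\<forall>(V, g)\<in>germ C a i U f. gval C a V i g = r"
    from bspec[OF this germ_self[OF graded_manifold_module[OF C] assms]] show "r = gval C a U i f" by simp
  qed
qed

lemma germ_val_nonzero_degree:
  "X \<in> gcar (stalk_alg C a) i \<Longrightarrow> i \<noteq> 0 \<Longrightarrow> germ_val C a i X = 0"
  by (erule stalk_rep[OF graded_manifold_module[OF C]]) (simp add: germ_val_germ gval_nonzero_degree[OF C])

end

lemma real_at_simps:
  "gcomp (real_at C a) j = real_graded j" "gact (real_at C a) i j X r = germ_val C a i X * r"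
  by (simp_all add: real_at_def)

lemma real_graded_simps [simp]:
  "\<zero>\<^bsub>real_graded j\<^esub> = 0" "x \<oplus>\<^bsub>real_graded j\<^esub> y = x + y" "r \<odot>\<^bsub>real_graded j\<^esub> x = r * x"
  by (simp_all add: real_graded_def)

lemma vs_real_graded: "vs (real_graded j)"
  by (rule vsI) (auto simp: carrier_real_graded algebra_simps split: if_splits)

context
  fixes C :: "('m::{second_countable_topology,t2_space}, 'f) galg_presheaf" and G :: "('m, 'f, 'v) gpresheaf" and a :: 'm
  assumes C: "graded_manifold C" and G: "module_presheaf C G"
begin

lemma tensor_ok_fiber: "tensor_ok (gcomp (stalk_alg C a)) (real_at C a) (stalk C G a)"
  unfolding tensor_ok_def graded_vs_def
proof (intro conjI allI ballI)
  fix i j X and p assume "X \<in> gcar (stalk_alg C a) i" "p \<in> gcar (real_at C a) j"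
  then show "gact (real_at C a) i j X p \<in> gcar (real_at C a) (i + j)"
    using germ_val_nonzero_degree[OF C, of X a i] by (auto simp: real_at_simps carrier_real_graded split: if_splits)
next
  fix i j X and q assume "X \<in> gcar (stalk_alg C a) i" "q \<in> gcar (stalk C G a) j"
  then show "gact (stalk C G a) i j X q \<in> gcar (stalk C G a) (i + j)"
    by (rule graded_module_closed[OF graded_module_stalk[OF graded_manifold_sheaf[OF C] G]])
qed (simp_all add: real_at_simps vs_real_graded vs_stalk[OF G])

text \<open>The element \<open>1 \<otimes> Y\<close> of the fiber.\<close>

definition fiber_elt :: "int \<Rightarrow> ('m set \<times> 'v) set \<Rightarrow> (real, ('m set \<times> 'v) set) ftens set" where
  "fiber_elt n Y = tensor_elt (gcomp (stalk_alg C a)) (real_at C a) (stalk C G a) n 0 1 Y"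

lemma gcomp_fiber: "gcomp (fiber C G a) n = tensor_vs (gcomp (stalk_alg C a)) (real_at C a) (stalk C G a) n"
  by (simp add: fiber_def tensor_left_def)

lemma vs_fiber: "vs (gcomp (fiber C G a) n)"
  unfolding gcomp_fiber by (rule vs_tensor_vs[OF tensor_ok_fiber])

lemma linear_map_fiber_elt: "linear_map (gcomp (stalk C G a) n) (gcomp (fiber C G a) n) (fiber_elt n)"
  using tensor_bilinearD(1)[OF tensor_bilinear_tensor_elt[OF tensor_ok_fiber, of n], of 1 0]
  by (simp add: fiber_elt_def[abs_def] gcomp_fiber real_at_simps carrier_real_graded)

text \<open>
  As \<open>\<real>\<close> sits in degree \<open>0\<close>, only the generators \<open>r \<otimes> Y\<close> with \<open>r\<close> of degree \<open>0\<close> contribute.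
\<close>

lemma tensor_elt_fiber:
  assumes "p \<in> gcar (real_at C a) i" "Y \<in> gcar (stalk C G a) (n - i)"
  shows "tensor_elt (gcomp (stalk_alg C a)) (real_at C a) (stalk C G a) n i p Y
    = (if i = 0 then p \<odot>\<^bsub>gcomp (fiber C G a) n\<^esub> fiber_elt n Y else \<zero>\<^bsub>gcomp (fiber C G a) n\<^esub>)"
proof -
  note B = tensor_bilinearD(2)[OF tensor_bilinear_tensor_elt[OF tensor_ok_fiber, of n] assms(2)]
  show ?thesis
  proof (cases "i = 0")
    case True
    then show ?thesis
      using linear_map_smult[OF B, of 1 p] by (simp add: fiber_elt_def gcomp_fiber real_at_simps carrier_real_graded)
  next
    case False
    then have "p = 0" using assms(1) by (simp add: real_at_simps carrier_real_graded)
    then show ?thesis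
      using False linear_map_zero[OF _ _ B] vs_tensor_vs[OF tensor_ok_fiber] vs_real_graded
      by (simp add: gcomp_fiber real_at_simps)
  qed
qed

lemma fiber_rep:
  assumes "x \<in> gcar (fiber C G a) n"
  obtains Y where "Y \<in> gcar (stalk C G a) n" "x = fiber_elt n Y"
proof -
  let ?N = "fiber_elt n ` gcar (stalk C G a) n"
  have N: "subspace_of ?N (gcomp (fiber C G a) n)"
    by (rule subspace_of_image[OF vs_stalk[OF G] vs_fiber linear_map_fiber_elt])
  have "x \<in> ?N"
  proof (rule linear_map_tensor_into[OF tensor_ok_fiber, where n = n and L = "\<lambda>x. x" and W = "gcomp (fiber C G a) n"])
    fix i p q assume "p \<in> gcar (real_at C a) i" "q \<in> gcar (stalk C G a) (n - i)"
    then show "tensor_elt (gcomp (stalk_alg C a)) (real_at C a) (stalk C G a) n i p q \<in> ?N"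
      using N by (auto simp: tensor_elt_fiber)
  qed (use N assms vs_fiber in \<open>simp_all add: gcomp_fiber linear_map_def\<close>)
  then show ?thesis using that by blast
qed

text \<open>In the fiber, \<open>1 \<otimes> f Y = f(a) \<otimes> Y\<close>.\<close>

lemma fiber_elt_gact:
  assumes X: "X \<in> gcar (stalk_alg C a) d" and Y: "Y \<in> gcar (stalk C G a) n"
  shows "fiber_elt (d + n) (gact (stalk C G a) d n X Y)
    = (if d = 0 then germ_val C a 0 X \<odot>\<^bsub>gcomp (fiber C G a) n\<^esub> fiber_elt n Y else \<zero>\<^bsub>gcomp (fiber C G a) (d + n)\<^esub>)"
proof -
  have one: "1 \<in> gcar (real_at C a) 0" by (simp add: real_at_simps carrier_real_graded)
  have v: "germ_val C a d X \<in> gcar (real_at C a) d"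
    using germ_val_nonzero_degree[OF C X] by (simp add: real_at_simps carrier_real_graded)
  have "tensor_elt (gcomp (stalk_alg C a)) (real_at C a) (stalk C G a) (d + n) d (germ_val C a d X) Y
      = fiber_elt (d + n) (gact (stalk C G a) d n X Y)"
    using tensor_bilinearD(3)[OF tensor_bilinear_tensor_elt[OF tensor_ok_fiber, of "d + n"] X one, of Y] Y
    by (simp add: real_at_simps fiber_elt_def)
  then show ?thesis using tensor_elt_fiber[OF v, of Y "d + n"] Y by auto
qed

text \<open>The action of a germ on the fiber is multiplication by its value.\<close>

lemma gact_fiber:
  assumes X: "X \<in> gcar (stalk_alg C a) d" and x: "x \<in> gcar (fiber C G a) n"
  shows "gact (fiber C G a) d n X x
    = (if d = 0 then germ_val C a 0 X \<odot>\<^bsub>gcomp (fiber C G a) n\<^esub> x else \<zero>\<^bsub>gcomp (fiber C G a) (d + n)\<^esub>)"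
proof -
  let ?A = "gcomp (stalk_alg C a)" and ?P = "real_at C a" and ?Q = "stalk C G a"
  obtain Y where Y: "Y \<in> gcar ?Q n" "x = fiber_elt n Y" by (rule fiber_rep[OF x])
  let ?b = "\<lambda>i p q. tensor_elt ?A ?P ?Q (d + n) (d + i) (germ_val C a d X * p) q"
  have pc: "germ_val C a d X * p \<in> gcar ?P (d + i)" if "p \<in> gcar ?P i" for i p
    using tensor_okD(3)[OF tensor_ok_fiber X that] by (simp add: real_at_simps)
  have qc: "q \<in> gcar ?Q (d + n - (d + i))" if "q \<in> gcar ?Q (n - i)" for q i using that by simp
  note TB = tensor_bilinear_tensor_elt[OF tensor_ok_fiber, of "d + n"]
  have b: "tensor_bilinear ?A ?P ?Q n (tensor_vs ?A ?P ?Q (d + n)) ?b"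
    unfolding tensor_bilinear_def
  proof (intro conjI allI ballI)
    fix i p assume "p \<in> gcar ?P i"
    from tensor_bilinearD(1)[OF TB pc[OF this]]
    show "linear_map (gcomp ?Q (n - i)) (tensor_vs ?A ?P ?Q (d + n)) (?b i p)" by simp
  next
    fix i q assume q: "q \<in> gcar ?Q (n - i)"
    have "linear_map (gcomp ?P i) (gcomp ?P (d + i)) (\<lambda>p. germ_val C a d X * p)"
      by (rule linear_mapI) (use pc in \<open>simp_all add: real_at_simps distrib_left mult.left_commute\<close>)
    from linear_map_comp[OF this tensor_bilinearD(2)[OF TB qc[OF q]]]
    show "linear_map (gcomp ?P i) (tensor_vs ?A ?P ?Q (d + n)) (\<lambda>p. ?b i p q)" .
  next
    fix i e Z p q assume Z: "Z \<in> carrier (?A e)" and p: "p \<in> gcar ?P i" and q: "q \<in> gcar ?Q (n - i - e)"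
    \<comment> \<open>the signs of the two sides differ only if \<open>e\<close> and \<open>d\<close> are odd, and then both sides vanish\<close>
    have sign: "germ_val C a d X * (ksign i e * (germ_val C a e Z * p))
        = ksign (d + i) e * (germ_val C a e Z * (germ_val C a d X * p))"
      using germ_val_nonzero_degree[OF C X] by (cases "d = 0") simp_all
    have "q \<in> gcar ?Q (d + n - (d + i) - e)" using q by simp
    from tensor_bilinearD(3)[OF TB Z pc[OF p] this]
    have "tensor_elt ?A ?P ?Q (d + n) (d + (i + e)) (ksign (d + i) e * (germ_val C a e Z * (germ_val C a d X * p))) q
        = ?b i p (gact ?Q e (n - i - e) Z q)" by (simp add: real_at_simps add.assoc)
    then show "?b (i + e) (ksign i e \<odot>\<^bsub>gcomp ?P (i + e)\<^esub> gact ?P e i Z p) q = ?b i p (gact ?Q e (n - i - e) Z q)"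
      unfolding sign[symmetric] real_at_simps real_graded_simps .
  qed
  let ?T = "tensor_vs ?A ?P ?Q (d + n)" and ?h = "\<lambda>(i, p, q). (d + i, gact ?P d i X p, q)"
  note TV = vs_tensor_vs[OF tensor_ok_fiber, of "d + n"]
  have b1: "tensor_bilinear ?A ?P ?Q n ?T (\<lambda>i p q. 1 \<odot>\<^bsub>?T\<^esub> ?b i p q)"
    unfolding tensor_bilinear_def
    by (intro conjI allI ballI linear_map_smult_map[OF TV] tensor_bilinearD(1,2)[OF b] arg_cong[OF
        tensor_bilinearD(3)[OF b]])
  have one: "1 \<in> gcar ?P 0" by (simp add: real_at_simps carrier_real_graded)
  have "gact (fiber C G a) d n X x = tensor_lift ?A ?P ?Q (d + n) (\<lambda>x. 1) ?h (tensor_elt ?A ?P ?Q n 0 1 Y)"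
    by (simp add: fiber_def tensor_left_def Y(2) fiber_elt_def)
  also have "\<dots> = 1 \<odot>\<^bsub>?T\<^esub> (case ?h (0, 1, Y) of (i, p, q) \<Rightarrow> tensor_elt ?A ?P ?Q (d + n) i p q)"
  proof (rule linear_map_tensor_lift(2)[OF tensor_ok_fiber tensor_ok_fiber _ _ one])
    show "?h (i, p, q) \<in> tensor_gens ?P ?Q (d + n)" if "p \<in> gcar ?P i" "q \<in> gcar ?Q (n - i)" for i p q
      using pc[OF that(1)] qc[OF that(2)] by (simp add: tensor_gens_def real_at_simps)
    show "tensor_bilinear ?A ?P ?Q n ?T (\<lambda>i p q. 1 \<odot>\<^bsub>?T\<^esub>
        (case ?h (i, p, q) of (i, p, q) \<Rightarrow> tensor_elt ?A ?P ?Q (d + n) i p q))"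
      using b1 by (simp add: real_at_simps)
  qed (use Y in simp)
  also have "\<dots> = ?b 0 1 Y"
    using tensor_elt_closed[OF pc[OF one] qc[of Y 0], of ?A] Y(1) TV by (simp add: real_at_simps)
  also have "\<dots> = fiber_elt (d + n) (gact ?Q d n X Y)"
    using tensor_bilinearD(3)[OF TB X, of 1 0 Y] Y(1) by (simp add: real_at_simps fiber_elt_def carrier_real_graded)
  finally show ?thesis unfolding fiber_elt_gact[OF X Y(1)] Y(2) .
qed

text \<open>
  A linear map on the stalk descends to the fiber if it turns the action of germs into multiplication by
  their values.
\<close>

lemma fiber_ext:
  assumes W: "vs W" and e: "linear_map (gcomp (stalk C G a) n) W e"
    and bal: "\<And>d X Y. X \<in> gcar (stalk_alg C a) d \<Longrightarrow> Y \<in> gcar (stalk C G a) (n - d) \<Longrightarrow>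
      e (gact (stalk C G a) d (n - d) X Y) = (if d = 0 then germ_val C a 0 X \<odot>\<^bsub>W\<^esub> e Y else \<zero>\<^bsub>W\<^esub>)"
  obtains \<Phi> where "linear_map (gcomp (fiber C G a) n) W \<Phi>"
    "\<And>Y. Y \<in> gcar (stalk C G a) n \<Longrightarrow> \<Phi> (fiber_elt n Y) = e Y"
proof -
  let ?b = "\<lambda>i p q. if i = 0 then p \<odot>\<^bsub>W\<^esub> e q else \<zero>\<^bsub>W\<^esub>"
  let ?A = "gcomp (stalk_alg C a)" and ?P = "real_at C a" and ?Q = "stalk C G a"
  have b: "tensor_bilinear ?A ?P ?Q n W ?b"
    unfolding tensor_bilinear_def
  proof (intro conjI allI ballI)
    fix i p assume "p \<in> gcar ?P i"
    show "linear_map (gcomp ?Q (n - i)) W (?b i p)"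
      using linear_map_smult_map[OF W e, of p] W by (cases "i = 0") (simp_all, simp add: linear_map_def)
  next
    fix i q assume "q \<in> gcar ?Q (n - i)"
    then show "linear_map (gcomp ?P i) W (\<lambda>p. ?b i p q)"
      using W linear_map_closed[OF e, of q]
      by (intro linear_mapI) (auto simp: real_at_simps vs_smult_add_left)
  next
    fix i d X p q assume X: "X \<in> carrier (?A d)" and p: "p \<in> gcar ?P i" and q: "q \<in> gcar ?Q (n - i - d)"
    show "?b (i + d) (ksign i d \<odot>\<^bsub>gcomp ?P (i + d)\<^esub> gact ?P d i X p) q = ?b i p (gact ?Q d (n - i - d) X q)"
    proof (cases "i = 0")
      case True
      then have "q \<in> gcar ?Q (n - d)" using q by simp
      from bal[OF X this] True show ?thesis using W linear_map_closed[OF e, of q] q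
        by (auto simp: real_at_simps mult.commute)
    next
      case False
      have deg: "n - i - d = n - (i + d)" by simp
      from False have "p = 0" using p by (simp add: real_at_simps carrier_real_graded)
      then show ?thesis using False W linear_map_closed[OF e, of q] q[unfolded deg]
        by (auto simp: real_at_simps)
    qed
  qed
  note ext = linear_map_tensor_ext[OF tensor_ok_fiber W b]
  have "tensor_ext W ?b (fiber_elt n Y) = e Y" if "Y \<in> gcar ?Q n" for Y
    using ext(2)[of 1 0 Y] that linear_map_closed[OF e that] W
    by (simp add: fiber_elt_def real_at_simps carrier_real_graded)
  then show ?thesis using that ext(1) by (simp add: gcomp_fiber)
qed

end

section \<open>Values of jets\<close>

text \<open>The class in \<open>gpJet\<close> of an element of \<open>jetX\<close>.\<close>

definition gpJet_class ::
  "('m::topological_space, 'f) galg_presheaf \<Rightarrow> ('m, 'f, 's) gpresheaf \<Rightarrow> nat \<Rightarrow> 'm set \<Rightarrow> int \<Rightarrow>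
   ('f, 's) ftens set \<Rightarrow> ('f, 's) ftens set set set" where
  "gpJet_class C E k U n x = bullet C (pJet C E k) U n +>\<^bsub>gcomp (gsec (pJet C E k) U) n\<^esub>
     (jetV C E k U n +>\<^bsub>gcomp (gsec (jetX C E) U) n\<^esub> x)"

text \<open>The section of the jet sheaf represented by an element of \<open>jetX\<close>.\<close>

definition jet_section ::
  "('m::topological_space, 'f) galg_presheaf \<Rightarrow> ('m, 'f, 's) gpresheaf \<Rightarrow> nat \<Rightarrow> 'm set \<Rightarrow> int \<Rightarrow>
   ('f, 's) ftens set \<Rightarrow> 'm \<Rightarrow> ('m set \<times> ('f, 's) ftens set set set) set" where
  "jet_section C E k U n x = germ_section (gpJet C E k) U n (gpJet_class C E k U n x)"

text \<open>The value at \<open>a\<close> of the section of the jet bundle represented by an element of \<open>jetX\<close>.\<close>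

definition jet_value ::
  "('m::{second_countable_topology,t2_space}, 'f) galg_presheaf \<Rightarrow> ('m, 'f, 's) gpresheaf \<Rightarrow> nat \<Rightarrow> 'm \<Rightarrow> 'm set \<Rightarrow> int \<Rightarrow>
   ('f, 's) ftens set \<Rightarrow> (real, ('m set \<times> ('m \<Rightarrow> ('m set \<times> ('f, 's) ftens set set set) set)) set) ftens set" where
  "jet_value C E k a U n x = fiber_elt C (Jet C E k) a n (germ (Jet C E k) a n U (jet_section C E k U n x))"

text \<open>The germs that vanish to order \<open>m\<close>: sums of \<open>f\<^sub>1 \<cdots> f\<^sub>m \<psi>\<close> with \<open>f\<^sub>i(a) = 0\<close>.\<close>

definition vanish_order ::
  "('m::topological_space, 'f) galg_presheaf \<Rightarrow> ('m, 'f, 's) gpresheaf \<Rightarrow> 'm \<Rightarrow> nat \<Rightarrow> int \<Rightarrow> ('m set \<times> 's) set set" where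
  "vanish_order C E a m = (ideal_smul (stalk C E a) (vanish_germ C a) ^^ m) (gcar (stalk C E a))"

context
  fixes C :: "('m::{second_countable_topology,t2_space}, 'f) galg_presheaf" and E :: "('m, 'f, 's) gpresheaf"
  assumes C: "graded_manifold C" and E: "module_presheaf C E"
begin

lemma module_presheaf_gpJet: "module_presheaf C (gpJet C E k)"
  unfolding gpJet_def geo_def
  by (rule module_presheaf_quot_presheaf[OF graded_manifold_sheaf[OF C] module_presheaf_pJet[OF graded_manifold_sheaf[OF
      C] E]
        subpresheaf_bullet[OF C module_presheaf_pJet[OF graded_manifold_sheaf[OF C] E]]])

lemma module_presheaf_Jet: "module_presheaf C (Jet C E k)"
  unfolding Jet_def by (rule module_presheaf_sheafify[OF graded_manifold_sheaf[OF C] module_presheaf_gpJet])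

lemma gcomp_pJet: "gcomp (gsec (pJet C E k) U) n = quot_vs (gcomp (gsec (jetX C E) U) n) (jetV C E k U n)"
  by (simp add: pJet_def)

lemma gcomp_gpJet: "gcomp (gsec (gpJet C E k) U) n = quot_vs (gcomp (gsec (pJet C E k) U) n) (bullet C (pJet C E k) U n)"
  by (simp add: gpJet_def geo_def)

lemma linear_map_pJet_coset:
  assumes "open U"
  shows "linear_map (gcomp (gsec (jetX C E) U) n) (gcomp (gsec (pJet C E k) U) n)
    (\<lambda>x. jetV C E k U n +>\<^bsub>gcomp (gsec (jetX C E) U) n\<^esub> x)"
  unfolding gcomp_pJet
  by (rule linear_map_coset[OF vs_jetX[OF graded_manifold_sheaf[OF C] E assms] subpresheafD(2)[OF subpresheaf_jetV[OF
      graded_manifold_sheaf[OF C] E] assms]])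

lemma linear_map_gpJet_coset:
  assumes "open U"
  shows "linear_map (gcomp (gsec (pJet C E k) U) n) (gcomp (gsec (gpJet C E k) U) n)
    (\<lambda>x. bullet C (pJet C E k) U n +>\<^bsub>gcomp (gsec (pJet C E k) U) n\<^esub> x)"
  unfolding gcomp_gpJet
  by (rule linear_map_coset[OF module_presheaf_vs[OF module_presheaf_pJet[OF graded_manifold_sheaf[OF C] E] assms]
        subpresheafD(2)[OF subpresheaf_bullet[OF C module_presheaf_pJet[OF graded_manifold_sheaf[OF C] E]] assms]])

lemma linear_map_gpJet_class:
  assumes "open U"
  shows "linear_map (gcomp (gsec (jetX C E) U) n) (gcomp (gsec (gpJet C E k) U) n) (gpJet_class C E k U n)"
  unfolding gpJet_class_def[abs_def]
  by (rule linear_map_comp[OF linear_map_pJet_coset[OF assms] linear_map_gpJet_coset[OF assms]])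

lemma pJet_rep:
  assumes "y \<in> scar (pJet C E k) U n"
  obtains x where "x \<in> scar (jetX C E) U n" "y = jetV C E k U n +>\<^bsub>gcomp (gsec (jetX C E) U) n\<^esub> x"
  using assms unfolding gcomp_pJet carrier_quot_vs by blast

lemma gpJet_rep:
  assumes "y \<in> scar (gpJet C E k) U n"
  obtains x where "x \<in> scar (jetX C E) U n" "y = gpJet_class C E k U n x"
proof -
  obtain z where z: "z \<in> scar (pJet C E k) U n"
    "y = bullet C (pJet C E k) U n +>\<^bsub>gcomp (gsec (pJet C E k) U) n\<^esub> z"
    using assms unfolding gcomp_gpJet carrier_quot_vs by blast
  obtain x where "x \<in> scar (jetX C E) U n" "z = jetV C E k U n +>\<^bsub>gcomp (gsec (jetX C E) U) n\<^esub> x"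
    by (rule pJet_rep[OF z(1)])
  then show ?thesis using that z(2) by (simp add: gpJet_class_def)
qed

lemma gact_pJet_coset:
  assumes U: "open U" and f: "f \<in> scar C U d" and x: "x \<in> scar (jetX C E) U n"
  shows "gact (gsec (pJet C E k) U) d n f (jetV C E k U n +>\<^bsub>gcomp (gsec (jetX C E) U) n\<^esub> x)
    = jetV C E k U (d + n) +>\<^bsub>gcomp (gsec (jetX C E) U) (d + n)\<^esub> gact (gsec (jetX C E) U) d n f x"
  using gact_gquot[OF module_presheaf_module[OF module_presheaf_jetX[OF graded_manifold_sheaf[OF C] E] U]
      subpresheafD(1)[OF subpresheaf_jetV[OF graded_manifold_sheaf[OF C] E] U] f x]
  by (simp add: pJet_def)

lemma gact_gpJet_class:
  assumes U: "open U" and f: "f \<in> scar C U d" and x: "x \<in> scar (jetX C E) U n"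
  shows "gact (gsec (gpJet C E k) U) d n f (gpJet_class C E k U n x)
    = gpJet_class C E k U (d + n) (gact (gsec (jetX C E) U) d n f x)"
  using gact_gquot[OF module_presheaf_module[OF module_presheaf_pJet[OF graded_manifold_sheaf[OF C] E] U]
      subpresheafD(1)[OF subpresheaf_bullet[OF C module_presheaf_pJet[OF graded_manifold_sheaf[OF C] E]] U] f
      linear_map_closed[OF linear_map_pJet_coset[OF U] x]] gact_pJet_coset[OF U f x]
  by (simp add: gpJet_def geo_def gpJet_class_def)

lemma gres_gpJet_class:
  assumes UV: "open U" "open V" "V \<subseteq> U" and x: "x \<in> scar (jetX C E) U n"
  shows "gres (gpJet C E k) U V n (gpJet_class C E k U n x) = gpJet_class C E k V n (gres (jetX C E) U V n x)"
  using gres_quot_presheaf[OF module_presheaf_pJet[OF graded_manifold_sheaf[OF C] E] subpresheaf_bullet[OF C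
      module_presheaf_pJet[OF graded_manifold_sheaf[OF C] E]]
      UV linear_map_closed[OF linear_map_pJet_coset[OF UV(1)] x]]
    gres_quot_presheaf[OF module_presheaf_jetX[OF graded_manifold_sheaf[OF C] E] subpresheaf_jetV[OF
        graded_manifold_sheaf[OF C] E] UV x]
  by (simp add: gpJet_def geo_def gpJet_class_def pJet_def)

lemma linear_map_jet_section:
  assumes "open U"
  shows "linear_map (gcomp (gsec (jetX C E) U) n) (gcomp (gsec (Jet C E k) U) n) (jet_section C E k U n)"
  unfolding jet_section_def[abs_def] Jet_def
  by (rule linear_map_comp[OF linear_map_gpJet_class[OF assms]
        linear_map_germ_section[OF graded_manifold_sheaf[OF C] module_presheaf_gpJet assms]])

lemma gact_jet_section:
  assumes U: "open U" and f: "f \<in> scar C U d" and x: "x \<in> scar (jetX C E) U n"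
  shows "gact (gsec (Jet C E k) U) d n f (jet_section C E k U n x)
    = jet_section C E k U (d + n) (gact (gsec (jetX C E) U) d n f x)"
  unfolding Jet_def jet_section_def
    gact_germ_section[OF graded_manifold_sheaf[OF C] module_presheaf_gpJet U f linear_map_closed[OF
        linear_map_gpJet_class[OF U] x]]
    gact_gpJet_class[OF U f x] ..

lemma gres_jet_section:
  assumes UV: "open U" "open V" "V \<subseteq> U" and x: "x \<in> scar (jetX C E) U n"
  shows "gres (Jet C E k) U V n (jet_section C E k U n x) = jet_section C E k V n (gres (jetX C E) U V n x)"
  unfolding Jet_def jet_section_def sheafify_simps
    restrict_germ_section[OF graded_manifold_sheaf[OF C] module_presheaf_gpJet UV linear_map_closed[OF
        linear_map_gpJet_class[OF UV(1)] x]]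
    gres_gpJet_class[OF UV x] ..

lemma stalk_Jet_rep:
  assumes "Y \<in> gcar (stalk C (Jet C E k) a) n"
  obtains U x where "open U" "a \<in> U" "x \<in> scar (jetX C E) U n" "Y = germ (Jet C E k) a n U (jet_section C E k U n x)"
proof -
  obtain V s where V: "open V" "a \<in> V" "s \<in> scar (gpJet C E k) V n"
    "Y = germ (Jet C E k) a n V (germ_section (gpJet C E k) V n s)"
    using stalk_sheafify_rep[OF graded_manifold_sheaf[OF C] module_presheaf_gpJet assms[unfolded Jet_def]]
        unfolding Jet_def by blast
  obtain x where "x \<in> scar (jetX C E) V n" "s = gpJet_class C E k V n x" by (rule gpJet_rep[OF V(3)])
  then show ?thesis using that V by (simp add: jet_section_def)
qed

lemma linear_map_jet_value:
  assumes "open U" "a \<in> U"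
  shows "linear_map (gcomp (gsec (jetX C E) U) n) (gcomp (fiber C (Jet C E k) a) n) (jet_value C E k a U n)"
  unfolding jet_value_def[abs_def]
  by (rule linear_map_comp[OF linear_map_comp[OF linear_map_jet_section[OF assms(1)]
        linear_map_germ[OF module_presheaf_Jet assms]] linear_map_fiber_elt[OF C module_presheaf_Jet]])

lemma vs_fiber_Jet: "vs (gcomp (fiber C (Jet C E k) a) n)"
  by (rule vs_fiber[OF C module_presheaf_Jet])

lemma jet_value_gact:
  assumes U: "open U" "a \<in> U" and f: "f \<in> scar C U d" and x: "x \<in> scar (jetX C E) U n"
  shows "jet_value C E k a U (d + n) (gact (gsec (jetX C E) U) d n f x)
    = (if d = 0 then gval C a U 0 f \<odot>\<^bsub>gcomp (fiber C (Jet C E k) a) n\<^esub> jet_value C E k a U n x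
       else \<zero>\<^bsub>gcomp (fiber C (Jet C E k) a) (d + n)\<^esub>)"
proof -
  note sx = linear_map_closed[OF linear_map_jet_section[OF U(1)] x]
  have "jet_value C E k a U (d + n) (gact (gsec (jetX C E) U) d n f x)
    = fiber_elt C (Jet C E k) a (d + n) (gact (stalk C (Jet C E k) a) d n (germ C a d U f) (germ (Jet C E k) a n U
        (jet_section C E k U n x)))"
    unfolding jet_value_def gact_jet_section[OF U(1) f x, symmetric]
      stalk_gact[OF graded_manifold_sheaf[OF C] module_presheaf_Jet U f sx] ..
  also have "\<dots> = (if d = 0 then gval C a U 0 f \<odot>\<^bsub>gcomp (fiber C (Jet C E k) a) n\<^esub> jet_value C E k a U n x
       else \<zero>\<^bsub>gcomp (fiber C (Jet C E k) a) (d + n)\<^esub>)"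
    using fiber_elt_gact[OF C module_presheaf_Jet germ_in_stalk[OF graded_manifold_module[OF C] U f] germ_in_stalk[OF
        module_presheaf_Jet U sx]]
      germ_val_germ[OF C U f] by (auto simp: jet_value_def)
  finally show ?thesis .
qed

lemma jet_value_gres:
  assumes "open U" "open V" "a \<in> V" "V \<subseteq> U" "x \<in> scar (jetX C E) U n"
  shows "jet_value C E k a V n (gres (jetX C E) U V n x) = jet_value C E k a U n x"
  unfolding jet_value_def gres_jet_section[OF assms(1,2,4,5), symmetric]
    germ_gres[OF module_presheaf_Jet assms(1-4) linear_map_closed[OF linear_map_jet_section[OF assms(1)] assms(5)]] ..

lemma jet_value_jetV:
  assumes U: "open U" "a \<in> U" and x: "x \<in> jetV C E k U n"
  shows "jet_value C E k a U n x = \<zero>\<^bsub>gcomp (fiber C (Jet C E k) a) n\<^esub>"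
proof -
  note sub = subpresheafD(2)[OF subpresheaf_jetV[OF graded_manifold_sheaf[OF C] E] U(1)] and X
      = vs_jetX[OF graded_manifold_sheaf[OF C] E U(1)]
  have "jetV C E k U n +>\<^bsub>gcomp (gsec (jetX C E) U) n\<^esub> x = jetV C E k U n +>\<^bsub>gcomp (gsec (jetX C E) U) n\<^esub> \<zero>\<^bsub>gcomp (gsec (jetX
      C E) U) n\<^esub>"
    using coset_eq_self_iff[OF X sub subspace_of_carrier_mem[OF sub x]] x
      coset_eq_self_iff[OF X sub vs_zero_closed[OF X]] subspace_of_zero[OF sub] by simp
  then have "jet_value C E k a U n x = jet_value C E k a U n \<zero>\<^bsub>gcomp (gsec (jetX C E) U) n\<^esub>"
    by (simp add: jet_value_def jet_section_def gpJet_class_def)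
  then show ?thesis using linear_map_zero[OF X vs_fiber_Jet linear_map_jet_value[OF U]] by simp
qed

lemma jet_unit_elt:
  assumes "open U" "\<psi> \<in> scar E U n"
  shows "jet_elt C E U n 0 (gunit C U) \<psi> \<in> scar (jetX C E) U n"
  by (rule jet_elt_closed[OF graded_manifold_sheaf[OF C] E algebra_sheaf_unit[OF graded_manifold_sheaf[OF C] assms(1)]])
      (use assms in simp)

lemma linear_map_jet_unit_elt:
  assumes "open U"
  shows "linear_map (gcomp (gsec E U) n) (gcomp (gsec (jetX C E) U) n) (jet_elt C E U n 0 (gunit C U))"
  using jet_elt_linear(1)[OF graded_manifold_sheaf[OF C] E assms algebra_sheaf_unit[OF graded_manifold_sheaf[OF C]
      assms], of n] by simp

lemma gres_jet_unit_elt: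
  assumes UV: "open U" "open V" "V \<subseteq> U" and \<psi>: "\<psi> \<in> scar E U n"
  shows "gres (jetX C E) U V n (jet_elt C E U n 0 (gunit C U) \<psi>) = jet_elt C E V n 0 (gunit C V) (gres E U V n \<psi>)"
  using linear_map_jetX_gres(2)[OF graded_manifold_sheaf[OF C] E UV algebra_sheaf_unit[OF graded_manifold_sheaf[OF C]
      UV(1)], of \<psi> n] \<psi>
    algebra_sheafD(3)[OF graded_manifold_sheaf[OF C] UV] by simp

lemma jet_elt_eq_gact:
  assumes U: "open U" and g: "g \<in> scar C U i" and \<psi>: "\<psi> \<in> scar E U (n - i)"
  shows "jet_elt C E U n i g \<psi> = gact (gsec (jetX C E) U) i (n - i) g (jet_elt C E U (n - i) 0 (gunit C U) \<psi>)"
proof -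
  note A = graded_comm_algebraD[OF algebra_sheafD(1)[OF graded_manifold_sheaf[OF C] U]]
  have "gact (gsec C U) i 0 g (gunit C U) = g"
    using A(3)[OF g A(1)] graded_module_unit[OF A(2) g] vs_smult_one[OF graded_module_vs[OF A(2)] g]
    by (simp add: ksign_def)
  then show ?thesis
    using linear_map_jetX_gact(2)[OF graded_manifold_sheaf[OF C] E U g A(1), of \<psi> "n - i"] \<psi> by simp
qed

text \<open>
  Every element of the fiber is the value of the prolongation of a section: an element of \<open>jetX\<close> is a sum of
  \<open>g \<otimes> \<psi> = g \<triangleright> (1 \<otimes> \<psi>)\<close>, whose value is \<open>g(a)\<close> times that of \<open>1 \<otimes> \<psi>\<close>.
\<close>

lemma fiber_Jet_rep:
  assumes "z \<in> gcar (fiber C (Jet C E k) a) n"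
  obtains U \<psi> where "open U" "a \<in> U" "\<psi> \<in> scar E U n" "z = jet_value C E k a U n (jet_elt C E U n 0 (gunit C U) \<psi>)"
proof -
  obtain Y where Y: "Y \<in> gcar (stalk C (Jet C E k) a) n" "z = fiber_elt C (Jet C E k) a n Y"
    by (rule fiber_rep[OF C module_presheaf_Jet assms])
  obtain U x where U: "open U" "a \<in> U" and x: "x \<in> scar (jetX C E) U n"
    and "Y = germ (Jet C E k) a n U (jet_section C E k U n x)" by (rule stalk_Jet_rep[OF Y(1)])
  then have z: "z = jet_value C E k a U n x" using Y(2) by (simp add: jet_value_def)
  let ?L = "\<lambda>\<psi>. jet_value C E k a U n (jet_elt C E U n 0 (gunit C U) \<psi>)"
  have N: "subspace_of (?L ` scar E U n) (gcomp (fiber C (Jet C E k) a) n)"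
    by (rule subspace_of_image[OF module_presheaf_vs[OF E U(1)] vs_fiber_Jet
          linear_map_comp[OF linear_map_jet_unit_elt[OF U(1)] linear_map_jet_value[OF U]]])
  have "jet_value C E k a U n x \<in> ?L ` scar E U n"
  proof (rule linear_map_jetX_into[OF graded_manifold_sheaf[OF C] E U(1) vs_fiber_Jet linear_map_jet_value[OF U] N _ x])
    fix i g \<psi> assume g: "g \<in> scar C U i" and \<psi>: "\<psi> \<in> scar E U (n - i)"
    have "jet_value C E k a U n (jet_elt C E U n i g \<psi>)
        = (if i = 0 then gval C a U 0 g \<odot>\<^bsub>gcomp (fiber C (Jet C E k) a) n\<^esub> ?L \<psi> else \<zero>\<^bsub>gcomp (fiber C (Jet C E k) a) n\<^esub>)"
      using jet_value_gact[OF U g jet_unit_elt[OF U(1) \<psi>], where k = k] by (simp add: jet_elt_eq_gact[OF U(1) g \<psi>])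
    then show "jet_value C E k a U n (jet_elt C E U n i g \<psi>) \<in> ?L ` scar E U n"
      using subspace_of_zero[OF N] subspace_of_smult[OF N imageI, of \<psi>] \<psi> by (cases "i = 0") simp_all
  qed
  then show ?thesis using that U z by blast
qed

section \<open>Evaluation at a point\<close>

text \<open>
  The map \<open>g \<otimes> \<psi> \<mapsto> g(a) [\<psi>]\<^sub>a\<close>. It turns \<open>f \<triangleright>\<close> into multiplication by the number \<open>f(a)\<close> and \<open>f \<blacktriangleright>\<close> into
  multiplication by the germ of \<open>f\<close>. The sign of \<open>f \<blacktriangleright>\<close> has no effect because \<open>g(a) = 0\<close> unless \<open>\<bar>g\<bar> = 0\<close>.
\<close>

definition jet_eval :: "'m \<Rightarrow> 'm set \<Rightarrow> int \<Rightarrow> ('f, 's) ftens set \<Rightarrow> ('m set \<times> 's) set" where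
  "jet_eval a U n = tensor_ext (gcomp (stalk C E a) n)
     (\<lambda>i g \<psi>. if i = 0 then gval C a U 0 g \<odot>\<^bsub>gcomp (stalk C E a) n\<^esub> germ E a n U \<psi> else \<zero>\<^bsub>gcomp (stalk C E a) n\<^esub>)"

lemma linear_map_jet_eval:
  assumes U: "open U" "a \<in> U"
  shows "linear_map (gcomp (gsec (jetX C E) U) n) (gcomp (stalk C E a) n) (jet_eval a U n)"
    and "g \<in> scar C U i \<Longrightarrow> \<psi> \<in> scar E U (n - i) \<Longrightarrow> jet_eval a U n (jet_elt C E U n i g \<psi>)
      = (if i = 0 then gval C a U 0 g \<odot>\<^bsub>gcomp (stalk C E a) n\<^esub> germ E a n U \<psi> else \<zero>\<^bsub>gcomp (stalk C E a) n\<^esub>)"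
proof -
  let ?W = "gcomp (stalk C E a) n"
  let ?b = "\<lambda>i g \<psi>. if i = 0 then gval C a U 0 g \<odot>\<^bsub>?W\<^esub> germ E a n U \<psi> else \<zero>\<^bsub>?W\<^esub>"
  note W = vs_stalk[OF E]
  have b: "tensor_bilinear real_graded (real_gmod (gcomp (gsec C U))) (real_gmod (gcomp (gsec E U))) n ?W ?b"
  proof (rule tensor_bilinear_real[OF module_presheaf_vs[OF graded_manifold_module[OF C] U(1)] module_presheaf_vs[OF E
      U(1)] W])
    fix i g assume "g \<in> scar C U i"
    show "linear_map (gcomp (gsec E U) (n - i)) ?W (?b i g)"
    proof (cases "i = 0")
      case True
      then show ?thesis using linear_map_smult_map[OF W linear_map_germ[OF E U], where r = "gval C a U 0 g"] by simp
    next
      case False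
      then show ?thesis using W by (simp add: linear_map_def)
    qed
  next
    fix i \<psi> assume \<psi>: "\<psi> \<in> scar E U (n - i)"
    show "linear_map (gcomp (gsec C U) i) ?W (\<lambda>g. ?b i g \<psi>)"
    proof (cases "i = 0")
      case True
      then show ?thesis using \<psi> germ_in_stalk[OF E U, of \<psi> n] W
        by (auto intro!: linear_mapI simp: gval_linear[OF C U] vs_smult_add_left)
    next
      case False
      then show ?thesis using W by (simp add: linear_map_def)
    qed
  qed
  note ext = linear_map_tensor_ext[OF tensor_ok_jetX[OF graded_manifold_sheaf[OF C] E U(1)] W b, folded jet_eval_def]
  show "linear_map (gcomp (gsec (jetX C E) U) n) (gcomp (stalk C E a) n) (jet_eval a U n)"
    using ext(1) by (simp add: gcomp_jetX[OF graded_manifold_sheaf[OF C] E])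
  show "jet_eval a U n (jet_elt C E U n i g \<psi>) = ?b i g \<psi>" if "g \<in> scar C U i" "\<psi> \<in> scar E U (n - i)"
    using ext(2)[of g i \<psi>] that by (simp add: jet_elt_def)
qed

lemma jet_eval_unit:
  assumes U: "open U" "a \<in> U" and \<psi>: "\<psi> \<in> scar E U n"
  shows "jet_eval a U n (jet_elt C E U n 0 (gunit C U) \<psi>) = germ E a n U \<psi>"
  using linear_map_jet_eval(2)[OF U algebra_sheaf_unit[OF graded_manifold_sheaf[OF C] U(1)], of \<psi> n] \<psi>
    gval_unit[OF C U] vs_smult_one[OF vs_stalk[OF E] germ_in_stalk[OF E U \<psi>]] by simp

lemma jet_eval_gact:
  assumes U: "open U" "a \<in> U" and f: "f \<in> scar C U d" and x: "x \<in> scar (jetX C E) U n"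
  shows "jet_eval a U (d + n) (gact (gsec (jetX C E) U) d n f x)
    = (if d = 0 then gval C a U 0 f \<odot>\<^bsub>gcomp (stalk C E a) n\<^esub> jet_eval a U n x else \<zero>\<^bsub>gcomp (stalk C E a) (d + n)\<^esub>)"
    (is "_ = ?R x")
proof -
  note W = vs_stalk[OF E] and ev = linear_map_jet_eval[OF U]
  have lin: "linear_map (gcomp (gsec (jetX C E) U) n) (gcomp (stalk C E a) (d + n)) ?R"
  proof (cases "d = 0")
    case True
    then show ?thesis using linear_map_smult_map[OF W ev(1), where r = "gval C a U 0 f"] by simp
  next
    case False
    then show ?thesis using W by (simp add: linear_map_def)
  qed
  show ?thesis
  proof (rule linear_map_jetX_eq[OF graded_manifold_sheaf[OF C] E U(1) W linear_map_comp[OF linear_map_jetX_gact(1)[OF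
      graded_manifold_sheaf[OF C] E U(1) f] ev(1)] lin _ x])
    fix i g \<psi> assume g: "g \<in> scar C U i" and \<psi>: "\<psi> \<in> scar E U (n - i)"
    have fg: "gact (gsec C U) d i f g \<in> scar C U (d + i)"
      by (rule graded_module_closed[OF module_presheaf_module[OF graded_manifold_module[OF C] U(1)] f g])
    have \<psi>': "\<psi> \<in> scar E U (d + n - (d + i))" using \<psi> by simp
    have L: "jet_eval a U (d + n) (gact (gsec (jetX C E) U) d n f (jet_elt C E U n i g \<psi>))
      = (if d + i = 0 then gval C a U 0 (gact (gsec C U) d i f g) \<odot>\<^bsub>gcomp (stalk C E a) (d + n)\<^esub> germ E a (d + n) U \<psi>
         else \<zero>\<^bsub>gcomp (stalk C E a) (d + n)\<^esub>)"
      by (simp add: linear_map_jetX_gact(2)[OF graded_manifold_sheaf[OF C] E U(1) f g \<psi>] ev(2)[OF fg \<psi>'])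
    have v: "gval C a U (d + i) (gact (gsec C U) d i f g) = gval C a U d f * gval C a U i g"
      by (rule gval_gact[OF C U f g])
    show "jet_eval a U (d + n) (gact (gsec (jetX C E) U) d n f (jet_elt C E U n i g \<psi>)) = ?R (jet_elt C E U n i g \<psi>)"
    proof (cases "d = 0")
      case True
      then show ?thesis using L v g \<psi> W germ_in_stalk[OF E U, of \<psi> n] ev(2)[OF g \<psi>]
        by (cases "i = 0") simp_all
    next
      case False
      show ?thesis
      proof (cases "d + i = 0")
        case True
        then have "\<psi> \<in> scar E U (d + n)" using \<psi>' by simp
        from vs_smult_zero_left[OF W germ_in_stalk[OF E U this]] show ?thesis
          using L v gval_nonzero_degree[OF C U f False] True False by simp
      qed (use L False in simp)
    qed
  qed
qed

lemma jet_eval_ract: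
  assumes U: "open U" "a \<in> U" and f: "f \<in> scar C U d" and x: "x \<in> scar (jetX C E) U n"
  shows "jet_eval a U (d + n) (jet_ract C E U d n f x) = gact (stalk C E a) d n (germ C a d U f) (jet_eval a U n x)"
proof -
  note W = vs_stalk[OF E] and ev = linear_map_jet_eval[OF U] and G = graded_module_stalk[OF graded_manifold_sheaf[OF C] E]
  have gf: "germ C a d U f \<in> gcar (stalk_alg C a) d" by (rule germ_in_stalk[OF graded_manifold_module[OF C] U f])
  show ?thesis
  proof (rule linear_map_jetX_eq[OF graded_manifold_sheaf[OF C] E U(1) W linear_map_comp[OF linear_map_jet_ract(1)[OF
      graded_manifold_sheaf[OF C] E U(1) f] ev(1)]
        linear_map_comp[OF ev(1) linear_map_gact[OF G gf]] _ x])
    fix i g \<psi> assume g: "g \<in> scar C U i" and \<psi>: "\<psi> \<in> scar E U (n - i)"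
    have f\<psi>: "gact (gsec E U) d (n - i) f \<psi> \<in> scar E U (d + n - i)"
      using graded_module_closed[OF module_presheaf_module[OF E U(1)] f \<psi>] by (simp add: add_diff_eq)
    have "jet_eval a U (d + n) (jet_ract C E U d n f (jet_elt C E U n i g \<psi>))
      = ksign d i \<odot>\<^bsub>gcomp (stalk C E a) (d + n)\<^esub> jet_eval a U (d + n) (jet_elt C E U (d + n) i g (gact (gsec E U) d (n -
          i) f \<psi>))"
      using linear_map_smult[OF ev(1) jet_elt_closed[OF graded_manifold_sheaf[OF C] E g f\<psi>]]
      by (simp add: linear_map_jet_ract(2)[OF graded_manifold_sheaf[OF C] E U(1) f g \<psi>])
    also have "\<dots> = gact (stalk C E a) d n (germ C a d U f) (jet_eval a U n (jet_elt C E U n i g \<psi>))"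
    proof (cases "i = 0")
      case True
      then have \<psi>': "\<psi> \<in> scar E U n" using \<psi> by simp
      show ?thesis
        using True f\<psi> g germ_in_stalk[OF E U \<psi>'] germ_in_stalk[OF E U, of "gact (gsec E U) d n f \<psi>" "d + n"] W
          graded_module_smult_right[OF G gf germ_in_stalk[OF E U \<psi>']] stalk_gact[OF graded_manifold_sheaf[OF C] E U f \<psi>']
          ev(2)[OF g \<psi>] ev(2)[OF g f\<psi>]
        by (simp add: ksign_def)
    next
      case False
      then show ?thesis using W linear_map_zero[OF W W linear_map_gact[OF G gf]]
        by (simp add: ev(2)[OF g \<psi>] ev(2)[OF g f\<psi>])
    qed
    finally show "jet_eval a U (d + n) (jet_ract C E U d n f (jet_elt C E U n i g \<psi>))
      = gact (stalk C E a) d n (germ C a d U f) (jet_eval a U n (jet_elt C E U n i g \<psi>))" .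
  qed
qed

lemma jet_eval_gres:
  assumes UV: "open U" "open V" "V \<subseteq> U" "a \<in> V" and x: "x \<in> scar (jetX C E) U n"
  shows "jet_eval a V n (gres (jetX C E) U V n x) = jet_eval a U n x"
proof -
  have aU: "a \<in> U" using UV by blast
  note evU = linear_map_jet_eval[OF UV(1) aU] and evV = linear_map_jet_eval[OF UV(2,4)]
  note res = linear_map_jetX_gres[OF graded_manifold_sheaf[OF C] E UV(1-3)]
  show ?thesis
  proof (rule linear_map_jetX_eq[OF graded_manifold_sheaf[OF C] E UV(1) vs_stalk[OF E] linear_map_comp[OF res(1) evV(1)]
      evU(1) _ x])
    fix i g \<psi> assume g: "g \<in> scar C U i" and \<psi>: "\<psi> \<in> scar E U (n - i)"
    show "jet_eval a V n (gres (jetX C E) U V n (jet_elt C E U n i g \<psi>)) = jet_eval a U n (jet_elt C E U n i g \<psi>)"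
      using g \<psi> gval_gres[OF C UV g] germ_gres[OF E UV(1,2,4,3), of \<psi> n]
        res(2)[OF g \<psi>] evU(2)[OF g \<psi>] evV(2)[OF module_presheaf_gres_closed[OF graded_manifold_module[OF C] UV(1-3) g]
            module_presheaf_gres_closed[OF E UV(1-3) \<psi>]]
      by (cases "i = 0") simp_all
  qed
qed

end

section \<open>Vanishing to higher order\<close>

text \<open>The sums of elements \<open>f \<triangleright> x\<close> with \<open>f(a) = 0\<close> and of elements \<open>\<delta>\<^sub>f\<^sub>1 \<cdots> \<delta>\<^sub>f\<^sub>m (g \<otimes> \<psi>)\<close>.\<close>

definition jet_null ::
  "('m::topological_space, 'f) galg_presheaf \<Rightarrow> ('m, 'f, 's) gpresheaf \<Rightarrow> 'm \<Rightarrow> nat \<Rightarrow> 'm set \<Rightarrow> int \<Rightarrow> ('f, 's) ftens set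
      set" where
  "jet_null C E a m U n = rspan (gcomp (gsec (jetX C E) U) n)
     ({gact (gsec (jetX C E) U) d (n - d) f x | d f x. f \<in> vanish_sec C U a d \<and> x \<in> scar (jetX C E) U (n - d)}
      \<union> delta_gens C E U m n)"

context
  fixes C :: "('m::{second_countable_topology,t2_space}, 'f) galg_presheaf" and E :: "('m, 'f, 's) gpresheaf"
  assumes C: "graded_manifold C" and E: "module_presheaf C E"
begin

lemma vanish_germ_subset: "vanish_germ C a i \<subseteq> gcar (stalk_alg C a) i"
  by (auto simp: vanish_germ_def)

lemma germ_in_vanish_germ:
  assumes "open U" "a \<in> U" "f \<in> scar C U i"
  shows "germ C a i U f \<in> vanish_germ C a i \<longleftrightarrow> f \<in> vanish_sec C U a i"
  using germ_val_germ[OF C assms] germ_in_stalk[OF graded_manifold_module[OF C] assms] assms(3)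
      by (simp add: vanish_germ_def vanish_sec_def)

lemma germ_unit:
  assumes "open U" "a \<in> U"
  shows "germ C a 0 U (gunit C U) = germ C a 0 UNIV (gunit C UNIV)"
  using germ_gres[OF graded_manifold_module[OF C] open_UNIV assms subset_UNIV algebra_sheaf_unit[OF
      graded_manifold_sheaf[OF C] open_UNIV]]
    algebra_sheafD(3)[OF graded_manifold_sheaf[OF C] open_UNIV assms(1) subset_UNIV] by simp

lemma vanish_order_Suc: "vanish_order C E a (Suc m) = ideal_smul (stalk C E a) (vanish_germ C a) (vanish_order C E a m)"
  by (simp add: vanish_order_def)

lemma subspace_of_vanish_order: "subspace_of (vanish_order C E a m n) (gcomp (stalk C E a) n)"
proof (induction m arbitrary: n)
  case 0 show ?case by (simp add: vanish_order_def subspace_of_carrier vs_stalk[OF E])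
next
  case (Suc m)
  show ?case unfolding vanish_order_Suc
    by (rule subspace_of_ideal_smul[OF graded_module_stalk[OF graded_manifold_sheaf[OF C] E] vanish_germ_subset
        subspace_of_subset[OF Suc]])
qed

lemma jet_sub_eq: "jet_sub C E k a = vanish_order C E a (Suc k)"
  unfolding jet_sub_def vanish_order_def
  by (rule ideal_smul_ideal_pow[OF graded_module_stalk[OF graded_manifold_sheaf[OF C] E] graded_module_stalk[OF
      graded_manifold_sheaf[OF C] graded_manifold_module[OF C]]
        germ_in_stalk[OF graded_manifold_module[OF C] open_UNIV UNIV_I algebra_sheaf_unit[OF graded_manifold_sheaf[OF C]
            open_UNIV]] vanish_germ_subset])

text \<open>Under \<open>jet_eval\<close>, the operator \<open>\<delta>\<^sub>f\<close> becomes multiplication by \<open>f(a) - f\<close>.\<close>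

lemma jet_eval_delta:
  assumes U: "open U" "a \<in> U" and f: "f \<in> scar C U d" and x: "x \<in> scar (jetX C E) U n"
  obtains f0 where "f0 \<in> vanish_sec C U a d"
    "jet_eval C E a U (d + n) (jet_delta C E U d n f x)
      = (-1) \<odot>\<^bsub>gcomp (stalk C E a) (d + n)\<^esub> gact (stalk C E a) d n (germ C a d U f0) (jet_eval C E a U n x)"
proof -
  let ?y = "jet_eval C E a U n x" and ?W = "gcomp (stalk C E a) (d + n)"
  note W = vs_stalk[OF E] and G = graded_module_stalk[OF graded_manifold_sheaf[OF C] E] and ev
      = linear_map_jet_eval(1)[OF C E U]
  have y: "?y \<in> gcar (stalk C E a) n" by (rule linear_map_closed[OF ev x])
  have gf: "germ C a d U f \<in> gcar (stalk_alg C a) d" by (rule germ_in_stalk[OF graded_manifold_module[OF C] U f])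
  have fy: "gact (stalk C E a) d n (germ C a d U f) ?y \<in> carrier ?W" by (rule graded_module_closed[OF G gf y])
  have eq: "jet_eval C E a U (d + n) (jet_delta C E U d n f x)
      = (if d = 0 then gval C a U 0 f \<odot>\<^bsub>gcomp (stalk C E a) n\<^esub> ?y else \<zero>\<^bsub>?W\<^esub>)
        \<oplus>\<^bsub>?W\<^esub> (-1) \<odot>\<^bsub>?W\<^esub> gact (stalk C E a) d n (germ C a d U f) ?y"
    using linear_map_closed[OF linear_map_jetX_gact(1)[OF graded_manifold_sheaf[OF C] E U(1) f] x]
      linear_map_closed[OF linear_map_jet_ract(1)[OF graded_manifold_sheaf[OF C] E U(1) f] x] vs_jetX[OF
          graded_manifold_sheaf[OF C] E U(1)]
    by (simp add: jet_delta_eq[OF graded_manifold_sheaf[OF C] E U(1) f x] linear_map_add[OF ev] linear_map_smult[OF ev]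
        jet_eval_gact[OF C E U f x] jet_eval_ract[OF C E U f x])
  show ?thesis
  proof (cases "d = 0")
    case False
    then have "f \<in> vanish_sec C U a d" using f gval_nonzero_degree[OF C U f] by (simp add: vanish_sec_def)
    then show ?thesis using that eq False W fy by simp
  next
    case True
    \<comment> \<open>\<open>f - f(a) 1\<close> vanishes at \<open>a\<close>\<close>
    let ?c = "gval C a U 0 f" and ?A = "gcomp (gsec C U) 0"
    let ?f0 = "f \<oplus>\<^bsub>?A\<^esub> (- ?c) \<odot>\<^bsub>?A\<^esub> gunit C U"
    note A = module_presheaf_vs[OF graded_manifold_module[OF C] U(1)] and e
        = algebra_sheaf_unit[OF graded_manifold_sheaf[OF C] U(1)]
    have f': "f \<in> scar C U 0" using f True by simp
    have ce: "(- ?c) \<odot>\<^bsub>?A\<^esub> gunit C U \<in> scar C U 0" using A e by simp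
    have ge: "germ C a 0 U (gunit C U) \<in> gcar (stalk_alg C a) 0" by (rule germ_in_stalk[OF graded_manifold_module[OF C] U e])
    have gf': "germ C a 0 U f \<in> gcar (stalk_alg C a) 0" by (rule germ_in_stalk[OF graded_manifold_module[OF C] U f'])
    have "?f0 \<in> vanish_sec C U a d"
      using True A f' e ce by (simp add: vanish_sec_def gval_linear[OF C U] gval_unit[OF C U])
    moreover have "gact (stalk C E a) 0 n (germ C a 0 U ?f0) ?y
        = gact (stalk C E a) 0 n (germ C a 0 U f) ?y \<oplus>\<^bsub>gcomp (stalk C E a) n\<^esub> (- ?c) \<odot>\<^bsub>gcomp (stalk C E a) n\<^esub> ?y"
      using linear_map_add[OF linear_map_gact_left[OF G y, of 0] gf', of
          "(- ?c) \<odot>\<^bsub>gcomp (stalk_alg C a) 0\<^esub> germ C a 0 U (gunit C U)"]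
        linear_map_smult[OF linear_map_gact_left[OF G y, of 0] ge, of "- ?c"] graded_module_unit[OF G y] ge
        vs_stalk[OF graded_manifold_module[OF C]]
      by (simp add: linear_map_add[OF linear_map_germ[OF graded_manifold_module[OF C] U] f' ce] linear_map_smult[OF
          linear_map_germ[OF graded_manifold_module[OF C] U] e]
          germ_unit[OF U])
    then have "(-1) \<odot>\<^bsub>gcomp (stalk C E a) n\<^esub> gact (stalk C E a) 0 n (germ C a 0 U ?f0) ?y
        = ?c \<odot>\<^bsub>gcomp (stalk C E a) n\<^esub> ?y \<oplus>\<^bsub>gcomp (stalk C E a) n\<^esub> (-1) \<odot>\<^bsub>gcomp (stalk C E a) n\<^esub> gact (stalk C E a) 0 n (germ C
            a 0 U f) ?y"
      using W y fy True vs_add_comm[OF W, of "(-1) \<odot>\<^bsub>gcomp (stalk C E a) n\<^esub> gact (stalk C E a) 0 n (germ C a 0 U f) ?y" a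
          n "?c \<odot>\<^bsub>gcomp (stalk C E a) n\<^esub> ?y"]
      by (simp add: vs_smult_add_right)
    ultimately show ?thesis using that eq True by simp
  qed
qed

lemma jet_eval_delta_gens:
  assumes U: "open U" "a \<in> U"
  shows "x \<in> delta_gens C E U m n \<Longrightarrow> jet_eval C E a U n x \<in> vanish_order C E a m n"
proof (induction m arbitrary: n x)
  case 0
  then have "x \<in> scar (jetX C E) U n" using delta_gens_subset[OF graded_manifold_sheaf[OF C] E U(1), of 0 n] by blast
  then show ?case using linear_map_closed[OF linear_map_jet_eval(1)[OF C E U]] by (simp add: vanish_order_def)
next
  case (Suc m)
  then obtain d f y where y: "x = jet_delta C E U d (n - d) f y" "f \<in> scar C U d" "y \<in> delta_gens C E U m (n - d)"
    by auto
  have yX: "y \<in> scar (jetX C E) U (n - d)" using delta_gens_subset[OF graded_manifold_sheaf[OF C] E U(1)] y(3) by blast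
  obtain f0 where f0: "f0 \<in> vanish_sec C U a d"
    "jet_eval C E a U (d + (n - d)) (jet_delta C E U d (n - d) f y)
      = (-1) \<odot>\<^bsub>gcomp (stalk C E a) (d + (n - d))\<^esub> gact (stalk C E a) d (n - d) (germ C a d U f0) (jet_eval C E a U (n - d) y)"
    by (rule jet_eval_delta[OF U y(2) yX])
  have "f0 \<in> scar C U d" using f0(1) by (simp add: vanish_sec_def)
  then have "germ C a d U f0 \<in> vanish_germ C a d" using germ_in_vanish_germ[OF U] f0(1) by simp
  from ideal_smulI[where I = "vanish_germ C a" and N = "vanish_order C E a m" and P = "stalk C E a", OF this Suc.IH[OF y(3)]]
  have "gact (stalk C E a) d (n - d) (germ C a d U f0) (jet_eval C E a U (n - d) y) \<in> vanish_order C E a (Suc m) n"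
    by (simp add: vanish_order_Suc)
  from subspace_of_smult[OF subspace_of_vanish_order this, of "-1"] show ?case using f0(2) y(1) by simp
qed

lemma jet_null_gens_subset:
  assumes U: "open U"
  shows "{gact (gsec (jetX C E) U) d (n - d) f x | d f x. f \<in> vanish_sec C U a d \<and> x \<in> scar (jetX C E) U (n - d)}
      \<union> delta_gens C E U m n \<subseteq> scar (jetX C E) U n"
proof (intro Un_least delta_gens_subset[OF graded_manifold_sheaf[OF C] E U] subsetI)
  fix y assume "y \<in> {gact (gsec (jetX C E) U) d (n - d) f x | d f x. f \<in> vanish_sec C U a d \<and> x \<in> scar (jetX C E) U (n - d)}"
  then obtain d f x where y: "y = gact (gsec (jetX C E) U) d (n - d) f x" "f \<in> vanish_sec C U a d"
      "x \<in> scar (jetX C E) U (n - d)"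
    by blast
  have "f \<in> scar C U d" using y(2) by (simp add: vanish_sec_def)
  from linear_map_closed[OF linear_map_jetX_gact(1)[OF graded_manifold_sheaf[OF C] E U this] y(3)] show
      "y \<in> scar (jetX C E) U n"
    using y(1) by simp
qed

lemma subspace_of_jet_null: "open U \<Longrightarrow> subspace_of (jet_null C E a m U n) (gcomp (gsec (jetX C E) U) n)"
  unfolding jet_null_def by (rule subspace_of_rspan[OF vs_jetX[OF graded_manifold_sheaf[OF C] E] jet_null_gens_subset])

lemma delta_gens_in_jet_null: "x \<in> delta_gens C E U m n \<Longrightarrow> x \<in> jet_null C E a m U n"
  unfolding jet_null_def by (rule rspan_superset) blast

lemma gact_in_jet_null:
  assumes "f \<in> vanish_sec C U a d" "x \<in> scar (jetX C E) U n"
  shows "gact (gsec (jetX C E) U) d n f x \<in> jet_null C E a m U (d + n)"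
  unfolding jet_null_def
proof (rule rspan_superset, rule UnI1, rule CollectI, intro exI conjI)
  show "gact (gsec (jetX C E) U) d n f x = gact (gsec (jetX C E) U) d (d + n - d) f x" by simp
qed (use assms in simp_all)

lemma linear_map_jet_null:
  assumes U: "open U" and W: "vs W" and L: "linear_map (gcomp (gsec (jetX C E) U) n) W L" and N: "subspace_of N W"
    and 1: "\<And>d f x. f \<in> vanish_sec C U a d \<Longrightarrow> x \<in> scar (jetX C E) U (n - d) \<Longrightarrow>
      L (gact (gsec (jetX C E) U) d (n - d) f x) \<in> N"
    and 2: "\<And>x. x \<in> delta_gens C E U m n \<Longrightarrow> L x \<in> N"
    and x: "x \<in> jet_null C E a m U n"
  shows "L x \<in> N"
  by (rule linear_map_rspan[OF vs_jetX[OF graded_manifold_sheaf[OF C] E U] W L N jet_null_gens_subset[OF U] _ x[unfolded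
      jet_null_def]])
    (use 1 2 in blast)

lemma jet_delta_jet_null:
  assumes U: "open U" and f: "f \<in> scar C U d" and x: "x \<in> jet_null C E a m U n"
  shows "jet_delta C E U d n f x \<in> jet_null C E a (Suc m) U (d + n)"
proof (rule linear_map_jet_null[OF U vs_jetX[OF graded_manifold_sheaf[OF C] E U] linear_map_jet_delta[OF
    graded_manifold_sheaf[OF C] E U f] subspace_of_jet_null[OF U] _ _ x])
  fix e g y assume g: "g \<in> vanish_sec C U a e" and y: "y \<in> scar (jetX C E) U (n - e)"
  have g': "g \<in> scar C U e" using g by (simp add: vanish_sec_def)
  have "jet_delta C E U d (n - e) f y \<in> scar (jetX C E) U (d + (n - e))"
    by (rule linear_map_closed[OF linear_map_jet_delta[OF graded_manifold_sheaf[OF C] E U f] y])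
  from gact_in_jet_null[OF g this]
  have "gact (gsec (jetX C E) U) e (d + (n - e)) g (jet_delta C E U d (n - e) f y) \<in> jet_null C E a (Suc m) U (d + n)"
    by (simp add: algebra_simps)
  from subspace_of_smult[OF subspace_of_jet_null[OF U] this, of "ksign d e"]
  show "jet_delta C E U d n f (gact (gsec (jetX C E) U) e (n - e) g y) \<in> jet_null C E a (Suc m) U (d + n)"
    using jet_delta_gact[OF graded_manifold_sheaf[OF C] E U f g' y] by simp
next
  fix y assume "y \<in> delta_gens C E U m n"
  then show "jet_delta C E U d n f y \<in> jet_null C E a (Suc m) U (d + n)"
    by (intro delta_gens_in_jet_null jet_delta_in_delta_gens[OF graded_manifold_sheaf[OF C] E] f)
qed

lemma jet_null_subset: "open U \<Longrightarrow> x \<in> jet_null C E a m U n \<Longrightarrow> x \<in> scar (jetX C E) U n"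
  by (rule subspace_of_carrier_mem[OF subspace_of_jet_null])

text \<open>The step of the induction on the order: \<open>f \<blacktriangleright> x = f \<triangleright> x - \<delta>\<^sub>f x\<close>.\<close>

lemma jet_ract_jet_null:
  assumes U: "open U" and f: "f \<in> vanish_sec C U a d" and x: "x \<in> jet_null C E a m U n"
  shows "jet_ract C E U d n f x \<in> jet_null C E a (Suc m) U (d + n)"
proof -
  let ?X = "gcomp (gsec (jetX C E) U) (d + n)"
  note X = vs_jetX[OF graded_manifold_sheaf[OF C] E U, of "d + n"]
  have f': "f \<in> scar C U d" using f by (simp add: vanish_sec_def)
  have xX: "x \<in> scar (jetX C E) U n" by (rule jet_null_subset[OF U x])
  let ?g = "gact (gsec (jetX C E) U) d n f x" and ?r = "jet_ract C E U d n f x" and ?D = "jet_delta C E U d n f x"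
  have c: "?g \<in> carrier ?X" "?r \<in> carrier ?X" "?D \<in> carrier ?X"
    using linear_map_closed[OF linear_map_jetX_gact(1)[OF graded_manifold_sheaf[OF C] E U f'] xX]
      linear_map_closed[OF linear_map_jet_ract(1)[OF graded_manifold_sheaf[OF C] E U f'] xX]
      linear_map_closed[OF linear_map_jet_delta[OF graded_manifold_sheaf[OF C] E U f'] xX] by simp_all
  have "?g \<oplus>\<^bsub>?X\<^esub> (-1) \<odot>\<^bsub>?X\<^esub> ?D \<in> jet_null C E a (Suc m) U (d + n)"
    by (intro subspace_of_add[OF subspace_of_jet_null[OF U]] subspace_of_smult[OF subspace_of_jet_null[OF U]]
        gact_in_jet_null[OF f xX] jet_delta_jet_null[OF U f' x])
  moreover have "?g \<oplus>\<^bsub>?X\<^esub> (-1) \<odot>\<^bsub>?X\<^esub> ?D = ?r"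
  proof -
    have "(-1) \<odot>\<^bsub>?X\<^esub> ?D = (-1) \<odot>\<^bsub>?X\<^esub> ?g \<oplus>\<^bsub>?X\<^esub> ?r"
      using c X by (simp add: jet_delta_eq[OF graded_manifold_sheaf[OF C] E U f' xX] vs_smult_add_right)
    then show ?thesis using c X by (simp add: vs_add_assoc[symmetric])
  qed
  ultimately show ?thesis by simp
qed

lemma gres_jet_null:
  assumes UV: "open U" "open V" "V \<subseteq> U" and a: "a \<in> V" and x: "x \<in> jet_null C E a m U n"
  shows "gres (jetX C E) U V n x \<in> jet_null C E a m V n"
proof (rule linear_map_jet_null[OF UV(1) vs_jetX[OF graded_manifold_sheaf[OF C] E UV(2)] linear_map_jetX_gres(1)[OF
    graded_manifold_sheaf[OF C] E UV]
      subspace_of_jet_null[OF UV(2)] _ _ x])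
  fix d f y assume f: "f \<in> vanish_sec C U a d" and y: "y \<in> scar (jetX C E) U (n - d)"
  have f': "f \<in> scar C U d" using f by (simp add: vanish_sec_def)
  have "gres C U V d f \<in> vanish_sec C V a d"
    using f gval_gres[OF C UV a f'] module_presheaf_gres_closed[OF graded_manifold_module[OF C] UV f']
        by (simp add: vanish_sec_def)
  from gact_in_jet_null[OF this linear_map_closed[OF linear_map_jetX_gres(1)[OF graded_manifold_sheaf[OF C] E UV] y]]
  show "gres (jetX C E) U V n (gact (gsec (jetX C E) U) d (n - d) f y) \<in> jet_null C E a m V n"
    using module_presheaf_gres_gact[OF module_presheaf_jetX[OF graded_manifold_sheaf[OF C] E] UV f' y] by simp
next
  fix y assume "y \<in> delta_gens C E U m n"
  then show "gres (jetX C E) U V n y \<in> jet_null C E a m V n"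
    by (intro delta_gens_in_jet_null gres_delta_gens[OF graded_manifold_sheaf[OF C] E UV])
qed

text \<open>
  With \<open>m = k + 1\<close>, the first kind of generators of \<open>jet_null\<close> is killed in the fiber, and the second kind spans
  the relations of the jet presheaf.
\<close>

lemma jet_value_jet_null:
  assumes U: "open U" "a \<in> U" and x: "x \<in> jet_null C E a (Suc k) U n"
  shows "jet_value C E k a U n x = \<zero>\<^bsub>gcomp (fiber C (Jet C E k) a) n\<^esub>"
proof -
  note Fb = vs_fiber_Jet[OF C E]
  have "jet_value C E k a U n x \<in> {\<zero>\<^bsub>gcomp (fiber C (Jet C E k) a) n\<^esub>}"
  proof (rule linear_map_jet_null[OF U(1) Fb linear_map_jet_value[OF C E U] subspace_of_zero_set[OF Fb] _ _ x])
    fix d f y assume f: "f \<in> vanish_sec C U a d" and y: "y \<in> scar (jetX C E) U (n - d)"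
    have f': "f \<in> scar C U d" using f by (simp add: vanish_sec_def)
    have "jet_value C E k a U (d + (n - d)) (gact (gsec (jetX C E) U) d (n - d) f y)
        = \<zero>\<^bsub>gcomp (fiber C (Jet C E k) a) (d + (n - d))\<^esub>"
      using jet_value_gact[OF C E U f' y, of k] f linear_map_closed[OF linear_map_jet_value[OF C E U] y] Fb
      by (auto simp: vanish_sec_def)
    then show "jet_value C E k a U n (gact (gsec (jetX C E) U) d (n - d) f y) \<in> {\<zero>\<^bsub>gcomp (fiber C (Jet C E k) a) n\<^esub>}"
      by simp
  next
    fix y assume "y \<in> delta_gens C E U (Suc k) n"
    then have "y \<in> jetV C E k U n" unfolding jetV_def by (rule rspan_superset)
    then show "jet_value C E k a U n y \<in> {\<zero>\<^bsub>gcomp (fiber C (Jet C E k) a) n\<^esub>}"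
      using jet_value_jetV[OF C E U] by simp
  qed
  then show ?thesis by simp
qed

text \<open>
  If \<open>[\<psi>]\<^sub>a\<close> vanishes to order \<open>m\<close>, then \<open>1 \<otimes> \<psi>\<close> lies in \<open>jet_null\<close> for a suitable representative \<open>\<psi>\<close>, because
  \<open>1 \<otimes> f \<psi> = f \<blacktriangleright> (1 \<otimes> \<psi>)\<close>.
\<close>

lemma vanish_order_rep:
  assumes "y \<in> vanish_order C E a m n"
  shows "\<exists>U \<psi>. open U \<and> a \<in> U \<and> \<psi> \<in> scar E U n \<and> y = germ E a n U \<psi> \<and>
    jet_elt C E U n 0 (gunit C U) \<psi> \<in> jet_null C E a m U n"
  using assms
proof (induction m arbitrary: n y)
  case 0
  then have "y \<in> gcar (stalk C E a) n" by (simp add: vanish_order_def)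
  then obtain U \<psi> where U: "open U" "a \<in> U" and \<psi>: "\<psi> \<in> scar E U n" "y = germ E a n U \<psi>" by (rule stalk_rep[OF E])
  have "\<psi> \<in> scar E U (n - 0)" using \<psi>(1) by simp
  then have "jet_elt C E U n 0 (gunit C U) \<psi> \<in> delta_gens C E U 0 n"
    using algebra_sheaf_unit[OF graded_manifold_sheaf[OF C] U(1)] unfolding delta_gens.simps by blast
  then show ?case using U \<psi> delta_gens_in_jet_null by blast
next
  case (Suc m)
  let ?S = "gcomp (stalk C E a) n" and ?N = "\<lambda>U. jet_null C E a (Suc m) U n"
  \<comment> \<open>the germs with such a representative form a subspace that contains the generators of \<open>J \<cdot> J\<^sup>m \<Gamma>\<close>\<close>
  let ?T = "{y. \<exists>U \<psi>. open U \<and> a \<in> U \<and> \<psi> \<in> scar E U n \<and> y = germ E a n U \<psi> \<and> jet_elt C E U n 0 (gunit C U) \<psi> \<in> ?N U}"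
  have "subspace_of ?T ?S"
  proof (rule subspace_ofI[OF vs_stalk[OF E]])
    show "?T \<subseteq> gcar (stalk C E a) n" using germ_in_stalk[OF E] by blast
    have "jet_elt C E UNIV n 0 (gunit C UNIV) \<zero>\<^bsub>gcomp (gsec E UNIV) n\<^esub> \<in> ?N UNIV"
      using linear_map_zero[OF module_presheaf_vs[OF E open_UNIV] vs_jetX[OF graded_manifold_sheaf[OF C] E open_UNIV]
          linear_map_jet_unit_elt[OF C E open_UNIV]]
        subspace_of_zero[OF subspace_of_jet_null[OF open_UNIV]] by simp
    then show "\<zero>\<^bsub>?S\<^esub> \<in> ?T"
      using stalk_zero[OF E open_UNIV UNIV_I] vs_zero_closed[OF module_presheaf_vs[OF E open_UNIV]] by blast
  next
    fix y z assume "y \<in> ?T" "z \<in> ?T"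
    then obtain U \<psi> V \<theta> where U: "open U" "a \<in> U" "\<psi> \<in> scar E U n" "y = germ E a n U \<psi>"
        "jet_elt C E U n 0 (gunit C U) \<psi> \<in> ?N U"
      and V: "open V" "a \<in> V" "\<theta> \<in> scar E V n" "z = germ E a n V \<theta>" "jet_elt C E V n 0 (gunit C V) \<theta> \<in> ?N V" by blast
    let ?W = "U \<inter> V" and ?\<psi> = "gres E U (U \<inter> V) n \<psi>" and ?\<theta> = "gres E V (U \<inter> V) n \<theta>"
    have W: "open ?W" "a \<in> ?W" "?W \<subseteq> U" "?W \<subseteq> V" using U V by auto
    have c: "?\<psi> \<in> scar E ?W n" "?\<theta> \<in> scar E ?W n"
      using module_presheaf_gres_closed[OF E U(1) W(1,3) U(3)] module_presheaf_gres_closed[OF E V(1) W(1,4) V(3)] by simp_all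
    have "y \<oplus>\<^bsub>?S\<^esub> z = germ E a n ?W (?\<psi> \<oplus>\<^bsub>gcomp (gsec E ?W) n\<^esub> ?\<theta>)"
      using germ_gres[OF E U(1) W(1,2,3) U(3)] germ_gres[OF E V(1) W(1,2,4) V(3)] U(4) V(4)
        stalk_add[OF E W(1,2) c] by simp
    moreover have "jet_elt C E ?W n 0 (gunit C ?W) (?\<psi> \<oplus>\<^bsub>gcomp (gsec E ?W) n\<^esub> ?\<theta>) \<in> ?N ?W"
      using subspace_of_add[OF subspace_of_jet_null[OF W(1)] gres_jet_null[OF U(1) W(1,3,2) U(5)] gres_jet_null[OF V(1)
          W(1,4,2) V(5)]]
      by (simp add: gres_jet_unit_elt[OF C E U(1) W(1,3) U(3)] gres_jet_unit_elt[OF C E V(1) W(1,4) V(3)]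
          linear_map_add[OF linear_map_jet_unit_elt[OF C E W(1)] c])
    moreover have "?\<psi> \<oplus>\<^bsub>gcomp (gsec E ?W) n\<^esub> ?\<theta> \<in> scar E ?W n"
      by (rule vs_add_closed[OF module_presheaf_vs[OF E W(1)] c])
    ultimately show "y \<oplus>\<^bsub>?S\<^esub> z \<in> ?T" using W(1,2) by blast
  next
    fix r y assume "y \<in> ?T"
    then obtain U \<psi> where U: "open U" "a \<in> U" "\<psi> \<in> scar E U n" "y = germ E a n U \<psi>" "jet_elt C E U n 0 (gunit C U) \<psi> \<in> ?N U"
      by blast
    have "r \<odot>\<^bsub>?S\<^esub> y = germ E a n U (r \<odot>\<^bsub>gcomp (gsec E U) n\<^esub> \<psi>)" using stalk_smult[OF E U(1-3)] U(4) by simp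
    moreover have "jet_elt C E U n 0 (gunit C U) (r \<odot>\<^bsub>gcomp (gsec E U) n\<^esub> \<psi>) \<in> ?N U"
      using subspace_of_smult[OF subspace_of_jet_null[OF U(1)] U(5)]
      by (simp add: linear_map_smult[OF linear_map_jet_unit_elt[OF C E U(1)] U(3)])
    moreover have "r \<odot>\<^bsub>gcomp (gsec E U) n\<^esub> \<psi> \<in> scar E U n" by (rule vs_smult_closed[OF module_presheaf_vs[OF E U(1)] U(3)])
    ultimately show "r \<odot>\<^bsub>?S\<^esub> y \<in> ?T" using U(1,2) by blast
  qed
  then have "vanish_order C E a (Suc m) n \<subseteq> ?T"
    unfolding vanish_order_Suc
  proof (rule ideal_smul_least)
    fix d Z y assume Z: "Z \<in> vanish_germ C a d" and "y \<in> vanish_order C E a m (n - d)"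
    from Suc.IH[OF this(2)] obtain U \<psi> where U: "open U" "a \<in> U" "\<psi> \<in> scar E U (n - d)" "y = germ E a (n - d) U \<psi>"
      "jet_elt C E U (n - d) 0 (gunit C U) \<psi> \<in> jet_null C E a m U (n - d)" by blast
    have "Z \<in> gcar (stalk_alg C a) d" using Z vanish_germ_subset by blast
    then obtain V f where V: "open V" "a \<in> V" "f \<in> scar C V d" "Z = germ C a d V f"
        by (rule stalk_rep[OF graded_manifold_module[OF C]])
    let ?W = "U \<inter> V" and ?\<psi> = "gres E U (U \<inter> V) (n - d) \<psi>" and ?f = "gres C V (U \<inter> V) d f"
    have W: "open ?W" "a \<in> ?W" "?W \<subseteq> U" "?W \<subseteq> V" using U V by auto
    have c: "?\<psi> \<in> scar E ?W (n - d)" "?f \<in> scar C ?W d"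
      using module_presheaf_gres_closed[OF E U(1) W(1,3) U(3)] module_presheaf_gres_closed[OF graded_manifold_module[OF
          C] V(1) W(1,4) V(3)] by simp_all
    have Zf: "Z = germ C a d ?W ?f" using germ_gres[OF graded_manifold_module[OF C] V(1) W(1,2,4) V(3)] V(4) by simp
    then have van: "?f \<in> vanish_sec C ?W a d" using germ_in_vanish_germ[OF W(1,2) c(2)] Z by simp
    let ?\<theta> = "gact (gsec E ?W) d (n - d) ?f ?\<psi>"
    have \<theta>: "?\<theta> \<in> scar E ?W n" using graded_module_closed[OF module_presheaf_module[OF E W(1)] c(2,1)] by simp
    have "gact (stalk C E a) d (n - d) Z y = germ E a n ?W ?\<theta>"
      using stalk_gact[OF graded_manifold_sheaf[OF C] E W(1,2) c(2,1)] Zf germ_gres[OF E U(1) W(1,2,3) U(3)] U(4) by simp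
    moreover have "jet_elt C E ?W n 0 (gunit C ?W) ?\<theta> \<in> ?N ?W"
    proof -
      have "jet_elt C E ?W (n - d) 0 (gunit C ?W) ?\<psi> \<in> jet_null C E a m ?W (n - d)"
        using gres_jet_null[OF U(1) W(1,3,2) U(5)] gres_jet_unit_elt[OF C E U(1) W(1,3) U(3)] by simp
      from jet_ract_jet_null[OF W(1) van this]
      have "jet_ract C E ?W d (n - d) ?f (jet_elt C E ?W (n - d) 0 (gunit C ?W) ?\<psi>) \<in> ?N ?W" by simp
      moreover have "jet_ract C E ?W d (n - d) ?f (jet_elt C E ?W (n - d) 0 (gunit C ?W) ?\<psi>)
          = jet_elt C E ?W n 0 (gunit C ?W) ?\<theta>"
        using linear_map_jet_ract(2)[OF graded_manifold_sheaf[OF C] E W(1) c(2) algebra_sheaf_unit[OF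
            graded_manifold_sheaf[OF C] W(1)], of ?\<psi> "n - d"] c(1)
          vs_smult_one[OF vs_jetX[OF graded_manifold_sheaf[OF C] E W(1)] jet_unit_elt[OF C E W(1) \<theta>]]
              by (simp add: ksign_def)
      ultimately show ?thesis by simp
    qed
    ultimately show "gact (stalk C E a) d (n - d) Z y \<in> ?T" using W(1,2) \<theta> by blast
  qed
  then show ?case using Suc.prems by blast
qed

end

section \<open>The map from the fiber to the jet space\<close>

text \<open>The class of \<open>jet_eval\<close> in the jet space.\<close>

definition jet_eval_class ::
  "('m::{second_countable_topology,t2_space}, 'f) galg_presheaf \<Rightarrow> ('m, 'f, 's) gpresheaf \<Rightarrow> nat \<Rightarrow> 'm \<Rightarrow> 'm set \<Rightarrow> int \<Rightarrow>
      ('f, 's) ftens set \<Rightarrow> ('m set \<times> 's) set set" where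
  "jet_eval_class C E k a U n x = jet_sub C E k a n +>\<^bsub>gcomp (stalk C E a) n\<^esub> jet_eval C E a U n x"

lemma linear_map_gval:
  assumes "graded_manifold C" "open U" "a \<in> U"
  shows "linear_map (gcomp (gsec C U) i) (real_graded 0) (gval C a U i)"
  using gval_linear[OF assms] by (intro linear_mapI) (auto simp: carrier_real_graded)

context
  fixes C :: "('m::{second_countable_topology,t2_space}, 'f) galg_presheaf" and E :: "('m, 'f, 's) gpresheaf"
  assumes C: "graded_manifold C" and E: "module_presheaf C E"
begin

lemma gcomp_jet_space: "gcomp (jet_space C E k a) n = quot_vs (gcomp (stalk C E a) n) (jet_sub C E k a n)"
  by (simp add: jet_space_def)

lemma subspace_of_jet_sub: "subspace_of (jet_sub C E k a n) (gcomp (stalk C E a) n)"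
  unfolding jet_sub_eq[OF C E] by (rule subspace_of_vanish_order[OF C E])

lemma vs_jet_space: "vs (gcomp (jet_space C E k a) n)"
  unfolding gcomp_jet_space by (rule vs_quot_vs[OF vs_stalk[OF E] subspace_of_jet_sub])

lemma linear_map_jet_coset:
  "linear_map (gcomp (stalk C E a) n) (gcomp (jet_space C E k a) n) (\<lambda>y. jet_sub C E k a n +>\<^bsub>gcomp (stalk C E a) n\<^esub> y)"
  unfolding gcomp_jet_space by (rule linear_map_coset[OF vs_stalk[OF E] subspace_of_jet_sub])

lemma linear_map_jet_eval_class:
  assumes "open U" "a \<in> U"
  shows "linear_map (gcomp (gsec (jetX C E) U) n) (gcomp (jet_space C E k a) n) (jet_eval_class C E k a U n)"
  unfolding jet_eval_class_def[abs_def]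
  by (rule linear_map_comp[OF linear_map_jet_eval(1)[OF C E assms] linear_map_jet_coset])

lemma jet_eval_class_gact:
  assumes U: "open U" "a \<in> U" and f: "f \<in> scar C U d" and x: "x \<in> scar (jetX C E) U n"
  shows "jet_eval_class C E k a U (d + n) (gact (gsec (jetX C E) U) d n f x)
    = (if d = 0 then gval C a U 0 f \<odot>\<^bsub>gcomp (jet_space C E k a) n\<^esub> jet_eval_class C E k a U n x
       else \<zero>\<^bsub>gcomp (jet_space C E k a) (d + n)\<^esub>)"
  using linear_map_smult[OF linear_map_jet_coset linear_map_closed[OF linear_map_jet_eval(1)[OF C E U] x], of k
      "gval C a U 0 f"]
    linear_map_zero[OF vs_stalk[OF E] vs_jet_space linear_map_jet_coset]
  by (simp add: jet_eval_class_def jet_eval_gact[OF C E U f x])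

lemma jet_eval_class_jetV:
  assumes U: "open U" "a \<in> U" and x: "x \<in> jetV C E k U n"
  shows "jet_eval_class C E k a U n x = \<zero>\<^bsub>gcomp (jet_space C E k a) n\<^esub>"
proof -
  have "jet_eval C E a U n x \<in> vanish_order C E a (Suc k) n"
    by (rule linear_map_rspan[OF vs_jetX[OF graded_manifold_sheaf[OF C] E U(1)] vs_stalk[OF E] linear_map_jet_eval(1)[OF
        C E U]
          subspace_of_vanish_order[OF C E] delta_gens_subset[OF graded_manifold_sheaf[OF C] E U(1)]
              jet_eval_delta_gens[OF C E U] x[unfolded jetV_def]])
  then have "jet_eval C E a U n x \<in> jet_sub C E k a n" by (simp add: jet_sub_eq[OF C E])
  then show ?thesis
    using coset_eq_self_iff[OF vs_stalk[OF E] subspace_of_jet_sub subspace_of_carrier_mem[OF subspace_of_jet_sub]]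
    by (simp add: jet_eval_class_def gcomp_jet_space zero_quot_vs)
qed

lemma pJet_eval:
  assumes U: "open U" "a \<in> U"
  shows "linear_map (gcomp (gsec (pJet C E k) U) n) (gcomp (jet_space C E k a) n) (quot_lift (jet_eval_class C E k a U n))"
    and "x \<in> scar (jetX C E) U n \<Longrightarrow>
      quot_lift (jet_eval_class C E k a U n) (jetV C E k U n +>\<^bsub>gcomp (gsec (jetX C E) U) n\<^esub> x) = jet_eval_class C E k a U n x"
  unfolding gcomp_pJet[OF C E]
  using linear_map_quot_lift[OF vs_jetX[OF graded_manifold_sheaf[OF C] E U(1)] subpresheafD(2)[OF subpresheaf_jetV[OF
      graded_manifold_sheaf[OF C] E] U(1)] vs_jet_space
      linear_map_jet_eval_class[OF U] jet_eval_class_jetV[OF U]]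
    quot_lift_coset[OF vs_jetX[OF graded_manifold_sheaf[OF C] E U(1)] subpresheafD(2)[OF subpresheaf_jetV[OF
        graded_manifold_sheaf[OF C] E] U(1)] vs_jet_space
      linear_map_jet_eval_class[OF U] jet_eval_class_jetV[OF U]]
  by blast+

text \<open>
  Geometrization divides out nothing that the evaluation at \<open>a\<close> sees: elements of \<open>P\<^sup>\<bullet>\<close> lie in \<open>J\<^sup>a \<triangleright> P\<close> (take
  \<open>q = 1\<close> and the point \<open>a\<close>), and functions in \<open>J\<^sup>a\<close> act as \<open>0\<close>.
\<close>

lemma pJet_eval_bullet:
  assumes U: "open U" "a \<in> U" and y: "y \<in> bullet C (pJet C E k) U n"
  shows "quot_lift (jet_eval_class C E k a U n) y = \<zero>\<^bsub>gcomp (jet_space C E k a) n\<^esub>"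
proof -
  note A = module_presheaf_module[OF graded_manifold_module[OF C] U(1)] and P
      = module_presheaf_module[OF module_presheaf_pJet[OF graded_manifold_sheaf[OF C] E] U(1)]
  have I: "ideal_pow (gsec C U) (vanish_sec C U a) 1 i \<subseteq> scar C U i" for i
    by (rule ideal_pow_subset[OF A vanish_sec_subset])
  have van: "gval C a U i h = 0" if h: "h \<in> ideal_pow (gsec C U) (vanish_sec C U a) 1 i" for i h
  proof -
    have "gval C a U i h \<in> {\<zero>\<^bsub>real_graded 0\<^esub>}"
    proof (rule linear_map_ideal_smul[OF A vanish_sec_subset order.refl vs_real_graded linear_map_gval[OF C U]
          subspace_of_zero_set[OF vs_real_graded]])
      show "h \<in> ideal_smul (gsec C U) (vanish_sec C U a) (scar C U) i" using h by simp
      fix d f g assume f: "f \<in> vanish_sec C U a d" and g: "g \<in> scar C U (i - d)"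
      then show "gval C a U i (gact (gsec C U) d (i - d) f g) \<in> {\<zero>\<^bsub>real_graded 0\<^esub>}"
        using gval_gact[OF C U, of f d g "i - d"] by (simp add: vanish_sec_def)
    qed
    then show ?thesis by simp
  qed
  have "quot_lift (jet_eval_class C E k a U n) y \<in> {\<zero>\<^bsub>gcomp (jet_space C E k a) n\<^esub>}"
  proof (rule linear_map_ideal_smul[OF P I order.refl vs_jet_space pJet_eval(1)[OF U] subspace_of_zero_set[OF vs_jet_space]])
    show "y \<in> ideal_smul (gsec (pJet C E k) U) (ideal_pow (gsec C U) (vanish_sec C U a) 1) (scar (pJet C E k) U) n"
      using y U(2) by (simp add: bullet_def del: ideal_pow_simps)
    fix d h z assume h: "h \<in> ideal_pow (gsec C U) (vanish_sec C U a) 1 d" and z: "z \<in> scar (pJet C E k) U (n - d)"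
    obtain x where x: "x \<in> scar (jetX C E) U (n - d)" "z = jetV C E k U (n - d) +>\<^bsub>gcomp (gsec (jetX C E) U) (n - d)\<^esub> x"
      by (rule pJet_rep[OF C E z])
    have h': "h \<in> scar C U d" using h I by blast
    have hx: "gact (gsec (jetX C E) U) d (n - d) h x \<in> scar (jetX C E) U n"
      using linear_map_closed[OF linear_map_jetX_gact(1)[OF graded_manifold_sheaf[OF C] E U(1) h'] x(1)] by simp
    have "quot_lift (jet_eval_class C E k a U n) (gact (gsec (pJet C E k) U) d (n - d) h z)
        = jet_eval_class C E k a U n (gact (gsec (jetX C E) U) d (n - d) h x)"
      using gact_pJet_coset[OF C E U(1) h' x(1), of k] pJet_eval(2)[OF U hx, of k] x(2) by simp
    also have "\<dots> = \<zero>\<^bsub>gcomp (jet_space C E k a) n\<^esub>"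
      using jet_eval_class_gact[OF U h' x(1), of k] van[OF h]
        vs_smult_zero_left[OF vs_jet_space linear_map_closed[OF linear_map_jet_eval_class[OF U] x(1)]]
      by (auto split: if_splits)
    finally show "quot_lift (jet_eval_class C E k a U n) (gact (gsec (pJet C E k) U) d (n - d) h z)
        \<in> {\<zero>\<^bsub>gcomp (jet_space C E k a) n\<^esub>}" by simp
  qed
  then show ?thesis by simp
qed

text \<open>The map that \<open>jet_eval_class\<close> induces on \<open>gpJet\<close>, a quotient of the quotient \<open>pJet\<close> of \<open>jetX\<close>.\<close>

definition gpJet_eval :: "nat \<Rightarrow> 'm \<Rightarrow> 'm set \<Rightarrow> int \<Rightarrow> ('f, 's) ftens set set set \<Rightarrow> ('m set \<times> 's) set set" where
  "gpJet_eval k a U n = quot_lift (quot_lift (jet_eval_class C E k a U n))"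

lemma gpJet_eval:
  assumes U: "open U" "a \<in> U"
  shows "linear_map (gcomp (gsec (gpJet C E k) U) n) (gcomp (jet_space C E k a) n) (gpJet_eval k a U n)"
    and "x \<in> scar (jetX C E) U n \<Longrightarrow> gpJet_eval k a U n (gpJet_class C E k U n x) = jet_eval_class C E k a U n x"
proof -
  note Q = module_presheaf_vs[OF module_presheaf_pJet[OF graded_manifold_sheaf[OF C] E] U(1)]
    subpresheafD(2)[OF subpresheaf_bullet[OF C module_presheaf_pJet[OF graded_manifold_sheaf[OF C] E]] U(1)] vs_jet_space
    pJet_eval(1)[OF U] pJet_eval_bullet[OF U]
  show "linear_map (gcomp (gsec (gpJet C E k) U) n) (gcomp (jet_space C E k a) n) (gpJet_eval k a U n)"
    unfolding gcomp_gpJet[OF C E] gpJet_eval_def by (rule linear_map_quot_lift[OF Q])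
  show "gpJet_eval k a U n (gpJet_class C E k U n x) = jet_eval_class C E k a U n x" if x: "x \<in> scar (jetX C E) U n"
    unfolding gpJet_class_def gpJet_eval_def
    by (rule trans[OF quot_lift_coset[OF Q linear_map_closed[OF linear_map_pJet_coset[OF C E U(1)] x]] pJet_eval(2)[OF U x]])
qed

lemma gpJet_eval_gres:
  assumes UV: "open U" "open V" "a \<in> V" "V \<subseteq> U" and s: "s \<in> scar (gpJet C E k) U n"
  shows "gpJet_eval k a V n (gres (gpJet C E k) U V n s) = gpJet_eval k a U n s"
proof -
  obtain x where x: "x \<in> scar (jetX C E) U n" "s = gpJet_class C E k U n x" by (rule gpJet_rep[OF C E s])
  have aU: "a \<in> U" using UV by blast
  show ?thesis
    using gpJet_eval(2)[OF UV(1) aU x(1), of k] x(2) gres_gpJet_class[OF C E UV(1,2,4) x(1), of k]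
      gpJet_eval(2)[OF UV(2,3) linear_map_closed[OF linear_map_jetX_gres(1)[OF graded_manifold_sheaf[OF C] E UV(1,2,4)]
          x(1)], of k]
      jet_eval_gres[OF C E UV(1,2,4,3) x(1)]
    by (simp add: jet_eval_class_def)
qed

text \<open>
  The induced map on the stalk of the jet sheaf: a section \<open>\<sigma>\<close> of the sheafification is sent to its germ
  \<open>\<sigma> a\<close> in the stalk of \<open>gpJet\<close>, which is then evaluated.
\<close>

definition Jet_eval :: "nat \<Rightarrow> 'm \<Rightarrow> int \<Rightarrow> ('m set \<times> ('m \<Rightarrow> ('m set \<times> ('f, 's) ftens set set set) set)) set \<Rightarrow> ('m set \<times> 's)
    set set" where
  "Jet_eval k a n = stalk_lift (\<lambda>U \<sigma>. stalk_lift (\<lambda>U. gpJet_eval k a U n) (\<sigma> a))"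

lemma Jet_eval:
  shows "linear_map (gcomp (stalk C (Jet C E k) a) n) (gcomp (jet_space C E k a) n) (Jet_eval k a n)"
    and "open U \<Longrightarrow> a \<in> U \<Longrightarrow> x \<in> scar (jetX C E) U n \<Longrightarrow>
      Jet_eval k a n (germ (Jet C E k) a n U (jet_section C E k U n x)) = jet_eval_class C E k a U n x"
proof -
  note gp = module_presheaf_gpJet[OF C E]
  let ?L = "stalk_lift (\<lambda>U. gpJet_eval k a U n)"
  have lin: "linear_map (gcomp (stalk C (gpJet C E k) a) n) (gcomp (jet_space C E k a) n) ?L"
    by (rule linear_map_stalk_lift[OF gp gpJet_eval_gres gpJet_eval(1)])
  have val: "?L (germ (gpJet C E k) a n U s) = gpJet_eval k a U n s"
    if "open U" "a \<in> U" "s \<in> scar (gpJet C E k) U n" for U s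
    by (rule stalk_lift_germ[OF gp gpJet_eval_gres that])
  have comp: "?L (gres (Jet C E k) U V n \<sigma> a) = ?L (\<sigma> a)" if "a \<in> V" for U V \<sigma>
    using that by (simp add: Jet_def sheafify_simps)
  have ev: "linear_map (gcomp (gsec (Jet C E k) U) n) (gcomp (stalk C (gpJet C E k) a) n) (\<lambda>\<sigma>. \<sigma> a)"
    if "open U" "a \<in> U" for U
    unfolding Jet_def
    by (rule linear_mapI) (use that sheafify_apply_closed[OF graded_manifold_sheaf[OF C] gp] in \<open>simp_all add:
        sheafify_simps\<close>)
  show "linear_map (gcomp (stalk C (Jet C E k) a) n) (gcomp (jet_space C E k a) n) (Jet_eval k a n)"
    unfolding Jet_eval_def
    by (rule linear_map_stalk_lift[OF module_presheaf_Jet[OF C E] comp linear_map_comp[OF ev lin]])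
  show "Jet_eval k a n (germ (Jet C E k) a n U (jet_section C E k U n x)) = jet_eval_class C E k a U n x"
    if U: "open U" "a \<in> U" and x: "x \<in> scar (jetX C E) U n"
  proof -
    have "Jet_eval k a n (germ (Jet C E k) a n U (jet_section C E k U n x)) = ?L (jet_section C E k U n x a)"
      unfolding Jet_eval_def
      by (rule stalk_lift_germ[OF module_presheaf_Jet[OF C E] comp U linear_map_closed[OF linear_map_jet_section[OF C E
          U(1)] x]])
    also have "\<dots> = gpJet_eval k a U n (gpJet_class C E k U n x)"
      using val[OF U linear_map_closed[OF linear_map_gpJet_class[OF C E U(1)] x]] U(2)
          by (simp add: jet_section_def germ_section_def)
    also have "\<dots> = jet_eval_class C E k a U n x" by (rule gpJet_eval(2)[OF U x])
    finally show ?thesis .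
  qed
qed

lemma Jet_eval_gact:
  assumes X: "X \<in> gcar (stalk_alg C a) d" and Y: "Y \<in> gcar (stalk C (Jet C E k) a) n"
  shows "Jet_eval k a (d + n) (gact (stalk C (Jet C E k) a) d n X Y)
    = (if d = 0 then germ_val C a 0 X \<odot>\<^bsub>gcomp (jet_space C E k a) n\<^esub> Jet_eval k a n Y
       else \<zero>\<^bsub>gcomp (jet_space C E k a) (d + n)\<^esub>)"
proof -
  note JJ = module_presheaf_Jet[OF C E]
  obtain U x where U: "open U" "a \<in> U" "x \<in> scar (jetX C E) U n" "Y = germ (Jet C E k) a n U (jet_section C E k U n x)"
    by (rule stalk_Jet_rep[OF C E Y])
  obtain V f where V: "open V" "a \<in> V" "f \<in> scar C V d" "X = germ C a d V f"
      by (rule stalk_rep[OF graded_manifold_module[OF C] X])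
  let ?W = "U \<inter> V" and ?f = "gres C V (U \<inter> V) d f" and ?x = "gres (jetX C E) U (U \<inter> V) n x"
  have W: "open ?W" "a \<in> ?W" "?W \<subseteq> U" "?W \<subseteq> V" using U V by auto
  have f: "?f \<in> scar C ?W d" by (rule module_presheaf_gres_closed[OF graded_manifold_module[OF C] V(1) W(1,4) V(3)])
  have x: "?x \<in> scar (jetX C E) ?W n" by (rule linear_map_closed[OF linear_map_jetX_gres(1)[OF graded_manifold_sheaf[OF
      C] E U(1) W(1,3)] U(3)])
  have fx: "gact (gsec (jetX C E) ?W) d n ?f ?x \<in> scar (jetX C E) ?W (d + n)"
    by (rule linear_map_closed[OF linear_map_jetX_gact(1)[OF graded_manifold_sheaf[OF C] E W(1) f] x])
  have Xf: "X = germ C a d ?W ?f" using germ_gres[OF graded_manifold_module[OF C] V(1) W(1,2,4) V(3)] V(4) by simp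
  have Yx: "Y = germ (Jet C E k) a n ?W (jet_section C E k ?W n ?x)"
    unfolding U(4) gres_jet_section[OF C E U(1) W(1,3) U(3), symmetric]
    by (rule germ_gres[OF JJ U(1) W(1,2,3) linear_map_closed[OF linear_map_jet_section[OF C E U(1)] U(3)], symmetric])
  have "gact (stalk C (Jet C E k) a) d n X Y
      = germ (Jet C E k) a (d + n) ?W (jet_section C E k ?W (d + n) (gact (gsec (jetX C E) ?W) d n ?f ?x))"
    unfolding Xf Yx stalk_gact[OF graded_manifold_sheaf[OF C] JJ W(1,2) f linear_map_closed[OF linear_map_jet_section[OF
        C E W(1)] x]]
      gact_jet_section[OF C E W(1) f x] ..
  then show ?thesis
    using Jet_eval(2)[OF W(1,2) fx, of k] Jet_eval(2)[OF W(1,2) x, of k] Yx Xf germ_val_germ[OF C W(1,2) f]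
      jet_eval_class_gact[OF W(1,2) f x, of k] by auto
qed

lemma fiber_class_jet_prolong:
  "fiber_class C (Jet C E k) a U n (jet_prolong C E k U n \<psi>) = jet_value C E k a U n (jet_elt C E U n 0 (gunit C U) \<psi>)"
  by (simp add: fiber_class_def jet_value_def fiber_elt_def[OF C module_presheaf_Jet[OF C E]] jet_prolong_def
      jet_section_def germ_section_def gpJet_class_def)

lemma jet_eval_class_unit:
  assumes "open U" "a \<in> U" "\<psi> \<in> scar E U n"
  shows "jet_eval_class C E k a U n (jet_elt C E U n 0 (gunit C U) \<psi>) = jet_class C E k a U n \<psi>"
  by (simp add: jet_eval_class_def jet_class_def jet_eval_unit[OF C E assms])

lemma gact_jet_space:
  "gact (jet_space C E k a) i j X y = (if i = 0 then germ_val C a 0 X \<odot>\<^bsub>gcomp (jet_space C E k a) j\<^esub> y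
     else \<zero>\<^bsub>gcomp (jet_space C E k a) (i + j)\<^esub>)"
  by (simp add: jet_space_def)

text \<open>
  As every element of the fiber is the value of a prolongation, this is the injectivity of the canonical map.
\<close>

lemma jet_value_eq_zero:
  assumes U: "open U" "a \<in> U" and \<psi>: "\<psi> \<in> scar E U n" and z: "jet_class C E k a U n \<psi> = \<zero>\<^bsub>gcomp (jet_space C E k a) n\<^esub>"
  shows "jet_value C E k a U n (jet_elt C E U n 0 (gunit C U) \<psi>) = \<zero>\<^bsub>gcomp (fiber C (Jet C E k) a) n\<^esub>"
proof -
  have "germ E a n U \<psi> \<in> jet_sub C E k a n"
    using z coset_eq_self_iff[OF vs_stalk[OF E] subspace_of_jet_sub germ_in_stalk[OF E U \<psi>]]
    by (simp add: jet_class_def gcomp_jet_space zero_quot_vs)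
  then have "germ E a n U \<psi> \<in> vanish_order C E a (Suc k) n" by (simp add: jet_sub_eq[OF C E])
  from vanish_order_rep[OF C E this] obtain V \<theta> where V: "open V" "a \<in> V" "\<theta> \<in> scar E V n" "germ E a n U \<psi> = germ E a n V \<theta>"
    "jet_elt C E V n 0 (gunit C V) \<theta> \<in> jet_null C E a (Suc k) V n" by blast
  obtain W where W: "open W" "a \<in> W" "W \<subseteq> U \<inter> V" "gres E U W n \<psi> = gres E V W n \<theta>"
    using germ_eq_iff[OF E U(1) V(1) U(2) V(2) \<psi> V(3)] V(4) by blast
  have WU: "W \<subseteq> U" "W \<subseteq> V" using W(3) by auto
  have "jet_value C E k a U n (jet_elt C E U n 0 (gunit C U) \<psi>)
      = jet_value C E k a W n (jet_elt C E W n 0 (gunit C W) (gres E U W n \<psi>))"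
    using jet_value_gres[OF C E U(1) W(1,2) WU(1) jet_unit_elt[OF C E U(1) \<psi>], of k] gres_jet_unit_elt[OF C E U(1) W(1)
        WU(1) \<psi>] by simp
  also have "\<dots> = jet_value C E k a V n (jet_elt C E V n 0 (gunit C V) \<theta>)"
    using jet_value_gres[OF C E V(1) W(1,2) WU(2) jet_unit_elt[OF C E V(1,3)], of k] gres_jet_unit_elt[OF C E V(1) W(1)
        WU(2) V(3)] W(4) by simp
  also have "\<dots> = \<zero>\<^bsub>gcomp (fiber C (Jet C E k) a) n\<^esub>" by (rule jet_value_jet_null[OF C E V(1,2,5)])
  finally show ?thesis .
qed

lemma exists_canonical_jet_iso: "\<exists>\<Phi>. canonical_jet_iso C E k a \<Phi>"
proof -
  note Fb = vs_fiber_Jet[OF C E] and Js = vs_jet_space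
  have "\<exists>\<Phi>. linear_map (gcomp (fiber C (Jet C E k) a) n) (gcomp (jet_space C E k a) n) \<Phi> \<and>
      (\<forall>Y \<in> gcar (stalk C (Jet C E k) a) n. \<Phi> (fiber_elt C (Jet C E k) a n Y) = Jet_eval k a n Y)" for n
  proof -
    have bal: "Jet_eval k a n (gact (stalk C (Jet C E k) a) d (n - d) X Y)
        = (if d = 0 then germ_val C a 0 X \<odot>\<^bsub>gcomp (jet_space C E k a) n\<^esub> Jet_eval k a n Y else \<zero>\<^bsub>gcomp (jet_space C E k a) n\<^esub>)"
      if "X \<in> gcar (stalk_alg C a) d" "Y \<in> gcar (stalk C (Jet C E k) a) (n - d)" for d X Y
      using Jet_eval_gact[OF that] by auto
    show ?thesis
    proof (rule fiber_ext[OF C module_presheaf_Jet[OF C E] Js Jet_eval(1) bal])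
      fix \<phi>
      assume "linear_map (gcomp (fiber C (Jet C E k) a) n) (gcomp (jet_space C E k a) n) \<phi>"
        "\<And>Y. Y \<in> gcar (stalk C (Jet C E k) a) n \<Longrightarrow> \<phi> (fiber_elt C (Jet C E k) a n Y) = Jet_eval k a n Y"
      then show ?thesis by (intro exI[of _ \<phi>] conjI ballI)
    qed
  qed
  then obtain \<Phi> where \<Phi>: "\<And>n. linear_map (gcomp (fiber C (Jet C E k) a) n) (gcomp (jet_space C E k a) n) (\<Phi> n)"
    and \<Phi>e: "\<And>n Y. Y \<in> gcar (stalk C (Jet C E k) a) n \<Longrightarrow> \<Phi> n (fiber_elt C (Jet C E k) a n Y) = Jet_eval k a n Y"
    by metis
  have val: "\<Phi> n (jet_value C E k a U n (jet_elt C E U n 0 (gunit C U) \<psi>)) = jet_class C E k a U n \<psi>"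
    if U: "open U" "a \<in> U" and \<psi>: "\<psi> \<in> scar E U n" for U n \<psi>
  proof -
    note x = jet_unit_elt[OF C E U(1) \<psi>]
    show ?thesis
      unfolding jet_value_def
        \<Phi>e[OF germ_in_stalk[OF module_presheaf_Jet[OF C E] U linear_map_closed[OF linear_map_jet_section[OF C E U(1)] x]]]
        Jet_eval(2)[OF U x] by (rule jet_eval_class_unit[OF U \<psi>])
  qed
  have inj: "x = \<zero>\<^bsub>gcomp (fiber C (Jet C E k) a) n\<^esub>"
    if x: "x \<in> gcar (fiber C (Jet C E k) a) n" and z: "\<Phi> n x = \<zero>\<^bsub>gcomp (jet_space C E k a) n\<^esub>" for n x
  proof -
    obtain U \<psi> where U: "open U" "a \<in> U" "\<psi> \<in> scar E U n" "x = jet_value C E k a U n (jet_elt C E U n 0 (gunit C U) \<psi>)"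
      by (rule fiber_Jet_rep[OF C E x])
    show ?thesis unfolding U(4) by (rule jet_value_eq_zero[OF U(1-3)]) (use val[OF U(1-3)] z U(4) in simp)
  qed
  have "bij_betw (\<Phi> n) (gcar (fiber C (Jet C E k) a) n) (gcar (jet_space C E k a) n)" for n
    unfolding bij_betw_def
  proof
    show "inj_on (\<Phi> n) (gcar (fiber C (Jet C E k) a) n)"
    proof (rule inj_onI)
      fix x y assume x: "x \<in> gcar (fiber C (Jet C E k) a) n" and y: "y \<in> gcar (fiber C (Jet C E k) a) n" and eq: "\<Phi> n x
          = \<Phi> n y"
      let ?F = "gcomp (fiber C (Jet C E k) a) n"
      have "\<Phi> n (x \<oplus>\<^bsub>?F\<^esub> (-1) \<odot>\<^bsub>?F\<^esub> y) = \<zero>\<^bsub>gcomp (jet_space C E k a) n\<^esub>"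
        using x y Fb linear_map_closed[OF \<Phi> y] Js eq by (simp add: linear_map_add[OF \<Phi>] linear_map_smult[OF \<Phi>])
      from inj[OF _ this] show "x = y" using vs_eq_iff_diff[OF Fb x y] x y Fb by simp
    qed
    show "\<Phi> n ` gcar (fiber C (Jet C E k) a) n = gcar (jet_space C E k a) n"
    proof
      show "\<Phi> n ` gcar (fiber C (Jet C E k) a) n \<subseteq> gcar (jet_space C E k a) n" using linear_map_closed[OF \<Phi>] by blast
      show "gcar (jet_space C E k a) n \<subseteq> \<Phi> n ` gcar (fiber C (Jet C E k) a) n"
      proof
        fix y assume "y \<in> gcar (jet_space C E k a) n"
        then obtain w where w: "w \<in> gcar (stalk C E a) n" "y = jet_sub C E k a n +>\<^bsub>gcomp (stalk C E a) n\<^esub> w"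
          unfolding gcomp_jet_space carrier_quot_vs by blast
        obtain U \<psi> where U: "open U" "a \<in> U" "\<psi> \<in> scar E U n" "w = germ E a n U \<psi>" by (rule stalk_rep[OF E w(1)])
        then have "y = \<Phi> n (jet_value C E k a U n (jet_elt C E U n 0 (gunit C U) \<psi>))"
          using val[OF U(1-3)] w(2) by (simp add: jet_class_def)
        then show "y \<in> \<Phi> n ` gcar (fiber C (Jet C E k) a) n"
          using linear_map_closed[OF linear_map_jet_value[OF C E U(1,2)] jet_unit_elt[OF C E U(1,3)]] by blast
      qed
    qed
  qed
  moreover have "\<Phi> (i + j) (gact (fiber C (Jet C E k) a) i j X x) = gact (jet_space C E k a) i j X (\<Phi> j x)"
    if X: "X \<in> gcar (stalk_alg C a) i" and x: "x \<in> gcar (fiber C (Jet C E k) a) j" for i j X x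
    using linear_map_smult[OF \<Phi> x, of "germ_val C a 0 X"] linear_map_zero[OF Fb Js \<Phi>]
    by (auto simp: gact_fiber[OF C module_presheaf_Jet[OF C E] X x] gact_jet_space)
  ultimately have "gmod_iso (stalk_alg C a) (fiber C (Jet C E k) a) (jet_space C E k a) \<Phi>"
    unfolding gmod_iso_def using linear_map_add[OF \<Phi>] linear_map_smult[OF \<Phi>] by blast
  moreover have "\<forall>U j. \<forall>\<psi> \<in> scar E U j. open U \<and> a \<in> U \<longrightarrow>
        \<Phi> j (fiber_class C (Jet C E k) a U j (jet_prolong C E k U j \<psi>)) = jet_class C E k a U j \<psi>"
    using val by (simp add: fiber_class_jet_prolong)
  ultimately show ?thesis unfolding canonical_jet_iso_def by blast
qed

lemma canonical_jet_iso_unique: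
  assumes "canonical_jet_iso C E k a \<Phi>" "canonical_jet_iso C E k a \<Phi>'" "x \<in> gcar (fiber C (Jet C E k) a) n"
  shows "\<Phi>' n x = \<Phi> n x"
proof -
  obtain U \<psi> where U: "open U" "a \<in> U" "\<psi> \<in> scar E U n" "x = jet_value C E k a U n (jet_elt C E U n 0 (gunit C U) \<psi>)"
    by (rule fiber_Jet_rep[OF C E assms(3)])
  have *: "\<Theta> n x = jet_class C E k a U n \<psi>" if "canonical_jet_iso C E k a \<Theta>" for \<Theta>
    using that U unfolding canonical_jet_iso_def by (simp add: fiber_class_jet_prolong)
  show ?thesis using *[OF assms(1)] *[OF assms(2)] by simp
qed

end

theorem proposition8p9:
  fixes C :: "('m::{second_countable_topology,t2_space}, 'f) galg_presheaf"
    and K :: "int \<Rightarrow> (real, 'k) module"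
    and E :: "('m, 'f, 's) gpresheaf"
    and k :: nat
    and a :: 'm
  assumes "graded_manifold C"
    and "graded_vector_bundle C K E"
  shows "\<exists>\<Phi>. canonical_jet_iso C E k a \<Phi> \<and>
    (\<forall>\<Phi>'. canonical_jet_iso C E k a \<Phi>' \<longrightarrow>
      (\<forall>j. \<forall>x \<in> gcar (fiber C (Jet C E k) a) j. \<Phi>' j x = \<Phi> j x))"
proof -
  have E: "module_presheaf C E" using assms(2) unfolding graded_vector_bundle_def by blast
  obtain \<Phi> where "canonical_jet_iso C E k a \<Phi>" using exists_canonical_jet_iso[OF assms(1) E] by blast
  then show ?thesis using canonical_jet_iso_unique[OF assms(1) E] by blast
qed

end
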